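(* Let $v\in S(1)$, and let $V$ be the operator of multiplication by $v(x)$ on $L^2(\mathbb{R}^d)$. Let $A_0=\mathrm{op}_h(a)$ for $a\in S(1)$ depending only on $\xi$. Then, for $0\le\Delta t\le1$ and $h\le\Delta t\le 1$, $$\sup_{\tau,s\in[-\Delta t,\Delta t]}\left\|\left[\left[V,\,e^{i\tau\frac{A_0}{h^2}}Ve^{-i\tau\frac{A_0}{h^2}}\right],\,e^{is\frac{A_0}{h^2}}Ve^{-is\frac{A_0}{h^2}}\right]\right\|_{L^2(\mathbb{R}^d)\to L^2(\mathbb{R}^d)}\le C_V\,\Delta t^2 ,$$ where $C_V$ is a constant depending only on $V(x)$ and the dimension $d$, uniformly in $h$ and $\Delta t$.
   Context: $S(1)$ is the set of smooth functions $a(x,\xi)$ on $T^*\mathbb{R}^d=\mathbb{R}^{2d}$ such that for all multi-indices $\alpha,\beta$ there is a constant $C_{\alpha\beta}$ with $|\partial_x^\alpha\partial_\xi^\beta a(x,\xi)|\le C_{\alpha\beta}$ everywhere. A function of $x$ alone (such as $v$) or of $\xi$ alone (such as $a$) is regarded as a function on $\mathbb{R}^{2d}$. The Weyl quantization with parameter $h\in(0,1]$ is $$(\mathrm{op}_h(a)u)(x)=\frac{1}{(2\pi h)^d}\iint_{\mathbb{R}^{2d}}e^{\frac{i}{h}\langle x-y,\xi\rangle}a\left(\tfrac{x+y}{2},\xi\right)u(y)\,dy\,d\xi ,$$ which for $a\in S(1)$ is a bounded operator on $L^2(\mathbb{R}^d)$. $[X,Y]=XY-YX$.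
   Formalization: The symbol a is taken real-valued, and the constant may depend, besides V and d, on prescribed bounds C_{αβ} for the derivatives of a (uniformly over all such a, h and Δt); for complex a, or with a constant independent of the size of a, the claim is false. *)

theory Defs
  imports "HOL-Analysis.Analysis"
begin

section \<open>The Hilbert space of square-integrable functions\<close>

definition square_integrable :: "('a::euclidean_space \<Rightarrow> complex) \<Rightarrow> bool" where
  "square_integrable f \<longleftrightarrow>
     f \<in> borel_measurable lborel \<and> integrable lborel (\<lambda>x. (norm (f x))\<^sup>2)"

definition L2_rel :: "('a::euclidean_space \<Rightarrow> complex) \<Rightarrow> ('a \<Rightarrow> complex) \<Rightarrow> bool" where
  "L2_rel f g \<longleftrightarrow> square_integrable f \<and> square_integrable g \<and> (AE x in lborel. f x = g x)"

lemma square_integrable_zero: "square_integrable (\<lambda>x. 0)"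
  by (simp add: square_integrable_def)

lemma square_integrable_add:
  assumes "square_integrable f" "square_integrable g"
  shows "square_integrable (\<lambda>x. f x + g x)"
  unfolding square_integrable_def
proof
  show m: "(\<lambda>x. f x + g x) \<in> borel_measurable lborel"
    using assms by (auto simp: square_integrable_def)
  have b: "(norm (u + w))\<^sup>2 \<le> 2 * (norm u)\<^sup>2 + 2 * (norm w)\<^sup>2" for u w :: complex
  proof -
    have "(norm (u + w))\<^sup>2 \<le> (norm u + norm w)\<^sup>2"
      by (intro power_mono norm_triangle_ineq) simp
    also have "\<dots> \<le> 2 * (norm u)\<^sup>2 + 2 * (norm w)\<^sup>2"
      using sum_squares_bound[of "norm u" "norm w"] by (simp add: power2_sum)
    finally show ?thesis .
  qed
  show "integrable lborel (\<lambda>x. (norm (f x + g x))\<^sup>2)"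
  proof (rule Bochner_Integration.integrable_bound)
    show "integrable lborel (\<lambda>x. 2 * (norm (f x))\<^sup>2 + 2 * (norm (g x))\<^sup>2)"
      using assms by (auto simp: square_integrable_def)
    show "(\<lambda>x. (norm (f x + g x))\<^sup>2) \<in> borel_measurable lborel"
      using m by measurable
    show "AE x in lborel. norm ((norm (f x + g x))\<^sup>2)
        \<le> norm (2 * (norm (f x))\<^sup>2 + 2 * (norm (g x))\<^sup>2)"
      using b by auto
  qed
qed

lemma square_integrable_mult:
  assumes "square_integrable f" "m \<in> borel_measurable borel" "bounded (range m)"
  shows "square_integrable (\<lambda>x. m x * f x)"
  unfolding square_integrable_def
proof
  show ms: "(\<lambda>x. m x * f x) \<in> borel_measurable lborel"
    using assms by (auto simp: square_integrable_def)
  obtain B where B: "\<And>x. norm (m x) \<le> B"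
    using assms(3) by (auto simp: bounded_iff)
  show "integrable lborel (\<lambda>x. (norm (m x * f x))\<^sup>2)"
  proof (rule Bochner_Integration.integrable_bound)
    show "integrable lborel (\<lambda>x. B\<^sup>2 * (norm (f x))\<^sup>2)"
      using assms by (auto simp: square_integrable_def)
    show "(\<lambda>x. (norm (m x * f x))\<^sup>2) \<in> borel_measurable lborel"
      using ms by measurable
    show "AE x in lborel. norm ((norm (m x * f x))\<^sup>2) \<le> norm (B\<^sup>2 * (norm (f x))\<^sup>2)"
      using B by (auto simp: norm_mult power_mult_distrib intro!: mult_right_mono power_mono)
  qed
qed

lemma square_integrable_cmult:
  "square_integrable f \<Longrightarrow> square_integrable (\<lambda>x. c * f x)"
  by (rule square_integrable_mult) auto

quotient_type (overloaded) 'a L2 = "'a::euclidean_space \<Rightarrow> complex" / partial: L2_rel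
proof (rule part_equivpI)
  show "\<exists>f. L2_rel f f"
    using square_integrable_zero by (auto simp: L2_rel_def)
  show "symp L2_rel"
    by (auto simp: symp_def L2_rel_def elim: AE_mp)
  show "transp L2_rel"
    by (auto simp: transp_def L2_rel_def elim: AE_mp)
qed

instantiation L2 :: (euclidean_space) real_inner
begin

lift_definition zero_L2 :: "'a L2" is "\<lambda>x. 0"
  by (simp add: L2_rel_def square_integrable_zero)

lift_definition plus_L2 :: "'a L2 \<Rightarrow> 'a L2 \<Rightarrow> 'a L2" is "\<lambda>f g x. f x + g x"
  by (auto simp: L2_rel_def intro: square_integrable_add)

lift_definition uminus_L2 :: "'a L2 \<Rightarrow> 'a L2" is "\<lambda>f x. - f x"
  by (auto simp: L2_rel_def dest: square_integrable_cmult[of _ "-1"])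

definition minus_L2 :: "'a L2 \<Rightarrow> 'a L2 \<Rightarrow> 'a L2" where
  "minus_L2 f g = f + - g"

lift_definition scaleR_L2 :: "real \<Rightarrow> 'a L2 \<Rightarrow> 'a L2" is "\<lambda>r f x. r *\<^sub>R f x"
  by (auto simp: L2_rel_def scaleR_conv_of_real intro: square_integrable_cmult)

text \<open>On \<^typ>\<open>complex\<close>, \<open>u \<bullet> w\<close> is the real part of \<open>cnj u * w\<close>; the norm below is therefore
  the usual one.\<close>

lift_definition inner_L2 :: "'a L2 \<Rightarrow> 'a L2 \<Rightarrow> real" is
  "\<lambda>f g. LINT x|lborel. f x \<bullet> g x"
proof -
  fix f f' g g' :: "'a \<Rightarrow> complex"
  assume "L2_rel f f'" "L2_rel g g'"
  then show "(LINT x|lborel. f x \<bullet> g x) = (LINT x|lborel. f' x \<bullet> g' x)"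
    by (intro integral_cong_AE) (auto simp: L2_rel_def square_integrable_def)
qed

definition norm_L2 :: "'a L2 \<Rightarrow> real" where
  "norm_L2 f = sqrt (f \<bullet> f)"

definition sgn_L2 :: "'a L2 \<Rightarrow> 'a L2" where
  "sgn_L2 f = inverse (norm f) *\<^sub>R f"

definition dist_L2 :: "'a L2 \<Rightarrow> 'a L2 \<Rightarrow> real" where
  "dist_L2 f g = norm (f - g)"

definition uniformity_L2 :: "('a L2 \<times> 'a L2) filter" where
  "uniformity_L2 = (INF e\<in>{0<..}. principal {(f, g). dist f g < e})"

definition open_L2 :: "'a L2 set \<Rightarrow> bool" where
  "open_L2 U \<longleftrightarrow> (\<forall>f\<in>U. eventually (\<lambda>(f', g). f' = f \<longrightarrow> g \<in> U) uniformity)"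

lemma integrable_inner_square_integrable:
  assumes "square_integrable f" "square_integrable g"
  shows "integrable lborel (\<lambda>x. f x \<bullet> g x)"
proof (rule Bochner_Integration.integrable_bound)
  show "integrable lborel (\<lambda>x. (norm (f x))\<^sup>2 + (norm (g x))\<^sup>2)"
    using assms by (auto simp: square_integrable_def)
  show "(\<lambda>x. f x \<bullet> g x) \<in> borel_measurable lborel"
    using assms by (auto simp: square_integrable_def)
  have "\<bar>u \<bullet> w\<bar> \<le> (norm u)\<^sup>2 + (norm w)\<^sup>2" for u w :: complex
  proof -
    have "\<bar>u \<bullet> w\<bar> \<le> norm u * norm w"
      by (rule Cauchy_Schwarz_ineq2)
    also have "\<dots> \<le> (norm u)\<^sup>2 + (norm w)\<^sup>2"
      using sum_squares_bound[of "norm u" "norm w"] mult_nonneg_nonneg[OF norm_ge_zero norm_ge_zero, of u w]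
      by linarith
    finally show ?thesis .
  qed
  then show "AE x in lborel. norm (f x \<bullet> g x) \<le> norm ((norm (f x))\<^sup>2 + (norm (g x))\<^sup>2)"
    by auto
qed

instance
proof
  fix f g k :: "'a L2" and r s :: real and U :: "'a L2 set"
  show "f + g + k = f + (g + k)"
    by transfer (auto simp: L2_rel_def add.assoc intro!: square_integrable_add)
  show "f + g = g + f"
    by transfer (auto simp: L2_rel_def add.commute intro!: square_integrable_add)
  show "0 + f = f"
    by transfer (auto simp: L2_rel_def)
  show "- f + f = 0"
    by transfer (auto simp: L2_rel_def square_integrable_zero)
  show "f - g = f + - g"
    by (simp add: minus_L2_def)
  show "r *\<^sub>R (f + g) = r *\<^sub>R f + r *\<^sub>R g"
    by transfer (auto simp: L2_rel_def scaleR_conv_of_real distrib_left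
        intro!: square_integrable_add square_integrable_cmult)
  show "(r + s) *\<^sub>R f = r *\<^sub>R f + s *\<^sub>R f"
    by transfer (auto simp: L2_rel_def scaleR_conv_of_real distrib_right
        intro!: square_integrable_add square_integrable_cmult dest: square_integrable_cmult)
  show "r *\<^sub>R s *\<^sub>R f = (r * s) *\<^sub>R f"
    by transfer (auto simp: L2_rel_def scaleR_conv_of_real mult.assoc
        intro!: square_integrable_cmult)
  show "1 *\<^sub>R f = f"
    by transfer (auto simp: L2_rel_def)
  show "dist f g = norm (f - g)"
    by (simp add: dist_L2_def)
  show "sgn f = inverse (norm f) *\<^sub>R f"
    by (simp add: sgn_L2_def)
  show "(uniformity :: ('a L2 \<times> 'a L2) filter)
      = (INF e\<in>{0<..}. principal {(f, g). dist f g < e})"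
    by (simp add: uniformity_L2_def)
  show "open U \<longleftrightarrow> (\<forall>f\<in>U. eventually (\<lambda>(f', g). f' = f \<longrightarrow> g \<in> U) uniformity)"
    by (simp add: open_L2_def)
  show "f \<bullet> g = g \<bullet> f"
    by transfer (simp add: inner_commute)
  show "(f + g) \<bullet> k = f \<bullet> k + g \<bullet> k"
    by transfer (auto simp: L2_rel_def inner_add_left
        intro!: Bochner_Integration.integral_add integrable_inner_square_integrable)
  show "(r *\<^sub>R f) \<bullet> g = r * (f \<bullet> g)"
    by transfer simp
  show "0 \<le> f \<bullet> f"
    by transfer (simp add: Bochner_Integration.integral_nonneg)
  show "f \<bullet> f = 0 \<longleftrightarrow> f = 0"
  proof transfer
    fix f :: "'a \<Rightarrow> complex"
    assume "L2_rel f f"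
    then have sq: "square_integrable f"
      by (simp add: L2_rel_def)
    have "(LINT x|lborel. f x \<bullet> f x) = 0 \<longleftrightarrow> (AE x in lborel. f x \<bullet> f x = 0)"
      by (intro integral_nonneg_eq_0_iff_AE integrable_inner_square_integrable sq) auto
    then show "(LINT x|lborel. f x \<bullet> f x) = 0 \<longleftrightarrow> L2_rel f (\<lambda>x. 0)"
      by (simp add: L2_rel_def sq square_integrable_zero)
  qed
  show "norm f = sqrt (f \<bullet> f)"
    by (simp add: norm_L2_def)
qed

end

lemma norm_abs_L2:
  assumes "square_integrable f"
  shows "norm (abs_L2 f) = sqrt (LINT x|lborel. (norm (f x))\<^sup>2)"
  using assms
  by (simp add: norm_L2_def inner_L2.abs_eq L2_rel_def power2_norm_eq_inner)


section \<open>Operators on the Hilbert space\<close>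

text \<open>The type \<open>'a L2 \<Rightarrow>\<^sub>L 'a L2\<close> consists of the real-linear bounded operators. The complex-linear
  ones are among them and have the same operator norm; multiplication by a complex scalar \<open>z\<close> is
  \<open>mult_op (\<lambda>_. z)\<close>.\<close>

definition bdd_mult :: "('a::euclidean_space \<Rightarrow> complex) \<Rightarrow> 'a \<Rightarrow> complex" where
  "bdd_mult m = (if m \<in> borel_measurable borel \<and> bounded (range m) then m else (\<lambda>_. 0))"

lemma square_integrable_bdd_mult:
  "square_integrable f \<Longrightarrow> square_integrable (\<lambda>x. bdd_mult m x * f x)"
  by (rule square_integrable_mult) (auto simp: bdd_mult_def image_constant_conv)

lift_definition mult_L2 :: "('a \<Rightarrow> complex) \<Rightarrow> 'a::euclidean_space L2 \<Rightarrow> 'a L2" is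
  "\<lambda>m f x. bdd_mult m x * f x"
  by (auto simp: L2_rel_def intro: square_integrable_bdd_mult)

lemma bounded_linear_mult_L2: "bounded_linear (mult_L2 m)"
proof -
  have "bounded (range (bdd_mult m))"
    by (auto simp: bdd_mult_def image_constant_conv)
  then obtain B where B: "\<And>x. norm (bdd_mult m x) \<le> B"
    by (auto simp: bounded_iff)
  have "B \<ge> 0"
    using B[of undefined] norm_ge_zero order_trans by blast
  show ?thesis
  proof (rule bounded_linear_intro)
    show "mult_L2 m (f + g) = mult_L2 m f + mult_L2 m g" for f g
      by transfer (auto simp: L2_rel_def distrib_left
          intro!: square_integrable_add square_integrable_bdd_mult)
    show "mult_L2 m (r *\<^sub>R f) = r *\<^sub>R mult_L2 m f" for r f
      by transfer (auto simp: L2_rel_def scaleR_conv_of_real mult.left_commute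
          intro!: square_integrable_cmult square_integrable_bdd_mult)
    show "norm (mult_L2 m f) \<le> norm f * B" for f
    proof -
      have "mult_L2 m f \<bullet> mult_L2 m f \<le> B\<^sup>2 * (f \<bullet> f)"
        using B
      proof (transfer fixing: B)
        fix m f :: "'a \<Rightarrow> complex"
        assume "L2_rel f f" and B: "\<And>x. norm (bdd_mult m x) \<le> B"
        then have sq: "square_integrable f"
          by (simp add: L2_rel_def)
        have "(LINT x|lborel. (bdd_mult m x * f x) \<bullet> (bdd_mult m x * f x))
            \<le> (LINT x|lborel. B\<^sup>2 * (f x \<bullet> f x))"
        proof (rule integral_mono)
          show "integrable lborel (\<lambda>x. (bdd_mult m x * f x) \<bullet> (bdd_mult m x * f x))"
            by (intro integrable_inner_square_integrable square_integrable_bdd_mult sq)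
          show "integrable lborel (\<lambda>x. B\<^sup>2 * (f x \<bullet> f x))"
            by (intro integrable_mult_right integrable_inner_square_integrable sq)
          show "(bdd_mult m x * f x) \<bullet> (bdd_mult m x * f x) \<le> B\<^sup>2 * (f x \<bullet> f x)" for x
            using B[of x]
            by (auto simp: norm_mult power_mult_distrib simp flip: power2_norm_eq_inner
                intro!: mult_right_mono power_mono)
        qed
        then show "(LINT x|lborel. (bdd_mult m x * f x) \<bullet> (bdd_mult m x * f x))
            \<le> B\<^sup>2 * (LINT x|lborel. f x \<bullet> f x)"
          by simp
      qed
      then have "norm (mult_L2 m f) \<le> sqrt (B\<^sup>2 * (f \<bullet> f))"
        by (simp add: norm_L2_def)
      also have "\<dots> = norm f * B"
        using \<open>B \<ge> 0\<close> by (simp add: norm_L2_def real_sqrt_mult)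
      finally show ?thesis .
    qed
  qed
qed

lift_definition mult_op :: "('a \<Rightarrow> complex) \<Rightarrow> ('a::euclidean_space L2 \<Rightarrow>\<^sub>L 'a L2)" is mult_L2
  by (rule bounded_linear_mult_L2)

lemma mult_op_abs_L2:
  assumes "m \<in> borel_measurable borel" "bounded (range m)" "square_integrable f"
  shows "mult_op m (abs_L2 f) = abs_L2 (\<lambda>x. m x * f x)"
  using assms by (simp add: mult_op.rep_eq mult_L2.abs_eq L2_rel_def bdd_mult_def)

definition exp_op :: "('b::real_normed_vector \<Rightarrow>\<^sub>L 'b) \<Rightarrow> ('b \<Rightarrow>\<^sub>L 'b)" where
  "exp_op T = (\<Sum>n. (1 / fact n) *\<^sub>R ((\<lambda>S. T o\<^sub>L S) ^^ n) id_blinfun)"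

definition commutator :: "('b::real_normed_vector \<Rightarrow>\<^sub>L 'b) \<Rightarrow> ('b \<Rightarrow>\<^sub>L 'b) \<Rightarrow> ('b \<Rightarrow>\<^sub>L 'b)" where
  "commutator X Y = (X o\<^sub>L Y) - (Y o\<^sub>L X)"


section \<open>Symbols and Weyl quantization\<close>

text \<open>A multi-index is given as the list of coordinate directions in which to differentiate; for
  smooth functions the order of the list is immaterial.\<close>

primrec pderivs :: "'b list \<Rightarrow> ('b::euclidean_space \<Rightarrow> complex) \<Rightarrow> 'b \<Rightarrow> complex" where
  "pderivs [] f = f"
| "pderivs (b # bs) f = (\<lambda>x. frechet_derivative (pderivs bs f) (at x) b)"

definition smooth :: "('b::euclidean_space \<Rightarrow> complex) \<Rightarrow> bool" where
  "smooth f \<longleftrightarrow> (\<forall>bs\<in>lists Basis. \<forall>x. pderivs bs f differentiable (at x))"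

definition S1 :: "('a::euclidean_space \<times> 'a \<Rightarrow> complex) set" where
  "S1 = {a. smooth a \<and> (\<forall>bs\<in>lists Basis. \<exists>C. \<forall>p. norm (pderivs bs a p) \<le> C)}"

text \<open>The symbols whose seminorms are bounded by prescribed constants \<open>C\<^sub>\<alpha>\<^sub>\<beta>\<close>; estimates that are uniform
  over a bounded set of symbols are stated with it.\<close>

definition S1_within ::
  "(('a \<times> 'a) list \<Rightarrow> real) \<Rightarrow> ('a::euclidean_space \<times> 'a \<Rightarrow> complex) set" where
  "S1_within K = {a \<in> S1. \<forall>bs\<in>lists Basis. \<forall>p. norm (pderivs bs a p) \<le> K bs}"

definition schwartz :: "('a::euclidean_space \<Rightarrow> complex) set" where
  "schwartz = {u. smooth u \<and>
     (\<forall>bs\<in>lists Basis. \<forall>n. \<exists>C. \<forall>x. (1 + norm x) ^ n * norm (pderivs bs u x) \<le> C)}"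

text \<open>For \<open>a \<in> S1\<close> and \<open>u\<close> a Schwartz function the integral over \<open>y\<close> converges absolutely and is
  rapidly decreasing in \<open>\<xi>\<close>, so that the iterated integral converges although the double integral
  need not converge absolutely.\<close>

definition weyl ::
  "real \<Rightarrow> ('a::euclidean_space \<times> 'a \<Rightarrow> complex) \<Rightarrow> ('a \<Rightarrow> complex) \<Rightarrow> 'a \<Rightarrow> complex" where
  "weyl h a u x = complex_of_real (1 / (2 * pi * h) ^ DIM('a)) *
     (LINT \<xi>|lborel. LINT y|lborel.
        exp (\<i> / complex_of_real h * complex_of_real ((x - y) \<bullet> \<xi>)) * a ((1/2) *\<^sub>R (x + y), \<xi>) * u y)"

text \<open>The unique bounded extension to \<open>'a L2\<close> from the dense subspace of Schwartz functions.\<close>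

definition weyl_op ::
  "real \<Rightarrow> ('a::euclidean_space \<times> 'a \<Rightarrow> complex) \<Rightarrow> ('a L2 \<Rightarrow>\<^sub>L 'a L2)" where
  "weyl_op h a = (THE T. \<forall>u\<in>schwartz.
     square_integrable (weyl h a u) \<and> blinfun_apply T (abs_L2 u) = abs_L2 (weyl h a u))"

text \<open>\<open>conj_op z A X\<close> is \<open>exp (z * A) X exp (- z * A)\<close>.\<close>

definition conj_op :: "complex \<Rightarrow> ('a::euclidean_space L2 \<Rightarrow>\<^sub>L 'a L2) \<Rightarrow>
    ('a L2 \<Rightarrow>\<^sub>L 'a L2) \<Rightarrow> ('a L2 \<Rightarrow>\<^sub>L 'a L2)" where
  "conj_op z A X =
     exp_op (mult_op (\<lambda>_. z) o\<^sub>L A) o\<^sub>L X o\<^sub>L exp_op (mult_op (\<lambda>_. - z) o\<^sub>L A)"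

end

theory Submission
  imports Defs "HOL-Probability.Probability"
begin

text \<open>
  Conjugated by the Fourier transform, \<open>A\<^sub>0\<close> becomes multiplication by \<open>a (h \<xi>)\<close>, so that
  \<open>exp (\<i> \<rho> A\<^sub>0 / h\<^sup>2)\<close> is a unitary multiplier. Let \<open>D\<^sub>b S\<close> be the derivative at \<open>r = 0\<close> of the
  conjugate of an operator \<open>S\<close> by the modulation \<open>exp (\<i> r x\<^sub>b)\<close>; thus \<open>D\<^sub>b\<close> is a derivation that
  kills multiplication operators and differentiates symbols in \<open>\<xi>\<close>. The analytic core is the bound
  \<open>\<parallel>[V, S]\<parallel> \<le> C \<cdot> max\<^sub>\<alpha> sup \<bar>\<partial>\<^sup>\<alpha> v\<bar> \<cdot> max\<^sub>\<alpha> \<parallel>D\<^sup>\<alpha> S\<parallel>\<close> with \<open>\<alpha> \<noteq> 0\<close> on both sides. For decaying \<open>v\<close>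
  it holds since \<open>V\<close> is then an absolutely convergent integral of modulations. In general one cuts
  \<open>[V, S]\<close> into blocks between unit cubes, replaces \<open>v\<close> in each block by a Gaussian cut-off of
  \<open>v - v (c)\<close>, and sums the blocks by Schur's test, their decay off the diagonal being provided by
  further derivations.

  With \<open>W (\<rho>)\<close> the conjugate of \<open>V\<close> by \<open>exp (\<i> \<rho> A\<^sub>0 / h\<^sup>2)\<close>, the derivative \<open>D\<^sub>b W (\<rho>)\<close> is the
  conjugate of \<open>[G, V]\<close>, where \<open>G\<close> has the symbol \<open>\<i> (\<rho> / h) (\<partial>\<^sub>b a) (h \<xi>)\<close>. Every derivative of this
  symbol is \<open>O(\<Delta>t)\<close> because \<open>\<bar>\<rho>\<bar> = O(\<Delta>t)\<close> and \<open>h \<le> \<Delta>t\<close>, so the core bound, used with position and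
  frequency exchanged, gives \<open>D\<^sup>\<alpha> W (\<rho>) = O(\<Delta>t\<^bsup>\<bar>\<alpha>\<bar>\<^esup>)\<close>. Conjugation turns the double commutator into
  \<open>[[W (- s), W (\<tau> - s)], V]\<close>, and the core bound reduces it to \<open>[D\<^sup>\<alpha> W (- s), D\<^sup>\<beta> W (\<tau> - s)]\<close> with
  \<open>\<alpha> + \<beta> \<noteq> 0\<close>. If both \<open>\<alpha>\<close> and \<open>\<beta>\<close> are nonzero, this is \<open>O(\<Delta>t\<^sup>2)\<close> by the norms; otherwise one factor
  is a conjugate of \<open>V\<close>, and the core bound supplies a further factor \<open>\<Delta>t\<close>.
\<close>

section \<open>Integration on Euclidean space\<close>

text \<open>The obstacle is that \<open>G\<close> is not small: its symbol has size \<Delta>t / h,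
  unbounded as h tends to 0, and only its derivatives are O(\<Delta>t). A product of two norms is
  therefore no estimate for [G, V], and the core bound must not contain the size of the symbol. For
  decaying symbols that size does enter. Subtracting \<open>v (c)\<close> in each block removes it,
  because constants commute with complex-linear operators, but leaves a factor growing linearly with
  the distance of the cubes. Hence 2 d + 1 further derivations: 2 d make the weights of Schur's test
  summable, one absorbs the linear factor.

  Each use of the core bound consumes 2 d + 2 derivatives of the inner operator, and derivatives of
  nested commutators are sums of longer ones. So all orders are estimated together, in classes
  stable under derivation. A word of total order m is worth the m-th power of \<Delta>t, because a
  letter of order l enters only through its derivatives of order j > l, which carry \<rho> h^(j -
  2).\<close>

lemma
  fixes f :: "'a::euclidean_space \<Rightarrow> real \<Rightarrow> 'b::{real_normed_field,banach,second_countable_topology}"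
  assumes "\<And>b. b \<in> Basis \<Longrightarrow> integrable lborel (f b)"
  shows integrable_prod_Basis: "integrable lborel (\<lambda>x::'a. \<Prod>b\<in>Basis. f b (x \<bullet> b))"
    and integral_prod_Basis:
      "(LINT x|lborel. (\<Prod>b\<in>Basis. f b ((x::'a) \<bullet> b))) = (\<Prod>b\<in>Basis. LINT x|lborel. f b x)"
proof -
  interpret product_sigma_finite "\<lambda>_::'a. lborel :: real measure" ..
  let ?g = "\<lambda>f::'a \<Rightarrow> real. \<Sum>b\<in>Basis. f b *\<^sub>R b"
  have [measurable]: "f b \<in> borel_measurable borel" if "b \<in> Basis" for b
    using borel_measurable_integrable[OF assms[OF that]] by simp
  have m: "?g \<in> measurable (Pi\<^sub>M Basis (\<lambda>_. lborel)) borel"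
    by measurable
  have fm: "(\<lambda>x::'a. \<Prod>b\<in>Basis. f b (x \<bullet> b)) \<in> borel_measurable borel"
    by measurable
  have eq: "(\<Prod>b\<in>Basis. f b (?g y \<bullet> b)) = (\<Prod>b\<in>Basis. f b (y b))" for y
    by (intro prod.cong refl) simp
  show "integrable lborel (\<lambda>x::'a. \<Prod>b\<in>Basis. f b (x \<bullet> b))"
    unfolding lborel_eq[where 'a='a] using product_integrable_prod[OF finite_Basis assms]
    by (subst integrable_distr_eq[OF m fm]) (simp add: eq)
  show "(LINT x|lborel. (\<Prod>b\<in>Basis. f b ((x::'a) \<bullet> b))) = (\<Prod>b\<in>Basis. LINT x|lborel. f b x)"
    unfolding lborel_eq[where 'a='a] using product_integral_prod[OF finite_Basis assms]
    by (subst integral_distr[OF m fm]) (simp add: eq)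
qed

lemma
  fixes f :: "'a::euclidean_space \<Rightarrow> 'b::{banach,second_countable_topology}"
  assumes "c > 0" "f \<in> borel_measurable borel"
  shows integrable_affine_iff: "integrable lborel (\<lambda>x. f (t + c *\<^sub>R x)) \<longleftrightarrow> integrable lborel f"
    and integral_affine: "(LINT x|lborel. f x) = c ^ DIM('a) *\<^sub>R (LINT x|lborel. f (t + c *\<^sub>R x))"
proof -
  have [measurable]: "(\<lambda>x. t + c *\<^sub>R x) \<in> borel \<rightarrow>\<^sub>M borel" "f \<in> borel_measurable borel"
    using assms by auto
  note aff = lborel_affine[of c t]
  have "integrable lborel f \<longleftrightarrow>
      integrable (density (distr lborel borel (\<lambda>x. t + c *\<^sub>R x)) (\<lambda>_. ennreal (\<bar>c\<bar>^DIM('a)))) f"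
    using aff assms by (simp add: ennreal_power)
  also have "\<dots> \<longleftrightarrow> integrable lborel (\<lambda>x. f (t + c *\<^sub>R x))"
    using assms integrable_scaleR_right[of "1 / c ^ DIM('a)" lborel "\<lambda>x. c ^ DIM('a) *\<^sub>R f (t + c *\<^sub>R x)"]
    by (subst integrable_density) (auto simp: integrable_distr_eq)
  finally show "integrable lborel (\<lambda>x. f (t + c *\<^sub>R x)) \<longleftrightarrow> integrable lborel f" ..
  have "integral\<^sup>L lborel f =
      integral\<^sup>L (density (distr lborel borel (\<lambda>x. t + c *\<^sub>R x)) (\<lambda>_. ennreal (\<bar>c\<bar>^DIM('a)))) f"
    using aff assms by (simp add: ennreal_power)
  also have "\<dots> = c ^ DIM('a) *\<^sub>R (LINT x|lborel. f (t + c *\<^sub>R x))"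
    using assms by (subst integral_density) (auto simp: integral_distr)
  finally show "(LINT x|lborel. f x) = c ^ DIM('a) *\<^sub>R (LINT x|lborel. f (t + c *\<^sub>R x))" .
qed

lemma
  fixes f :: "'a::euclidean_space \<Rightarrow> 'b::{banach,second_countable_topology}"
  assumes "f \<in> borel_measurable borel"
  shows integrable_translation_iff: "integrable lborel (\<lambda>x. f (t + x)) \<longleftrightarrow> integrable lborel f"
    and integral_translation: "(LINT x|lborel. f (t + x)) = (LINT x|lborel. f x)"
  using integrable_affine_iff[of 1 f t] integral_affine[of 1 f t] assms by auto

text \<open>The common form of the Fubini arguments below: up to factors of modulus one, the kernels
  are dominated by a tensor product of two integrable functions.\<close>

lemma integrable_tensor:
  fixes f :: "'a::euclidean_space \<Rightarrow> 'c::{banach,second_countable_topology}"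
    and g :: "'b::euclidean_space \<Rightarrow> 'd::{banach,second_countable_topology}"
    and k :: "'a \<times> 'b \<Rightarrow> 'e::{banach,second_countable_topology}"
  assumes f: "integrable lborel f" and g: "integrable lborel g"
    and k: "k \<in> borel_measurable (lborel \<Otimes>\<^sub>M lborel)"
    and le: "\<And>x y. norm (k (x, y)) \<le> norm (f x) * norm (g y)"
  shows "integrable (lborel \<Otimes>\<^sub>M lborel) k"
proof (rule lborel_pair.Fubini_integrable[OF k])
  have [measurable]: "f \<in> borel_measurable borel" "g \<in> borel_measurable borel"
    using borel_measurable_integrable[OF f] borel_measurable_integrable[OF g] by simp_all
  have km: "(\<lambda>y. k (x, y)) \<in> borel_measurable lborel" for x
    using k by measurable
  show "AE x in lborel. integrable lborel (\<lambda>y. k (x, y))"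
  proof (rule AE_I2)
    fix x :: 'a
    show "integrable lborel (\<lambda>y. k (x, y))"
      by (rule Bochner_Integration.integrable_bound[where f="\<lambda>y. norm (f x) * norm (g y)"])
        (use g km le in auto)
  qed
  show "integrable lborel (\<lambda>x. LINT y|lborel. norm (k (x, y)))"
  proof (rule Bochner_Integration.integrable_bound
      [where f="\<lambda>x. norm (f x) * (LINT y|lborel. norm (g y))"])
    show "integrable lborel (\<lambda>x. norm (f x) * (LINT y|lborel. norm (g y)))"
      using f by auto
    show "(\<lambda>x. LINT y|lborel. norm (k (x, y))) \<in> borel_measurable lborel"
      using k by measurable
    show "AE x in lborel. norm (LINT y|lborel. norm (k (x, y))) \<le> norm (norm (f x) * (LINT y|lborel. norm (g y)))"
    proof (rule AE_I2)
      fix x :: 'a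
      have "(LINT y|lborel. norm (k (x, y))) \<le> (LINT y|lborel. norm (f x) * norm (g y))"
        using le g by (intro integral_mono' ) auto
      then show "norm (LINT y|lborel. norm (k (x, y))) \<le> norm (norm (f x) * (LINT y|lborel. norm (g y)))"
        by (simp add: abs_mult)
    qed
  qed
qed

lemma integrable_inverse_square: "integrable lborel (\<lambda>x::real. 1 / (1 + x\<^sup>2))"
  using integrable_inverse_1_plus_square
  by (simp add: set_integrable_def inverse_eq_divide)

text \<open>The exponent places the function below the product of the
  \<open>1 / (1 + (x \<bullet> b)\<^sup>2)\<close>, whose integrability is a one-dimensional matter.
  This one weight serves for functions and for their Fourier transforms.\<close>

definition decay :: "'a::euclidean_space \<Rightarrow> real" where
  "decay x = 1 / (1 + norm x) ^ (2 * DIM('a))"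

lemma decay_pos: "0 < decay x"
  by (simp add: decay_def add_pos_nonneg)

lemma decay_le_1: "decay x \<le> 1"
  using one_le_power[of "1 + norm x" "2 * DIM('a)"] decay_pos[of x]
  by (simp add: decay_def field_simps)

lemma continuous_decay: "continuous_on UNIV (decay :: 'a::euclidean_space \<Rightarrow> real)"
  unfolding decay_def
  by (intro continuous_intros) (metis add_nonneg_eq_0_iff norm_ge_zero power_not_zero zero_le_one zero_neq_one)

lemma decay_borel [measurable]: "decay \<in> borel_measurable borel"
  by (rule borel_measurable_continuous_onI[OF continuous_decay])

lemma decay_le_prod: "decay x \<le> (\<Prod>b\<in>Basis. 1 / (1 + (x \<bullet> b)\<^sup>2))"
proof -
  have "(\<Prod>b\<in>Basis. 1 + (x \<bullet> b)\<^sup>2) \<le> (\<Prod>b\<in>(Basis::'a set). (1 + norm x)\<^sup>2)"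
  proof (rule prod_mono, safe)
    fix b :: 'a assume "b \<in> Basis"
    then have "\<bar>x \<bullet> b\<bar>\<^sup>2 \<le> (norm x)\<^sup>2"
      by (intro power_mono Basis_le_norm) auto
    then show "1 + (x \<bullet> b)\<^sup>2 \<le> (1 + norm x)\<^sup>2"
      using norm_ge_zero[of x] by (auto simp: power2_sum intro: add_increasing2)
  qed auto
  also have "\<dots> = (1 + norm x) ^ (2 * DIM('a))"
    by (simp add: power_mult)
  finally show ?thesis
    unfolding decay_def prod_dividef
    by (intro frac_le) (auto intro!: prod_pos simp: add_pos_nonneg)
qed

lemma integrable_decay: "integrable lborel (decay :: 'a::euclidean_space \<Rightarrow> real)"
proof (rule Bochner_Integration.integrable_bound)
  show "integrable lborel (\<lambda>x::'a. \<Prod>b\<in>Basis. 1 / (1 + (x \<bullet> b)\<^sup>2))"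
    by (rule integrable_prod_Basis) (rule integrable_inverse_square)
  show "AE x::'a in lborel. norm (decay x) \<le> norm (\<Prod>b\<in>Basis. 1 / (1 + (x \<bullet> b)\<^sup>2))"
    using decay_le_prod decay_pos[where 'a='a]
    by (intro AE_I2) (auto simp: abs_of_pos intro: order_trans[OF decay_le_prod abs_ge_self])
qed simp

subsection \<open>Gaussians\<close>

lemma cis_borel [measurable]: "f \<in> borel_measurable M \<Longrightarrow> (\<lambda>x. cis (f x)) \<in> borel_measurable M"
proof -
  assume f: "f \<in> borel_measurable M"
  have "continuous_on UNIV cis"
    by (intro continuous_intros)
  then show ?thesis
    using f measurable_compose[OF f borel_measurable_continuous_onI] by blast
qed

text \<open>The characteristic function of the standard normal distribution supplies the value,
  which spares a contour shift or a differential equation.\<close>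

lemma
  fixes t :: real
  shows integrable_gauss_cis: "integrable lborel (\<lambda>x. complex_of_real (exp (- x\<^sup>2 / 2)) * cis (x * t))"
    and integral_gauss_cis: "(LINT x|lborel. complex_of_real (exp (- x\<^sup>2 / 2)) * cis (x * t))
      = complex_of_real (sqrt (2 * pi) * exp (- t\<^sup>2 / 2))"
proof -
  have gi: "integrable lborel (\<lambda>x. exp (- x\<^sup>2 / 2) :: real)"
  proof -
    have "integrable lborel (\<lambda>x. sqrt (2 * pi) * std_normal_density x)"
      by (intro integrable_mult_right integrable_normal_density) simp
    then show ?thesis
      by (simp add: normal_density_def)
  qed
  have "integrable lborel (\<lambda>x. complex_of_real (exp (- x\<^sup>2 / 2)))"
    using gi by (rule integrable_of_real)
  then show "integrable lborel (\<lambda>x. complex_of_real (exp (- x\<^sup>2 / 2)) * cis (x * t))"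
  proof (rule Bochner_Integration.integrable_bound)
    show "(\<lambda>x. complex_of_real (exp (- x\<^sup>2 / 2)) * cis (x * t)) \<in> borel_measurable lborel"
      by measurable
  qed (auto simp: norm_mult)
  have "complex_of_real (exp (- t\<^sup>2 / 2)) = char std_normal_distribution t"
    by (simp add: char_std_normal_distribution)
  also have "\<dots> = (LINT x|lborel. std_normal_density x *\<^sub>R iexp (t * x))"
    unfolding char_def by (subst integral_density) (auto simp: normal_density_nonneg)
  also have "\<dots> = (LINT x|lborel. complex_of_real (1 / sqrt (2 * pi)) * (complex_of_real (exp (- x\<^sup>2 / 2)) * cis (x * t)))"
    by (intro Bochner_Integration.integral_cong refl)
      (simp add: std_normal_density_def scaleR_conv_of_real cis_conv_exp mult.commute)
  also have "\<dots> = complex_of_real (1 / sqrt (2 * pi)) * (LINT x|lborel. complex_of_real (exp (- x\<^sup>2 / 2)) * cis (x * t))"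
    by simp
  finally show "(LINT x|lborel. complex_of_real (exp (- x\<^sup>2 / 2)) * cis (x * t))
      = complex_of_real (sqrt (2 * pi) * exp (- t\<^sup>2 / 2))"
    by (simp add: field_simps)
qed

lemma cis_sum: "finite I \<Longrightarrow> cis (\<Sum>i\<in>I. f i) = (\<Prod>i\<in>I. cis (f i))"
  by (induction I rule: finite_induct) (auto simp flip: cis_mult)

definition gauss :: "'a::euclidean_space \<Rightarrow> real" where
  "gauss x = exp (- (norm x)\<^sup>2 / 2)"

lemma gauss_pos: "0 < gauss x" and gauss_le_1: "gauss x \<le> 1" and gauss_0 [simp]: "gauss 0 = 1"
  by (simp_all add: gauss_def)

lemma continuous_on_gauss [continuous_intros]:
  "continuous_on S f \<Longrightarrow> continuous_on S (\<lambda>x. gauss (f x))"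
  unfolding gauss_def by (intro continuous_on_exp continuous_on_divide continuous_on_minus
    continuous_on_power continuous_on_norm continuous_on_const) simp_all

lemma abs_gauss [simp]: "\<bar>gauss x\<bar> = gauss x" and gauss_nonneg [simp]: "0 \<le> gauss x"
  by (simp_all add: gauss_def)

lemma gauss_borel [measurable]: "gauss \<in> borel_measurable borel"
  by (intro borel_measurable_continuous_onI continuous_intros)

lemma gauss_prod: "gauss x = (\<Prod>b\<in>Basis. exp (- (x \<bullet> b)\<^sup>2 / 2))"
proof -
  have "(norm x)\<^sup>2 = (\<Sum>b\<in>Basis. (x \<bullet> b)\<^sup>2)"
    using euclidean_inner[of x x] by (simp add: power2_norm_eq_inner) (simp add: power2_eq_square)
  then show ?thesis
    by (simp add: gauss_def flip: exp_sum) (simp add: sum_negf sum_divide_distrib)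
qed

lemma
  fixes t :: "'a::euclidean_space"
  shows integrable_gauss_cis_euclidean: "integrable lborel (\<lambda>x. complex_of_real (gauss x) * cis (x \<bullet> t))"
    and integral_gauss_cis_euclidean: "(LINT x|lborel. complex_of_real (gauss x) * cis (x \<bullet> t))
      = complex_of_real (sqrt (2 * pi) ^ DIM('a) * gauss t)"
proof -
  have eq: "(\<lambda>x. complex_of_real (gauss x) * cis (x \<bullet> t))
      = (\<lambda>x. \<Prod>b\<in>Basis. complex_of_real (exp (- (x \<bullet> b)\<^sup>2 / 2)) * cis ((x \<bullet> b) * (t \<bullet> b)))"
  proof
    fix x :: 'a
    have "cis (x \<bullet> t) = (\<Prod>b\<in>Basis. cis ((x \<bullet> b) * (t \<bullet> b)))"
      by (subst euclidean_inner) (simp add: cis_sum)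
    then show "complex_of_real (gauss x) * cis (x \<bullet> t)
      = (\<Prod>b\<in>Basis. complex_of_real (exp (- (x \<bullet> b)\<^sup>2 / 2)) * cis ((x \<bullet> b) * (t \<bullet> b)))"
      by (simp add: gauss_prod prod.distrib)
  qed
  show "integrable lborel (\<lambda>x. complex_of_real (gauss x) * cis (x \<bullet> t))"
    unfolding eq
    by (rule integrable_prod_Basis[of "\<lambda>b x. complex_of_real (exp (- x\<^sup>2 / 2)) * cis (x * (t \<bullet> b))"])
      (rule integrable_gauss_cis)
  show "(LINT x|lborel. complex_of_real (gauss x) * cis (x \<bullet> t))
      = complex_of_real (sqrt (2 * pi) ^ DIM('a) * gauss t)"
    unfolding eq
    by (subst integral_prod_Basis[of "\<lambda>b x. complex_of_real (exp (- x\<^sup>2 / 2)) * cis (x * (t \<bullet> b))"])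
      (simp_all only: integrable_gauss_cis integral_gauss_cis, simp add: gauss_prod prod.distrib)
qed

lemma integrable_gauss: "integrable lborel (gauss :: 'a::euclidean_space \<Rightarrow> real)"
proof -
  have "integrable lborel (\<lambda>x::'a. complex_of_real (gauss x))"
    using integrable_gauss_cis_euclidean[of "0::'a"] by simp
  from integrable_Re[OF this] show ?thesis by simp
qed

lemma integral_gauss: "(LINT x|lborel. gauss (x::'a::euclidean_space)) = sqrt (2 * pi) ^ DIM('a)"
proof -
  have "complex_of_real (LINT x|lborel. gauss (x::'a)) = (LINT x|lborel. complex_of_real (gauss x) * cis (x \<bullet> (0::'a)))"
    by simp
  also have "\<dots> = complex_of_real (sqrt (2 * pi) ^ DIM('a))"
    by (subst integral_gauss_cis_euclidean) simp
  finally show ?thesis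
    using of_real_eq_iff by blast
qed

section \<open>The Fourier transform\<close>

text \<open>The sign \<open>s\<close> is \<open>1\<close> or \<open>- 1\<close> wherever it matters,
  so that the transform and its inverse share their lemmas. There is no normalizing factor;
  inversion then carries \<open>(2 * pi) ^ DIM('a)\<close>, and \<open>nft\<close> is the unitary
  version.\<close>

definition ft :: "real \<Rightarrow> ('a::euclidean_space \<Rightarrow> complex) \<Rightarrow> 'a \<Rightarrow> complex" where
  "ft s u \<xi> = (LINT y|lborel. cis (s * (y \<bullet> \<xi>)) * u y)"


lemma integrable_cis_mult:
  assumes "integrable lborel u" "f \<in> borel_measurable borel"
  shows "integrable lborel (\<lambda>y. cis (f y) * u y)"
  using assms(1)
proof (rule Bochner_Integration.integrable_bound)
  show "(\<lambda>y. cis (f y) * u y) \<in> borel_measurable lborel"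
    using assms(2) borel_measurable_integrable[OF assms(1)] by simp
qed (auto simp: norm_mult)

lemma norm_ft_le:
  shows "norm (ft s u \<xi>) \<le> (LINT y|lborel. norm (u y))"
  unfolding ft_def by (rule order_trans[OF integral_norm_bound]) (simp add: norm_mult)

lemma continuous_ft:
  assumes "integrable lborel u"
  shows "continuous_on UNIV (ft s u)"
  unfolding continuous_on_sequentially ft_def comp_def
proof safe
  fix X :: "nat \<Rightarrow> 'a" and \<xi>
  assume "X \<longlonglongrightarrow> \<xi>"
  have [measurable]: "u \<in> borel_measurable borel"
    using borel_measurable_integrable[OF assms] by simp
  show "(\<lambda>n. LINT y|lborel. cis (s * (y \<bullet> X n)) * u y) \<longlonglongrightarrow> (LINT y|lborel. cis (s * (y \<bullet> \<xi>)) * u y)"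
  proof (rule integral_dominated_convergence[where w="\<lambda>y. norm (u y)"])
    show "AE y in lborel. (\<lambda>n. cis (s * (y \<bullet> X n)) * u y) \<longlonglongrightarrow> cis (s * (y \<bullet> \<xi>)) * u y"
      by (intro AE_I2 tendsto_intros \<open>X \<longlonglongrightarrow> \<xi>\<close>)
  qed (use assms in \<open>auto simp: norm_mult\<close>)
qed

text \<open>Gaussian regularization. The factor \<open>gauss (\<epsilon> n *\<^sub>R \<xi>)\<close>
  makes the double integral absolutely convergent, and Fubini turns \<open>I n\<close> into a
  Gaussian average of \<open>u\<close> around \<open>x\<close> at scale \<open>\<epsilon> n\<close>.
  Dominated convergence gives both limits. One factor \<open>sqrt (2 * pi) ^ DIM('a)\<close> comes
  from the transform of the Gaussian, the other from its total mass.\<close>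

lemma fourier_inversion:
  fixes u :: "'a::euclidean_space \<Rightarrow> complex"
  assumes s: "s = 1 \<or> s = - 1" and cont: "continuous_on UNIV u" and bdd: "\<And>x. norm (u x) \<le> B"
    and int: "integrable lborel u" and int': "integrable lborel (ft s u)"
  shows "ft (- s) (ft s u) x = (2 * pi) ^ DIM('a) * u x"
proof -
  define \<epsilon> where "\<epsilon> n = 1 / real (Suc n)" for n
  have \<epsilon>: "\<epsilon> n > 0" for n by (simp add: \<epsilon>_def)
  have \<epsilon>0: "\<epsilon> \<longlonglongrightarrow> 0"
    unfolding \<epsilon>_def using LIMSEQ_inverse_real_of_nat by (simp add: inverse_eq_divide)
  define I where "I n = (LINT \<xi>|lborel. complex_of_real (gauss (\<epsilon> n *\<^sub>R \<xi>)) * (cis (- s * (\<xi> \<bullet> x)) * ft s u \<xi>))" for n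
  have [measurable]: "u \<in> borel_measurable borel" "ft s u \<in> borel_measurable borel"
    using cont continuous_ft[OF int] by (auto intro: borel_measurable_continuous_onI)
  have lim1: "I \<longlonglongrightarrow> ft (- s) (ft s u) x"
    unfolding I_def ft_def[of "- s"]
  proof (rule integral_dominated_convergence[where w="\<lambda>\<xi>. norm (ft s u \<xi>)"])
    show "AE \<xi> in lborel. (\<lambda>n. complex_of_real (gauss (\<epsilon> n *\<^sub>R \<xi>)) * (cis (- s * (\<xi> \<bullet> x)) * ft s u \<xi>))
        \<longlonglongrightarrow> cis (- s * (\<xi> \<bullet> x)) * ft s u \<xi>"
    proof (rule AE_I2)
      fix \<xi> :: 'a
      have "(\<lambda>n. gauss (\<epsilon> n *\<^sub>R \<xi>)) \<longlonglongrightarrow> exp (- (norm (0 *\<^sub>R \<xi>))\<^sup>2 / 2)"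
        unfolding gauss_def by (intro tendsto_intros \<epsilon>0) auto
      then have "(\<lambda>n. complex_of_real (gauss (\<epsilon> n *\<^sub>R \<xi>)) * (cis (- s * (\<xi> \<bullet> x)) * ft s u \<xi>))
        \<longlonglongrightarrow> complex_of_real 1 * (cis (- s * (\<xi> \<bullet> x)) * ft s u \<xi>)"
        by (intro tendsto_intros) simp
      then show "(\<lambda>n. complex_of_real (gauss (\<epsilon> n *\<^sub>R \<xi>)) * (cis (- s * (\<xi> \<bullet> x)) * ft s u \<xi>))
        \<longlonglongrightarrow> cis (- s * (\<xi> \<bullet> x)) * ft s u \<xi>" by simp
    qed
    show "AE \<xi> in lborel. norm (complex_of_real (gauss (\<epsilon> n *\<^sub>R \<xi>)) * (cis (- s * (\<xi> \<bullet> x)) * ft s u \<xi>)) \<le> norm (ft s u \<xi>)" for n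
      using gauss_le_1 by (intro AE_I2) (auto simp: norm_mult intro!: mult_left_le_one_le)
  qed (use int' in auto)
  have I_eq: "I n = complex_of_real (sqrt (2 * pi) ^ DIM('a)) *
      (LINT z|lborel. complex_of_real (gauss z) * u (x + \<epsilon> n *\<^sub>R z))" for n
  proof -
    have [measurable]: "(\<lambda>y. u (x + \<epsilon> n *\<^sub>R y)) \<in> borel_measurable borel"
      by measurable
    let ?k = "\<lambda>\<xi> y. complex_of_real (gauss (\<epsilon> n *\<^sub>R \<xi>)) * (cis (- s * (\<xi> \<bullet> x)) * (cis (s * (y \<bullet> \<xi>)) * u y))"
    have gi: "integrable lborel (\<lambda>\<xi>::'a. gauss (\<epsilon> n *\<^sub>R \<xi>))"
      using integrable_affine_iff[OF \<epsilon>[of n], of "gauss :: 'a \<Rightarrow> real" 0] integrable_gauss by simp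
    have ki: "integrable (lborel \<Otimes>\<^sub>M lborel) (case_prod ?k)"
    proof (rule integrable_tensor[OF gi int])
      show "case_prod ?k \<in> borel_measurable (lborel \<Otimes>\<^sub>M lborel)"
        by measurable
    qed (simp add: norm_mult)
    have "I n = (LINT \<xi>|lborel. LINT y|lborel. ?k \<xi> y)"
      unfolding I_def ft_def by (simp only: integral_mult_right_zero)
    also have "\<dots> = (LINT y|lborel. LINT \<xi>|lborel. ?k \<xi> y)"
      by (rule lborel_pair.Fubini_integral[OF ki, symmetric])
    also have "\<dots> = (LINT y|lborel. u y * (complex_of_real (1 / \<epsilon> n ^ DIM('a)) *
        complex_of_real (sqrt (2 * pi) ^ DIM('a) * gauss ((s / \<epsilon> n) *\<^sub>R (y - x)))))"
    proof (rule Bochner_Integration.integral_cong[OF refl])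
      fix y
      let ?t = "(s / \<epsilon> n) *\<^sub>R (y - x)"
      let ?f = "\<lambda>\<xi>. complex_of_real (gauss \<xi>) * cis (\<xi> \<bullet> ?t)"
      have "(LINT \<xi>|lborel. ?k \<xi> y) = (LINT \<xi>|lborel. u y * ?f (0 + \<epsilon> n *\<^sub>R \<xi>))"
      proof (rule Bochner_Integration.integral_cong[OF refl])
        fix \<xi> :: 'a
        have "cis (- s * (\<xi> \<bullet> x)) * cis (s * (y \<bullet> \<xi>)) = cis (s * (\<xi> \<bullet> (y - x)))"
          by (simp add: cis_mult inner_diff_right right_diff_distrib inner_commute)
        moreover have "(0 + \<epsilon> n *\<^sub>R \<xi>) \<bullet> ?t = s * (\<xi> \<bullet> (y - x))"
          using \<epsilon>[of n] by simp
        ultimately show "?k \<xi> y = u y * ?f (0 + \<epsilon> n *\<^sub>R \<xi>)"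
          by (simp only: mult.assoc[symmetric]) (simp add: mult_ac)
      qed
      also have "\<dots> = u y * (LINT \<xi>|lborel. ?f (0 + \<epsilon> n *\<^sub>R \<xi>))"
        by simp
      also have "(LINT \<xi>|lborel. ?f (0 + \<epsilon> n *\<^sub>R \<xi>)) = complex_of_real (1 / \<epsilon> n ^ DIM('a)) * (LINT \<xi>|lborel. ?f \<xi>)"
        using \<epsilon>[of n] by (subst integral_affine[of "\<epsilon> n" ?f 0]) (auto simp: scaleR_conv_of_real)
      finally show "(LINT \<xi>|lborel. ?k \<xi> y) = u y * (complex_of_real (1 / \<epsilon> n ^ DIM('a)) *
        complex_of_real (sqrt (2 * pi) ^ DIM('a) * gauss ?t))"
        by (simp only: integral_gauss_cis_euclidean)
    qed
    also have "\<dots> = \<epsilon> n ^ DIM('a) *\<^sub>R (LINT z|lborel. u (x + \<epsilon> n *\<^sub>R z) * (complex_of_real (1 / \<epsilon> n ^ DIM('a)) *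
        complex_of_real (sqrt (2 * pi) ^ DIM('a) * gauss ((s / \<epsilon> n) *\<^sub>R (x + \<epsilon> n *\<^sub>R z - x)))))"
      using \<epsilon> by (intro integral_affine) auto
    also have "\<dots> = \<epsilon> n ^ DIM('a) *\<^sub>R (LINT z|lborel. complex_of_real (sqrt (2 * pi) ^ DIM('a) / \<epsilon> n ^ DIM('a)) *
        (complex_of_real (gauss z) * u (x + \<epsilon> n *\<^sub>R z)))"
    proof -
      have "gauss (s *\<^sub>R z) = gauss z" for z :: 'a
        using s by (auto simp: gauss_def)
      moreover have "(s / \<epsilon> n) *\<^sub>R (x + \<epsilon> n *\<^sub>R z - x) = s *\<^sub>R z" for z
        using \<epsilon>[of n] by simp
      ultimately have "gauss ((s / \<epsilon> n) *\<^sub>R (x + \<epsilon> n *\<^sub>R z - x)) = gauss z" for z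
        by metis
      then show ?thesis
        by (intro arg_cong2[where f="(*\<^sub>R)"] refl Bochner_Integration.integral_cong) (simp add: field_simps)
    qed
    also have "\<dots> = complex_of_real (sqrt (2 * pi) ^ DIM('a)) *
      (LINT z|lborel. complex_of_real (gauss z) * u (x + \<epsilon> n *\<^sub>R z))"
      using \<epsilon>[of n] by (subst integral_mult_right_zero) (simp add: scaleR_conv_of_real)
    finally show ?thesis .
  qed
  have "(\<lambda>n. LINT z|lborel. complex_of_real (gauss z) * u (x + \<epsilon> n *\<^sub>R z))
      \<longlonglongrightarrow> (LINT z|lborel. complex_of_real (gauss (z::'a)) * u x)"
  proof (rule integral_dominated_convergence[where w="\<lambda>z. gauss z * B"])
    show "AE z in lborel. (\<lambda>n. complex_of_real (gauss z) * u (x + \<epsilon> n *\<^sub>R z)) \<longlonglongrightarrow> complex_of_real (gauss z) * u x"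
    proof (rule AE_I2)
      fix z
      have "(\<lambda>n. x + \<epsilon> n *\<^sub>R z) \<longlonglongrightarrow> x + 0 *\<^sub>R z"
        by (intro tendsto_intros \<epsilon>0)
      then have "(\<lambda>n. u (x + \<epsilon> n *\<^sub>R z)) \<longlonglongrightarrow> u x"
        using continuous_on_tendsto_compose[OF cont, of "\<lambda>n. x + \<epsilon> n *\<^sub>R z" x] by simp
      then show "(\<lambda>n. complex_of_real (gauss z) * u (x + \<epsilon> n *\<^sub>R z)) \<longlonglongrightarrow> complex_of_real (gauss z) * u x"
        by (intro tendsto_intros)
    qed
    show "AE z in lborel. norm (complex_of_real (gauss z) * u (x + \<epsilon> n *\<^sub>R z)) \<le> gauss z * B" for n
      using bdd by (intro AE_I2) (auto simp: norm_mult intro!: mult_left_mono)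
    show "integrable lborel (\<lambda>z::'a. gauss z * B)"
      by (intro integrable_mult_left integrable_gauss)
    show "(\<lambda>z::'a. complex_of_real (gauss z) * u x) \<in> borel_measurable lborel"
      by measurable
    show "(\<lambda>z::'a. complex_of_real (gauss z) * u (x + \<epsilon> n *\<^sub>R z)) \<in> borel_measurable lborel" for n
      by measurable
  qed
  then have "I \<longlonglongrightarrow> complex_of_real (sqrt (2 * pi) ^ DIM('a)) * (LINT z|lborel. complex_of_real (gauss (z::'a)) * u x)"
    unfolding I_eq[abs_def] by (rule tendsto_mult[OF tendsto_const])
  also have "(LINT z|lborel. complex_of_real (gauss (z::'a)) * u x) = complex_of_real (sqrt (2 * pi) ^ DIM('a)) * u x"
    by (simp only: integral_mult_left_zero integral_complex_of_real integral_gauss)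
  finally have "ft (- s) (ft s u) x = complex_of_real (sqrt (2 * pi) ^ DIM('a)) * (complex_of_real (sqrt (2 * pi) ^ DIM('a)) * u x)"
    by (rule LIMSEQ_unique[OF lim1])
  moreover have "sqrt (2 * pi) ^ DIM('a) * sqrt (2 * pi) ^ DIM('a) = (2 * pi) ^ DIM('a)"
    by (subst power_mult_distrib[symmetric]) simp
  ultimately show ?thesis
    by (simp only: mult.assoc[symmetric] of_real_mult[symmetric] of_real_power[symmetric])
qed

section \<open>Functions with bounded derivatives\<close>

definition pd :: "'a::euclidean_space \<Rightarrow> ('a \<Rightarrow> complex) \<Rightarrow> 'a \<Rightarrow> complex" where
  "pd b f x = frechet_derivative f (at x) b"

lemma pderivs_Cons: "pderivs (b # bs) f = pd b (pderivs bs f)"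
  by (simp add: pd_def fun_eq_iff)

lemma has_derivative_imp_pd: "(f has_derivative D) (at x) \<Longrightarrow> pd b f x = D b"
  using frechet_derivative_at by (metis pd_def)

lemma pd_vector_derivative:
  assumes "f differentiable (at (x + r *\<^sub>R b))"
  shows "((\<lambda>r. f (x + r *\<^sub>R b)) has_vector_derivative pd b f (x + r *\<^sub>R b)) (at r within S)"
proof -
  have f: "(f has_derivative frechet_derivative f (at (x + r *\<^sub>R b))) (at (x + r *\<^sub>R b))"
    using assms frechet_derivative_works by blast
  have "((\<lambda>r. x + r *\<^sub>R b) has_derivative (\<lambda>h. h *\<^sub>R b)) (at r within S)"
    by (auto intro!: derivative_eq_intros)
  from has_derivative_compose[OF this f] linear_frechet_derivative[OF assms]
  show ?thesis
    by (simp add: has_vector_derivative_def pd_def linear_scale)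
qed

text \<open>One weight dominates all partial derivatives up to order \<open>n\<close>. The recursion
  runs through the derivatives themselves, so that the product rule and translations are plain
  inductions; at order 0 only continuity is asked for.\<close>

primrec bd :: "nat \<Rightarrow> ('a::euclidean_space \<Rightarrow> real) \<Rightarrow> ('a \<Rightarrow> complex) \<Rightarrow> bool" where
  "bd 0 w f \<longleftrightarrow> continuous_on UNIV f \<and> (\<forall>x. norm (f x) \<le> w x)"
| "bd (Suc n) w f \<longleftrightarrow> (\<forall>x. f differentiable (at x)) \<and> (\<forall>x. norm (f x) \<le> w x) \<and> (\<forall>b\<in>Basis. bd n w (pd b f))"

lemma differentiable_imp_continuous_on_UNIV: "(\<And>x. f differentiable (at x)) \<Longrightarrow> continuous_on UNIV f"
  using differentiable_imp_continuous_within continuous_at_imp_continuous_on by blast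

lemma bd_continuous: "bd n w f \<Longrightarrow> continuous_on UNIV f"
  by (cases n) (auto intro: differentiable_imp_continuous_on_UNIV)

lemma bd_le: "bd n w f \<Longrightarrow> norm (f x) \<le> w x"
  by (cases n) auto

lemma bd_Suc_D: "bd (Suc n) w f \<Longrightarrow> bd n w f"
  by (induction n arbitrary: f) (auto intro: differentiable_imp_continuous_on_UNIV)

lemma bd_order_mono: "bd n w f \<Longrightarrow> m \<le> n \<Longrightarrow> bd m w f"
  by (induction n) (use bd_Suc_D le_Suc_eq in auto)

lemma bd_mono: "bd n w f \<Longrightarrow> (\<And>x. w x \<le> w' x) \<Longrightarrow> bd n w' f"
  by (induction n arbitrary: f) (auto intro: order_trans)

lemma pd_add:
  assumes "\<And>x. f differentiable (at x)" "\<And>x. g differentiable (at x)"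
  shows "pd b (\<lambda>x. f x + g x) = (\<lambda>x. pd b f x + pd b g x)"
proof
  fix x
  have "((\<lambda>x. f x + g x) has_derivative (\<lambda>h. frechet_derivative f (at x) h + frechet_derivative g (at x) h)) (at x)"
    using assms[of x] frechet_derivative_works by (intro has_derivative_add) blast+
  then show "pd b (\<lambda>x. f x + g x) x = pd b f x + pd b g x"
    by (simp add: has_derivative_imp_pd) (simp add: pd_def)
qed

lemma pd_mult:
  assumes "\<And>x. f differentiable (at x)" "\<And>x. g differentiable (at x)"
  shows "pd b (\<lambda>x. f x * g x) = (\<lambda>x. pd b f x * g x + f x * pd b g x)"
proof
  fix x
  have "((\<lambda>x. f x * g x) has_derivative (\<lambda>h. f x * frechet_derivative g (at x) h + frechet_derivative f (at x) h * g x)) (at x)"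
    using assms[of x] frechet_derivative_works by (intro has_derivative_mult) blast+
  then show "pd b (\<lambda>x. f x * g x) x = pd b f x * g x + f x * pd b g x"
    by (simp add: has_derivative_imp_pd) (simp add: pd_def)
qed

lemma pd_const: "pd b (\<lambda>x. c) = (\<lambda>x. 0)"
  by (auto simp: has_derivative_imp_pd[OF has_derivative_const])

lemma pd_cmult: "(\<And>x. f differentiable (at x)) \<Longrightarrow> pd b (\<lambda>x. c * f x) = (\<lambda>x. c * pd b f x)"
  by (simp add: pd_mult pd_const)

lemma bd_add: "bd n w f \<Longrightarrow> bd n w' g \<Longrightarrow> bd n (\<lambda>x. w x + w' x) (\<lambda>x. f x + g x)"
  by (induction n arbitrary: f g)
    (auto simp: pd_add intro!: continuous_on_add norm_triangle_mono differentiable_add)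

text \<open>Each differentiation doubles the number of terms in Leibniz' rule, whence
  \<open>2 ^ n\<close>.\<close>

lemma bd_mult:
  "bd n w f \<Longrightarrow> bd n w' g \<Longrightarrow> bd n (\<lambda>x. 2 ^ n * (w x * w' x)) (\<lambda>x. f x * g x)"
proof (induction n arbitrary: f g)
  case 0
  then show ?case
    by (auto simp: norm_mult intro!: continuous_on_mult mult_mono intro: order_trans[OF norm_ge_zero])
next
  case (Suc n)
  have nn: "0 \<le> w x" "0 \<le> w' x" for x
    using bd_le[OF Suc.prems(1)] bd_le[OF Suc.prems(2)] norm_ge_zero order_trans by blast+
  have "norm (f x * g x) \<le> 2 ^ Suc n * (w x * w' x)" for x
  proof -
    have "norm (f x * g x) \<le> w x * w' x"
      using bd_le[OF Suc.prems(1)] bd_le[OF Suc.prems(2)] nn by (auto simp: norm_mult intro!: mult_mono)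
    also have "\<dots> \<le> 2 ^ Suc n * (w x * w' x)"
      using nn[of x] mult_right_mono[OF one_le_power[of "2::real" "Suc n"], of "w x * w' x"] by simp
    finally show ?thesis .
  qed
  moreover have "bd n (\<lambda>x. 2 ^ Suc n * (w x * w' x)) (pd b (\<lambda>x. f x * g x))" if b: "b \<in> Basis" for b
  proof -
    have "bd n (\<lambda>x. 2 ^ n * (w x * w' x)) (\<lambda>x. pd b f x * g x)"
      using Suc.IH[OF _ bd_Suc_D[OF Suc.prems(2)]] Suc.prems(1) b by auto
    moreover have "bd n (\<lambda>x. 2 ^ n * (w x * w' x)) (\<lambda>x. f x * pd b g x)"
      using Suc.IH[OF bd_Suc_D[OF Suc.prems(1)]] Suc.prems(2) b by auto
    ultimately show ?thesis
      using bd_add[of n "\<lambda>x. 2 ^ n * (w x * w' x)" "\<lambda>x. pd b f x * g x"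
          "\<lambda>x. 2 ^ n * (w x * w' x)" "\<lambda>x. f x * pd b g x"] Suc.prems
      by (simp add: pd_mult mult_ac)
  qed
  ultimately show ?case
    using Suc.prems by (auto intro: differentiable_mult)
qed

lemma bd_pderivs:
  assumes "\<And>cs. cs \<in> lists Basis \<Longrightarrow> length cs \<le> n \<Longrightarrow> (\<forall>x. norm (pderivs (cs @ bs) f x) \<le> w x)"
    and "smooth f" "bs \<in> lists Basis"
  shows "bd n w (pderivs bs f)"
  using assms(1,3)
proof (induction n arbitrary: bs)
  case 0
  then show ?case
    using assms(2) 0(1)[of "[]"] by (auto simp: smooth_def intro!: differentiable_imp_continuous_on_UNIV)
next
  case (Suc n)
  have "bd n w (pderivs (b # bs) f)" if "b \<in> Basis" for b
  proof (rule Suc.IH)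
    show "\<forall>x. norm (pderivs (cs @ b # bs) f x) \<le> w x" if "cs \<in> lists Basis" "length cs \<le> n" for cs
      using Suc.prems(1)[of "cs @ [b]"] that \<open>b \<in> Basis\<close> by simp
  qed (use Suc.prems that in auto)
  then show ?case
    using Suc.prems(1)[of "[]"] Suc.prems(2) assms(2) by (auto simp: pderivs_Cons[symmetric] smooth_def simp del: pderivs.simps)
qed

subsection \<open>Integration by parts\<close>

text \<open>By translation invariance the integral equals that of the average of
  \<open>pd b f (x + r *\<^sub>R b)\<close> over \<open>r\<close> between 0 and 1. The fundamental
  theorem turns the average into \<open>f (x + b) - f x\<close>, whose integral vanishes. In this
  way no boundary terms at infinity arise.\<close>

lemma integral_pd_zero:
  fixes f :: "'a::euclidean_space \<Rightarrow> complex"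
  assumes diff: "\<And>x. f differentiable (at x)" and cont: "continuous_on UNIV (pd b f)"
    and int: "integrable lborel f" "integrable lborel (pd b f)"
  shows "(LINT x|lborel. pd b f x) = 0"
proof -
  let ?k = "\<lambda>x r. indicator {0..1::real} r *\<^sub>R pd b f (x + r *\<^sub>R b)"
  have [measurable]: "pd b f \<in> borel_measurable borel" "f \<in> borel_measurable borel"
    using cont differentiable_imp_continuous_on_UNIV[OF diff] by (auto intro: borel_measurable_continuous_onI)
  have ki: "integrable (lborel \<Otimes>\<^sub>M lborel) (\<lambda>(r, x). ?k x r)"
  proof (rule lborel_pair.Fubini_integrable)
    show "(\<lambda>(r, x). ?k x r) \<in> borel_measurable (lborel \<Otimes>\<^sub>M lborel)"
      by measurable
    have tr: "integrable lborel (\<lambda>x. pd b f (x + r *\<^sub>R b))" for r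
      using integrable_translation_iff[of "pd b f" "r *\<^sub>R b"] int by (simp add: add.commute)
    have "(LINT x|lborel. norm (pd b f (x + r *\<^sub>R b))) = (LINT x|lborel. norm (pd b f x))" for r
      using integral_translation[of "\<lambda>x. norm (pd b f x)" "r *\<^sub>R b"] by (simp add: add.commute)
    then have "(\<lambda>r. LINT x|lborel. norm (case (r, x) of (r, x) \<Rightarrow> ?k x r))
        = (\<lambda>r. indicator {0..1} r * (LINT x|lborel. norm (pd b f x)))"
      by simp
    then show "integrable lborel (\<lambda>r. LINT x|lborel. norm (case (r, x) of (r, x) \<Rightarrow> ?k x r))"
      by simp
    show "AE r in lborel. integrable lborel (\<lambda>x. case (r, x) of (r, x) \<Rightarrow> ?k x r)"
      using tr by simp
  qed
  have "(LINT x|lborel. LINT r|lborel. ?k x r) = (LINT r|lborel. LINT x|lborel. ?k x r)"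
    by (rule lborel_pair.Fubini_integral[OF ki])
  also have "\<dots> = (LINT r|lborel. indicator {0..1::real} r *\<^sub>R (LINT x|lborel. pd b f x))"
  proof (rule Bochner_Integration.integral_cong[OF refl])
    fix r
    show "(LINT x|lborel. ?k x r) = indicator {0..1::real} r *\<^sub>R (LINT x|lborel. pd b f x)"
      using integral_translation[of "pd b f" "r *\<^sub>R b"] by (simp add: add.commute)
  qed
  also have "\<dots> = (LINT x|lborel. pd b f x)"
    by simp
  also have "(LINT x|lborel. LINT r|lborel. ?k x r) = (LINT x|lborel. f (x + b) - f x)"
  proof (rule Bochner_Integration.integral_cong[OF refl])
    fix x
    have "(LINT r|lborel. ?k x r) = f (x + 1 *\<^sub>R b) - f (x + 0 *\<^sub>R b)"
    proof (rule integral_FTC_atLeastAtMost)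
      have "continuous_on {0..1} (\<lambda>r. x + r *\<^sub>R b)"
        by (intro continuous_intros)
      then show "continuous_on {0..1} (\<lambda>r. pd b f (x + r *\<^sub>R b))"
        using continuous_on_compose2[OF cont] by blast
    qed (auto intro: pd_vector_derivative diff)
    then show "(LINT r|lborel. ?k x r) = f (x + b) - f x" by simp
  qed
  also have "\<dots> = 0"
    using integral_translation[of f b] integrable_translation_iff[of f b] int
    by (simp add: add.commute)
  finally show ?thesis by simp
qed

lemma has_derivative_cis:
  assumes "(f has_derivative f') (at x within S)"
  shows "((\<lambda>x. cis (f x)) has_derivative (\<lambda>h. f' h *\<^sub>R (\<i> * cis (f x)))) (at x within S)"
proof -
  have "((\<lambda>t. exp (\<i> * complex_of_real t)) has_vector_derivative \<i> * exp (\<i> * complex_of_real t)) (at t)" for t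
    by (auto intro!: derivative_eq_intros has_vector_derivative_real_field)
  then have "(cis has_vector_derivative \<i> * cis t) (at t)" for t
    by (simp add: cis_conv_exp[abs_def])
  then have "(cis has_derivative (\<lambda>h. h *\<^sub>R (\<i> * cis (f x)))) (at (f x))"
    by (simp add: has_vector_derivative_def)
  from has_derivative_compose[OF assms this] show ?thesis by simp
qed

text \<open>\<open>integral_pd_zero\<close> applied to the product of \<open>f\<close> with a
  character.\<close>

lemma ft_pd:
  fixes f :: "'a::euclidean_space \<Rightarrow> complex"
  assumes diff: "\<And>x. f differentiable (at x)" and cont: "continuous_on UNIV (pd b f)"
    and int: "integrable lborel f" "integrable lborel (pd b f)"
  shows "ft s (pd b f) \<xi> = - (\<i> * (s * (\<xi> \<bullet> b)) * ft s f \<xi>)"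
proof -
  let ?c = "\<lambda>y. cis (s * (y \<bullet> \<xi>))"
  have cder: "(?c has_derivative (\<lambda>h. (s * (h \<bullet> \<xi>)) *\<^sub>R (\<i> * ?c y))) (at y)" for y
    by (rule has_derivative_cis) (auto intro!: derivative_eq_intros)
  have cdiff: "?c differentiable (at y)" for y
    using cder differentiableI by blast
  have pdc: "pd b ?c = (\<lambda>y. (\<i> * (s * (\<xi> \<bullet> b))) * ?c y)"
    by (auto simp: has_derivative_imp_pd[OF cder] scaleR_conv_of_real inner_commute)
  have eq: "pd b (\<lambda>y. ?c y * f y) = (\<lambda>y. (\<i> * (s * (\<xi> \<bullet> b))) * (?c y * f y) + ?c y * pd b f y)"
    using cdiff diff by (simp add: pd_mult pdc mult.assoc)
  have i1: "integrable lborel (\<lambda>y. ?c y * f y)" and i2: "integrable lborel (\<lambda>y. ?c y * pd b f y)"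
    by (intro integrable_cis_mult int; measurable)+
  have "(LINT y|lborel. pd b (\<lambda>y. ?c y * f y) y) = 0"
  proof (rule integral_pd_zero)
    show "continuous_on UNIV (pd b (\<lambda>y. ?c y * f y))"
      unfolding eq by (intro continuous_intros cont differentiable_imp_continuous_on_UNIV diff)
    show "integrable lborel (pd b (\<lambda>y. ?c y * f y))"
      unfolding eq by (intro Bochner_Integration.integrable_add integrable_mult_right i1 i2)
  qed (use cdiff diff i1 in \<open>auto intro!: differentiable_mult\<close>)
  then have "(\<i> * (s * (\<xi> \<bullet> b))) * (LINT y|lborel. ?c y * f y) + (LINT y|lborel. ?c y * pd b f y) = 0"
    using i1 i2 by (simp add: eq)
  then show ?thesis
    unfolding ft_def by (simp add: add_eq_0_iff)
qed

lemma bd_integrable: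
  assumes "bd n w f" "integrable lborel w"
  shows "integrable lborel f"
  using assms(2)
proof (rule Bochner_Integration.integrable_bound)
  show "f \<in> borel_measurable lborel"
    using bd_continuous[OF assms(1)] by (simp add: borel_measurable_continuous_onI)
  show "AE x in lborel. norm (f x) \<le> norm (w x)"
    using bd_le[OF assms(1)] by (auto intro: order_trans[OF _ abs_ge_self])
qed

lemma norm_ft_le_integral:
  assumes "bd n w f" "integrable lborel w"
  shows "norm (ft s f \<xi>) \<le> (LINT x|lborel. w x)"
  using norm_ft_le[of s f \<xi>] integral_mono[of lborel "\<lambda>x. norm (f x)" w]
    bd_integrable[OF assms] assms(2) bd_le[OF assms(1)] by force

lemma power_mult_ft_le:
  assumes "bd n w f" "integrable lborel w" "s = 1 \<or> s = - 1" "b \<in> Basis"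
  shows "\<bar>\<xi> \<bullet> b\<bar> ^ n * norm (ft s f \<xi>) \<le> (LINT x|lborel. w x)"
  using assms(1)
proof (induction n arbitrary: f)
  case 0
  then show ?case
    using norm_ft_le_integral[OF 0 assms(2)] by simp
next
  case (Suc n)
  have "ft s (pd b f) \<xi> = - (\<i> * (s * (\<xi> \<bullet> b)) * ft s f \<xi>)"
    using Suc.prems assms(4) bd_integrable[OF Suc.prems assms(2)] bd_integrable[OF _ assms(2), of n "pd b f"]
    by (intro ft_pd) (auto intro: bd_continuous)
  then have "norm (ft s (pd b f) \<xi>) = \<bar>\<xi> \<bullet> b\<bar> * norm (ft s f \<xi>)"
    using assms(3) by (auto simp: norm_mult)
  then show ?case
    using Suc.IH[of "pd b f"] Suc.prems assms(4) by (simp add: mult_ac)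
qed

text \<open>Only a largest coordinate of \<open>\<xi>\<close> is used; \<open>norm \<xi>\<close> is
  at most \<open>DIM('a)\<close> times its modulus. If that modulus exceeds 1, then
  \<open>1 + norm \<xi>\<close> is at most \<open>2 * DIM('a)\<close> times it and
  \<open>power_mult_ft_le\<close> applies in this direction. Otherwise \<open>1 + norm \<xi>\<close>
  is itself at most \<open>2 * DIM('a)\<close>.\<close>

lemma norm_ft_decay:
  fixes f :: "'a::euclidean_space \<Rightarrow> complex"
  assumes "bd n w f" "integrable lborel w" "s = 1 \<or> s = - 1"
  shows "(1 + norm \<xi>) ^ n * norm (ft s f \<xi>) \<le> (2 * real DIM('a)) ^ n * (LINT x|lborel. w x)"
proof -
  let ?m = "Max ((\<lambda>b. \<bar>\<xi> \<bullet> b\<bar>) ` Basis)"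
  have "?m \<in> (\<lambda>b. \<bar>\<xi> \<bullet> b\<bar>) ` Basis"
    by (intro Max_in) auto
  then obtain b where b: "b \<in> Basis" "?m = \<bar>\<xi> \<bullet> b\<bar>" by (elim imageE)
  have le: "\<bar>\<xi> \<bullet> c\<bar> \<le> \<bar>\<xi> \<bullet> b\<bar>" if "c \<in> Basis" for c
    using that b(2) by (metis (no_types, lifting) Max_ge finite_Basis finite_imageI imageI)
  have "norm \<xi> \<le> (\<Sum>c\<in>Basis. \<bar>\<xi> \<bullet> c\<bar>)"
    by (rule norm_le_l1)
  also have "\<dots> \<le> DIM('a) * \<bar>\<xi> \<bullet> b\<bar>"
    using le by (intro sum_bounded_above) auto
  finally have n: "norm \<xi> \<le> DIM('a) * \<bar>\<xi> \<bullet> b\<bar>" .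
  have D: "1 \<le> real DIM('a)" using DIM_positive[where 'a='a] by linarith
  show ?thesis
  proof (cases "\<bar>\<xi> \<bullet> b\<bar> \<le> 1")
    case True
    have "norm \<xi> \<le> real DIM('a) * 1"
      by (rule order_trans[OF n]) (use True in \<open>intro mult_left_mono; simp\<close>)
    then have "(1 + norm \<xi>) ^ n \<le> (2 * real DIM('a)) ^ n"
      using D norm_ge_zero[of \<xi>] by (intro power_mono) linarith+
    then show ?thesis
      using norm_ft_le_integral[OF assms(1,2)] by (intro mult_mono) auto
  next
    case False
    have "1 + norm \<xi> \<le> DIM('a) * \<bar>\<xi> \<bullet> b\<bar> + DIM('a) * \<bar>\<xi> \<bullet> b\<bar>"
      using n False D mult_mono[of 1 "real DIM('a)" 1 "\<bar>\<xi> \<bullet> b\<bar>"] by linarith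
    then have "(1 + norm \<xi>) ^ n \<le> (2 * real DIM('a) * \<bar>\<xi> \<bullet> b\<bar>) ^ n"
      by (intro power_mono) auto
    then have "(1 + norm \<xi>) ^ n * norm (ft s f \<xi>) \<le> (2 * real DIM('a) * \<bar>\<xi> \<bullet> b\<bar>) ^ n * norm (ft s f \<xi>)"
      by (intro mult_right_mono) auto
    also have "\<dots> = (2 * real DIM('a)) ^ n * (\<bar>\<xi> \<bullet> b\<bar> ^ n * norm (ft s f \<xi>))"
      by (simp add: power_mult_distrib)
    also have "\<dots> \<le> (2 * real DIM('a)) ^ n * (LINT x|lborel. w x)"
      using power_mult_ft_le[OF assms b(1)] by (intro mult_left_mono) auto
    finally show ?thesis .
  qed
qed

section \<open>Plancherel's identity\<close>

text \<open>A dense class on which inversion holds pointwise and Plancherel's identity is a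
  statement about integrals. Both signs are required to give integrable transforms, so that
  inversion makes the class stable under each of them.\<close>

definition wiener :: "('a::euclidean_space \<Rightarrow> complex) set" where
  "wiener = {u. continuous_on UNIV u \<and> bounded (range u) \<and> integrable lborel u \<and>
     integrable lborel (ft 1 u) \<and> integrable lborel (ft (- 1) u)}"

lemma wiener_ft:
  fixes u :: "'a::euclidean_space \<Rightarrow> complex"
  assumes "u \<in> wiener" "s = 1 \<or> s = - 1"
  shows "ft (- s) (ft s u) = (\<lambda>x. (2 * pi) ^ DIM('a) * u x)" "ft s u \<in> wiener"
proof -
  obtain B where B: "\<And>x. norm (u x) \<le> B"
    using assms by (auto simp: wiener_def bounded_iff)
  show inv: "ft (- s) (ft s u) = (\<lambda>x. (2 * pi) ^ DIM('a) * u x)"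
    using assms by (intro ext fourier_inversion[OF _ _ B]) (auto simp: wiener_def)
  have "ft s v x = ft (- s) v (- x)" for v :: "'a \<Rightarrow> complex" and x
    by (simp add: ft_def)
  then have inv': "ft s (ft s u) = (\<lambda>x. (2 * pi) ^ DIM('a) * u (- x))"
    using inv by (simp add: fun_eq_iff)
  have i: "integrable lborel u" using assms by (auto simp: wiener_def)
  \<comment> \<open>Two applications of \<open>ft s\<close> give a multiple of the reflection of
    \<open>u\<close>, so the reflection has to be integrable.\<close>
  have "integrable lborel (\<lambda>x. u (- x))"
    using integrable_distr_eq[of uminus lborel borel u] i lborel_affine_euclidean[of "\<lambda>_. -1" "0::'a"]
      borel_measurable_integrable[OF i]
    by (simp add: sum_negf euclidean_representation density_1 abs_minus prod.neutral)
  then have "integrable lborel (ft s (ft s u))" "integrable lborel (ft (- s) (ft s u))"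
    using i by (auto simp: inv inv')
  moreover have "bounded (range (ft s u))"
    using norm_ft_le[of s u] by (auto simp: bounded_iff)
  ultimately show "ft s u \<in> wiener"
    using assms continuous_ft[OF i] by (auto simp: wiener_def)
qed

lemma wiener_square_integrable: "u \<in> wiener \<Longrightarrow> square_integrable u"
proof -
  assume u: "u \<in> wiener"
  then obtain B where B: "\<And>x. norm (u x) \<le> B"
    by (auto simp: wiener_def bounded_iff)
  have m: "u \<in> borel_measurable lborel"
    using u by (auto simp: wiener_def borel_measurable_continuous_onI)
  have "integrable lborel (\<lambda>x. (norm (u x))\<^sup>2)"
  proof (rule Bochner_Integration.integrable_bound)
    show "integrable lborel (\<lambda>x. B * norm (u x))"
      using u by (auto simp: wiener_def)
    show "AE x in lborel. norm ((norm (u x))\<^sup>2) \<le> norm (B * norm (u x))"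
      using B by (auto simp: power2_eq_square abs_mult intro!: mult_right_mono order_trans[OF B abs_ge_self])
  qed (use m in measurable)
  then show ?thesis using m by (simp add: square_integrable_def)
qed

section \<open>Sufficient conditions for membership in \<open>wiener\<close>\<close>

lemma le_mult_inverse: "0 < p \<Longrightarrow> p * x \<le> C \<Longrightarrow> x \<le> C * (1 / p)" for p x C :: real
  by (simp add: field_simps)

text \<open>The \<open>2 * DIM('a)\<close> derivatives give the transform the integrable decay
  \<open>decay\<close>. The centre \<open>c\<close> is free because the Gaussian cut-offs will sit
  at the corners of cubes.\<close>

lemma bd_decay_wiener:
  assumes "bd (2 * DIM('a)) (\<lambda>x. K * decay (x - c)) (u :: 'a::euclidean_space \<Rightarrow> complex)"
  shows "u \<in> wiener"
proof -
  let ?w = "\<lambda>x. K * decay (x - c)"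
  have wi: "integrable lborel ?w"
    using integrable_translation_iff[of "decay :: 'a \<Rightarrow> real" "- c"] integrable_decay[where 'a='a] by simp
  have K: "0 \<le> K"
    using bd_le[OF assms, of c] norm_ge_zero[of "u c"] decay_pos[of "c - c"]
    by (metis (no_types) less_eq_real_def not_less order_trans zero_le_mult_iff)
  have i: "integrable lborel (ft s u)" if s: "s = 1 \<or> s = - 1" for s
  proof (rule Bochner_Integration.integrable_bound)
    let ?C = "(2 * real DIM('a)) ^ (2 * DIM('a)) * (LINT x|lborel. ?w x)"
    show "integrable lborel (\<lambda>x::'a. ?C * decay x)"
      using integrable_decay[where 'a='a] by (intro integrable_mult_right)
    show "ft s u \<in> borel_measurable lborel"
      using continuous_ft[OF bd_integrable[OF assms wi]] by (simp add: borel_measurable_continuous_onI)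
    show "AE \<xi> in lborel. norm (ft s u \<xi>) \<le> norm (?C * decay \<xi>)"
    proof (rule AE_I2)
      fix \<xi> :: 'a
      have "0 < (1 + norm \<xi>) ^ (2 * DIM('a))" by (simp add: add_pos_nonneg)
      then have "norm (ft s u \<xi>) \<le> ?C * decay \<xi>"
        unfolding decay_def[of \<xi>]
        by (rule le_mult_inverse) (rule norm_ft_decay[OF assms wi s])
      also have "\<dots> \<le> \<bar>?C * decay \<xi>\<bar>" by (rule abs_ge_self)
      finally show "norm (ft s u \<xi>) \<le> norm (?C * decay \<xi>)"
        by (simp only: real_norm_def)
    qed
  qed
  have "norm (u x) \<le> K" for x
    using bd_le[OF assms, of x] mult_left_mono[OF decay_le_1[of "x - c"] K] by simp
  then show ?thesis
    using i[of 1] i[of "-1"] bd_integrable[OF assms wi] bd_continuous[OF assms]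
    by (auto simp: wiener_def bounded_iff)
qed

lemma finite_lists_Basis: "finite {bs \<in> lists (Basis :: 'a::euclidean_space set). length bs \<le> n}"
  using finite_lists_length_le[OF finite_Basis, of n] by (auto simp: in_lists_conv_set subset_eq elim: rev_finite_subset)

text \<open>Only finitely many lists of basis vectors have length at most \<open>n\<close>. This
  turns a family of seminorm bounds into one nonnegative constant.\<close>

lemma bounded_on_short_lists:
  fixes K :: "'a::euclidean_space list \<Rightarrow> real"
  shows "\<exists>M\<ge>0. \<forall>bs\<in>lists Basis. length bs \<le> n \<longrightarrow> K bs \<le> M"
proof -
  let ?S = "{bs \<in> lists (Basis :: 'a set). length bs \<le> n}"
  have "K bs \<le> max 0 (Max (K ` ?S))" if "bs \<in> ?S" for bs
    by (rule order_trans[OF Max_ge max.cobounded2]) (use finite_lists_Basis[of n] that in blast)+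
  then show ?thesis
    by (intro exI[of _ "max 0 (Max (K ` ?S))"]) auto
qed

lemma schwartz_bd:
  assumes "u \<in> schwartz"
  shows "\<exists>C\<ge>0. bd n (\<lambda>x. C / (1 + norm x) ^ m) u"
proof -
  have "\<exists>C. \<forall>x. (1 + norm x) ^ m * norm (pderivs bs u x) \<le> C" if "bs \<in> lists Basis" for bs
    using assms that by (auto simp: schwartz_def)
  then obtain C where C: "\<And>bs x. bs \<in> lists Basis \<Longrightarrow> (1 + norm x) ^ m * norm (pderivs bs u x) \<le> C bs"
    by metis
  obtain K where K: "0 \<le> K" "\<And>bs. bs \<in> lists Basis \<Longrightarrow> length bs \<le> n \<Longrightarrow> C bs \<le> K"
    using bounded_on_short_lists[of n C] by blast
  have pos: "0 < (1 + norm x) ^ m" for x :: 'a by (simp add: add_pos_nonneg)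
  have le: "norm (pderivs bs u x) \<le> K / (1 + norm x) ^ m" if "bs \<in> lists Basis" "length bs \<le> n" for bs x
    using C[of bs x] K(2)[OF that] that pos[of x] by (simp add: field_simps)
  have "bd n (\<lambda>x. K / (1 + norm x) ^ m) (pderivs [] u)"
    using assms le by (intro bd_pderivs) (auto simp: schwartz_def)
  then show ?thesis using K(1) by auto
qed

lemma schwartz_wiener: "u \<in> schwartz \<Longrightarrow> (u :: 'a::euclidean_space \<Rightarrow> complex) \<in> wiener"
  using schwartz_bd[of u "2 * DIM('a)" "2 * DIM('a)"] bd_decay_wiener[of _ "0::'a" u]
  by (auto simp: decay_def)

text \<open>On complex numbers \<open>\<bullet>\<close> is the real part of
  \<open>cnj u * w\<close>; the conjugation is what turns \<open>s\<close> into \<open>- s\<close>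
  on the right.\<close>

lemma ft_duality:
  fixes f g :: "'a::euclidean_space \<Rightarrow> complex"
  assumes f: "integrable lborel f" and g: "integrable lborel g"
  shows "(LINT x|lborel. ft s f x \<bullet> g x) = (LINT x|lborel. f x \<bullet> ft (- s) g x)"
proof -
  have [measurable]: "f \<in> borel_measurable borel" "g \<in> borel_measurable borel"
    using borel_measurable_integrable[OF f] borel_measurable_integrable[OF g] by auto
  let ?k = "\<lambda>x y. (cis (s * (y \<bullet> x)) * f y) \<bullet> g x"
  have ki: "integrable (lborel \<Otimes>\<^sub>M lborel) (case_prod ?k)"
  proof (rule integrable_tensor[OF g f])
    show "norm (case_prod ?k (x, y)) \<le> norm (g x) * norm (f y)" for x y
      using Cauchy_Schwarz_ineq2[of "cis (s * (y \<bullet> x)) * f y" "g x"] by (simp add: norm_mult mult.commute)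
  qed measurable
  have "(LINT x|lborel. ft s f x \<bullet> g x) = (LINT x|lborel. LINT y|lborel. ?k x y)"
    unfolding ft_def
    by (intro Bochner_Integration.integral_cong refl integral_inner_left[symmetric] impI
        integrable_cis_mult f) measurable
  also have "\<dots> = (LINT y|lborel. LINT x|lborel. ?k x y)"
    by (rule lborel_pair.Fubini_integral[OF ki, symmetric])
  also have "\<dots> = (LINT y|lborel. f y \<bullet> ft (- s) g y)"
  proof (rule Bochner_Integration.integral_cong[OF refl])
    fix y
    have "?k x y = f y \<bullet> (cis (- s * (x \<bullet> y)) * g x)" for x
      by (simp add: inner_complex_def inner_commute algebra_simps)
    then show "(LINT x|lborel. ?k x y) = f y \<bullet> ft (- s) g y"
      unfolding ft_def by (simp only: integral_inner_right integrable_cis_mult g)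
        (intro integral_inner_right impI integrable_cis_mult g, measurable)
  qed
  finally show ?thesis .
qed

lemma plancherel:
  fixes u w :: "'a::euclidean_space \<Rightarrow> complex"
  assumes "u \<in> wiener" "w \<in> wiener" "s = 1 \<or> s = - 1"
  shows "(LINT x|lborel. ft s u x \<bullet> ft s w x) = (2 * pi) ^ DIM('a) * (LINT x|lborel. u x \<bullet> w x)"
proof -
  have "(LINT x|lborel. ft s u x \<bullet> ft s w x) = (LINT x|lborel. u x \<bullet> ft (- s) (ft s w) x)"
    using assms wiener_ft(2)[of w s] by (intro ft_duality) (auto simp: wiener_def)
  also have "\<dots> = (LINT x|lborel. (2 * pi) ^ DIM('a) * (u x \<bullet> w x))"
    unfolding wiener_ft(1)[OF assms(2,3)]
    by (intro Bochner_Integration.integral_cong refl)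
      (simp add: inner_scaleR_right[symmetric] scaleR_conv_of_real del: inner_scaleR_right)
  finally show ?thesis by simp
qed

section \<open>Operations under which \<open>wiener\<close> is stable\<close>

lemma ft_modulation:
  fixes u :: "'a::euclidean_space \<Rightarrow> complex"
  assumes "s = 1 \<or> s = - 1"
  shows "ft s (\<lambda>x. cis (\<zeta> \<bullet> x) * u x) \<xi> = ft s u (\<xi> + s *\<^sub>R \<zeta>)"
  unfolding ft_def
proof (rule Bochner_Integration.integral_cong[OF refl])
  fix y
  have "cis (s * (y \<bullet> \<xi>)) * cis (\<zeta> \<bullet> y) = cis (s * (y \<bullet> (\<xi> + s *\<^sub>R \<zeta>)))"
    using assms by (auto simp: cis_mult inner_add_right inner_commute algebra_simps)
  then show "cis (s * (y \<bullet> \<xi>)) * (cis (\<zeta> \<bullet> y) * u y) = cis (s * (y \<bullet> (\<xi> + s *\<^sub>R \<zeta>))) * u y"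
    by (simp add: mult.assoc[symmetric])
qed

lemma wiener_modulation:
  fixes u :: "'a::euclidean_space \<Rightarrow> complex"
  assumes "u \<in> wiener"
  shows "(\<lambda>x. cis (\<zeta> \<bullet> x) * u x) \<in> wiener"
proof -
  have "integrable lborel (ft s (\<lambda>x. cis (\<zeta> \<bullet> x) * u x))" if s: "s = 1 \<or> s = - 1" for s
  proof -
    have "integrable lborel (ft s u)" using assms s by (auto simp: wiener_def)
    then have "integrable lborel (\<lambda>\<xi>. ft s u (s *\<^sub>R \<zeta> + \<xi>))"
      using integrable_translation_iff[of "ft s u" "s *\<^sub>R \<zeta>"] borel_measurable_integrable[of lborel "ft s u"] by auto
    then show ?thesis
      by (simp add: ft_modulation[OF s, abs_def] add.commute)
  qed
  from this[of 1] this[of "- 1"] show ?thesis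
    using assms unfolding wiener_def
    by (auto intro!: continuous_intros integrable_cis_mult simp: bounded_iff norm_mult)
qed

lemma wiener_add:
  fixes u w :: "'a::euclidean_space \<Rightarrow> complex"
  assumes "u \<in> wiener" "w \<in> wiener"
  shows "(\<lambda>x. u x + w x) \<in> wiener" and "ft s (\<lambda>x. u x + w x) = (\<lambda>\<xi>. ft s u \<xi> + ft s w \<xi>)"
proof -
  have *: "ft s (\<lambda>x. u x + w x) = (\<lambda>\<xi>. ft s u \<xi> + ft s w \<xi>)" for s
    unfolding ft_def distrib_left using assms
    by (intro ext Bochner_Integration.integral_add integrable_cis_mult) (auto simp: wiener_def)
  show "ft s (\<lambda>x. u x + w x) = (\<lambda>\<xi>. ft s u \<xi> + ft s w \<xi>)" by (rule *)
  have "bounded (range (\<lambda>x. u x + w x))"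
    using assms bounded_plus_comp[of u UNIV w] by (auto simp: wiener_def)
  then show "(\<lambda>x. u x + w x) \<in> wiener"
    using assms by (auto simp: wiener_def * intro!: continuous_intros)
qed

lemma wiener_cmult:
  fixes u :: "'a::euclidean_space \<Rightarrow> complex"
  assumes "u \<in> wiener"
  shows "(\<lambda>x. c * u x) \<in> wiener" and "ft s (\<lambda>x. c * u x) = (\<lambda>\<xi>. c * ft s u \<xi>)"
proof -
  have *: "ft s (\<lambda>x. c * u x) = (\<lambda>\<xi>. c * ft s u \<xi>)" for s
    unfolding ft_def by (subst mult.left_commute) simp
  show "ft s (\<lambda>x. c * u x) = (\<lambda>\<xi>. c * ft s u \<xi>)" by (rule *)
  obtain B where "\<And>x. norm (u x) \<le> B"
    using assms by (auto simp: wiener_def bounded_iff)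
  then have "norm (c * u x) \<le> norm c * B" for x
    by (simp add: norm_mult mult_left_mono)
  then have "bounded (range (\<lambda>x. c * u x))"
    by (auto simp: bounded_iff)
  then show "(\<lambda>x. c * u x) \<in> wiener"
    using assms by (auto simp: wiener_def * intro!: continuous_intros)
qed

section \<open>Completeness and density in the Hilbert space\<close>

lemma L2_cases:
  fixes \<phi> :: "'a::euclidean_space L2"
  obtains f where "square_integrable f" "\<phi> = abs_L2 f"
proof -
  have "L2_rel (rep_L2 \<phi>) (rep_L2 \<phi>)" "abs_L2 (rep_L2 \<phi>) = \<phi>"
    using Quotient_rep_reflp[OF Quotient_L2] Quotient_abs_rep[OF Quotient_L2] by blast+
  then show ?thesis
    using that[of "rep_L2 \<phi>"] by (simp add: L2_rel_def)
qed

lemma abs_L2_eq_iff: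
  assumes "square_integrable f" "square_integrable g"
  shows "abs_L2 f = abs_L2 g \<longleftrightarrow> (AE x in lborel. f x = g x)"
proof -
  have "L2_rel f f" "L2_rel g g"
    using assms by (auto simp: L2_rel_def)
  then show ?thesis
    using Quotient_rel[OF Quotient_L2, of f g] assms by (simp add: L2_rel_def)
qed

lemma abs_L2_add:
  "square_integrable f \<Longrightarrow> square_integrable g \<Longrightarrow> abs_L2 f + abs_L2 g = abs_L2 (\<lambda>x. f x + g x)"
  by (simp add: plus_L2.abs_eq L2_rel_def)

lemma abs_L2_scaleR: "square_integrable f \<Longrightarrow> r *\<^sub>R abs_L2 f = abs_L2 (\<lambda>x. r *\<^sub>R f x)"
  by (simp add: scaleR_L2.abs_eq L2_rel_def)

lemma square_integrable_scaleR: "square_integrable f \<Longrightarrow> square_integrable (\<lambda>x. r *\<^sub>R f x)"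
  unfolding scaleR_conv_of_real by (rule square_integrable_cmult)

lemma square_integrable_diff:
  "square_integrable f \<Longrightarrow> square_integrable g \<Longrightarrow> square_integrable (\<lambda>x. f x - g x)"
  using square_integrable_add[OF _ square_integrable_cmult[of g "-1"], of f] by simp

lemma abs_L2_diff:
  "square_integrable f \<Longrightarrow> square_integrable g \<Longrightarrow> abs_L2 f - abs_L2 g = abs_L2 (\<lambda>x. f x - g x)"
  using abs_L2_add[of f "\<lambda>x. (-1) *\<^sub>R g x"] abs_L2_scaleR[of g "-1"] square_integrable_scaleR[of g "-1"]
  by (simp add: minus_L2_def)

lemma inner_abs_L2:
  "square_integrable f \<Longrightarrow> square_integrable g \<Longrightarrow> abs_L2 f \<bullet> abs_L2 g = (LINT x|lborel. f x \<bullet> g x)"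
  by (simp add: inner_L2.abs_eq L2_rel_def)

lemma square_integrable_dominated:
  assumes "f \<in> borel_measurable borel" "integrable lborel (\<lambda>x. (g x)\<^sup>2)" "AE x in lborel. norm (f x) \<le> g x"
  shows "square_integrable f"
  unfolding square_integrable_def
proof
  show m: "f \<in> borel_measurable lborel" using assms by simp
  show "integrable lborel (\<lambda>x. (norm (f x))\<^sup>2)"
    using assms(2)
    by (rule Bochner_Integration.integrable_bound) (use assms m in \<open>auto elim!: eventually_mono intro!: power_mono\<close>)
qed

lemma abs_L2_dominated_convergence:
  fixes f :: "nat \<Rightarrow> 'a::euclidean_space \<Rightarrow> complex"
  assumes m: "\<And>n. f n \<in> borel_measurable borel" "F \<in> borel_measurable borel"
    and g: "integrable lborel (\<lambda>x. (g x)\<^sup>2)"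
    and le: "\<And>n. AE x in lborel. norm (f n x) \<le> g x" "AE x in lborel. norm (F x) \<le> g x"
    and lim: "AE x in lborel. (\<lambda>n. f n x) \<longlonglongrightarrow> F x"
  shows "(\<lambda>n. abs_L2 (f n)) \<longlonglongrightarrow> abs_L2 F"
proof -
  have sq: "square_integrable (f n)" "square_integrable F" for n
    using square_integrable_dominated[OF _ g] m le by blast+
  have [measurable]: "f n \<in> borel_measurable borel" "F \<in> borel_measurable borel" for n
    by (rule m)+
  have "(\<lambda>n. LINT x|lborel. (norm (f n x - F x))\<^sup>2) \<longlonglongrightarrow> (LINT x|(lborel::'a measure). 0)"
  proof (rule integral_dominated_convergence[where w="\<lambda>x. 4 * (g x)\<^sup>2"])
    show "AE x in lborel. (\<lambda>n. (norm (f n x - F x))\<^sup>2) \<longlonglongrightarrow> 0"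
      using lim
    proof eventually_elim
      fix x assume "(\<lambda>n. f n x) \<longlonglongrightarrow> F x"
      then have "(\<lambda>n. (norm (f n x - F x))\<^sup>2) \<longlonglongrightarrow> (norm (F x - F x))\<^sup>2"
        by (intro tendsto_intros)
      then show "(\<lambda>n. (norm (f n x - F x))\<^sup>2) \<longlonglongrightarrow> 0" by simp
    qed
    show "AE x in lborel. norm ((norm (f n x - F x))\<^sup>2) \<le> 4 * (g x)\<^sup>2" for n
      using le(1)[of n] le(2)
    proof eventually_elim
      fix x assume "norm (f n x) \<le> g x" "norm (F x) \<le> g x"
      then have "norm (f n x - F x) \<le> 2 * g x"
        using norm_triangle_ineq4[of "f n x" "F x"] by linarith
      then have "(norm (f n x - F x))\<^sup>2 \<le> (2 * g x)\<^sup>2"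
        by (intro power_mono) auto
      then show "norm ((norm (f n x - F x))\<^sup>2) \<le> 4 * (g x)\<^sup>2"
        by (simp add: power_mult_distrib)
    qed
  qed (use g in auto)
  then have "(\<lambda>n. sqrt (LINT x|lborel. (norm (f n x - F x))\<^sup>2)) \<longlonglongrightarrow> sqrt 0"
    by (intro tendsto_intros) simp
  then have "(\<lambda>n. norm (abs_L2 (f n) - abs_L2 F)) \<longlonglongrightarrow> 0"
    by (simp add: abs_L2_diff sq norm_abs_L2 square_integrable_diff)
  then show ?thesis
    using LIM_zero_cancel tendsto_norm_zero_iff by blast
qed

lemma gauss_square_integrable: "square_integrable (\<lambda>x. complex_of_real (gauss x))"
proof -
  have "(\<lambda>x::'a. (gauss x)\<^sup>2) = (\<lambda>x. gauss (0 + sqrt 2 *\<^sub>R x))"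
    by (simp add: gauss_def fun_eq_iff power2_eq_square exp_add[symmetric] power_mult_distrib)
  then have "integrable lborel (\<lambda>x::'a. (gauss x)\<^sup>2)"
    using integrable_affine_iff[of "sqrt 2" "gauss :: 'a \<Rightarrow> real" 0] integrable_gauss[where 'a='a] by simp
  then show ?thesis
    by (simp add: square_integrable_def)
qed

text \<open>Multiplication by a Gaussian maps into the integrable functions by the Cauchy-Schwarz
  inequality. Hence a subsequence converges almost everywhere after this multiplication, and also
  before it, as the Gaussian has no zeros. Fatou's lemma shows that the pointwise limit is the limit
  in norm.\<close>

lemma Cauchy_L2_convergent:
  fixes X :: "nat \<Rightarrow> 'a::euclidean_space L2"
  assumes "Cauchy X"
  shows "convergent X"
proof -
  have "\<forall>n. \<exists>f. square_integrable f \<and> X n = abs_L2 f"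
    using L2_cases by metis
  then obtain f where sq: "\<And>n. square_integrable (f n)" and X: "\<And>n. X n = abs_L2 (f n)"
    by metis
  have [measurable]: "f n \<in> borel_measurable borel" for n
    using sq[of n] by (simp add: square_integrable_def)
  let ?g = "\<lambda>x. complex_of_real (gauss x)"
  let ?G = "abs_L2 (?g :: 'a \<Rightarrow> complex)"
  have gm: "integrable lborel (\<lambda>x. u x * ?g x)" "(LINT x|lborel. norm (u x * ?g x)) \<le> norm (abs_L2 u) * norm ?G"
    if u: "square_integrable u" for u :: "'a \<Rightarrow> complex"
  proof -
    let ?u = "\<lambda>x. complex_of_real (norm (u x))"
    have [measurable]: "u \<in> borel_measurable borel" using u by (simp add: square_integrable_def)
    have su: "square_integrable ?u"
      using u by (simp add: square_integrable_def)
    have "integrable lborel (\<lambda>x. ?u x \<bullet> ?g x)"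
      by (rule integrable_inner_square_integrable[OF su gauss_square_integrable])
    then have i: "integrable lborel (\<lambda>x. norm (u x * ?g x))"
      by (simp add: inner_complex_def norm_mult)
    then show "integrable lborel (\<lambda>x. u x * ?g x)"
      by (subst integrable_norm_iff[symmetric]) auto
    have "(LINT x|lborel. norm (u x * ?g x)) = abs_L2 ?u \<bullet> ?G"
      by (simp add: inner_abs_L2 su gauss_square_integrable inner_complex_def norm_mult)
    also have "\<dots> \<le> norm (abs_L2 ?u) * norm ?G"
      by (rule norm_cauchy_schwarz)
    also have "norm (abs_L2 ?u) = norm (abs_L2 u)"
      using u su by (simp add: norm_abs_L2)
    finally show "(LINT x|lborel. norm (u x * ?g x)) \<le> norm (abs_L2 u) * norm ?G" .
  qed
  obtain r where r: "strict_mono r" and C: "AE x in lborel. Cauchy (\<lambda>i. f (r i) x * ?g x)"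
  proof (rule cauchy_L1_AE_cauchy_subseq[of lborel "\<lambda>n x. f n x * ?g x"])
    show "integrable lborel (\<lambda>x. f n x * ?g x)" for n
      by (rule gm[OF sq])
    show "\<exists>N. \<forall>i\<ge>N. \<forall>j\<ge>N. (LINT x|lborel. norm (f i x * ?g x - f j x * ?g x)) < e" if "e > 0" for e
    proof -
      have pos: "0 < norm ?G + 1" by (rule add_nonneg_pos[OF norm_ge_zero zero_less_one])
      then have "0 < e / (norm ?G + 1)" using that by simp
      then obtain N where N: "\<And>i j. i \<ge> N \<Longrightarrow> j \<ge> N \<Longrightarrow> norm (X i - X j) < e / (norm ?G + 1)"
        using assms unfolding Cauchy_def dist_norm by metis
      have "(LINT x|lborel. norm (f i x * ?g x - f j x * ?g x)) < e" if "i \<ge> N" "j \<ge> N" for i j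
      proof -
        have "(LINT x|lborel. norm (f i x * ?g x - f j x * ?g x)) \<le> norm (X i - X j) * norm ?G"
          using gm(2)[OF square_integrable_diff[OF sq[of i] sq[of j]]]
          by (simp add: X abs_L2_diff sq left_diff_distrib)
        also have "\<dots> \<le> norm (X i - X j) * (norm ?G + 1)"
          by (intro mult_left_mono) auto
        also have "\<dots> < e"
          using N[OF that] by (simp only: pos_less_divide_eq[OF pos])
        finally show ?thesis .
      qed
      then show ?thesis by blast
    qed
  qed auto
  define F where "F x = lim (\<lambda>i. f (r i) x)" for x
  have [measurable]: "F \<in> borel_measurable borel"
    unfolding F_def by measurable
  have lim: "AE x in lborel. (\<lambda>i. f (r i) x) \<longlonglongrightarrow> F x"
    using C
  proof eventually_elim
    fix x assume "Cauchy (\<lambda>i. f (r i) x * ?g x)"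
    then obtain L where "(\<lambda>i. f (r i) x * ?g x) \<longlonglongrightarrow> L"
      using Cauchy_convergent convergent_def by blast
    then have "(\<lambda>i. f (r i) x * ?g x / ?g x) \<longlonglongrightarrow> L / ?g x"
      using gauss_pos[of x] by (intro tendsto_divide tendsto_const) auto
    then have "(\<lambda>i. f (r i) x) \<longlonglongrightarrow> L / ?g x"
      using gauss_pos[of x] by simp
    then show "(\<lambda>i. f (r i) x) \<longlonglongrightarrow> F x"
      unfolding F_def using convergentI convergent_LIMSEQ_iff by blast
  qed
  \<comment> \<open>Fatou's lemma along the subsequence. The statement concerns
    \<open>F - f n\<close> because square integrability of \<open>F\<close> is only deduced from it
    afterwards.\<close>
  have bound: "square_integrable (\<lambda>x. F x - f n x)" "norm (abs_L2 (\<lambda>x. F x - f n x)) \<le> e"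
    if e: "e \<ge> 0" and n: "\<And>m. m \<ge> n \<Longrightarrow> norm (X m - X n) \<le> e" for n e
  proof -
    have "(\<integral>\<^sup>+x. ennreal ((norm (F x - f n x))\<^sup>2) \<partial>lborel)
        = (\<integral>\<^sup>+x. liminf (\<lambda>i. ennreal ((norm (f (r i) x - f n x))\<^sup>2)) \<partial>lborel)"
    proof (rule nn_integral_cong_AE)
      show "AE x in lborel. ennreal ((norm (F x - f n x))\<^sup>2) = liminf (\<lambda>i. ennreal ((norm (f (r i) x - f n x))\<^sup>2))"
        using lim
      proof eventually_elim
        fix x assume "(\<lambda>i. f (r i) x) \<longlonglongrightarrow> F x"
        then have "(\<lambda>i. ennreal ((norm (f (r i) x - f n x))\<^sup>2)) \<longlonglongrightarrow> ennreal ((norm (F x - f n x))\<^sup>2)"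
          by (intro tendsto_intros)
        then show "ennreal ((norm (F x - f n x))\<^sup>2) = liminf (\<lambda>i. ennreal ((norm (f (r i) x - f n x))\<^sup>2))"
          using lim_imp_Liminf[OF sequentially_bot] by metis
      qed
    qed
    also have "\<dots> \<le> liminf (\<lambda>i. \<integral>\<^sup>+x. ennreal ((norm (f (r i) x - f n x))\<^sup>2) \<partial>lborel)"
      by (rule nn_integral_liminf) measurable
    also have "\<dots> \<le> ennreal (e\<^sup>2)"
    proof (rule Liminf_le)
      show "\<forall>\<^sub>F i in sequentially. (\<integral>\<^sup>+x. ennreal ((norm (f (r i) x - f n x))\<^sup>2) \<partial>lborel) \<le> ennreal (e\<^sup>2)"
        using eventually_ge_at_top[of n]
      proof eventually_elim
        fix i assume "n \<le> i"
        then have "n \<le> r i" using seq_suble[OF r, of i] by linarith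
        then have le: "norm (X (r i) - X n) \<le> e" by (rule n)
        have s: "square_integrable (\<lambda>x. f (r i) x - f n x)"
          by (intro square_integrable_diff sq)
        then have "(\<integral>\<^sup>+x. ennreal ((norm (f (r i) x - f n x))\<^sup>2) \<partial>lborel) = ennreal (LINT x|lborel. (norm (f (r i) x - f n x))\<^sup>2)"
          by (intro nn_integral_eq_integral) (auto simp: square_integrable_def)
        also have "(LINT x|lborel. (norm (f (r i) x - f n x))\<^sup>2) = (norm (X (r i) - X n))\<^sup>2"
          using s by (simp add: X abs_L2_diff sq norm_abs_L2)
        also have "ennreal \<dots> \<le> ennreal (e\<^sup>2)"
          using le by (intro ennreal_leI power_mono) auto
        finally show "(\<integral>\<^sup>+x. ennreal ((norm (f (r i) x - f n x))\<^sup>2) \<partial>lborel) \<le> ennreal (e\<^sup>2)" .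
      qed
    qed simp
    finally have nn: "(\<integral>\<^sup>+x. ennreal ((norm (F x - f n x))\<^sup>2) \<partial>lborel) \<le> ennreal (e\<^sup>2)" .
    have i: "integrable lborel (\<lambda>x. (norm (F x - f n x))\<^sup>2)"
      using nn by (intro integrableI_bounded) (auto simp: less_top[symmetric] top_unique intro: le_less_trans)
    then show s: "square_integrable (\<lambda>x. F x - f n x)"
      by (simp add: square_integrable_def)
    have "ennreal (LINT x|lborel. (norm (F x - f n x))\<^sup>2) \<le> ennreal (e\<^sup>2)"
      using nn i by (subst nn_integral_eq_integral[symmetric]) auto
    then have "(LINT x|lborel. (norm (F x - f n x))\<^sup>2) \<le> e\<^sup>2"
      by (subst (asm) ennreal_le_iff) auto
    then show "norm (abs_L2 (\<lambda>x. F x - f n x)) \<le> e"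
      using s e by (simp add: norm_abs_L2 real_le_lsqrt)
  qed
  have "X \<longlonglongrightarrow> abs_L2 F"
  proof (rule LIMSEQ_I)
    fix e :: real assume "e > 0"
    then have "0 < e / 2" by simp
    then obtain N where N: "\<And>i j. i \<ge> N \<Longrightarrow> j \<ge> N \<Longrightarrow> norm (X i - X j) < e / 2"
      using assms unfolding Cauchy_def dist_norm by metis
    have "norm (X n - abs_L2 F) < e" if "n \<ge> N" for n
    proof -
      have b: "square_integrable (\<lambda>x. F x - f n x)" "norm (abs_L2 (\<lambda>x. F x - f n x)) \<le> e / 2"
        using bound[of "e / 2" n] N that \<open>0 < e / 2\<close> by (meson less_imp_le order_trans)+
      have sF: "square_integrable F"
        using square_integrable_add[OF b(1) sq[of n]] by simp
      have "norm (X n - abs_L2 F) = norm (abs_L2 (\<lambda>x. F x - f n x))"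
        by (subst norm_minus_commute) (simp only: X abs_L2_diff[OF sF sq])
      then show ?thesis
        using b(2) \<open>e > 0\<close> by simp
    qed
    then show "\<exists>N. \<forall>n\<ge>N. norm (X n - abs_L2 F) < e" by blast
  qed
  then show ?thesis by (rule convergentI)
qed

instance L2 :: (euclidean_space) banach
  by standard (rule Cauchy_L2_convergent)

subsection \<open>Density of the Schwartz functions\<close>

lemma real_polynomial_function_derivative:
  "real_polynomial_function p \<Longrightarrow>
    \<exists>D. (\<forall>x. (p has_derivative D x) (at x)) \<and> (\<forall>b. real_polynomial_function (\<lambda>x. D x b))"
proof (induction rule: real_polynomial_function.induct)
  case (linear f)
  then show ?case
    by (intro exI[of _ "\<lambda>x. f"]) (auto intro: bounded_linear_imp_has_derivative real_polynomial_function.intros(2))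
next
  case (const c)
  show ?case
    by (intro exI[of _ "\<lambda>x h. 0"]) (auto intro: real_polynomial_function.intros(2))
next
  case (add f g)
  then obtain D E where "\<forall>x. (f has_derivative D x) (at x)" "\<forall>b. real_polynomial_function (\<lambda>x. D x b)"
    "\<forall>x. (g has_derivative E x) (at x)" "\<forall>b. real_polynomial_function (\<lambda>x. E x b)" by blast
  then show ?case
    by (intro exI[of _ "\<lambda>x h. D x h + E x h"]) (auto intro!: has_derivative_add)
next
  case (mult f g)
  then obtain D E where "\<forall>x. (f has_derivative D x) (at x)" "\<forall>b. real_polynomial_function (\<lambda>x. D x b)"
    "\<forall>x. (g has_derivative E x) (at x)" "\<forall>b. real_polynomial_function (\<lambda>x. E x b)" by blast
  then show ?case using mult(1,2)
    by (intro exI[of _ "\<lambda>x h. f x * E x h + D x h * g x"])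
      (auto intro!: has_derivative_mult real_polynomial_function.intros(3,4))
qed

lemma real_polynomial_function_growth:
  "real_polynomial_function p \<Longrightarrow> \<exists>C n. 0 \<le> C \<and> (\<forall>x. \<bar>p x\<bar> \<le> C * (1 + norm x) ^ n)"
proof (induction rule: real_polynomial_function.induct)
  case (linear f)
  then obtain K where *: "\<And>x. norm (f x) \<le> norm x * K" "0 \<le> K"
    using bounded_linear.nonneg_bounded by blast
  have "\<bar>f x\<bar> \<le> K * (1 + norm x) ^ 1" for x
    using *(1)[of x] *(2) by (simp add: distrib_left mult.commute)
  then show ?case using *(2) by blast
next
  case (const c)
  show ?case by (intro exI[of _ "\<bar>c\<bar>"] exI[of _ 0]) auto
next
  case (add f g)
  then obtain C n C' n' where *: "0 \<le> C" "0 \<le> C'" "\<And>x. \<bar>f x\<bar> \<le> C * (1 + norm x) ^ n" "\<And>x. \<bar>g x\<bar> \<le> C' * (1 + norm x) ^ n'"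
    by blast
  have "\<bar>f x + g x\<bar> \<le> (C + C') * (1 + norm x) ^ (n + n')" for x
  proof -
    have "C * (1 + norm x) ^ n \<le> C * (1 + norm x) ^ (n + n')" "C' * (1 + norm x) ^ n' \<le> C' * (1 + norm x) ^ (n + n')"
      using *(1,2) by (auto intro!: mult_left_mono power_increasing)
    then show ?thesis
      using *(3,4)[of x] by (simp add: distrib_right)
  qed
  then show ?case using *(1,2) by (metis add_nonneg_nonneg)
next
  case (mult f g)
  then obtain C n C' n' where *: "0 \<le> C" "0 \<le> C'" "\<And>x. \<bar>f x\<bar> \<le> C * (1 + norm x) ^ n" "\<And>x. \<bar>g x\<bar> \<le> C' * (1 + norm x) ^ n'"
    by blast
  have "\<bar>f x * g x\<bar> \<le> (C * C') * (1 + norm x) ^ (n + n')" for x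
    using mult_mono[OF *(3,4)[of x]] *(1,2) by (simp add: abs_mult power_add mult_ac)
  then show ?case using *(1,2) by (metis mult_nonneg_nonneg)
qed

lemma power_le_exp:
  fixes \<alpha> :: real
  assumes "0 < \<alpha>"
  shows "\<exists>C\<ge>0. \<forall>t\<ge>0. (1 + t) ^ n \<le> C * exp (\<alpha> * t)"
proof -
  \<comment> \<open>\<open>k \<le> 1\<close> gives
    \<open>(1 + t) * k \<le> 1 + k * t \<le> exp (k * t)\<close>, and
    \<open>n * k \<le> \<alpha>\<close> survives the \<open>n\<close>-th power. The denominator
    \<open>n + 1\<close> covers the case \<open>n = 0\<close>.\<close>
  define k where "k = min 1 (\<alpha> / (real n + 1))"
  have k: "0 < k" "k \<le> 1" "real n * k \<le> \<alpha>"
  proof -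
    show "0 < k" "k \<le> 1" using assms by (auto simp: k_def)
    have "real n * k \<le> (real n + 1) * (\<alpha> / (real n + 1))"
      using assms by (intro mult_mono) (auto simp: k_def)
    then show "real n * k \<le> \<alpha>" by simp
  qed
  have "(1 + t) ^ n \<le> (1 / k ^ n) * exp (\<alpha> * t)" if t: "t \<ge> 0" for t
  proof -
    have "(1 + t) * k \<le> 1 + k * t"
      using k t by (simp add: distrib_left mult.commute)
    also have "\<dots> \<le> exp (k * t)"
      by (rule exp_ge_add_one_self)
    finally have "(1 + t) * k \<le> exp (k * t)" .
    then have "((1 + t) * k) ^ n \<le> exp (k * t) ^ n"
      using k t by (intro power_mono) auto
    also have "\<dots> = exp (real n * k * t)"
      by (simp add: exp_of_nat_mult[symmetric] mult.assoc)
    also have "\<dots> \<le> exp (\<alpha> * t)"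
      using mult_right_mono[OF k(3) t] by simp
    finally show ?thesis
      using k by (simp add: power_mult_distrib pos_le_divide_eq mult.commute)
  qed
  then show ?thesis
    using k by (intro exI[of _ "1 / k ^ n"]) auto
qed

lemma pderivs_poly_exp:
  fixes P :: "'a::euclidean_space \<Rightarrow> real"
  assumes P: "real_polynomial_function P"
  shows "real_polynomial_function q \<Longrightarrow> \<exists>q'. real_polynomial_function q' \<and>
    pderivs bs (\<lambda>x. complex_of_real (q x * exp (- P x))) = (\<lambda>x. complex_of_real (q' x * exp (- P x)))"
proof (induction bs)
  case Nil
  then show ?case by auto
next
  case (Cons b bs)
  then obtain q' where q': "real_polynomial_function q'"
    "pderivs bs (\<lambda>x. complex_of_real (q x * exp (- P x))) = (\<lambda>x. complex_of_real (q' x * exp (- P x)))"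
    by blast
  obtain D where D: "\<And>x. (q' has_derivative D x) (at x)" "\<And>b. real_polynomial_function (\<lambda>x. D x b)"
    using real_polynomial_function_derivative[OF q'(1)] by blast
  obtain E where E: "\<And>x. (P has_derivative E x) (at x)" "\<And>b. real_polynomial_function (\<lambda>x. E x b)"
    using real_polynomial_function_derivative[OF P] by blast
  have "((\<lambda>x. complex_of_real (q' x * exp (- P x))) has_derivative
      (\<lambda>h. complex_of_real ((D x h - q' x * E x h) * exp (- P x)))) (at x)" for x
    by (rule has_derivative_of_real) (auto intro!: derivative_eq_intros D(1) E(1) simp: algebra_simps)
  from has_derivative_imp_pd[OF this, of b]
  have "pderivs (b # bs) (\<lambda>x. complex_of_real (q x * exp (- P x))) =
      (\<lambda>x. complex_of_real ((D x b + (- 1) * (q' x * E x b)) * exp (- P x)))"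
    unfolding pderivs_Cons q'(2) fun_eq_iff by simp
  moreover have "real_polynomial_function (\<lambda>x. D x b + (- 1) * (q' x * E x b))"
    using D(2) E(2) q'(1) by (intro real_polynomial_function.intros(2-4))
  ultimately show ?case by blast
qed

text \<open>Products of a polynomial with \<open>exp (- P)\<close> are closed under differentiation
  by \<open>pderivs_poly_exp\<close>, so one growth estimate settles all derivatives: the linear
  lower bound on \<open>P\<close> outweighs every power of \<open>1 + norm x\<close>.\<close>

lemma schwartz_poly_exp:
  fixes P :: "'a::euclidean_space \<Rightarrow> real"
  assumes P: "real_polynomial_function P" and q: "real_polynomial_function q"
    and \<alpha>: "0 < \<alpha>" and le: "\<And>x. \<alpha> * norm x - \<beta> \<le> P x"
  shows "(\<lambda>x. complex_of_real (q x * exp (- P x))) \<in> schwartz"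
proof -
  have 1: "pderivs bs (\<lambda>x. complex_of_real (q x * exp (- P x))) differentiable (at x)" for bs x
  proof -
    obtain q' where q': "real_polynomial_function q'"
      "pderivs bs (\<lambda>x. complex_of_real (q x * exp (- P x))) = (\<lambda>x. complex_of_real (q' x * exp (- P x)))"
      using pderivs_poly_exp[OF P q] by blast
    obtain D where D: "\<And>x. (q' has_derivative D x) (at x)"
      using real_polynomial_function_derivative[OF q'(1)] by blast
    obtain E where E: "\<And>x. (P has_derivative E x) (at x)"
      using real_polynomial_function_derivative[OF P] by blast
    have "((\<lambda>x. complex_of_real (q' x * exp (- P x))) has_derivative
        (\<lambda>h. complex_of_real ((D x h - q' x * E x h) * exp (- P x)))) (at x)"
      by (rule has_derivative_of_real) (auto intro!: derivative_eq_intros D(1) E(1) simp: algebra_simps)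
    then show ?thesis
      unfolding q'(2) by (rule differentiableI)
  qed
  have 2: "\<exists>C. \<forall>x. (1 + norm x) ^ n * norm (pderivs bs (\<lambda>x. complex_of_real (q x * exp (- P x))) x) \<le> C" for bs n
  proof -
    obtain q' where q': "real_polynomial_function q'"
      "pderivs bs (\<lambda>x. complex_of_real (q x * exp (- P x))) = (\<lambda>x. complex_of_real (q' x * exp (- P x)))"
      using pderivs_poly_exp[OF P q] by blast
    obtain K m where K: "0 \<le> K" "\<And>x. \<bar>q' x\<bar> \<le> K * (1 + norm x) ^ m"
      using real_polynomial_function_growth[OF q'(1)] by blast
    obtain C where C: "0 \<le> C" "\<And>t. t \<ge> 0 \<Longrightarrow> (1 + t) ^ (n + m) \<le> C * exp (\<alpha> * t)"
      using power_le_exp[OF \<alpha>] by blast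
    have "(1 + norm x) ^ n * norm (complex_of_real (q' x * exp (- P x))) \<le> K * C * exp \<beta>" for x
    proof -
      have "(1 + norm x) ^ n * norm (complex_of_real (q' x * exp (- P x))) = (1 + norm x) ^ n * (\<bar>q' x\<bar> * exp (- P x))"
        by (simp only: norm_of_real abs_mult abs_exp_cancel)
      also have "\<dots> \<le> (1 + norm x) ^ n * ((K * (1 + norm x) ^ m) * exp (\<beta> - \<alpha> * norm x))"
        using K(2)[of x] le[of x] K(1) by (intro mult_left_mono mult_mono) auto
      also have "\<dots> = K * ((1 + norm x) ^ (n + m) * exp (\<beta> - \<alpha> * norm x))"
        by (simp add: power_add mult_ac)
      also have "\<dots> \<le> K * ((C * exp (\<alpha> * norm x)) * exp (\<beta> - \<alpha> * norm x))"
        using K(1) C(2)[of "norm x"] by (intro mult_left_mono mult_right_mono) auto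
      also have "\<dots> = K * C * exp \<beta>"
        by (simp add: exp_diff)
      finally show ?thesis .
    qed
    then show ?thesis unfolding q'(2) by blast
  qed
  show ?thesis
    using 1 2 by (simp add: schwartz_def smooth_def)
qed

lemma schwartz_cmult:
  assumes "u \<in> schwartz"
  shows "(\<lambda>x. z * u x) \<in> schwartz"
proof -
  have sm: "smooth u" using assms by (simp add: schwartz_def)
  have eq: "pderivs bs (\<lambda>x. z * u x) = (\<lambda>x. z * pderivs bs u x)" if "bs \<in> lists Basis" for bs
    using that sm by (induction bs) (auto simp: pderivs_Cons pd_cmult smooth_def simp del: pderivs.simps(2))
  have "\<exists>C. \<forall>x. (1 + norm x) ^ n * norm (z * pderivs bs u x) \<le> C" if bs: "bs \<in> lists Basis" for bs n
  proof -
    obtain C where C: "\<And>x. (1 + norm x) ^ n * norm (pderivs bs u x) \<le> C"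
      using assms bs unfolding schwartz_def by blast
    have "(1 + norm x) ^ n * norm (z * pderivs bs u x) \<le> norm z * C" for x
      using mult_left_mono[OF C[of x] norm_ge_zero[of z]] by (simp add: norm_mult mult_ac)
    then show ?thesis by blast
  qed
  then show ?thesis
    using sm by (auto simp: schwartz_def smooth_def eq)
qed

text \<open>As \<open>m\<close> tends to infinity, \<open>bump c r m\<close> tends almost everywhere to the indicator function of the
  box with centre \<open>c\<close> and half side lengths \<open>r \<bullet> b\<close>, while remaining below \<open>bump_env\<close>.\<close>

definition bump :: "'a::euclidean_space \<Rightarrow> 'a \<Rightarrow> nat \<Rightarrow> 'a \<Rightarrow> real" where
  "bump c r m x = exp (- (\<Sum>b\<in>Basis. (((x - c) \<bullet> b) / (r \<bullet> b)) ^ (2 * Suc m)))"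

lemma AE_inner_neq: "b \<in> Basis \<Longrightarrow> AE x in lborel. x \<bullet> b \<noteq> (k::real)"
proof -
  assume b: "b \<in> Basis"
  have "{x. x \<bullet> b = k} \<in> null_sets (completion lborel)"
    using negligible_standard_hyperplane[OF b, of k] by (simp add: negligible_iff_null_sets)
  moreover have "{x. x \<bullet> b = k} \<in> sets lborel"
    by measurable
  ultimately have "{x. x \<bullet> b = k} \<in> null_sets lborel"
    using null_sets_completion_iff by blast
  then show ?thesis
    by (rule AE_I') auto
qed

context
  fixes c r :: "'a::euclidean_space"
  assumes r: "\<And>b. b \<in> Basis \<Longrightarrow> 0 < r \<bullet> b"
begin

definition bump_env :: "'a \<Rightarrow> real" where
  "bump_env x = exp (2 * real DIM('a) - 2 * (\<Sum>b\<in>Basis. \<bar>((x - c) \<bullet> b) / (r \<bullet> b)\<bar>))"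

lemma bump_exponent: "\<exists>\<alpha>>0. \<exists>\<beta>. \<forall>x. \<alpha> * norm x - \<beta> \<le> 2 * (\<Sum>b\<in>Basis. \<bar>((x - c) \<bullet> b) / (r \<bullet> b)\<bar>) - 2 * real DIM('a)"
proof -
  define R where "R = (\<Sum>b\<in>Basis. r \<bullet> b)"
  have le: "r \<bullet> b \<le> R" if "b \<in> Basis" for b
    unfolding R_def using that r by (intro member_le_sum) (auto intro: less_imp_le)
  have R: "0 < R"
    using r le SOME_Basis by (meson less_le_trans)
  have "2 / R * norm x - (2 / R * norm c + 2 * real DIM('a))
      \<le> 2 * (\<Sum>b\<in>Basis. \<bar>((x - c) \<bullet> b) / (r \<bullet> b)\<bar>) - 2 * real DIM('a)" for x
  proof -
    have "norm x - norm c \<le> norm (x - c)"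
      by (rule norm_triangle_ineq2)
    also have "\<dots> \<le> (\<Sum>b\<in>Basis. \<bar>(x - c) \<bullet> b\<bar>)"
      by (rule norm_le_l1)
    finally have "(norm x - norm c) / R \<le> (\<Sum>b\<in>Basis. \<bar>(x - c) \<bullet> b\<bar>) / R"
      using R by (intro divide_right_mono) auto
    also have "\<dots> \<le> (\<Sum>b\<in>Basis. \<bar>((x - c) \<bullet> b) / (r \<bullet> b)\<bar>)"
      unfolding sum_divide_distrib
    proof (rule sum_mono)
      fix b :: 'a assume b: "b \<in> Basis"
      then show "\<bar>(x - c) \<bullet> b\<bar> / R \<le> \<bar>((x - c) \<bullet> b) / (r \<bullet> b)\<bar>"
        using r[OF b] le[OF b] by (auto simp: abs_divide intro!: divide_left_mono)
    qed
    finally show ?thesis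
      by (simp add: diff_divide_distrib)
  qed
  moreover have "0 < 2 / R" using R by simp
  ultimately show ?thesis by blast
qed

text \<open>In each coordinate \<open>2 * \<bar>t\<bar> - 2 \<le> t\<^sup>2 - 1 \<le> (t\<^sup>2) ^
  Suc m\<close>; for \<open>t\<^sup>2 < 1\<close> the middle term is negative. The left side is free
  of \<open>m\<close>, which makes \<open>bump_env\<close> a common majorant.\<close>

lemma bump_exponent_le: "2 * (\<Sum>b\<in>Basis. \<bar>((x - c) \<bullet> b) / (r \<bullet> b)\<bar>) - 2 * real DIM('a)
    \<le> (\<Sum>b\<in>Basis. (((x - c) \<bullet> b) / (r \<bullet> b)) ^ (2 * Suc m))"
proof -
  have "2 * \<bar>t\<bar> - 2 \<le> t ^ (2 * Suc m)" for t :: real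
  proof -
    have 1: "2 * \<bar>t\<bar> - 2 \<le> t\<^sup>2 - 1"
      using zero_le_power2[of "\<bar>t\<bar> - 1"] by (simp add: power2_diff)
    have "t\<^sup>2 - 1 \<le> (t\<^sup>2) ^ Suc m"
    proof (cases "1 \<le> t\<^sup>2")
      case True
      then show ?thesis
        using power_increasing[of 1 "Suc m" "t\<^sup>2"] by simp
    next
      case False
      then show ?thesis
        using zero_le_power[of "t\<^sup>2" "Suc m"] by (simp del: zero_le_power power_Suc)
    qed
    with 1 show ?thesis
      unfolding power_mult by linarith
  qed
  then have "(\<Sum>b\<in>Basis. 2 * \<bar>((x - c) \<bullet> b) / (r \<bullet> b)\<bar> - 2) \<le> (\<Sum>b\<in>Basis. (((x - c) \<bullet> b) / (r \<bullet> b)) ^ (2 * Suc m))"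
    by (intro sum_mono)
  then show ?thesis
    by (simp add: sum_subtractf sum_distrib_left)
qed

lemma bump_le_env: "bump c r m x \<le> bump_env x"
  unfolding bump_def bump_env_def using bump_exponent_le[of x m] by simp

lemma bump_schwartz: "(\<lambda>x. z * complex_of_real (bump c r m x)) \<in> schwartz"
proof (rule schwartz_cmult)
  let ?P = "\<lambda>x. \<Sum>b\<in>Basis. (((x - c) \<bullet> b) / (r \<bullet> b)) ^ (2 * Suc m)"
  obtain \<alpha> \<beta> where \<alpha>: "0 < \<alpha>"
    and le: "\<And>x. \<alpha> * norm x - \<beta> \<le> 2 * (\<Sum>b\<in>Basis. \<bar>((x - c) \<bullet> b) / (r \<bullet> b)\<bar>) - 2 * real DIM('a)"
    using bump_exponent by blast
  have lin: "real_polynomial_function (\<lambda>x. ((x - c) \<bullet> b) / (r \<bullet> b))" for b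
  proof -
    have "bounded_linear (\<lambda>x. (x \<bullet> b) * (1 / (r \<bullet> b)))"
      by (intro bounded_linear_mult_left[THEN bounded_linear_compose] bounded_linear_inner_left)
    from real_polynomial_function.intros(3)[OF real_polynomial_function.intros(1)[OF this]
        real_polynomial_function.intros(2)[of "- (c \<bullet> b) / (r \<bullet> b)"]]
    show ?thesis by (simp add: inner_diff_left diff_divide_distrib)
  qed
  have pw: "real_polynomial_function (\<lambda>x. (((x - c) \<bullet> b) / (r \<bullet> b)) ^ n)" for b n
    by (induction n) (auto simp only: power_0 power_Suc
      intro!: real_polynomial_function.intros(2) real_polynomial_function.intros(4)[OF lin])
  have "real_polynomial_function ?P"
    by (intro real_polynomial_function_sum pw) simp
  from schwartz_poly_exp[OF this real_polynomial_function.intros(2)[of 1] \<alpha>, of \<beta>]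
  show "(\<lambda>x. complex_of_real (bump c r m x)) \<in> schwartz"
    using order_trans[OF le bump_exponent_le] by (simp add: bump_def[abs_def])
qed

lemma integrable_bump_env: "integrable lborel (\<lambda>x. (bump_env x)\<^sup>2)"
proof -
  obtain \<alpha> \<beta> where \<alpha>: "0 < \<alpha>"
    and le: "\<And>x. \<alpha> * norm x - \<beta> \<le> 2 * (\<Sum>b\<in>Basis. \<bar>((x - c) \<bullet> b) / (r \<bullet> b)\<bar>) - 2 * real DIM('a)"
    using bump_exponent by blast
  obtain C where C: "0 \<le> C" "\<And>t. t \<ge> 0 \<Longrightarrow> (1 + t) ^ (2 * DIM('a)) \<le> C * exp (\<alpha> * t)"
    using power_le_exp[OF \<alpha>] by blast
  have env: "bump_env x \<le> exp \<beta> * C * decay x" for x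
  proof -
    have p: "0 < (1 + norm x) ^ (2 * DIM('a))" by (simp add: add_pos_nonneg)
    have "bump_env x \<le> exp (\<beta> - \<alpha> * norm x)"
      unfolding bump_env_def using le[of x] by simp
    also have "\<dots> = exp \<beta> * (1 / exp (\<alpha> * norm x))"
      by (simp add: exp_diff)
    also have "\<dots> \<le> exp \<beta> * (C * (1 / (1 + norm x) ^ (2 * DIM('a))))"
      using C(2)[of "norm x"] p by (intro mult_left_mono) (auto simp: field_simps)
    finally show ?thesis by (simp add: decay_def mult.assoc)
  qed
  show ?thesis
  proof (rule Bochner_Integration.integrable_bound)
    show "integrable lborel (\<lambda>x::'a. (exp \<beta> * C)\<^sup>2 * decay x)"
      using integrable_decay[where 'a='a] by (intro integrable_mult_right)
    show "(\<lambda>x. (bump_env x)\<^sup>2) \<in> borel_measurable lborel"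
      unfolding bump_env_def by measurable
    show "AE x in lborel. norm ((bump_env x)\<^sup>2) \<le> norm ((exp \<beta> * C)\<^sup>2 * decay x)"
    proof (rule AE_I2)
      fix x
      have "(bump_env x)\<^sup>2 \<le> (exp \<beta> * C * decay x)\<^sup>2"
        using env[of x] by (intro power_mono) (auto simp: bump_env_def)
      also have "\<dots> = (exp \<beta> * C)\<^sup>2 * (decay x * decay x)"
        by (simp add: power2_eq_square mult_ac)
      also have "\<dots> \<le> (exp \<beta> * C)\<^sup>2 * decay x"
        using decay_le_1[of x] decay_pos[of x] by (intro mult_left_mono) (auto simp: mult_left_le)
      finally show "norm ((bump_env x)\<^sup>2) \<le> norm ((exp \<beta> * C)\<^sup>2 * decay x)"
        using decay_pos[of x] by simp
    qed
  qed
qed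

text \<open>\<open>t ^ (2 * Suc m)\<close> tends to 0 for \<open>\<bar>t\<bar> < 1\<close> and to
  infinity for \<open>\<bar>t\<bar> > 1\<close>. On the faces of the box the limit may be different;
  they are excluded here and are null sets in \<open>AE_bump_tendsto\<close>.\<close>

lemma bump_tendsto:
  assumes "\<And>b. b \<in> Basis \<Longrightarrow> \<bar>((x - c) \<bullet> b) / (r \<bullet> b)\<bar> \<noteq> 1"
  shows "(\<lambda>m. bump c r m x) \<longlonglongrightarrow> indicator (box (c - r) (c + r)) x"
proof -
  let ?t = "\<lambda>b. ((x - c) \<bullet> b) / (r \<bullet> b)"
  have mem: "x \<in> box (c - r) (c + r) \<longleftrightarrow> (\<forall>b\<in>Basis. \<bar>?t b\<bar> < 1)"
    using r by (force simp: mem_box abs_divide abs_of_pos inner_diff_left inner_add_left abs_less_iff)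
  show ?thesis
  proof (cases "\<forall>b\<in>Basis. \<bar>?t b\<bar> < 1")
    case True
    have "(\<lambda>m. (?t b) ^ (2 * Suc m)) \<longlonglongrightarrow> 0" if b: "b \<in> Basis" for b
    proof -
      have "(\<lambda>m. ((?t b)\<^sup>2) ^ Suc m) \<longlonglongrightarrow> 0"
        by (intro LIMSEQ_power_zero[THEN LIMSEQ_Suc])
          (use True b in \<open>simp add: abs_square_less_1 del: abs_divide\<close>)
      then show ?thesis by (simp only: power_mult)
    qed
    then have "(\<lambda>m. exp (- (\<Sum>b\<in>Basis. (?t b) ^ (2 * Suc m)))) \<longlonglongrightarrow> exp (- (\<Sum>b\<in>(Basis::'a set). 0))"
      by (intro tendsto_intros) auto
    then show ?thesis
      using True mem by (simp add: bump_def[abs_def])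
  next
    case False
    then obtain b where b: "b \<in> Basis" "1 < \<bar>?t b\<bar>"
      using assms by (meson linorder_neqE_linordered_idom)
    have "1 < (?t b)\<^sup>2"
      using b(2) by (metis one_less_power power2_abs zero_less_numeral)
    from this have "filterlim (\<lambda>m. ((?t b)\<^sup>2) ^ Suc m) at_top sequentially"
    proof -
      assume "1 < (?t b)\<^sup>2"
      then have "filterlim (\<lambda>m. ((?t b)\<^sup>2) ^ m) at_infinity sequentially"
        by (intro filterlim_realpow_sequentially_gt1) (simp only: real_norm_def abs_of_nonneg zero_le_power2)
      then have "filterlim (\<lambda>m. norm (((?t b)\<^sup>2) ^ m)) at_top sequentially"
        by (simp only: filterlim_at_infinity_conv_norm_at_top)
      then have "filterlim (\<lambda>m. ((?t b)\<^sup>2) ^ m) at_top sequentially"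
        by (simp only: real_norm_def abs_of_nonneg zero_le_power zero_le_power2)
      then show ?thesis
        by (simp only: filterlim_sequentially_Suc[of "\<lambda>m. ((?t b)\<^sup>2) ^ m"])
    qed
    then have "filterlim (\<lambda>m. (\<Sum>b\<in>Basis. (?t b) ^ (2 * Suc m))) at_top sequentially"
    proof (rule filterlim_at_top_mono, intro always_eventually allI)
      fix m
      have "((?t b)\<^sup>2) ^ Suc m = (?t b) ^ (2 * Suc m)"
        by (rule power_mult[symmetric])
      also have "\<dots> \<le> (\<Sum>b\<in>Basis. (?t b) ^ (2 * Suc m))"
        by (rule member_le_sum[OF b(1)]) (simp_all only: zero_le_even_power even_mult_iff even_numeral finite_Basis simp_thms)
      finally show "((?t b)\<^sup>2) ^ Suc m \<le> (\<Sum>b\<in>Basis. (?t b) ^ (2 * Suc m))" .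
    qed
    then have "(\<lambda>m. exp (- (\<Sum>b\<in>Basis. (?t b) ^ (2 * Suc m)))) \<longlonglongrightarrow> 0"
      by (intro filterlim_compose[OF exp_at_bot] filterlim_compose[OF filterlim_uminus_at_bot_at_top])
    then show ?thesis
      using False mem by (simp add: bump_def[abs_def])
  qed
qed

lemma AE_bump_tendsto: "AE x in lborel. (\<lambda>m. bump c r m x) \<longlonglongrightarrow> indicator (box (c - r) (c + r)) x"
proof -
  have "AE x in lborel. \<forall>b\<in>Basis. x \<bullet> b \<noteq> c \<bullet> b + r \<bullet> b \<and> x \<bullet> b \<noteq> c \<bullet> b - r \<bullet> b"
    by (intro AE_finite_allI AE_conjI AE_inner_neq) auto
  then show ?thesis
  proof eventually_elim
    fix x assume x: "\<forall>b\<in>Basis. x \<bullet> b \<noteq> c \<bullet> b + r \<bullet> b \<and> x \<bullet> b \<noteq> c \<bullet> b - r \<bullet> b"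
    show "(\<lambda>m. bump c r m x) \<longlonglongrightarrow> indicator (box (c - r) (c + r)) x"
    proof (rule bump_tendsto)
      fix b :: 'a assume b: "b \<in> Basis"
      then show "\<bar>((x - c) \<bullet> b) / (r \<bullet> b)\<bar> \<noteq> 1"
        using x r[OF b] by (auto simp: abs_if divide_eq_eq inner_diff_left split: if_splits)
    qed
  qed
qed

lemma box_indicator_le_env: "indicator (box (c - r) (c + r)) x \<le> bump_env x"
proof (cases "x \<in> box (c - r) (c + r)")
  case True
  have "\<bar>((x - c) \<bullet> b) / (r \<bullet> b)\<bar> \<le> 1" if b: "b \<in> Basis" for b
    using True b r[OF b] by (force simp: mem_box abs_divide abs_of_pos inner_diff_left inner_add_left abs_le_iff)
  then have "(\<Sum>b\<in>Basis. \<bar>((x - c) \<bullet> b) / (r \<bullet> b)\<bar>) \<le> real (card (Basis :: 'a set)) * 1"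
    by (intro sum_bounded_above)
  then show ?thesis
    using True by (simp add: bump_env_def)
qed (simp add: bump_env_def)

end

lemma square_integrable_indicator:
  assumes "A \<in> sets borel" "emeasure lborel A < \<infinity>"
  shows "square_integrable (\<lambda>x. z * indicator A (x::'a::euclidean_space))"
proof -
  have "(\<lambda>x. (norm (z * indicator A x))\<^sup>2) = (\<lambda>x. (norm z)\<^sup>2 * indicator A x)"
    by (auto simp: norm_mult fun_eq_iff split: split_indicator)
  then show ?thesis
    using assms by (auto simp: square_integrable_def)
qed

context
  fixes N :: "'a::euclidean_space L2 set"
  assumes closed: "closed N" and subspace: "subspace N"
    and schwartz: "\<And>u. u \<in> schwartz \<Longrightarrow> abs_L2 u \<in> N"
begin

lemma closed_limit: "X \<longlonglongrightarrow> L \<Longrightarrow> (\<And>n. X n \<in> N) \<Longrightarrow> L \<in> N"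
  using closed closed_sequentially by blast

text \<open>Dominated limits of bumps. \<open>N\<close> is only a real subspace, which is why a
  complex factor \<open>z\<close> is carried along from boxes to Borel sets.\<close>

lemma box_indicator_closure: "abs_L2 (\<lambda>x. z * indicator (box a b) x) \<in> N"
proof (cases "box a b = {}")
  case True
  then show ?thesis
    using subspace_0[OF subspace] by (simp add: zero_L2.abs_eq[symmetric])
next
  case False
  let ?c = "(1/2) *\<^sub>R (a + b)" and ?r = "(1/2) *\<^sub>R (b - a)"
  have r: "0 < ?r \<bullet> i" if "i \<in> Basis" for i
    using False that by (auto simp: box_ne_empty inner_diff_left)
  have eq: "?c - ?r = a" "?c + ?r = b"
    by (simp_all add: scaleR_right_diff_distrib scaleR_right_distrib scaleR_left_distrib[symmetric]
        algebra_simps flip: scaleR_2)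
  let ?env = "\<lambda>x. norm z * bump_env ?c ?r x"
  have "(\<lambda>m. abs_L2 (\<lambda>x. z * complex_of_real (bump ?c ?r m x))) \<longlonglongrightarrow> abs_L2 (\<lambda>x. z * indicator (box a b) x)"
  proof (rule abs_L2_dominated_convergence[where g="?env"])
    show "(\<lambda>x. z * complex_of_real (bump ?c ?r n x)) \<in> borel_measurable borel" for n
      unfolding bump_def by measurable
    show "integrable lborel (\<lambda>x. (?env x)\<^sup>2)"
      using integrable_bump_env[OF r] by (simp add: power_mult_distrib)
    show "AE x in lborel. norm (z * complex_of_real (bump ?c ?r n x)) \<le> ?env x" for n
      using bump_le_env[OF r] by (auto simp: norm_mult bump_def intro!: mult_left_mono)
    show "AE x in lborel. norm (z * indicator (box a b) x :: complex) \<le> ?env x"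
    proof (rule AE_I2)
      fix x
      show "norm (z * indicator (box a b) x :: complex) \<le> ?env x"
        using mult_left_mono[OF box_indicator_le_env[OF r, of ?c x, unfolded eq] norm_ge_zero[of z]]
        by (cases "x \<in> box a b") (simp_all add: norm_mult)
    qed
    show "AE x in lborel. (\<lambda>n. z * complex_of_real (bump ?c ?r n x)) \<longlonglongrightarrow> z * indicator (box a b) x"
    proof -
      have "AE x in lborel. (\<lambda>m. bump ?c ?r m x) \<longlonglongrightarrow> indicator (box a b) x"
        using AE_bump_tendsto[of ?r ?c] r by (simp only: eq)
      then show ?thesis
      proof eventually_elim
      fix x assume "(\<lambda>m. bump ?c ?r m x) \<longlonglongrightarrow> indicator (box a b) x"
      then have "(\<lambda>n. z * complex_of_real (bump ?c ?r n x)) \<longlonglongrightarrow> z * complex_of_real (indicator (box a b) x)"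
        by (intro tendsto_intros)
      then show "(\<lambda>n. z * complex_of_real (bump ?c ?r n x)) \<longlonglongrightarrow> z * indicator (box a b) x"
        by (simp add: of_real_indicator)
      qed
    qed
  qed auto
  then show ?thesis
    by (rule closed_limit) (intro schwartz bump_schwartz r)
qed

lemma square_integrable_Int_box:
  "A \<in> sets borel \<Longrightarrow> square_integrable (\<lambda>x. z * indicator (A \<inter> box a (b::'a)) x)"
  using emeasure_mono[of "A \<inter> box a b" "box a b" lborel] emeasure_lborel_box_finite[of a b]
  by (intro square_integrable_indicator) (auto intro: le_less_trans)

text \<open>Dynkin's argument over the intersection-stable family of boxes. Intersecting with a
  fixed box keeps every indicator square integrable, and complements become differences inside that
  box.\<close>

lemma borel_indicator_closure:
  assumes "A \<in> sets borel"
  shows "abs_L2 (\<lambda>x. z * indicator (A \<inter> box a b) x) \<in> N"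
proof -
  let ?G = "range (\<lambda>(a, b). box a b :: 'a set)"
  have sets: "sets borel = sigma_sets UNIV ?G"
    unfolding borel_eq_box by (rule sets_measure_of) auto
  have Int: "box a b \<inter> box c d \<in> ?G" for a b c d :: 'a
    unfolding box_Int_box by (rule range_eqI[of _ _ "(_, _)"]) simp
  have "A \<in> sigma_sets UNIV ?G" using assms by (simp only: sets)
  then show ?thesis
  proof (rule sigma_sets_induct_disjoint[rotated 2])
    show "Int_stable ?G"
      using Int by (auto simp: Int_stable_def)
    show "abs_L2 (\<lambda>x. z * indicator (A \<inter> box a b) x) \<in> N" if "A \<in> ?G" for A
    proof -
      obtain c d where "A = box c d" using \<open>A \<in> ?G\<close> by auto
      moreover obtain a' b' where "box c d \<inter> box a b = box a' b'"
        using Int[of c d a b] by auto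
      ultimately show ?thesis
        using box_indicator_closure by simp
    qed
    show "abs_L2 (\<lambda>x. z * indicator ({} \<inter> box a b) x) \<in> N"
      using subspace_0[OF subspace] by (simp add: zero_L2.abs_eq[symmetric])
    show "abs_L2 (\<lambda>x. z * indicator ((UNIV - A) \<inter> box a b) x) \<in> N"
      if A: "A \<in> sigma_sets UNIV ?G" and IH: "abs_L2 (\<lambda>x. z * indicator (A \<inter> box a b) x) \<in> N" for A
    proof -
      have "A \<in> sets borel" using A by (simp only: sets)
      have "(\<lambda>x. z * indicator ((UNIV - A) \<inter> box a b) x) =
          (\<lambda>x. z * indicator (UNIV \<inter> box a b) x - z * indicator (A \<inter> box a b) x)"
        by (auto split: split_indicator)
      moreover have "abs_L2 \<dots> = abs_L2 (\<lambda>x. z * indicator (UNIV \<inter> box a b) x) - abs_L2 (\<lambda>x. z * indicator (A \<inter> box a b) x)"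
        by (intro abs_L2_diff[symmetric] square_integrable_Int_box \<open>A \<in> sets borel\<close>) auto
      ultimately show ?thesis
        using subspace_diff[OF subspace box_indicator_closure IH] by simp
    qed
    show "abs_L2 (\<lambda>x. z * indicator (\<Union> (range A) \<inter> box a b) x) \<in> N"
      if disj: "disjoint_family A" and A: "range A \<subseteq> sigma_sets UNIV ?G"
        and IH: "\<And>i. abs_L2 (\<lambda>x. z * indicator (A i \<inter> box a b) x) \<in> N" for A :: "nat \<Rightarrow> 'a set"
    proof -
      have [measurable]: "A i \<in> sets borel" for i using A unfolding sets by blast
      have fin: "abs_L2 (\<lambda>x. z * indicator ((\<Union>i<n. A i) \<inter> box a b) x) \<in> N" for n
      proof (induction n)
        case 0
        show ?case using subspace_0[OF subspace] by (simp add: zero_L2.abs_eq[symmetric])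
      next
        case (Suc n)
        have "(\<lambda>x. z * indicator ((\<Union>i<Suc n. A i) \<inter> box a b) x) =
            (\<lambda>x. z * indicator ((\<Union>i<n. A i) \<inter> box a b) x + z * indicator (A n \<inter> box a b) x)"
        proof
          fix x
          have "x \<notin> A n \<or> (\<forall>i<n. x \<notin> A i)"
            using disj unfolding disjoint_family_on_def by (metis IntI UNIV_I emptyE less_irrefl)
          then show "z * indicator ((\<Union>i<Suc n. A i) \<inter> box a b) x =
              z * indicator ((\<Union>i<n. A i) \<inter> box a b) x + z * indicator (A n \<inter> box a b) x"
            by (auto simp: less_Suc_eq split: split_indicator)
        qed
        moreover have "abs_L2 \<dots> = abs_L2 (\<lambda>x. z * indicator ((\<Union>i<n. A i) \<inter> box a b) x) + abs_L2 (\<lambda>x. z * indicator (A n \<inter> box a b) x)"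
          by (intro abs_L2_add[symmetric] square_integrable_Int_box) auto
        ultimately show ?case
          using subspace_add[OF subspace Suc.IH IH[of n]] by simp
      qed
      have "(\<lambda>n. abs_L2 (\<lambda>x. z * indicator ((\<Union>i<n. A i) \<inter> box a b) x)) \<longlonglongrightarrow> abs_L2 (\<lambda>x. z * indicator (\<Union> (range A) \<inter> box a b) x)"
      proof (rule abs_L2_dominated_convergence[where g="\<lambda>x. norm z * indicator (box a b) x"])
        have "(\<lambda>x. (norm z * indicator (box a b) x)\<^sup>2) = (\<lambda>x. (norm z)\<^sup>2 * indicator (box a b) x)"
          by (auto simp: fun_eq_iff split: split_indicator)
        then show "integrable lborel (\<lambda>x. (norm z * indicator (box a b) x)\<^sup>2)"
          using emeasure_lborel_box_finite[of a b] by simp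
        show "AE x in lborel. (\<lambda>n. z * indicator ((\<Union>i<n. A i) \<inter> box a b) x :: complex) \<longlonglongrightarrow> z * indicator (\<Union> (range A) \<inter> box a b) x"
          unfolding indicator_inter_arith
          by (intro AE_I2 tendsto_intros LIMSEQ_indicator_UN)
      qed (auto simp: norm_mult split: split_indicator)
      then show ?thesis
        by (rule closed_limit) (rule fin)
    qed
  qed auto
qed

text \<open>Simple functions approximating \<open>f\<close>, cut off to growing boxes, are finite
  sums of the indicators already treated and are dominated by \<open>2 * norm (f x)\<close>. Density
  is phrased through a closed subspace because most of its uses are equations, such as equality of
  two operators or orthogonality.\<close>

lemma schwartz_dense: "\<phi> \<in> N"
proof -
  obtain f where sq: "square_integrable f" and \<phi>: "\<phi> = abs_L2 f"
    by (rule L2_cases)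
  have fm[measurable]: "f \<in> borel_measurable borel"
    using sq by (simp add: square_integrable_def)
  obtain F where simple: "\<And>i. simple_function borel (F i)" and lim: "\<And>x. (\<lambda>i. F i x) \<longlonglongrightarrow> f x"
    and le: "\<And>i x. norm (F i x) \<le> 2 * norm (f x)"
    using borel_measurable_implies_sequence_metric[OF fm, of 0] by auto
  let ?B = "\<lambda>i. box (- (real i *\<^sub>R One)) (real i *\<^sub>R One) :: 'a set"
  have [measurable]: "F i \<in> borel_measurable borel" for i
    using simple by (rule borel_measurable_simple_function)
  have mem: "abs_L2 (\<lambda>x. F i x * indicator (?B i) x) \<in> N" for i
  proof -
    have fin: "finite (range (F i))"
      using simple[of i] by (simp add: simple_function_def)
    have m: "F i -` {y} \<in> sets borel" for y
      using measurable_sets[of "F i" borel borel "{y}"] by auto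
    have "abs_L2 (\<lambda>x. \<Sum>y\<in>Y. y * indicator (F i -` {y} \<inter> ?B i) x) \<in> N \<and>
        square_integrable (\<lambda>x. \<Sum>y\<in>Y. y * indicator (F i -` {y} \<inter> ?B i) x)" if "finite Y" for Y
      using that
    proof (induction Y)
      case empty
      then show ?case
        using subspace_0[OF subspace] by (simp add: zero_L2.abs_eq[symmetric] square_integrable_zero)
    next
      case (insert y Y)
      have s: "square_integrable (\<lambda>x. y * indicator (F i -` {y} \<inter> ?B i) x)"
        by (rule square_integrable_Int_box[OF m])
      show ?case
        using insert subspace_add[OF subspace borel_indicator_closure[OF m[of y], of y "- (real i *\<^sub>R One)" "real i *\<^sub>R One"]]
        by (simp only: sum.insert abs_L2_add[symmetric] s simp_thms square_integrable_add[OF s])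
    qed
    moreover have "(\<lambda>x. \<Sum>y\<in>range (F i). y * indicator (F i -` {y} \<inter> ?B i) x) = (\<lambda>x. F i x * indicator (?B i) x)"
    proof
      fix x
      have "(\<Sum>y\<in>range (F i). y * indicator (F i -` {y} \<inter> ?B i) x) = (\<Sum>y\<in>range (F i). if y = F i x then F i x * indicator (?B i) x else 0)"
        by (intro sum.cong refl) (auto split: split_indicator)
      also have "\<dots> = F i x * indicator (?B i) x"
        by (subst sum.delta[OF fin]) simp
      finally show "(\<Sum>y\<in>range (F i). y * indicator (F i -` {y} \<inter> ?B i) x) = F i x * indicator (?B i) x" .
    qed
    ultimately show ?thesis
      using fin by force
  qed
  have "(\<lambda>i. abs_L2 (\<lambda>x. F i x * indicator (?B i) x)) \<longlonglongrightarrow> abs_L2 f"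
  proof (rule abs_L2_dominated_convergence[where g="\<lambda>x. 2 * norm (f x)"])
    show "integrable lborel (\<lambda>x. (2 * norm (f x))\<^sup>2)"
      using sq by (simp add: square_integrable_def power_mult_distrib)
    show "AE x in lborel. norm (F n x * indicator (?B n) x) \<le> 2 * norm (f x)" for n
      using le by (auto simp: norm_mult split: split_indicator)
    show "AE x in lborel. (\<lambda>n. F n x * indicator (?B n) x) \<longlonglongrightarrow> f x"
    proof (rule AE_I2)
      fix x
      have "\<forall>\<^sub>F n in sequentially. F n x * indicator (?B n) x = F n x"
        using eventually_gt_at_top[of "nat \<lceil>norm x\<rceil>"]
      proof eventually_elim
        fix n assume "nat \<lceil>norm x\<rceil> < n"
        then have n: "norm x < real n" by linarith
        have "\<bar>x \<bullet> b\<bar> < real n" if "b \<in> Basis" for b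
          using Basis_le_norm[OF that, of x] n by linarith
        then have "x \<in> ?B n"
          by (auto simp: mem_box abs_less_iff minus_less_iff)
        then show "F n x * indicator (?B n) x = F n x" by simp
      qed
      then show "(\<lambda>n. F n x * indicator (?B n) x) \<longlonglongrightarrow> f x"
        using lim[of x] by (simp only: tendsto_cong)
    qed
  qed auto
  then show ?thesis
    unfolding \<phi> by (rule closed_limit) (rule mem)
qed

end

section \<open>The Fourier transform as an operator\<close>

text \<open>The condition under which \<open>bdd_mult\<close> leaves a multiplier unchanged.\<close>

definition bmeas :: "('a::euclidean_space \<Rightarrow> complex) \<Rightarrow> bool" where
  "bmeas m \<longleftrightarrow> m \<in> borel_measurable borel \<and> bounded (range m)"

lemma bmeas_const [simp]: "bmeas (\<lambda>x. z)"
  by (simp add: bmeas_def image_constant_conv)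

lemma bmeas_bound: "m \<in> borel_measurable borel \<Longrightarrow> (\<And>x. norm (m x) \<le> B) \<Longrightarrow> bmeas m"
  by (auto simp: bmeas_def bounded_iff)

lemma bmeasE:
  assumes "bmeas m"
  obtains B where "0 \<le> B" "\<And>x. norm (m x) \<le> B"
proof -
  obtain B where B: "\<And>x. norm (m x) \<le> B"
    using assms by (auto simp: bmeas_def bounded_iff)
  then show ?thesis
    using that[of B] norm_ge_zero order_trans by blast
qed

lemma bmeas_measurable: "bmeas m \<Longrightarrow> m \<in> borel_measurable borel"
  by (simp add: bmeas_def)

lemma bmeas_add [simp]: "bmeas f \<Longrightarrow> bmeas g \<Longrightarrow> bmeas (\<lambda>x. f x + g x)"
  unfolding bmeas_def using bounded_plus_comp[of f UNIV g] by auto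

lemma bmeas_diff [simp]: "bmeas f \<Longrightarrow> bmeas g \<Longrightarrow> bmeas (\<lambda>x. f x - g x)"
  unfolding bmeas_def using bounded_minus_comp[of f UNIV g] by auto

lemma bmeas_mult [simp]: "bmeas f \<Longrightarrow> bmeas g \<Longrightarrow> bmeas (\<lambda>x. f x * g x)"
proof -
  assume fg: "bmeas f" "bmeas g"
  obtain B C where "0 \<le> B" "\<And>x. norm (f x) \<le> B" "0 \<le> C" "\<And>x. norm (g x) \<le> C"
    using fg by (metis bmeasE)
  then have "norm (f x * g x) \<le> B * C" for x
    by (simp add: norm_mult mult_mono)
  then show ?thesis
    using fg by (intro bmeas_bound[of _ "B * C"]) (auto simp: bmeas_def)
qed

lemma bmeas_cnj [simp]: "bmeas f \<Longrightarrow> bmeas (\<lambda>x. cnj (f x))"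
  using borel_measurable_continuous_onI[of cnj] by (auto simp: bmeas_def bounded_iff continuous_on_cnj)

lemma bmeas_cis [simp]: "bmeas (\<lambda>x. cis (\<zeta> \<bullet> x))"
  by (rule bmeas_bound[of _ 1]) auto

lemma bmeas_scaleR [simp]: "bmeas f \<Longrightarrow> bmeas (\<lambda>x. r *\<^sub>R f x)"
  unfolding scaleR_conv_of_real by simp

lemma bmeas_power [simp]: "bmeas f \<Longrightarrow> bmeas (\<lambda>x. f x ^ n)"
  by (induction n) auto

lemma square_integrable_bmeas: "bmeas m \<Longrightarrow> square_integrable f \<Longrightarrow> square_integrable (\<lambda>x. m x * f x)"
  by (simp add: bmeas_def square_integrable_mult)

lemma mult_op_abs: "bmeas m \<Longrightarrow> square_integrable f \<Longrightarrow> mult_op m (abs_L2 f) = abs_L2 (\<lambda>x. m x * f x)"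
  by (simp add: bmeas_def mult_op_abs_L2)

lemma blinfun_L2_eqI: "(\<And>f. square_integrable f \<Longrightarrow> S (abs_L2 f) = T (abs_L2 f)) \<Longrightarrow> S = T"
  for S T :: "'a::euclidean_space L2 \<Rightarrow>\<^sub>L 'a L2"
  by (metis L2_cases blinfun_eqI)

lemma mult_op_compose: "bmeas m \<Longrightarrow> bmeas k \<Longrightarrow> mult_op m o\<^sub>L mult_op k = mult_op (\<lambda>x. m x * k x)"
  by (rule blinfun_L2_eqI) (simp add: mult_op_abs square_integrable_bmeas mult.assoc)

lemma mult_op_add: "bmeas m \<Longrightarrow> bmeas k \<Longrightarrow> mult_op m + mult_op k = mult_op (\<lambda>x. m x + k x)"
  by (rule blinfun_L2_eqI)
    (simp add: blinfun.add_left mult_op_abs abs_L2_add square_integrable_bmeas distrib_right)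

lemma mult_op_diff: "bmeas m \<Longrightarrow> bmeas k \<Longrightarrow> mult_op m - mult_op k = mult_op (\<lambda>x. m x - k x)"
  by (rule blinfun_L2_eqI)
    (simp add: blinfun.diff_left mult_op_abs abs_L2_diff square_integrable_bmeas left_diff_distrib)

lemma mult_op_scaleR: "bmeas m \<Longrightarrow> r *\<^sub>R mult_op m = mult_op (\<lambda>x. r *\<^sub>R m x)"
  by (rule blinfun_L2_eqI)
    (simp add: blinfun.scaleR_left mult_op_abs abs_L2_scaleR square_integrable_bmeas)

lemma mult_op_1: "mult_op (\<lambda>x. 1) = id_blinfun"
  by (rule blinfun_L2_eqI) (simp add: mult_op_abs)

lemma norm_mult_op_le:
  assumes "\<And>x. norm (m x) \<le> B"
  shows "norm (mult_op m) \<le> B"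
proof (rule norm_blinfun_bound)
  have "0 \<le> B" using assms norm_ge_zero order_trans by blast
  then show "0 \<le> B" .
  fix \<phi> :: "'a L2"
  obtain f where sq: "square_integrable f" and \<phi>: "\<phi> = abs_L2 f" by (rule L2_cases)
  show "norm (mult_op m \<phi>) \<le> B * norm \<phi>"
  proof (cases "bmeas m")
    case True
    have "(LINT x|lborel. (norm (m x * f x))\<^sup>2) \<le> (LINT x|lborel. B\<^sup>2 * (norm (f x))\<^sup>2)"
      using sq square_integrable_bmeas[OF True sq] assms
      by (intro integral_mono)
        (auto simp: square_integrable_def norm_mult power_mult_distrib intro!: mult_right_mono power_mono)
    then have "sqrt (LINT x|lborel. (norm (m x * f x))\<^sup>2) \<le> sqrt (B\<^sup>2 * (LINT x|lborel. (norm (f x))\<^sup>2))"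
      by (intro real_sqrt_le_mono) simp
    then show ?thesis
      using \<open>0 \<le> B\<close> sq square_integrable_bmeas[OF True sq] True
      by (simp add: \<phi> mult_op_abs norm_abs_L2 real_sqrt_mult)
  next
    \<comment> \<open>Here \<open>bdd_mult\<close> replaces \<open>m\<close> by zero; given the
      pointwise bound, this can only be for lack of measurability.\<close>
    case False
    then have "bdd_mult m = (\<lambda>_. 0)"
      by (auto simp: bdd_mult_def bmeas_def)
    then have "mult_op m \<phi> = 0"
      using sq by (simp add: \<phi> mult_op.rep_eq mult_L2.abs_eq L2_rel_def zero_L2.abs_eq)
    then show ?thesis using \<open>0 \<le> B\<close> by simp
  qed
qed

lemma mult_op_adjoint: "bmeas m \<Longrightarrow> mult_op m \<phi> \<bullet> \<psi> = \<phi> \<bullet> mult_op (\<lambda>x. cnj (m x)) \<psi>"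
proof -
  assume m: "bmeas m"
  obtain f g where sq: "square_integrable f" "square_integrable g" and eq: "\<phi> = abs_L2 f" "\<psi> = abs_L2 g"
    by (metis L2_cases)
  have "(m x * f x) \<bullet> g x = f x \<bullet> (cnj (m x) * g x)" for x
    by (simp add: inner_complex_def algebra_simps)
  then show ?thesis
    using sq m by (simp add: eq mult_op_abs inner_abs_L2 square_integrable_bmeas)
qed

section \<open>Extension of operators from dense subspaces\<close>

lemma subspace_closure:
  fixes S :: "'b::real_normed_vector set"
  assumes "subspace S"
  shows "subspace (closure S)"
  unfolding subspace_def
proof (intro conjI ballI allI)
  show "0 \<in> closure S"
    using subspace_0[OF assms] closure_subset by blast
next
  fix x y assume "x \<in> closure S" "y \<in> closure S"
  then obtain X Y where "\<And>n. X n \<in> S" "X \<longlonglongrightarrow> x" "\<And>n. Y n \<in> S" "Y \<longlonglongrightarrow> y"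
    unfolding closure_sequential by blast
  then show "x + y \<in> closure S"
    unfolding closure_sequential
    by (intro exI[of _ "\<lambda>n. X n + Y n"]) (auto intro: subspace_add[OF assms] tendsto_add)
next
  fix c x assume "x \<in> closure S"
  then obtain X where "\<And>n. X n \<in> S" "X \<longlonglongrightarrow> x"
    unfolding closure_sequential by blast
  then show "c *\<^sub>R x \<in> closure S"
    unfolding closure_sequential
    by (intro exI[of _ "\<lambda>n. c *\<^sub>R X n"]) (auto intro: subspace_scale[OF assms] tendsto_scaleR)
qed

text \<open>The bound is a Lipschitz condition on \<open>X\<close>, so \<open>f\<close> extends
  continuously to the closure; linearity and the bound pass to limits of sequences from
  \<open>X\<close>.\<close>

lemma blinfun_extension:
  fixes f :: "'b::real_normed_vector \<Rightarrow> 'c::banach"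
  assumes X: "subspace X" "closure X = UNIV"
    and add: "\<And>x y. x \<in> X \<Longrightarrow> y \<in> X \<Longrightarrow> f (x + y) = f x + f y"
    and scale: "\<And>r x. x \<in> X \<Longrightarrow> f (r *\<^sub>R x) = r *\<^sub>R f x"
    and bound: "\<And>x. x \<in> X \<Longrightarrow> norm (f x) \<le> B * norm x"
  shows "\<exists>T :: 'b \<Rightarrow>\<^sub>L 'c. \<forall>x\<in>X. T x = f x"
proof -
  have diff: "f (x - y) = f x - f y" if "x \<in> X" "y \<in> X" for x y
    using add[of x "(-1) *\<^sub>R y"] scale[of y "-1"] that subspace_scale[OF X(1), of y "-1"] by simp
  have "(max B 0)-lipschitz_on X f"
  proof (rule lipschitz_onI)
    fix x y assume "x \<in> X" "y \<in> X"
    then have "dist (f x) (f y) \<le> B * dist x y"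
      using bound[of "x - y"] subspace_diff[OF X(1)] by (simp add: dist_norm diff)
    also have "\<dots> \<le> max B 0 * dist x y"
      by (intro mult_right_mono) auto
    finally show "dist (f x) (f y) \<le> max B 0 * dist x y" .
  qed simp
  then have "uniformly_continuous_on X f"
    by (rule lipschitz_on_uniformly_continuous)
  then obtain g where g: "uniformly_continuous_on (closure X) g" "\<And>x. x \<in> X \<Longrightarrow> f x = g x"
    by (rule uniformly_continuous_on_extension_on_closure) blast
  have cont: "continuous_on UNIV g"
    using uniformly_continuous_imp_continuous[OF g(1)] X(2) by simp
  have seq: "\<exists>S. (\<forall>n. S n \<in> X) \<and> S \<longlonglongrightarrow> x" for x
    using X(2) closure_sequential[of x X] by auto
  have gl: "(\<lambda>n. f (S n)) \<longlonglongrightarrow> g x" if "\<And>n. S n \<in> X" "S \<longlonglongrightarrow> x" for S x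
    using continuous_on_tendsto_compose[OF cont that(2)] that(1) by (simp add: g(2))
  have "bounded_linear g"
  proof (rule bounded_linear_intro)
    fix x y
    obtain S R where S: "\<And>n. S n \<in> X" "S \<longlonglongrightarrow> x" and R: "\<And>n. R n \<in> X" "R \<longlonglongrightarrow> y"
      using seq by metis
    have "(\<lambda>n. f (S n + R n)) \<longlonglongrightarrow> g (x + y)"
      using S R by (intro gl subspace_add[OF X(1)] tendsto_add)
    moreover have "(\<lambda>n. f (S n) + f (R n)) \<longlonglongrightarrow> g x + g y"
      using S R by (intro gl tendsto_add)
    ultimately show "g (x + y) = g x + g y"
      using S(1) R(1) by (simp add: add LIMSEQ_unique)
  next
    fix r x
    obtain S where S: "\<And>n. S n \<in> X" "S \<longlonglongrightarrow> x"
      using seq by metis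
    have "(\<lambda>n. f (r *\<^sub>R S n)) \<longlonglongrightarrow> g (r *\<^sub>R x)"
      using S by (intro gl subspace_scale[OF X(1)] tendsto_scaleR tendsto_const)
    moreover have "(\<lambda>n. r *\<^sub>R f (S n)) \<longlonglongrightarrow> r *\<^sub>R g x"
      using S by (intro gl tendsto_scaleR tendsto_const)
    ultimately show "g (r *\<^sub>R x) = r *\<^sub>R g x"
      using S(1) by (simp add: scale LIMSEQ_unique)
  next
    fix x
    obtain S where S: "\<And>n. S n \<in> X" "S \<longlonglongrightarrow> x"
      using seq by metis
    have "(\<lambda>n. norm (f (S n))) \<longlonglongrightarrow> norm (g x)" "(\<lambda>n. norm (S n) * B) \<longlonglongrightarrow> norm x * B"
      using S by (intro tendsto_intros gl; simp)+
    then show "norm (g x) \<le> norm x * B"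
      by (rule LIMSEQ_le) (use bound S(1) in \<open>auto simp: mult.commute\<close>)
  qed
  then show ?thesis
    by (intro exI[of _ "Blinfun g"]) (simp add: bounded_linear_Blinfun_apply g(2))
qed

lemma subspace_wiener: "subspace (abs_L2 ` wiener :: 'a::euclidean_space L2 set)"
  unfolding subspace_def
proof (intro conjI ballI allI)
  have "(\<lambda>x::'a. 0) \<in> (wiener :: ('a \<Rightarrow> complex) set)"
    by (simp add: wiener_def ft_def[abs_def] image_constant_conv)
  then show "0 \<in> abs_L2 ` (wiener :: ('a \<Rightarrow> complex) set)"
    by (auto simp: zero_L2.abs_eq)
next
  fix x y :: "'a L2" assume "x \<in> abs_L2 ` wiener" "y \<in> abs_L2 ` wiener"
  then obtain u w where "u \<in> wiener" "w \<in> wiener" "x = abs_L2 u" "y = abs_L2 w" by auto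
  then show "x + y \<in> abs_L2 ` wiener"
    using wiener_add(1)[of u w] by (simp add: abs_L2_add wiener_square_integrable)
next
  fix r and x :: "'a L2" assume "x \<in> abs_L2 ` wiener"
  then obtain u where "u \<in> wiener" "x = abs_L2 u" by auto
  then show "r *\<^sub>R x \<in> abs_L2 ` wiener"
    using wiener_cmult(1)[of u "complex_of_real r"]
    by (simp add: abs_L2_scaleR wiener_square_integrable scaleR_conv_of_real)
qed

lemma closure_wiener: "closure (abs_L2 ` wiener) = (UNIV :: 'a::euclidean_space L2 set)"
proof -
  have "\<phi> \<in> closure (abs_L2 ` wiener)" for \<phi> :: "'a L2"
  proof (rule schwartz_dense)
    show "abs_L2 u \<in> closure (abs_L2 ` wiener)" if "u \<in> schwartz" for u :: "'a \<Rightarrow> complex"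
      using subsetD[OF closure_subset imageI[OF schwartz_wiener[OF that]]] .
  qed (auto intro!: subspace_closure subspace_wiener)
  then show ?thesis by blast
qed

lemma blinfun_eq_schwartz:
  fixes S T :: "'a::euclidean_space L2 \<Rightarrow>\<^sub>L 'a L2"
  assumes "\<And>u. u \<in> schwartz \<Longrightarrow> S (abs_L2 u) = T (abs_L2 u)"
  shows "S = T"
proof (rule blinfun_eqI)
  fix \<phi>
  have "closed {\<phi>. S \<phi> = T \<phi>}"
    by (intro closed_Collect_eq continuous_intros)
  moreover have "subspace {\<phi>. S \<phi> = T \<phi>}"
    by (auto simp: subspace_def blinfun.add_right blinfun.scaleR_right)
  ultimately have "\<phi> \<in> {\<phi>. S \<phi> = T \<phi>}"
    by (rule schwartz_dense) (use assms in auto)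
  then show "S \<phi> = T \<phi>" by simp
qed

lemma blinfun_eq_wiener:
  fixes S T :: "'a::euclidean_space L2 \<Rightarrow>\<^sub>L 'a L2"
  assumes "\<And>u. u \<in> wiener \<Longrightarrow> S (abs_L2 u) = T (abs_L2 u)"
  shows "S = T"
  using assms schwartz_wiener by (intro blinfun_eq_schwartz) auto

text \<open>The factor that makes the Fourier transform unitary; the dimension is passed through the
  \<open>itself\<close> argument.\<close>

definition fconst :: "'a::euclidean_space itself \<Rightarrow> real" where
  "fconst _ = 1 / sqrt (2 * pi) ^ DIM('a)"

lemma fconst_pos: "0 < fconst TYPE('a::euclidean_space)"
  by (simp add: fconst_def)

lemma fconst_square: "fconst TYPE('a::euclidean_space) * fconst TYPE('a) * (2 * pi) ^ DIM('a) = 1"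
proof -
  have "sqrt (2 * pi) ^ DIM('a) * sqrt (2 * pi) ^ DIM('a) = (2 * pi) ^ DIM('a)"
    by (subst power_mult_distrib[symmetric]) simp
  then show ?thesis by (simp add: fconst_def field_simps)
qed

definition nft :: "real \<Rightarrow> ('a::euclidean_space \<Rightarrow> complex) \<Rightarrow> 'a \<Rightarrow> complex" where
  "nft s u \<xi> = complex_of_real (fconst TYPE('a)) * ft s u \<xi>"

lemma nft_wiener:
  fixes u :: "'a::euclidean_space \<Rightarrow> complex"
  assumes "u \<in> wiener" "s = 1 \<or> s = - 1"
  shows "nft s u \<in> wiener" "nft (- s) (nft s u) = u"
proof -
  show "nft s u \<in> wiener"
    using wiener_cmult(1)[OF wiener_ft(2)[OF assms]] by (simp add: nft_def[abs_def])
  show "nft (- s) (nft s u) = u"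
    unfolding nft_def[abs_def] wiener_cmult(2)[OF wiener_ft(2)[OF assms]] wiener_ft(1)[OF assms]
    by (simp only: mult.assoc[symmetric] of_real_mult[symmetric] fconst_square of_real_1 mult_1)
qed

lemma nft_cong_AE: "AE x in lborel. u x = w x \<Longrightarrow> u \<in> borel_measurable borel \<Longrightarrow> w \<in> borel_measurable borel \<Longrightarrow> nft s u = nft s w"
  unfolding nft_def ft_def by (auto simp: fun_eq_iff intro!: integral_cong_AE)

lemma inner_nft:
  fixes u w :: "'a::euclidean_space \<Rightarrow> complex"
  assumes "u \<in> wiener" "w \<in> wiener" "s = 1 \<or> s = - 1"
  shows "abs_L2 (nft s u) \<bullet> abs_L2 (nft s w) = abs_L2 u \<bullet> abs_L2 w"
proof -
  have "abs_L2 (nft s u) \<bullet> abs_L2 (nft s w) = (LINT x|lborel. nft s u x \<bullet> nft s w x)"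
    using assms by (intro inner_abs_L2 wiener_square_integrable nft_wiener)
  also have "\<dots> = (LINT x|lborel. (fconst TYPE('a) * fconst TYPE('a)) * (ft s u x \<bullet> ft s w x))"
    by (simp add: nft_def scaleR_conv_of_real[symmetric] mult.assoc)
  also have "\<dots> = (fconst TYPE('a) * fconst TYPE('a) * (2 * pi) ^ DIM('a)) * (LINT x|lborel. u x \<bullet> w x)"
    by (simp only: integral_mult_right_zero plancherel[OF assms] mult.assoc)
  also have "\<dots> = (LINT x|lborel. u x \<bullet> w x)"
    by (simp only: fconst_square mult_1)
  finally show ?thesis
    using assms by (simp add: inner_abs_L2 wiener_square_integrable)
qed

definition fourier :: "real \<Rightarrow> ('a::euclidean_space L2 \<Rightarrow>\<^sub>L 'a L2)" where
  "fourier s = (SOME T. \<forall>u\<in>wiener. blinfun_apply T (abs_L2 u) = abs_L2 (nft s u))"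

context
  fixes s :: real
  assumes s: "s = 1 \<or> s = - 1"
begin

text \<open>The operator is prescribed on the dense subspace of classes of \<open>wiener\<close>
  functions. Functions equal almost everywhere have the same transform, so the choice of a
  representative is harmless, and Plancherel's identity provides the bound 1 for the
  extension.\<close>

lemma fourier_abs:
  fixes u :: "'a::euclidean_space \<Rightarrow> complex"
  assumes "u \<in> wiener"
  shows "fourier s (abs_L2 u) = abs_L2 (nft s u)"
proof -
  let ?f = "\<lambda>\<phi>::'a L2. abs_L2 (nft s (SOME u. u \<in> wiener \<and> \<phi> = abs_L2 u))"
  have f: "?f (abs_L2 u) = abs_L2 (nft s u)" if u: "u \<in> wiener" for u
  proof -
    let ?w = "SOME w. w \<in> wiener \<and> abs_L2 u = abs_L2 w"
    have w: "?w \<in> wiener" "abs_L2 u = abs_L2 ?w"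
      using someI[of "\<lambda>w. w \<in> wiener \<and> abs_L2 u = abs_L2 w" u] u by auto
    have sq: "square_integrable u" "square_integrable ?w"
      using u w(1) wiener_square_integrable by blast+
    have "AE x in lborel. u x = ?w x"
      using w(2) abs_L2_eq_iff[OF sq] by blast
    then have "nft s u = nft s ?w"
      using sq by (intro nft_cong_AE) (auto simp: square_integrable_def)
    then show ?thesis by simp
  qed
  have "\<exists>T :: 'a L2 \<Rightarrow>\<^sub>L 'a L2. \<forall>\<phi>\<in>abs_L2 ` wiener. T \<phi> = ?f \<phi>"
  proof (rule blinfun_extension[OF subspace_wiener closure_wiener])
    fix x y :: "'a L2" assume "x \<in> abs_L2 ` wiener" "y \<in> abs_L2 ` wiener"
    then obtain u w where uw: "u \<in> wiener" "w \<in> wiener" "x = abs_L2 u" "y = abs_L2 w" by auto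
    have "x + y = abs_L2 (\<lambda>x. u x + w x)"
      using uw by (simp add: abs_L2_add wiener_square_integrable)
    moreover have "nft s (\<lambda>x. u x + w x) = (\<lambda>\<xi>. nft s u \<xi> + nft s w \<xi>)"
      using uw by (simp add: nft_def[abs_def] wiener_add(2) distrib_left)
    ultimately show "?f (x + y) = ?f x + ?f y"
      using uw f wiener_add(1)[OF uw(1,2)]
      by (simp add: abs_L2_add wiener_square_integrable nft_wiener s)
  next
    fix r and x :: "'a L2" assume "x \<in> abs_L2 ` wiener"
    then obtain u where u: "u \<in> wiener" "x = abs_L2 u" by auto
    have "r *\<^sub>R x = abs_L2 (\<lambda>x. complex_of_real r * u x)"
      using u by (simp add: abs_L2_scaleR wiener_square_integrable scaleR_conv_of_real)
    moreover have "nft s (\<lambda>x. complex_of_real r * u x) = (\<lambda>\<xi>. r *\<^sub>R nft s u \<xi>)"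
      using u by (simp add: nft_def[abs_def] wiener_cmult(2) scaleR_conv_of_real mult.left_commute)
    ultimately show "?f (r *\<^sub>R x) = r *\<^sub>R ?f x"
      using u f wiener_cmult(1)[OF u(1), of r]
      by (simp add: abs_L2_scaleR wiener_square_integrable nft_wiener s)
  next
    fix x :: "'a L2" assume "x \<in> abs_L2 ` wiener"
    then obtain u where u: "u \<in> wiener" "x = abs_L2 u" by auto
    show "norm (?f x) \<le> 1 * norm x"
      using inner_nft[OF u(1) u(1) s] f[OF u(1)] by (simp add: u(2) norm_eq_sqrt_inner)
  qed
  then have "\<exists>T :: 'a L2 \<Rightarrow>\<^sub>L 'a L2. \<forall>u\<in>wiener. T (abs_L2 u) = abs_L2 (nft s u)"
    using f by auto
  from someI_ex[OF this] show ?thesis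
    using assms by (simp add: fourier_def)
qed

lemma norm_fourier_le: "norm (fourier s \<phi>) \<le> norm (\<phi> :: 'a::euclidean_space L2)"
proof -
  have "closed {\<phi> :: 'a L2. norm (fourier s \<phi>) \<le> norm \<phi>}"
    by (intro closed_Collect_le continuous_intros)
  moreover have "abs_L2 ` wiener \<subseteq> {\<phi> :: 'a L2. norm (fourier s \<phi>) \<le> norm \<phi>}"
    by (auto simp: fourier_abs norm_eq_sqrt_inner inner_nft[OF _ _ s])
  ultimately have "closure (abs_L2 ` wiener) \<subseteq> {\<phi> :: 'a L2. norm (fourier s \<phi>) \<le> norm \<phi>}"
    by (intro closure_minimal)
  then show ?thesis
    unfolding closure_wiener by blast
qed

lemma fourier_complex_linear:
  "fourier s o\<^sub>L mult_op (\<lambda>_. z) = mult_op (\<lambda>_. z) o\<^sub>L (fourier s :: 'a::euclidean_space L2 \<Rightarrow>\<^sub>L 'a L2)"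
proof (rule blinfun_eq_wiener)
  fix u :: "'a \<Rightarrow> complex" assume u: "u \<in> wiener"
  have "nft s (\<lambda>x. z * u x) = (\<lambda>\<xi>. z * nft s u \<xi>)"
    using u by (simp add: nft_def[abs_def] wiener_cmult(2) mult.left_commute)
  then show "(fourier s o\<^sub>L mult_op (\<lambda>_. z)) (abs_L2 u) = (mult_op (\<lambda>_. z) o\<^sub>L fourier s) (abs_L2 u)"
    using u by (simp add: mult_op_abs wiener_square_integrable fourier_abs wiener_cmult(1) nft_wiener s)
qed

end

lemma fourier_inverse:
  assumes s: "s = 1 \<or> s = - 1"
  shows "fourier (- s) o\<^sub>L fourier s = (id_blinfun :: 'a::euclidean_space L2 \<Rightarrow>\<^sub>L 'a L2)"
proof (rule blinfun_eq_wiener)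
  fix u :: "'a \<Rightarrow> complex" assume u: "u \<in> wiener"
  have s': "- s = 1 \<or> - s = - 1" using s by auto
  show "(fourier (- s) o\<^sub>L fourier s) (abs_L2 u) = id_blinfun (abs_L2 u)"
    using u by (simp add: fourier_abs[OF s] fourier_abs[OF s'] nft_wiener[OF _ s])
qed

lemma fourier_inverse_apply: "s = 1 \<or> s = - 1 \<Longrightarrow> fourier (- s) (fourier s \<phi>) = \<phi>"
  using fourier_inverse[of s] by (metis blinfun_apply_blinfun_compose blinfun_apply_id_blinfun)

lemma norm_fourier:
  assumes s: "s = 1 \<or> s = - 1"
  shows "norm (fourier s \<phi>) = norm \<phi>"
proof -
  have s': "- s = 1 \<or> - s = - 1" using s by auto
  show ?thesis
    using norm_fourier_le[OF s, of \<phi>] norm_fourier_le[OF s', of "fourier s \<phi>"]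
    by (simp add: fourier_inverse_apply[OF s])
qed

text \<open>An isometry preserves inner products by polarization, and \<open>fourier (- s)\<close>
  inverts \<open>fourier s\<close>.\<close>

lemma fourier_adjoint:
  assumes s: "s = 1 \<or> s = - 1"
  shows "fourier s \<phi> \<bullet> \<psi> = \<phi> \<bullet> fourier (- s) \<psi>"
proof -
  have s': "- s = 1 \<or> - s = - 1" using s by auto
  have "fourier s \<phi> \<bullet> fourier s \<psi>' = \<phi> \<bullet> \<psi>'" for \<psi>'
    unfolding dot_norm by (simp add: norm_fourier[OF s] flip: blinfun.add_right)
  from this[of "fourier (- s) \<psi>"] show ?thesis
    using fourier_inverse_apply[OF s', of \<psi>] by simp
qed

section \<open>The integral formula beyond \<open>wiener\<close>\<close>

lemma gauss_schwartz: "(\<lambda>x::'a::euclidean_space. complex_of_real (gauss x)) \<in> schwartz"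
proof -
  let ?P = "\<lambda>x::'a. (1/2) * (\<Sum>b\<in>Basis. (x \<bullet> b) * (x \<bullet> b))"
  have P: "real_polynomial_function ?P"
    by (intro real_polynomial_function.intros real_polynomial_function_sum) (auto intro: bounded_linear_inner_left)
  have eq: "?P x = (norm x)\<^sup>2 / 2" for x
    using euclidean_inner[of x x] by (simp add: power2_norm_eq_inner)
  have "1 * norm x - 1/2 \<le> ?P x" for x
    unfolding eq using zero_le_power2[of "norm x - 1"] by (simp add: power2_diff)
  from schwartz_poly_exp[OF P real_polynomial_function.intros(2)[of 1] _ this]
  have "(\<lambda>x::'a. complex_of_real (1 * exp (- ((norm x)\<^sup>2 / 2)))) \<in> schwartz"
    unfolding eq by simp
  then show ?thesis
    by (simp add: gauss_def[abs_def])
qed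

lemma wiener_gauss_mult:
  fixes w :: "'a::euclidean_space \<Rightarrow> complex"
  assumes "w \<in> schwartz"
  shows "(\<lambda>x. complex_of_real (gauss x) * w x) \<in> wiener"
proof -
  obtain C where C: "bd (2 * DIM('a)) (\<lambda>x. C / (1 + norm x) ^ 0) (\<lambda>x::'a. complex_of_real (gauss x))"
    using schwartz_bd[OF gauss_schwartz, of "2 * DIM('a)" 0] by blast
  obtain K where K: "bd (2 * DIM('a)) (\<lambda>x. K / (1 + norm x) ^ (2 * DIM('a))) w"
    using schwartz_bd[OF assms, of "2 * DIM('a)" "2 * DIM('a)"] by blast
  have "bd (2 * DIM('a)) (\<lambda>x. (2 ^ (2 * DIM('a)) * C * K) * decay (x - 0)) (\<lambda>x. complex_of_real (gauss x) * w x)"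
    by (rule bd_mono[OF bd_mult[OF C K]]) (simp add: decay_def)
  then show ?thesis by (rule bd_decay_wiener)
qed

text \<open>A bounded multiplier may lead out of \<open>wiener\<close>, but the product stays
  integrable and square integrable, so the integral formula is wanted for such functions. Square
  integrability of \<open>nft s p\<close> is not known beforehand; therefore its difference
  \<open>r\<close> from the abstract transform carries a Gaussian weight. Duality shows that
  \<open>r\<close> is orthogonal to all Schwartz functions, and the weight has no zeros.\<close>

lemma fourier_integrable:
  fixes p :: "'a::euclidean_space \<Rightarrow> complex"
  assumes s: "s = 1 \<or> s = - 1" and sq: "square_integrable p" and int: "integrable lborel p"
  shows "square_integrable (nft s p)" "fourier s (abs_L2 p) = abs_L2 (nft s p)"
proof -
  have s': "- s = 1 \<or> - s = - 1" using s by auto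
  obtain f where f: "square_integrable f" "fourier s (abs_L2 p) = abs_L2 f"
    by (rule L2_cases)
  have cont: "continuous_on UNIV (nft s p)"
    unfolding nft_def[abs_def] by (intro continuous_intros continuous_ft int)
  have [measurable]: "f \<in> borel_measurable borel" "nft s p \<in> borel_measurable borel" "p \<in> borel_measurable borel"
    using f(1) sq cont by (auto simp: square_integrable_def borel_measurable_continuous_onI)
  define r where "r x = complex_of_real (gauss x) * (f x - nft s p x)" for x
  have bm: "bmeas (\<lambda>x::'a. complex_of_real (gauss x))"
    by (rule bmeas_bound[of _ 1]) (auto simp: gauss_le_1)
  have bn: "bmeas (nft s p)"
    by (rule bmeas_bound[of _ "fconst TYPE('a) * (LINT y|lborel. norm (p y))"])
      (auto simp: nft_def norm_mult abs_of_pos[OF fconst_pos] fconst_pos[THEN less_imp_le] intro!: mult_left_mono norm_ft_le)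
  have "square_integrable (\<lambda>x. nft s p x * complex_of_real (gauss x))"
    by (rule square_integrable_bmeas[OF bn gauss_square_integrable])
  then have rs: "square_integrable r"
    using square_integrable_diff[OF square_integrable_bmeas[OF bm f(1)]]
    by (simp add: r_def[abs_def] right_diff_distrib mult.commute)
  have orth: "abs_L2 r \<bullet> abs_L2 w = 0" if w: "w \<in> schwartz" for w
  proof -
    let ?w = "\<lambda>x. complex_of_real (gauss x) * w x"
    have w': "?w \<in> wiener" by (rule wiener_gauss_mult[OF w])
    have wi: "integrable lborel ?w" using w' by (simp add: wiener_def)
    have i1: "integrable lborel (\<lambda>x. f x \<bullet> ?w x)"
      by (intro integrable_inner_square_integrable f wiener_square_integrable w')
    have i2: "integrable lborel (\<lambda>x. nft s p x \<bullet> ?w x)"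
    proof -
      obtain B where "0 \<le> B" and B: "\<And>x. norm (nft s p x) \<le> B" using bmeasE[OF bn] by blast
      show ?thesis
      proof (rule Bochner_Integration.integrable_bound)
        show "integrable lborel (\<lambda>x. B * norm (?w x))"
          by (intro integrable_mult_right integrable_norm wi)
        have [measurable]: "?w \<in> borel_measurable borel"
          using borel_measurable_integrable[OF wi] by simp
        show "(\<lambda>x. nft s p x \<bullet> ?w x) \<in> borel_measurable lborel" by measurable
        show "AE x in lborel. norm (nft s p x \<bullet> ?w x) \<le> norm (B * norm (?w x))"
        proof (rule AE_I2)
          fix x
          have "norm (nft s p x \<bullet> ?w x) \<le> norm (nft s p x) * norm (?w x)"
            using Cauchy_Schwarz_ineq2 by simp
          also have "\<dots> \<le> B * norm (?w x)"
            by (intro mult_right_mono B) auto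
          finally show "norm (nft s p x \<bullet> ?w x) \<le> norm (B * norm (?w x))"
            using \<open>0 \<le> B\<close> by simp
        qed
      qed
    qed
    have "(LINT x|lborel. f x \<bullet> ?w x) = abs_L2 f \<bullet> abs_L2 ?w"
      by (intro inner_abs_L2[symmetric] f wiener_square_integrable w')
    also have "\<dots> = abs_L2 p \<bullet> abs_L2 (nft (- s) ?w)"
      by (simp add: f(2)[symmetric] fourier_adjoint[OF s] fourier_abs[OF s' w'])
    also have "\<dots> = (LINT x|lborel. p x \<bullet> nft (- s) ?w x)"
      by (intro inner_abs_L2 sq wiener_square_integrable nft_wiener w' s')
    also have "\<dots> = fconst TYPE('a) * (LINT x|lborel. p x \<bullet> ft (- s) ?w x)"
      by (simp add: nft_def scaleR_conv_of_real[symmetric])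
    also have "(LINT x|lborel. p x \<bullet> ft (- s) ?w x) = (LINT x|lborel. ft s p x \<bullet> ?w x)"
      by (rule ft_duality[OF int wi, symmetric])
    also have "fconst TYPE('a) * \<dots> = (LINT x|lborel. nft s p x \<bullet> ?w x)"
      by (subst integral_mult_right_zero[symmetric], intro Bochner_Integration.integral_cong refl)
        (simp add: nft_def scaleR_conv_of_real[symmetric])
    finally have "(LINT x|lborel. f x \<bullet> ?w x - nft s p x \<bullet> ?w x) = 0"
      using i1 i2 by simp
    also have "(\<lambda>x. f x \<bullet> ?w x - nft s p x \<bullet> ?w x) = (\<lambda>x. r x \<bullet> w x)"
      by (auto simp: r_def inner_complex_def algebra_simps)
    finally show ?thesis
      using inner_abs_L2[OF rs wiener_square_integrable[OF schwartz_wiener[OF w]]] by simp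
  qed
  have "abs_L2 r \<in> {\<phi>. abs_L2 r \<bullet> \<phi> = 0}"
  proof (rule schwartz_dense)
    show "closed {\<phi>. abs_L2 r \<bullet> \<phi> = 0}"
      by (intro closed_Collect_eq continuous_intros)
    show "subspace {\<phi>. abs_L2 r \<bullet> \<phi> = 0}"
      by (auto simp: subspace_def inner_add_right)
  qed (use orth in auto)
  then have "abs_L2 r = abs_L2 (\<lambda>x. 0)"
    by (simp add: zero_L2.abs_eq)
  then have "AE x in lborel. r x = 0"
    using abs_L2_eq_iff[OF rs square_integrable_zero] by simp
  then have AE: "AE x in lborel. nft s p x = f x"
    by eventually_elim (simp add: r_def less_imp_neq[OF gauss_pos, THEN not_sym])
  have "integrable lborel (\<lambda>x. (norm (nft s p x))\<^sup>2) = integrable lborel (\<lambda>x. (norm (f x))\<^sup>2)"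
    by (rule integrable_cong_AE) (use AE in auto)
  then show sq': "square_integrable (nft s p)"
    using f(1) by (simp add: square_integrable_def)
  show "fourier s (abs_L2 p) = abs_L2 (nft s p)"
    unfolding f(2) using abs_L2_eq_iff[OF sq' f(1)] AE by simp
qed

section \<open>Fourier multipliers\<close>

text \<open>The Fourier multipliers are \<open>fmult 1\<close>; the sign \<open>- 1\<close> serves for the picture in which position
  and frequency are exchanged.\<close>

definition fmult :: "real \<Rightarrow> ('a::euclidean_space \<Rightarrow> complex) \<Rightarrow> ('a L2 \<Rightarrow>\<^sub>L 'a L2)" where
  "fmult s f = fourier s o\<^sub>L mult_op f o\<^sub>L fourier (- s)"

lemma blinfun_compose_simps:
  "(A + B) o\<^sub>L C = (A o\<^sub>L C) + (B o\<^sub>L C)" "A o\<^sub>L (B + C) = (A o\<^sub>L B) + (A o\<^sub>L C)"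
  "(A - B) o\<^sub>L C = (A o\<^sub>L C) - (B o\<^sub>L C)" "A o\<^sub>L (B - C) = (A o\<^sub>L B) - (A o\<^sub>L C)"
  "(r *\<^sub>R A) o\<^sub>L C = r *\<^sub>R (A o\<^sub>L C)" "A o\<^sub>L (r *\<^sub>R C) = r *\<^sub>R (A o\<^sub>L C)"
  "0 o\<^sub>L C = 0" "A o\<^sub>L 0 = 0" "(- A) o\<^sub>L C = - (A o\<^sub>L C)" "A o\<^sub>L (- C) = - (A o\<^sub>L C)"
  by (rule blinfun_eqI; simp add: blinfun.bilinear_simps)+

lemma blinfun_compose_assoc: "(A o\<^sub>L B) o\<^sub>L C = A o\<^sub>L (B o\<^sub>L C)"
  by (rule blinfun_eqI) simp

lemma ft_cmult: "ft s (\<lambda>\<xi>. c * g \<xi>) x = c * ft s g x"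
  unfolding ft_def by (subst mult.left_commute) simp

lemma blinfun_compose_id [simp]: "id_blinfun o\<^sub>L A = A" "A o\<^sub>L id_blinfun = A"
  by (rule blinfun_eqI; simp)+

lemma fmult_add: "bmeas f \<Longrightarrow> bmeas g \<Longrightarrow> fmult s f + fmult s g = fmult s (\<lambda>x. f x + g x)"
  by (simp add: fmult_def blinfun_compose_simps flip: mult_op_add)

lemma fmult_diff: "bmeas f \<Longrightarrow> bmeas g \<Longrightarrow> fmult s f - fmult s g = fmult s (\<lambda>x. f x - g x)"
  by (simp add: fmult_def blinfun_compose_simps flip: mult_op_diff)

lemma fmult_scaleR: "bmeas f \<Longrightarrow> r *\<^sub>R fmult s f = fmult s (\<lambda>x. r *\<^sub>R f x)"
  by (simp add: fmult_def blinfun_compose_simps flip: mult_op_scaleR)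

lemma norm_compose_le: "norm A \<le> a \<Longrightarrow> norm B \<le> b \<Longrightarrow> norm (A o\<^sub>L B) \<le> a * b"
  by (rule order_trans[OF norm_blinfun_compose]) (intro mult_mono, auto intro: order_trans[OF norm_ge_zero])

context
  fixes s :: real
  assumes s: "s = 1 \<or> s = - 1"
begin

lemma sign_minus: "- s = 1 \<or> - s = - 1"
  using s by auto

lemma fourier_inverse': "fourier s o\<^sub>L fourier (- s) = (id_blinfun :: 'a::euclidean_space L2 \<Rightarrow>\<^sub>L 'a L2)"
  using fourier_inverse[OF sign_minus] by simp

lemma norm_fourier_le_1: "norm (fourier s :: 'a::euclidean_space L2 \<Rightarrow>\<^sub>L 'a L2) \<le> 1" "norm (fourier (- s) :: 'a L2 \<Rightarrow>\<^sub>L 'a L2) \<le> 1"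
  using norm_fourier_le[OF s] norm_fourier_le[OF sign_minus] by (auto intro!: norm_blinfun_bound)

lemma fmult_compose: "bmeas f \<Longrightarrow> bmeas g \<Longrightarrow> fmult s f o\<^sub>L fmult s g = fmult s (\<lambda>x. f x * g x)"
proof -
  assume fg: "bmeas f" "bmeas g"
  have "fmult s f o\<^sub>L fmult s g = fourier s o\<^sub>L mult_op f o\<^sub>L (fourier (- s) o\<^sub>L fourier s) o\<^sub>L mult_op g o\<^sub>L fourier (- s)"
    by (simp add: fmult_def blinfun_compose_assoc)
  also have "\<dots> = fmult s (\<lambda>x. f x * g x)"
    by (simp add: fmult_def fourier_inverse[OF s] blinfun_compose_assoc flip: mult_op_compose[OF fg])
  finally show ?thesis .
qed

lemma fmult_1: "fmult s (\<lambda>x. 1) = id_blinfun"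
  by (simp add: fmult_def mult_op_1 fourier_inverse')

lemma norm_fmult_le:
  assumes "\<And>x. norm (f x) \<le> B"
  shows "norm (fmult s f) \<le> B"
proof -
  have "norm (fmult s f) \<le> (1 * B) * 1"
    unfolding fmult_def by (intro norm_compose_le norm_fourier_le_1 norm_mult_op_le assms)
  then show ?thesis by simp
qed

lemma fmult_complex_linear:
  "mult_op (\<lambda>_. z) o\<^sub>L fmult s f = fmult s f o\<^sub>L (mult_op (\<lambda>_. z) :: 'a::euclidean_space L2 \<Rightarrow>\<^sub>L 'a L2)" (is ?A)
  "bmeas f \<Longrightarrow> mult_op (\<lambda>_. z) o\<^sub>L fmult s f = fmult s (\<lambda>x. z * f x :: complex)" (is "_ \<Longrightarrow> ?B")
proof -
  let ?z = "mult_op (\<lambda>_. z) :: 'a L2 \<Rightarrow>\<^sub>L 'a L2"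
  have f: "?z o\<^sub>L mult_op f = mult_op f o\<^sub>L ?z"
  proof (cases "bmeas f")
    case True
    then show ?thesis by (simp add: mult_op_compose mult.commute)
  next
    case False
    then have "bdd_mult f = (\<lambda>_. 0)"
      by (auto simp: bdd_mult_def bmeas_def)
    then have "mult_op f (abs_L2 g) = 0" if "square_integrable g" for g
      using that by (simp add: mult_op.rep_eq mult_L2.abs_eq L2_rel_def zero_L2.abs_eq)
    then have "mult_op f = 0"
      by (intro blinfun_L2_eqI) simp
    then show ?thesis by (simp add: blinfun_compose_simps)
  qed
  have "?z o\<^sub>L fmult s f = (?z o\<^sub>L fourier s) o\<^sub>L mult_op f o\<^sub>L fourier (- s)"
    by (simp add: fmult_def blinfun_compose_assoc)
  also have 1: "\<dots> = fourier s o\<^sub>L (?z o\<^sub>L mult_op f) o\<^sub>L fourier (- s)"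
    by (simp add: blinfun_compose_assoc flip: fourier_complex_linear[OF s])
  also have "\<dots> = fourier s o\<^sub>L mult_op f o\<^sub>L (?z o\<^sub>L fourier (- s))"
    unfolding f by (simp add: blinfun_compose_assoc)
  also have "\<dots> = fmult s f o\<^sub>L ?z"
    by (simp add: fmult_def blinfun_compose_assoc flip: fourier_complex_linear[OF sign_minus])
  finally show ?A .
  assume bf: "bmeas f"
  have "?z o\<^sub>L fmult s f = (?z o\<^sub>L fourier s) o\<^sub>L mult_op f o\<^sub>L fourier (- s)"
    by (simp add: fmult_def blinfun_compose_assoc)
  then show ?B
    unfolding 1 by (simp add: fmult_def mult_op_compose bf)
qed

lemma fmult_adjoint: "bmeas f \<Longrightarrow> fmult s f \<phi> \<bullet> \<psi> = \<phi> \<bullet> fmult s (\<lambda>x. cnj (f x)) \<psi>"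
  by (simp add: fmult_def mult_op_adjoint fourier_adjoint[OF s] fourier_adjoint[OF sign_minus])

lemma fmult_abs:
  assumes "bmeas f" "u \<in> wiener"
  shows "square_integrable (nft s (\<lambda>\<xi>. f \<xi> * nft (- s) u \<xi>))"
    and "fmult s f (abs_L2 u) = abs_L2 (nft s (\<lambda>\<xi>. f \<xi> * nft (- s) u \<xi>))"
proof -
  have w: "nft (- s) u \<in> wiener"
    by (rule nft_wiener(1)[OF assms(2) sign_minus])
  have sq: "square_integrable (\<lambda>\<xi>. f \<xi> * nft (- s) u \<xi>)"
    by (intro square_integrable_bmeas assms wiener_square_integrable w)
  obtain B where B: "0 \<le> B" "\<And>x. norm (f x) \<le> B"
    using bmeasE[OF assms(1)] by blast
  have int: "integrable lborel (\<lambda>\<xi>. f \<xi> * nft (- s) u \<xi>)"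
  proof (rule Bochner_Integration.integrable_bound)
    show "integrable lborel (\<lambda>\<xi>. B * norm (nft (- s) u \<xi>))"
      using w by (auto simp: wiener_def)
    show "(\<lambda>\<xi>. f \<xi> * nft (- s) u \<xi>) \<in> borel_measurable lborel"
      using sq by (simp add: square_integrable_def)
    show "AE x in lborel. norm (f x * nft (- s) u x) \<le> norm (B * norm (nft (- s) u x))"
      using B by (intro AE_I2) (auto simp: norm_mult intro!: mult_right_mono)
  qed
  show "square_integrable (nft s (\<lambda>\<xi>. f \<xi> * nft (- s) u \<xi>))"
    by (rule fourier_integrable[OF s sq int])
  show "fmult s f (abs_L2 u) = abs_L2 (nft s (\<lambda>\<xi>. f \<xi> * nft (- s) u \<xi>))"
    using assms fourier_integrable(2)[OF s sq int]
    by (simp add: fmult_def fourier_abs[OF sign_minus] mult_op_abs wiener_square_integrable w)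
qed

text \<open>The partial sums of the series are multipliers by the partial sums of
  \<open>exp (f x)\<close>. The norm of a multiplier is at most the supremum of its symbol, so a
  bound \<open>B\<close> of \<open>f\<close> reduces the tail to that of
  \<open>exp B\<close>.\<close>

lemma exp_op_fmult:
  fixes f :: "'a::euclidean_space \<Rightarrow> complex"
  assumes f: "bmeas f"
  shows "exp_op (fmult s f) = fmult s (\<lambda>x. exp (f x))"
proof -
  have pow: "((\<lambda>S. fmult s f o\<^sub>L S) ^^ n) id_blinfun = fmult s (\<lambda>x. f x ^ n)" for n
    by (induction n) (simp_all add: fmult_1 fmult_compose f)
  have trm: "(1 / fact n) *\<^sub>R ((\<lambda>S. fmult s f o\<^sub>L S) ^^ n) id_blinfun = fmult s (\<lambda>x. (1 / fact n) *\<^sub>R f x ^ n)" for n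
    by (simp add: pow fmult_scaleR f)
  have part: "(\<Sum>n<N. (1 / fact n) *\<^sub>R ((\<lambda>S. fmult s f o\<^sub>L S) ^^ n) id_blinfun)
      = fmult s (\<lambda>x. \<Sum>n<N. (1 / fact n) *\<^sub>R f x ^ n)" "bmeas (\<lambda>x. \<Sum>n<N. (1 / fact n) *\<^sub>R f x ^ n)" for N
  proof (induction N)
    case 0
    show "(\<Sum>n<0. (1 / fact n) *\<^sub>R ((\<lambda>S. fmult s f o\<^sub>L S) ^^ n) id_blinfun)
      = fmult s (\<lambda>x. \<Sum>n<0. (1 / fact n) *\<^sub>R f x ^ n)"
      \<comment> \<open>The zero operator is obtained as a difference of two multipliers by
        1.\<close>
      using fmult_diff[of "\<lambda>x. 1" "\<lambda>x. 1" s] by simp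
    show "bmeas (\<lambda>x. \<Sum>n<0. (1 / fact n) *\<^sub>R f x ^ n)" by simp
  next
    case (Suc N)
    show "(\<Sum>n<Suc N. (1 / fact n) *\<^sub>R ((\<lambda>S. fmult s f o\<^sub>L S) ^^ n) id_blinfun)
      = fmult s (\<lambda>x. \<Sum>n<Suc N. (1 / fact n) *\<^sub>R f x ^ n)"
      unfolding sum.lessThan_Suc by (subst Suc(1), subst trm, rule fmult_add) (use Suc(2) f in auto)
    show "bmeas (\<lambda>x. \<Sum>n<Suc N. (1 / fact n) *\<^sub>R f x ^ n)"
      unfolding sum.lessThan_Suc using Suc(2) f by (intro bmeas_add) auto
  qed
  obtain B where B: "0 \<le> B" "\<And>x. norm (f x) \<le> B"
    using bmeasE[OF f] by blast
  have bexp: "bmeas (\<lambda>x. exp (f x))"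
  proof (rule bmeas_bound)
    show "(\<lambda>x. exp (f x)) \<in> borel_measurable borel"
      by (rule measurable_compose[OF bmeas_measurable[OF f] borel_measurable_continuous_onI])
        (intro continuous_intros)
    show "norm (exp (f x)) \<le> exp B" for x
      by (rule order_trans[OF norm_exp]) (simp add: B(2))
  qed
  have sums: "(\<lambda>n. (1 / fact n) *\<^sub>R z ^ n) sums exp z" for z :: complex
    using exp_converges[of z] by (simp add: divide_inverse_commute)
  have "(\<lambda>n. (1 / fact n) *\<^sub>R ((\<lambda>S. fmult s f o\<^sub>L S) ^^ n) id_blinfun) sums fmult s (\<lambda>x. exp (f x))"
    unfolding sums_def part(1)
  proof (rule LIMSEQ_I)
    fix r :: real assume "r > 0"
    have "(\<lambda>n. (1 / fact n) * B ^ n) sums exp B"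
      using exp_converges[of B] by (simp add: divide_inverse_commute)
    then have limB: "(\<lambda>N. \<Sum>n<N. (1 / fact n) * B ^ n) \<longlonglongrightarrow> exp B" and summ: "summable (\<lambda>n. (1 / fact n) * B ^ n)"
      by (rule sums_def[THEN iffD1], rule sums_summable)
    obtain N where N: "\<And>n. n \<ge> N \<Longrightarrow> norm ((\<Sum>n<n. (1 / fact n) * B ^ n) - exp B) < r"
      using LIMSEQ_D[OF limB \<open>r > 0\<close>] by blast
    have "norm (fmult s (\<lambda>x. \<Sum>n<n. (1 / fact n) *\<^sub>R f x ^ n) - fmult s (\<lambda>x. exp (f x))) < r" if "n \<ge> N" for n
    proof -
      let ?d = "exp B - (\<Sum>n<n. (1 / fact n) * B ^ n)"
      have "norm ((\<Sum>n<n. (1 / fact n) *\<^sub>R f x ^ n) - exp (f x)) \<le> ?d" for x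
      proof -
        let ?t = "\<lambda>k. (1 / fact (k + n)) *\<^sub>R f x ^ (k + n)"
        have le: "norm (?t k) \<le> (1 / fact (k + n)) * B ^ (k + n)" for k
        proof -
          have "norm (?t k) = (1 / fact (k + n)) * norm (f x) ^ (k + n)"
            by (simp only: norm_scaleR norm_power abs_of_nonneg divide_nonneg_nonneg zero_le_one fact_ge_zero)
          also have "\<dots> \<le> (1 / fact (k + n)) * B ^ (k + n)"
            by (intro mult_left_mono power_mono B) auto
          finally show ?thesis .
        qed
        have s2: "summable (\<lambda>k. (1 / fact (k + n)) * B ^ (k + n))"
          using summ by (rule summable_ignore_initial_segment)
        have "exp (f x) - (\<Sum>n<n. (1 / fact n) *\<^sub>R f x ^ n) = (\<Sum>k. ?t k)"
          using sums_unique[OF sums[of "f x"]] suminf_minus_initial_segment[OF sums_summable[OF sums[of "f x"]], of n] by simp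
        then have "norm ((\<Sum>n<n. (1 / fact n) *\<^sub>R f x ^ n) - exp (f x)) = norm (\<Sum>k. ?t k)"
          by (metis norm_minus_commute)
        also have "\<dots> \<le> (\<Sum>k. (1 / fact (k + n)) * B ^ (k + n))"
          by (rule norm_suminf_le[OF le s2])
        also have "\<dots> = ?d"
          using suminf_minus_initial_segment[OF summ, of n] sums_unique[OF \<open>(\<lambda>n. (1 / fact n) * B ^ n) sums exp B\<close>] by simp
        finally show ?thesis .
      qed
      then have "norm (fmult s (\<lambda>x. \<Sum>n<n. (1 / fact n) *\<^sub>R f x ^ n) - fmult s (\<lambda>x. exp (f x))) \<le> ?d"
        unfolding fmult_diff[OF part(2) bexp] by (rule norm_fmult_le)
      also have "\<dots> < r"
        using N[OF that] by (simp add: norm_minus_commute[of _ "exp B"])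
      finally show ?thesis .
    qed
    then show "\<exists>N. \<forall>n\<ge>N. norm (fmult s (\<lambda>x. \<Sum>n<n. (1 / fact n) *\<^sub>R f x ^ n) - fmult s (\<lambda>x. exp (f x))) < r"
      by blast
  qed
  then show ?thesis
    unfolding exp_op_def by (rule sums_unique[symmetric])
qed

end

section \<open>Weyl quantization of symbols depending on the frequency alone\<close>

lemma weyl_multiplier:
  fixes a u :: "'a::euclidean_space \<Rightarrow> complex"
  assumes a: "bmeas a" and u: "u \<in> wiener" and h: "0 < h"
  shows "weyl h (\<lambda>(x, \<xi>). a \<xi>) u = nft 1 (\<lambda>\<xi>. a (h *\<^sub>R \<xi>) * nft (- 1) u \<xi>)"
proof
  fix x :: 'a
  let ?g = "\<lambda>\<xi>. a \<xi> * cis ((x \<bullet> \<xi>) / h) * ft (- 1) u ((1 / h) *\<^sub>R \<xi>)"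
  have [measurable]: "a \<in> borel_measurable borel" using a by (simp add: bmeas_def)
  have ui: "integrable lborel u" using u by (simp add: wiener_def)
  have "continuous_on UNIV (ft (- 1) u)" by (rule continuous_ft[OF ui])
  then have [measurable]: "ft (- 1) u \<in> borel_measurable borel" by (rule borel_measurable_continuous_onI)
  \<comment> \<open>The integral over \<open>y\<close> is a Fourier transform taken at
    \<open>\<xi> / h\<close>.\<close>
  have inner: "(LINT y|lborel. exp (\<i> / complex_of_real h * complex_of_real ((x - y) \<bullet> \<xi>)) * a \<xi> * u y) = ?g \<xi>" for \<xi>
  proof -
    have "exp (\<i> / complex_of_real h * complex_of_real ((x - y) \<bullet> \<xi>)) * a \<xi> * u y
        = (a \<xi> * cis ((x \<bullet> \<xi>) / h)) * (cis (- 1 * (y \<bullet> ((1 / h) *\<^sub>R \<xi>))) * u y)" for y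
    proof -
      have "exp (\<i> / complex_of_real h * complex_of_real ((x - y) \<bullet> \<xi>)) = cis (((x - y) \<bullet> \<xi>) / h)"
        by (simp add: cis_conv_exp mult.commute)
      also have "((x - y) \<bullet> \<xi>) / h = (x \<bullet> \<xi>) / h + (- 1 * (y \<bullet> ((1 / h) *\<^sub>R \<xi>)))"
        by (simp add: inner_diff_left diff_divide_distrib)
      finally have "exp (\<i> / complex_of_real h * complex_of_real ((x - y) \<bullet> \<xi>)) = cis ((x \<bullet> \<xi>) / h) * cis (- 1 * (y \<bullet> ((1 / h) *\<^sub>R \<xi>)))"
        by (simp only: cis_mult)
      then show ?thesis by (simp only: mult_ac)
    qed
    then show ?thesis
      unfolding ft_def by (simp only: integral_mult_right_zero)
  qed
  have "weyl h (\<lambda>(x, \<xi>). a \<xi>) u x = complex_of_real (1 / (2 * pi * h) ^ DIM('a)) * (LINT \<xi>|lborel. ?g \<xi>)"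
    unfolding weyl_def prod.case inner ..
  \<comment> \<open>Rescaling \<open>\<xi>\<close> by \<open>h\<close> cancels the powers of
    \<open>h\<close> in the prefactor and moves \<open>h\<close> into the argument of
    \<open>a\<close>.\<close>
  also have "(LINT \<xi>|lborel. ?g \<xi>) = h ^ DIM('a) *\<^sub>R (LINT \<xi>|lborel. ?g (0 + h *\<^sub>R \<xi>))"
    by (rule integral_affine[OF h]) measurable
  also have "(LINT \<xi>|lborel. ?g (0 + h *\<^sub>R \<xi>)) = ft 1 (\<lambda>\<xi>. a (h *\<^sub>R \<xi>) * ft (- 1) u \<xi>) x"
    unfolding ft_def[of 1]
    by (rule Bochner_Integration.integral_cong[OF refl]) (use h in \<open>simp add: inner_commute mult_ac\<close>)
  also have "complex_of_real (1 / (2 * pi * h) ^ DIM('a)) * (h ^ DIM('a) *\<^sub>R ft 1 (\<lambda>\<xi>. a (h *\<^sub>R \<xi>) * ft (- 1) u \<xi>) x)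
      = complex_of_real (fconst TYPE('a) * fconst TYPE('a)) * ft 1 (\<lambda>\<xi>. a (h *\<^sub>R \<xi>) * ft (- 1) u \<xi>) x"
  proof -
    have "(1 / (2 * pi * h) ^ DIM('a)) * h ^ DIM('a) = 1 / (2 * pi) ^ DIM('a)"
      using h by (simp add: power_mult_distrib)
    also have "\<dots> = fconst TYPE('a) * fconst TYPE('a)"
      using fconst_square[where 'a='a] by (simp add: field_simps)
    finally show ?thesis
      by (simp only: scaleR_conv_of_real mult.assoc[symmetric] of_real_mult[symmetric])
  qed
  also have "\<dots> = nft 1 (\<lambda>\<xi>. a (h *\<^sub>R \<xi>) * nft (- 1) u \<xi>) x"
  proof -
    have "(\<lambda>\<xi>. a (h *\<^sub>R \<xi>) * nft (- 1) u \<xi>) = (\<lambda>\<xi>. complex_of_real (fconst TYPE('a)) * (a (h *\<^sub>R \<xi>) * ft (- 1) u \<xi>))"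
      by (simp add: nft_def fun_eq_iff mult.left_commute)
    then show ?thesis
      unfolding nft_def[of 1] by (simp add: ft_cmult)
  qed
  finally show "weyl h (\<lambda>(x, \<xi>). a \<xi>) u x = nft 1 (\<lambda>\<xi>. a (h *\<^sub>R \<xi>) * nft (- 1) u \<xi>) x" .
qed

lemma bmeas_scale: "bmeas a \<Longrightarrow> bmeas (\<lambda>\<xi>. a (h *\<^sub>R \<xi>))"
  unfolding bmeas_def by (auto simp: bounded_iff)

text \<open>The definite description is resolved here: \<open>fmult_abs\<close> shows that the
  multiplier satisfies it, and density of the Schwartz functions that no other operator
  does.\<close>

lemma weyl_op_multiplier:
  fixes a :: "'a::euclidean_space \<Rightarrow> complex"
  assumes a: "bmeas a" and h: "0 < h"
  shows "weyl_op h (\<lambda>(x, \<xi>). a \<xi>) = fmult 1 (\<lambda>\<xi>. a (h *\<^sub>R \<xi>))"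
  unfolding weyl_op_def
proof (rule the_equality)
  show *: "\<forall>u\<in>schwartz. square_integrable (weyl h (\<lambda>(x, \<xi>). a \<xi>) u) \<and>
      fmult 1 (\<lambda>\<xi>. a (h *\<^sub>R \<xi>)) (abs_L2 u) = abs_L2 (weyl h (\<lambda>(x, \<xi>). a \<xi>) u)"
    using fmult_abs[of 1 "\<lambda>\<xi>. a (h *\<^sub>R \<xi>)"] bmeas_scale[OF a]
    by (simp add: weyl_multiplier[OF a _ h] schwartz_wiener)
  fix T :: "'a L2 \<Rightarrow>\<^sub>L 'a L2"
  assume "\<forall>u\<in>schwartz. square_integrable (weyl h (\<lambda>(x, \<xi>). a \<xi>) u) \<and>
      T (abs_L2 u) = abs_L2 (weyl h (\<lambda>(x, \<xi>). a \<xi>) u)"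
  then show "T = fmult 1 (\<lambda>\<xi>. a (h *\<^sub>R \<xi>))"
    using * by (intro blinfun_eq_schwartz) auto
qed

section \<open>Derivations given by conjugation with modulations\<close>

definition modulation :: "'a::euclidean_space \<Rightarrow> ('a L2 \<Rightarrow>\<^sub>L 'a L2)" where
  "modulation \<zeta> = mult_op (\<lambda>x. cis (\<zeta> \<bullet> x))"

definition modconj :: "'a::euclidean_space \<Rightarrow> ('a L2 \<Rightarrow>\<^sub>L 'a L2) \<Rightarrow> ('a L2 \<Rightarrow>\<^sub>L 'a L2)" where
  "modconj \<zeta> S = modulation (- \<zeta>) o\<^sub>L S o\<^sub>L modulation \<zeta>"

lemma bmeas_cis_minus [simp]: "bmeas (\<lambda>x. cis (- (\<zeta> \<bullet> x)))"
  by (rule bmeas_bound[of _ 1]) auto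

lemma modulation_add: "modulation \<zeta> o\<^sub>L modulation \<eta> = modulation (\<zeta> + \<eta>)"
  by (simp add: modulation_def mult_op_compose cis_mult inner_add_left)

lemma modulation_0: "modulation 0 = id_blinfun"
  by (simp add: modulation_def mult_op_1)

lemma norm_modulation_le: "norm (modulation \<zeta>) \<le> 1"
  unfolding modulation_def by (rule norm_mult_op_le) simp

lemma modconj_0 [simp]: "modconj 0 S = S"
  by (simp add: modconj_def modulation_0)

lemma modconj_add_left: "modconj (\<zeta> + \<eta>) S = modconj \<zeta> (modconj \<eta> S)"
proof -
  have "modulation (- (\<zeta> + \<eta>)) = modulation (- \<zeta>) o\<^sub>L modulation (- \<eta>)" "modulation (\<zeta> + \<eta>) = modulation \<eta> o\<^sub>L modulation \<zeta>"
    by (simp_all add: modulation_add add.commute)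
  then show ?thesis
    by (simp add: modconj_def blinfun_compose_assoc)
qed

lemma norm_modconj_le: "norm (modconj \<zeta> S) \<le> norm S"
proof -
  have "norm (modconj \<zeta> S) \<le> (1 * norm S) * 1"
    unfolding modconj_def by (intro norm_compose_le norm_modulation_le order_refl)
  then show ?thesis by simp
qed

lemma modconj_compose: "modconj \<zeta> (S o\<^sub>L T) = modconj \<zeta> S o\<^sub>L modconj \<zeta> T"
proof -
  have "modconj \<zeta> S o\<^sub>L modconj \<zeta> T = modulation (- \<zeta>) o\<^sub>L S o\<^sub>L (modulation \<zeta> o\<^sub>L modulation (- \<zeta>)) o\<^sub>L T o\<^sub>L modulation \<zeta>"
    by (simp add: modconj_def blinfun_compose_assoc)
  then show ?thesis
    by (simp add: modulation_add modulation_0 modconj_def blinfun_compose_assoc)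
qed

lemma bounded_linear_modconj: "bounded_linear (modconj \<zeta>)"
  by (rule bounded_linear_intro[where K=1])
    (simp_all add: modconj_def[abs_def] blinfun_compose_simps, simp add: norm_modconj_le[unfolded modconj_def])

lemmas modconj_simps = linear_add[OF bounded_linear.linear[OF bounded_linear_modconj]]
  linear_diff[OF bounded_linear.linear[OF bounded_linear_modconj]]
  linear_scale[OF bounded_linear.linear[OF bounded_linear_modconj]]

lemma modconj_mult_op: "bmeas m \<Longrightarrow> modconj \<zeta> (mult_op m) = mult_op m"
proof -
  assume m: "bmeas m"
  have "cis (- (\<zeta> \<bullet> x)) * m x * cis (\<zeta> \<bullet> x) = m x" for x
    using cis_mult[of "- (\<zeta> \<bullet> x)" "\<zeta> \<bullet> x"] by (simp add: mult_ac)
  then have eq: "(\<lambda>x. cis (- (\<zeta> \<bullet> x)) * m x * cis (\<zeta> \<bullet> x)) = m"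
    by (rule ext)
  have "modconj \<zeta> (mult_op m) = mult_op (\<lambda>x. cis (- (\<zeta> \<bullet> x)) * m x * cis (\<zeta> \<bullet> x))"
    using m by (simp add: modconj_def modulation_def mult_op_compose)
  then show ?thesis by (simp only: eq)
qed

text \<open>A modulation translates Fourier transforms, so conjugation by it translates the symbol;
  \<open>s\<close> decides the direction.\<close>

lemma modconj_fmult:
  fixes f :: "'a::euclidean_space \<Rightarrow> complex"
  assumes s: "s = 1 \<or> s = - 1" and f: "bmeas f"
  shows "modconj \<zeta> (fmult s f) = fmult s (\<lambda>\<xi>. f (\<xi> + s *\<^sub>R \<zeta>))"
proof -
  have f': "bmeas (\<lambda>\<xi>. f (\<xi> + s *\<^sub>R \<zeta>))"
    using f unfolding bmeas_def by (auto simp: bounded_iff)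
  have s': "- s = 1 \<or> - s = - 1" using s by auto
  have "fmult s f o\<^sub>L modulation \<zeta> = modulation \<zeta> o\<^sub>L fmult s (\<lambda>\<xi>. f (\<xi> + s *\<^sub>R \<zeta>))"
  proof (rule blinfun_eq_wiener)
    fix u :: "'a \<Rightarrow> complex" assume u: "u \<in> wiener"
    let ?g = "\<lambda>\<xi>. f (\<xi> + s *\<^sub>R \<zeta>) * nft (- s) u \<xi>"
    have w: "(\<lambda>x. cis (\<zeta> \<bullet> x) * u x) \<in> wiener" by (rule wiener_modulation[OF u])
    have m: "?g \<in> borel_measurable borel"
      using nft_wiener(1)[OF u s']
      by (intro borel_measurable_times bmeas_measurable[OF f'] borel_measurable_continuous_onI)
        (simp add: wiener_def)
    have g: "f \<xi> * nft (- s) (\<lambda>x. cis (\<zeta> \<bullet> x) * u x) \<xi> = ?g (- (s *\<^sub>R \<zeta>) + \<xi>)" for \<xi>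
      by (simp add: nft_def ft_modulation[OF s'] add.commute)
    have ft: "ft s (\<lambda>\<xi>. ?g (- (s *\<^sub>R \<zeta>) + \<xi>)) x = cis (\<zeta> \<bullet> x) * ft s ?g x" for x
    proof -
      have "(LINT \<xi>|lborel. cis (s * (\<xi> \<bullet> x)) * ?g (- (s *\<^sub>R \<zeta>) + \<xi>))
          = (LINT \<xi>|lborel. (\<lambda>\<xi>. cis (s * ((s *\<^sub>R \<zeta> + \<xi>) \<bullet> x)) * ?g \<xi>) (- (s *\<^sub>R \<zeta>) + \<xi>))"
        by simp
      also have "\<dots> = (LINT \<xi>|lborel. cis (s * ((s *\<^sub>R \<zeta> + \<xi>) \<bullet> x)) * ?g \<xi>)"
        by (intro integral_translation borel_measurable_times m) measurable
      also have "\<dots> = (LINT \<xi>|lborel. cis (\<zeta> \<bullet> x) * (cis (s * (\<xi> \<bullet> x)) * ?g \<xi>))"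
      proof (rule Bochner_Integration.integral_cong[OF refl])
        fix \<xi>
        have "cis (s * ((s *\<^sub>R \<zeta> + \<xi>) \<bullet> x)) = cis (\<zeta> \<bullet> x) * cis (s * (\<xi> \<bullet> x))"
          using s by (auto simp: cis_mult inner_add_left algebra_simps)
        then show "cis (s * ((s *\<^sub>R \<zeta> + \<xi>) \<bullet> x)) * ?g \<xi> = cis (\<zeta> \<bullet> x) * (cis (s * (\<xi> \<bullet> x)) * ?g \<xi>)"
          by (simp only: mult.assoc)
      qed
      also have "\<dots> = cis (\<zeta> \<bullet> x) * (LINT \<xi>|lborel. cis (s * (\<xi> \<bullet> x)) * ?g \<xi>)"
        by (rule integral_mult_right_zero)
      finally show ?thesis by (simp only: ft_def)
    qed
    have "(fmult s f o\<^sub>L modulation \<zeta>) (abs_L2 u) = fmult s f (abs_L2 (\<lambda>x. cis (\<zeta> \<bullet> x) * u x))"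
      using u by (simp add: modulation_def mult_op_abs wiener_square_integrable)
    also have "\<dots> = abs_L2 (nft s (\<lambda>\<xi>. ?g (- (s *\<^sub>R \<zeta>) + \<xi>)))"
      unfolding fmult_abs(2)[OF s f w] g ..
    also have "\<dots> = abs_L2 (\<lambda>x. cis (\<zeta> \<bullet> x) * nft s ?g x)"
      unfolding nft_def[of s, abs_def] ft by (simp only: mult.left_commute)
    also have "\<dots> = (modulation \<zeta> o\<^sub>L fmult s (\<lambda>\<xi>. f (\<xi> + s *\<^sub>R \<zeta>))) (abs_L2 u)"
      using fmult_abs[OF s f' u] by (simp add: modulation_def mult_op_abs)
    finally show "(fmult s f o\<^sub>L modulation \<zeta>) (abs_L2 u) = (modulation \<zeta> o\<^sub>L fmult s (\<lambda>\<xi>. f (\<xi> + s *\<^sub>R \<zeta>))) (abs_L2 u)" .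
  qed
  then have "modconj \<zeta> (fmult s f) = (modulation (- \<zeta>) o\<^sub>L modulation \<zeta>) o\<^sub>L fmult s (\<lambda>\<xi>. f (\<xi> + s *\<^sub>R \<zeta>))"
    by (simp add: modconj_def blinfun_compose_assoc)
  then show ?thesis
    by (simp add: modulation_add modulation_0)
qed

text \<open>A relation and not a function, because the limit is taken in operator norm and need not
  exist. Asserting it includes differentiability in this sense.\<close>

definition mderiv :: "'a::euclidean_space \<Rightarrow> ('a L2 \<Rightarrow>\<^sub>L 'a L2) \<Rightarrow> ('a L2 \<Rightarrow>\<^sub>L 'a L2) \<Rightarrow> bool" where
  "mderiv b S R \<longleftrightarrow> ((\<lambda>r. modconj (r *\<^sub>R b) S) has_vector_derivative R) (at 0)"

lemma mderiv_mult_op: "bmeas m \<Longrightarrow> mderiv b (mult_op m) 0"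
  by (simp add: mderiv_def modconj_mult_op)

lemma mderiv_add: "mderiv b S R \<Longrightarrow> mderiv b T Q \<Longrightarrow> mderiv b (S + T) (R + Q)"
  unfolding mderiv_def modconj_simps by (rule has_vector_derivative_add)

lemma mderiv_diff: "mderiv b S R \<Longrightarrow> mderiv b T Q \<Longrightarrow> mderiv b (S - T) (R - Q)"
  unfolding mderiv_def modconj_simps by (rule has_vector_derivative_diff)

lemma mderiv_compose: "mderiv b S R \<Longrightarrow> mderiv b T Q \<Longrightarrow> mderiv b (S o\<^sub>L T) ((R o\<^sub>L T) + (S o\<^sub>L Q))"
  unfolding mderiv_def modconj_compose
  by (drule (1) bounded_bilinear.has_vector_derivative[OF bounded_bilinear_blinfun_compose])
    (simp add: add.commute)

lemma mderiv_commutator: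
  "mderiv b S R \<Longrightarrow> mderiv b T Q \<Longrightarrow> mderiv b (commutator S T) (commutator R T + commutator S Q)"
proof -
  assume a: "mderiv b S R" "mderiv b T Q"
  have eq: "((R o\<^sub>L T) + (S o\<^sub>L Q)) - ((Q o\<^sub>L S) + (T o\<^sub>L R)) = commutator R T + commutator S Q"
    by (simp add: commutator_def)
  have "mderiv b ((S o\<^sub>L T) - (T o\<^sub>L S)) (((R o\<^sub>L T) + (S o\<^sub>L Q)) - ((Q o\<^sub>L S) + (T o\<^sub>L R)))"
    by (intro mderiv_diff mderiv_compose a)
  then show ?thesis
    unfolding eq by (simp only: commutator_def[of S T])
qed

text \<open>Along \<open>b\<close>, \<open>modconj\<close> is a one-parameter group of bounded
  linear maps, which transports the derivative from 0 to \<open>t\<close>.\<close>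

lemma mderiv_at:
  assumes "mderiv b S R"
  shows "((\<lambda>r. modconj (r *\<^sub>R b) S) has_vector_derivative modconj (t *\<^sub>R b) R) (at t)"
proof -
  have "((\<lambda>r. modconj (t *\<^sub>R b) (modconj ((r - t) *\<^sub>R b) S)) has_vector_derivative modconj (t *\<^sub>R b) R) (at t)"
  proof (rule bounded_linear.has_vector_derivative[OF bounded_linear_modconj])
    have "((\<lambda>r. r - t) has_vector_derivative 1) (at t)"
      by (auto intro!: derivative_eq_intros)
    from vector_diff_chain_at[OF this, of "\<lambda>r. modconj (r *\<^sub>R b) S" R]
    show "((\<lambda>r. modconj ((r - t) *\<^sub>R b) S) has_vector_derivative R) (at t)"
      using assms by (simp add: mderiv_def o_def)
  qed
  moreover have "modconj (t *\<^sub>R b) (modconj ((r - t) *\<^sub>R b) S) = modconj (r *\<^sub>R b) S" for r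
    by (simp add: modconj_add_left[symmetric] scaleR_left_distrib[symmetric])
  ultimately show ?thesis by simp
qed

lemma modconj_lipschitz:
  assumes "mderiv b S R"
  shows "norm (modconj (t *\<^sub>R b) S - S) \<le> \<bar>t\<bar> * norm R"
proof -
  have "norm (modconj (t *\<^sub>R b) S - modconj (0 *\<^sub>R b) S) \<le> norm R * norm (t - 0)"
  proof (rule differentiable_bound[of UNIV _ "\<lambda>r h. h *\<^sub>R modconj (r *\<^sub>R b) R"])
    fix r :: real
    show "((\<lambda>r. modconj (r *\<^sub>R b) S) has_derivative (\<lambda>h. h *\<^sub>R modconj (r *\<^sub>R b) R)) (at r within UNIV)"
      using mderiv_at[OF assms, of r] by (simp add: has_vector_derivative_def)
    show "onorm (\<lambda>h. h *\<^sub>R modconj (r *\<^sub>R b) R) \<le> norm R"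
      using norm_modconj_le[of "r *\<^sub>R b" R]
      by (intro onorm_bound) (auto simp: mult.commute intro: mult_left_mono)
  qed auto
  then show ?thesis by (simp add: mult.commute)
qed

text \<open>The route to derivatives in operator norm: second-order Taylor estimates of the symbols,
  uniform in the variable.\<close>

lemma has_vector_derivative_quadratic:
  fixes F :: "real \<Rightarrow> 'b::real_normed_vector"
  assumes "\<And>r. norm (F r - F 0 - r *\<^sub>R D) \<le> C * r\<^sup>2"
  shows "(F has_vector_derivative D) (at 0)"
  unfolding has_vector_derivative_def has_derivative_at
proof
  show "bounded_linear (\<lambda>x. x *\<^sub>R D)" by (rule bounded_linear_scaleR_left)
  show "((\<lambda>r. norm (F (0 + r) - F 0 - r *\<^sub>R D) / norm r) \<longlongrightarrow> 0) (at 0)"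
  proof (rule Lim_null_comparison)
    show "\<forall>\<^sub>F r in at 0. norm (norm (F (0 + r) - F 0 - r *\<^sub>R D) / norm r) \<le> C * \<bar>r\<bar>"
    proof (rule eventually_at_topological[THEN iffD2], intro exI[of _ UNIV] conjI ballI impI)
      fix r :: real assume "r \<noteq> 0"
      then have "norm (F r - F 0 - r *\<^sub>R D) / \<bar>r\<bar> \<le> C * r\<^sup>2 / \<bar>r\<bar>"
        using assms[of r] by (intro divide_right_mono) auto
      also have "\<dots> = C * \<bar>r\<bar>"
        using \<open>r \<noteq> 0\<close> by (simp add: power2_eq_square abs_if field_simps)
      finally show "norm (norm (F (0 + r) - F 0 - r *\<^sub>R D) / norm r) \<le> C * \<bar>r\<bar>"
        by simp
    qed auto
    show "((\<lambda>r. C * \<bar>r\<bar>) \<longlongrightarrow> 0) (at 0)"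
      by (auto intro!: tendsto_eq_intros)
  qed
qed

text \<open>The bound on the second derivative makes the Taylor remainder uniform in
  \<open>\<xi>\<close>, and a uniform bound on a symbol bounds the norm of its multiplier.\<close>

lemma mderiv_fmult:
  fixes f :: "'a::euclidean_space \<Rightarrow> complex"
  assumes s: "s = 1 \<or> s = - 1" and f: "bmeas f" "bmeas (pd b f)"
    and diff: "\<And>x. f differentiable (at x)" "\<And>x. pd b f differentiable (at x)"
    and bound: "\<And>x. norm (pd b (pd b f) x) \<le> C"
  shows "mderiv b (fmult s f) (fmult s (\<lambda>\<xi>. s *\<^sub>R pd b f \<xi>))"
  unfolding mderiv_def
proof (rule has_vector_derivative_quadratic[of _ _ C])
  fix r :: real
  have f': "bmeas (\<lambda>\<xi>. f (\<xi> + s *\<^sub>R r *\<^sub>R b))"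
    using f unfolding bmeas_def by (auto simp: bounded_iff)
  have lin: "norm (f (\<xi> + (s * r) *\<^sub>R b) - f \<xi> - (s * r) *\<^sub>R pd b f \<xi>) \<le> C * r\<^sup>2" for \<xi>
  proof -
    let ?t = "s * r"
    have t: "\<bar>?t\<bar> = \<bar>r\<bar>" using s by (auto simp: abs_mult)
    have d1: "((\<lambda>r. f (\<xi> + r *\<^sub>R b)) has_vector_derivative pd b f (\<xi> + x *\<^sub>R b)) (at x within S)" for x S
      by (rule pd_vector_derivative) (rule diff)
    have d2: "((\<lambda>r. pd b f (\<xi> + r *\<^sub>R b)) has_vector_derivative pd b (pd b f) (\<xi> + x *\<^sub>R b)) (at x within S)" for x S
      by (rule pd_vector_derivative) (rule diff)
    have "norm (f (\<xi> + ?t *\<^sub>R b) - f (\<xi> + 0 *\<^sub>R b) - (?t - 0) *\<^sub>R pd b f (\<xi> + 0 *\<^sub>R b)) \<le> norm (?t - 0) * (C * \<bar>r\<bar>)"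
    proof (rule vector_differentiable_bound_linearization[where S="closed_segment 0 ?t" and f'="\<lambda>x. pd b f (\<xi> + x *\<^sub>R b)"])
      fix x assume x: "x \<in> closed_segment 0 ?t"
      have "norm (pd b f (\<xi> + x *\<^sub>R b) - pd b f (\<xi> + 0 *\<^sub>R b)) \<le> C * norm (x - 0)"
      proof (rule differentiable_bound[of UNIV _ "\<lambda>r h. h *\<^sub>R pd b (pd b f) (\<xi> + r *\<^sub>R b)"])
        fix y :: real
        show "((\<lambda>r. pd b f (\<xi> + r *\<^sub>R b)) has_derivative (\<lambda>h. h *\<^sub>R pd b (pd b f) (\<xi> + y *\<^sub>R b))) (at y within UNIV)"
          using d2[of y UNIV] by (simp add: has_vector_derivative_def)
        show "onorm (\<lambda>h. h *\<^sub>R pd b (pd b f) (\<xi> + y *\<^sub>R b)) \<le> C"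
        proof (rule onorm_bound)
          show "0 \<le> C" using bound[of \<xi>] norm_ge_zero order_trans by blast
          show "norm (h *\<^sub>R pd b (pd b f) (\<xi> + y *\<^sub>R b)) \<le> C * norm h" for h :: real
            using mult_right_mono[OF bound, of "norm h"] by (simp add: mult.commute)
        qed
      qed auto
      also have "\<dots> \<le> C * \<bar>r\<bar>"
      proof (rule mult_left_mono)
        show "norm (x - 0) \<le> \<bar>r\<bar>"
          using x t by (auto simp: closed_segment_eq_real_ivl split: if_splits)
        show "0 \<le> C" using bound[of \<xi>] norm_ge_zero order_trans by blast
      qed
      finally show "norm (pd b f (\<xi> + x *\<^sub>R b) - pd b f (\<xi> + 0 *\<^sub>R b)) \<le> C * \<bar>r\<bar>" .
    qed (auto intro: d1)
    also have "norm (?t - 0) * (C * \<bar>r\<bar>) = C * r\<^sup>2"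
      using t by (simp add: power2_eq_square mult_ac)
    finally show ?thesis by simp
  qed
  have "norm (fmult s (\<lambda>\<xi>. f (\<xi> + s *\<^sub>R r *\<^sub>R b) - f \<xi> - r *\<^sub>R s *\<^sub>R pd b f \<xi>)) \<le> C * r\<^sup>2"
    using lin by (intro norm_fmult_le[OF s]) (simp add: mult.commute)
  moreover have "modconj (r *\<^sub>R b) (fmult s f) - modconj (0 *\<^sub>R b) (fmult s f) - r *\<^sub>R fmult s (\<lambda>\<xi>. s *\<^sub>R pd b f \<xi>)
      = fmult s (\<lambda>\<xi>. f (\<xi> + s *\<^sub>R r *\<^sub>R b) - f \<xi> - r *\<^sub>R s *\<^sub>R pd b f \<xi>)"
    using f f' by (simp add: modconj_fmult[OF s] fmult_scaleR fmult_diff)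
  ultimately show "norm (modconj (r *\<^sub>R b) (fmult s f) - modconj (0 *\<^sub>R b) (fmult s f) - r *\<^sub>R fmult s (\<lambda>\<xi>. s *\<^sub>R pd b f \<xi>)) \<le> C * r\<^sup>2"
    by simp
qed

section \<open>Complex-linear operators with an adjoint\<close>

text \<open>Bounded operators are only real-linear here. Commuting with complex scalars lets
  constants and Fourier coefficients pass through \<open>S\<close>; the adjoint moves
  \<open>S\<close> to the other side of the inner products in weak integrals.\<close>

definition clinear_adj :: "('a::euclidean_space L2 \<Rightarrow>\<^sub>L 'a L2) \<Rightarrow> bool" where
  "clinear_adj S \<longleftrightarrow> (\<forall>z. mult_op (\<lambda>_. z) o\<^sub>L S = S o\<^sub>L mult_op (\<lambda>_. z)) \<and> (\<exists>S' :: 'a L2 \<Rightarrow>\<^sub>L 'a L2. \<forall>\<phi> \<psi>. S \<phi> \<bullet> \<psi> = \<phi> \<bullet> S' \<psi>)"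

lemma clinear_adj_mult_op: "bmeas m \<Longrightarrow> clinear_adj (mult_op m)"
  unfolding clinear_adj_def by (auto simp: mult_op_compose mult.commute mult_op_adjoint)

lemma clinear_adj_fmult: "s = 1 \<or> s = - 1 \<Longrightarrow> bmeas f \<Longrightarrow> clinear_adj (fmult s f)"
  unfolding clinear_adj_def using fmult_complex_linear(1) fmult_adjoint by blast

lemma clinear_adj_add: "clinear_adj S \<Longrightarrow> clinear_adj T \<Longrightarrow> clinear_adj (S + T)"
  unfolding clinear_adj_def
  by (auto simp: blinfun_compose_simps blinfun.add_left inner_add_left)
    (metis blinfun.add_left inner_add_right)

lemma clinear_adj_scaleR: "clinear_adj S \<Longrightarrow> clinear_adj (r *\<^sub>R S)"
  unfolding clinear_adj_def
  by (auto simp: blinfun_compose_simps blinfun.scaleR_left)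
    (metis blinfun.scaleR_left inner_scaleR_right)

lemma clinear_adj_diff: "clinear_adj S \<Longrightarrow> clinear_adj T \<Longrightarrow> clinear_adj (S - T)"
  using clinear_adj_add[of S "(-1) *\<^sub>R T"] clinear_adj_scaleR[of T "-1"] by simp

lemma clinear_adj_compose: "clinear_adj S \<Longrightarrow> clinear_adj T \<Longrightarrow> clinear_adj (S o\<^sub>L T)"
  unfolding clinear_adj_def
proof (elim conjE exE, intro conjI allI)
  fix z S' T'
  assume "\<forall>z. mult_op (\<lambda>_. z) o\<^sub>L S = S o\<^sub>L mult_op (\<lambda>_. z)" "\<forall>z. mult_op (\<lambda>_. z) o\<^sub>L T = T o\<^sub>L mult_op (\<lambda>_. z)"
  then show "mult_op (\<lambda>_. z) o\<^sub>L (S o\<^sub>L T) = (S o\<^sub>L T) o\<^sub>L mult_op (\<lambda>_. z)"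
    by (metis blinfun_compose_assoc)
next
  fix S' T'
  assume "\<forall>\<phi> \<psi>. S \<phi> \<bullet> \<psi> = \<phi> \<bullet> blinfun_apply S' \<psi>" "\<forall>\<phi> \<psi>. T \<phi> \<bullet> \<psi> = \<phi> \<bullet> blinfun_apply T' \<psi>"
  then show "\<exists>S'. \<forall>\<phi> \<psi>. (S o\<^sub>L T) \<phi> \<bullet> \<psi> = \<phi> \<bullet> blinfun_apply S' \<psi>"
    by (intro exI[of _ "T' o\<^sub>L S'"]) simp
qed

lemma clinear_adj_commutator: "clinear_adj S \<Longrightarrow> clinear_adj T \<Longrightarrow> clinear_adj (commutator S T)"
  by (simp add: commutator_def clinear_adj_compose clinear_adj_diff)

lemma clinear_adj_modconj: "clinear_adj S \<Longrightarrow> clinear_adj (modconj \<zeta> S)"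
  by (simp add: modconj_def modulation_def clinear_adj_compose clinear_adj_mult_op)

lemma norm_adjoint_le:
  fixes S S' :: "'b::real_inner \<Rightarrow>\<^sub>L 'b"
  assumes "\<And>\<phi> \<psi>. S \<phi> \<bullet> \<psi> = \<phi> \<bullet> S' \<psi>"
  shows "norm S' \<le> norm S"
proof (rule norm_blinfun_bound)
  fix \<psi>
  have "(norm (S' \<psi>))\<^sup>2 = S (S' \<psi>) \<bullet> \<psi>"
    by (simp add: assms power2_norm_eq_inner)
  also have "\<dots> \<le> norm (S (S' \<psi>)) * norm \<psi>"
    by (rule norm_cauchy_schwarz)
  also have "\<dots> \<le> (norm S * norm (S' \<psi>)) * norm \<psi>"
    by (intro mult_right_mono norm_blinfun norm_ge_zero)
  finally have "norm (S' \<psi>) * norm (S' \<psi>) \<le> norm (S' \<psi>) * (norm S * norm \<psi>)"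
    by (simp add: power2_eq_square mult_ac)
  then show "norm (S' \<psi>) \<le> norm S * norm \<psi>"
    by (cases "norm (S' \<psi>) = 0") (auto simp: mult_le_cancel_left)
qed simp

text \<open>By \<open>norm_adjoint_le\<close> the adjoints form a Cauchy sequence, and their limit
  is an adjoint of \<open>T\<close>.\<close>

lemma clinear_adj_limit:
  fixes S :: "nat \<Rightarrow> ('a::euclidean_space L2 \<Rightarrow>\<^sub>L 'a L2)"
  assumes S: "\<And>n. clinear_adj (S n)" and lim: "S \<longlonglongrightarrow> T"
  shows "clinear_adj T"
proof -
  obtain S' where S': "\<And>n \<phi> \<psi>. S n \<phi> \<bullet> \<psi> = \<phi> \<bullet> blinfun_apply (S' n) \<psi>"
    using S unfolding clinear_adj_def by metis
  have le: "norm (S' m - S' n) \<le> norm (S m - S n)" for m n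
    by (rule norm_adjoint_le) (simp add: blinfun.diff_left inner_diff_left inner_diff_right S')
  have "Cauchy S'"
    unfolding Cauchy_def dist_norm
    using LIMSEQ_imp_Cauchy[OF lim] le unfolding Cauchy_def dist_norm by (meson le_less_trans)
  then obtain T' where T': "S' \<longlonglongrightarrow> T'"
    using Cauchy_convergent convergent_def by blast
  have "T \<phi> \<bullet> \<psi> = \<phi> \<bullet> T' \<psi>" for \<phi> \<psi>
  proof (rule LIMSEQ_unique)
    show "(\<lambda>n. S n \<phi> \<bullet> \<psi>) \<longlonglongrightarrow> T \<phi> \<bullet> \<psi>"
      by (intro tendsto_intros lim)
    show "(\<lambda>n. S n \<phi> \<bullet> \<psi>) \<longlonglongrightarrow> \<phi> \<bullet> T' \<psi>"
      unfolding S' by (intro tendsto_intros T')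
  qed
  moreover have "mult_op (\<lambda>_. z) o\<^sub>L T = T o\<^sub>L mult_op (\<lambda>_. z)" for z
  proof (rule LIMSEQ_unique)
    show "(\<lambda>n. mult_op (\<lambda>_. z) o\<^sub>L S n) \<longlonglongrightarrow> (mult_op (\<lambda>_. z) o\<^sub>L T)"
      by (intro bounded_bilinear.tendsto[OF bounded_bilinear_blinfun_compose] tendsto_const lim)
    have "mult_op (\<lambda>_. z) o\<^sub>L S n = S n o\<^sub>L mult_op (\<lambda>_. z)" for n
      using S by (simp add: clinear_adj_def)
    then show "(\<lambda>n. mult_op (\<lambda>_. z) o\<^sub>L S n) \<longlonglongrightarrow> (T o\<^sub>L mult_op (\<lambda>_. z))"
      by (simp, intro bounded_bilinear.tendsto[OF bounded_bilinear_blinfun_compose] tendsto_const lim)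
  qed
  ultimately show ?thesis
    unfolding clinear_adj_def by blast
qed

text \<open>\<open>R\<close> is the norm limit of difference quotients along
  \<open>r = 1 / (n + 1)\<close>, each of which inherits the property from \<open>S\<close>.\<close>

lemma clinear_adj_mderiv:
  assumes "mderiv b S R" "clinear_adj S"
  shows "clinear_adj R"
proof (rule clinear_adj_limit)
  let ?r = "\<lambda>n. inverse (real (Suc n))"
  show "clinear_adj ((1 / ?r n) *\<^sub>R (modconj (?r n *\<^sub>R b) S - S))" for n
    by (intro clinear_adj_scaleR clinear_adj_diff clinear_adj_modconj assms)
  have lim: "((\<lambda>r. (1 / r) *\<^sub>R (modconj (r *\<^sub>R b) S - S)) \<longlongrightarrow> R) (at 0)"
  proof -
    have "((\<lambda>r. norm (modconj (r *\<^sub>R b) S - S - r *\<^sub>R R) / \<bar>r\<bar>) \<longlongrightarrow> 0) (at 0)"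
      using assms(1) unfolding mderiv_def has_vector_derivative_def has_derivative_at by simp
    moreover have "\<forall>\<^sub>F r in at 0. norm (modconj (r *\<^sub>R b) S - S - r *\<^sub>R R) / \<bar>r\<bar> = norm ((1 / r) *\<^sub>R (modconj (r *\<^sub>R b) S - S) - R)"
    proof (rule eventually_at_topological[THEN iffD2], intro exI[of _ UNIV] conjI ballI impI)
      fix r :: real assume r: "r \<noteq> 0"
      have "(1 / r) *\<^sub>R (modconj (r *\<^sub>R b) S - S) - R = (1 / r) *\<^sub>R (modconj (r *\<^sub>R b) S - S - r *\<^sub>R R)"
        using r by (simp add: scaleR_diff_right)
      then show "norm (modconj (r *\<^sub>R b) S - S - r *\<^sub>R R) / \<bar>r\<bar> = norm ((1 / r) *\<^sub>R (modconj (r *\<^sub>R b) S - S) - R)"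
        by simp
    qed auto
    ultimately have "((\<lambda>r. norm ((1 / r) *\<^sub>R (modconj (r *\<^sub>R b) S - S) - R)) \<longlongrightarrow> 0) (at 0)"
      using tendsto_cong by fast
    then show ?thesis
      using LIM_zero_cancel tendsto_norm_zero_iff by blast
  qed
  have "filterlim ?r (at 0) sequentially"
    unfolding filterlim_at using LIMSEQ_inverse_real_of_nat by auto
  from filterlim_compose[OF lim this]
  show "(\<lambda>n. (1 / ?r n) *\<^sub>R (modconj (?r n *\<^sub>R b) S - S)) \<longlonglongrightarrow> R" .
qed

text \<open>The operator analogue of \<open>bd\<close> with a constant weight: iterated derivatives
  up to order \<open>n\<close> exist and have norm at most \<open>B\<close>. Keeping the derivatives
  inside the quantifier allows inductions over sums and commutators.\<close>

primrec opbd :: "nat \<Rightarrow> real \<Rightarrow> ('a::euclidean_space L2 \<Rightarrow>\<^sub>L 'a L2) \<Rightarrow> bool" where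
  "opbd 0 B S \<longleftrightarrow> norm S \<le> B"
| "opbd (Suc n) B S \<longleftrightarrow> norm S \<le> B \<and> (\<forall>b\<in>Basis. \<exists>R. mderiv b S R \<and> opbd n B R)"

lemma opbd_le: "opbd n B S \<Longrightarrow> norm S \<le> B"
  by (cases n) auto

lemma opbd_mono: "opbd n B S \<Longrightarrow> B \<le> B' \<Longrightarrow> opbd n B' S"
  by (induction n arbitrary: S) (auto, meson)

lemma opbd_add: "opbd n B S \<Longrightarrow> opbd n C T \<Longrightarrow> opbd n (B + C) (S + T)"
proof (induction n arbitrary: S T)
  case 0
  then show ?case by (auto intro: norm_triangle_mono)
next
  case (Suc n)
  show ?case
    unfolding opbd.simps
  proof (intro conjI ballI)
    show "norm (S + T) \<le> B + C"
      using Suc.prems by (auto intro: norm_triangle_mono)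
    fix b :: 'a assume "b \<in> Basis"
    then obtain R Q where "mderiv b S R" "opbd n B R" "mderiv b T Q" "opbd n C Q"
      using Suc.prems by (meson opbd.simps(2))
    then show "\<exists>R. mderiv b (S + T) R \<and> opbd n (B + C) R"
      using Suc.IH mderiv_add by blast
  qed
qed

section \<open>Commutators with multiplication operators\<close>

text \<open>The coordinates of \<open>\<zeta>\<close> are added one at a time.
  \<open>modconj_lipschitz\<close> bounds each new step, and the earlier ones are transported by a
  contraction.\<close>

lemma norm_modconj_diff_le:
  fixes S :: "'a::euclidean_space L2 \<Rightarrow>\<^sub>L 'a L2"
  assumes "\<And>b. b \<in> Basis \<Longrightarrow> \<exists>R. mderiv b S R \<and> norm R \<le> B"
  shows "norm (modconj \<zeta> S - S) \<le> (\<Sum>b\<in>Basis. \<bar>\<zeta> \<bullet> b\<bar>) * B"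
proof -
  have "norm (modconj (\<Sum>b\<in>F. (\<zeta> \<bullet> b) *\<^sub>R b) S - S) \<le> (\<Sum>b\<in>F. \<bar>\<zeta> \<bullet> b\<bar>) * B" if "finite F" "F \<subseteq> Basis" for F
    using that
  proof (induction F rule: finite_induct)
    case empty
    show ?case by simp
  next
    case (insert b F)
    let ?\<eta> = "\<Sum>b\<in>F. (\<zeta> \<bullet> b) *\<^sub>R b"
    obtain R where R: "mderiv b S R" "norm R \<le> B"
      using assms insert.prems by blast
    have "modconj (\<Sum>b\<in>insert b F. (\<zeta> \<bullet> b) *\<^sub>R b) S - S
        = modconj ((\<zeta> \<bullet> b) *\<^sub>R b) (modconj ?\<eta> S - S) + (modconj ((\<zeta> \<bullet> b) *\<^sub>R b) S - S)"
      using insert.hyps by (simp add: modconj_add_left modconj_simps)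
    also have "norm \<dots> \<le> norm (modconj ?\<eta> S - S) + \<bar>\<zeta> \<bullet> b\<bar> * norm R"
      by (intro norm_triangle_mono norm_modconj_le modconj_lipschitz R)
    also have "\<dots> \<le> (\<Sum>b\<in>F. \<bar>\<zeta> \<bullet> b\<bar>) * B + \<bar>\<zeta> \<bullet> b\<bar> * B"
      using insert.IH insert.prems R(2) by (intro add_mono mult_left_mono) auto
    also have "\<dots> = (\<Sum>b\<in>insert b F. \<bar>\<zeta> \<bullet> b\<bar>) * B"
      using insert.hyps by (simp add: distrib_right)
    finally show ?case .
  qed
  from this[of Basis] show ?thesis
    by (simp add: euclidean_representation)
qed

lemma modulation_commutator:
  "(modulation \<zeta> o\<^sub>L S) - (S o\<^sub>L modulation \<zeta>) = modulation \<zeta> o\<^sub>L (S - modconj \<zeta> S)"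
proof -
  have "modulation \<zeta> o\<^sub>L modconj \<zeta> S = (modulation \<zeta> o\<^sub>L modulation (- \<zeta>)) o\<^sub>L (S o\<^sub>L modulation \<zeta>)"
    by (simp add: modconj_def blinfun_compose_assoc)
  then show ?thesis
    by (simp add: modulation_add modulation_0 blinfun_compose_simps)
qed

text \<open>Stated weakly, for inner products with \<open>\<psi>\<close>, so that Fubini for scalar
  integrals is enough and no operator-valued integral occurs.\<close>

lemma mult_op_fourier_integral:
  fixes g :: "'a::euclidean_space \<Rightarrow> complex"
  assumes G: "integrable lborel G" and g: "\<And>x. g x = (LINT \<zeta>|lborel. G \<zeta> * cis (\<zeta> \<bullet> x))" and bg: "bmeas g"
  shows "integrable lborel (\<lambda>\<zeta>. mult_op (\<lambda>_. G \<zeta>) (modulation \<zeta> \<phi>) \<bullet> \<psi>)"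
    and "mult_op g \<phi> \<bullet> \<psi> = (LINT \<zeta>|lborel. mult_op (\<lambda>_. G \<zeta>) (modulation \<zeta> \<phi>) \<bullet> \<psi>)"
proof -
  obtain f q where sq: "square_integrable f" "square_integrable q" and eq: "\<phi> = abs_L2 f" "\<psi> = abs_L2 q"
    by (metis L2_cases)
  have [measurable]: "f \<in> borel_measurable borel" "q \<in> borel_measurable borel" "G \<in> borel_measurable borel"
    using sq G by (auto simp: square_integrable_def)
  let ?k = "\<lambda>x \<zeta>. (G \<zeta> * cis (\<zeta> \<bullet> x) * f x) \<bullet> q x"
  have "square_integrable (\<lambda>x. complex_of_real (norm (f x)))" "square_integrable (\<lambda>x. complex_of_real (norm (q x)))"
    using sq by (auto simp: square_integrable_def)
  from integrable_inner_square_integrable[OF this]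
  have fq: "integrable lborel (\<lambda>x. norm (f x) * norm (q x))"
    by (simp add: inner_complex_def)
  have ki: "integrable (lborel \<Otimes>\<^sub>M lborel) (case_prod ?k)"
  proof (rule integrable_tensor[OF fq G])
    show "norm (case_prod ?k (x, \<zeta>)) \<le> norm (norm (f x) * norm (q x)) * norm (G \<zeta>)" for x \<zeta>
      using Cauchy_Schwarz_ineq2[of "G \<zeta> * cis (\<zeta> \<bullet> x) * f x" "q x"] by (simp add: norm_mult mult_ac)
  qed measurable
  have inner: "mult_op (\<lambda>_. G \<zeta>) (modulation \<zeta> \<phi>) \<bullet> \<psi> = (LINT x|lborel. ?k x \<zeta>)" for \<zeta>
    using sq by (simp add: eq modulation_def mult_op_abs square_integrable_bmeas square_integrable_cmult inner_abs_L2 mult.assoc)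
  show "integrable lborel (\<lambda>\<zeta>. mult_op (\<lambda>_. G \<zeta>) (modulation \<zeta> \<phi>) \<bullet> \<psi>)"
    unfolding inner using lborel_pair.integrable_snd[OF ki] by simp
  have i: "integrable lborel (\<lambda>\<zeta>. G \<zeta> * cis (\<zeta> \<bullet> x) * z)" for x z
    using integrable_cis_mult[OF G, of "\<lambda>\<zeta>. \<zeta> \<bullet> x"] by (simp add: mult.commute)
  have "mult_op g \<phi> \<bullet> \<psi> = (LINT x|lborel. (g x * f x) \<bullet> q x)"
    using sq bg by (simp add: eq mult_op_abs square_integrable_bmeas inner_abs_L2)
  also have "\<dots> = (LINT x|lborel. LINT \<zeta>|lborel. ?k x \<zeta>)"
  proof (rule Bochner_Integration.integral_cong[OF refl])
    fix x
    have "(LINT \<zeta>|lborel. ?k x \<zeta>) = (LINT \<zeta>|lborel. G \<zeta> * cis (\<zeta> \<bullet> x) * f x) \<bullet> q x"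
      by (intro integral_inner_left impI i)
    then show "(g x * f x) \<bullet> q x = (LINT \<zeta>|lborel. ?k x \<zeta>)"
      by (simp add: g)
  qed
  also have "\<dots> = (LINT \<zeta>|lborel. LINT x|lborel. ?k x \<zeta>)"
    by (rule lborel_pair.Fubini_integral[OF ki, symmetric])
  finally show "mult_op g \<phi> \<bullet> \<psi> = (LINT \<zeta>|lborel. mult_op (\<lambda>_. G \<zeta>) (modulation \<zeta> \<phi>) \<bullet> \<psi>)"
    by (simp only: inner)
qed

text \<open>The commutator is a superposition, with weight \<open>G\<close>, of commutators of
  \<open>S\<close> with modulations, and each of these is at most \<open>B\<close> times the sum of
  the moduli of the coordinates of \<open>\<zeta>\<close>. Taking \<open>\<psi>\<close> to be the
  image of \<open>\<phi>\<close> itself extracts the norm from the weak formula.\<close>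

lemma commutator_fourier_integral:
  fixes S :: "'a::euclidean_space L2 \<Rightarrow>\<^sub>L 'a L2"
  assumes G: "integrable lborel G" and g: "\<And>x. g x = (LINT \<zeta>|lborel. G \<zeta> * cis (\<zeta> \<bullet> x))" and bg: "bmeas g"
    and S: "clinear_adj S" "\<And>b. b \<in> Basis \<Longrightarrow> \<exists>R. mderiv b S R \<and> norm R \<le> B" "0 \<le> B"
    and int: "integrable lborel w" and le: "\<And>\<zeta>. norm (G \<zeta>) * (\<Sum>b\<in>Basis. \<bar>\<zeta> \<bullet> b\<bar>) \<le> w \<zeta>"
  shows "norm (commutator (mult_op g) S) \<le> (LINT \<zeta>|lborel. w \<zeta>) * B"
proof (rule norm_blinfun_bound)
  have w0: "0 \<le> w \<zeta>" for \<zeta>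
    by (rule order_trans[OF _ le]) (auto intro!: mult_nonneg_nonneg sum_nonneg)
  then show "0 \<le> (LINT \<zeta>|lborel. w \<zeta>) * B"
    using S(3) by simp
  fix \<phi>
  obtain S' where S': "\<And>\<phi> \<psi>. S \<phi> \<bullet> \<psi> = \<phi> \<bullet> blinfun_apply S' \<psi>"
    and lin: "\<And>z. mult_op (\<lambda>_. z) o\<^sub>L S = S o\<^sub>L mult_op (\<lambda>_. z)"
    using S(1) unfolding clinear_adj_def by blast
  let ?T = "commutator (mult_op g) S"
  define \<psi> where "\<psi> = ?T \<phi>"
  let ?D = "\<lambda>\<zeta>. (modulation \<zeta> o\<^sub>L S) - (S o\<^sub>L modulation \<zeta>)"
  have D: "norm (?D \<zeta>) \<le> (\<Sum>b\<in>Basis. \<bar>\<zeta> \<bullet> b\<bar>) * B" for \<zeta>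
  proof -
    have "norm (?D \<zeta>) \<le> 1 * ((\<Sum>b\<in>Basis. \<bar>\<zeta> \<bullet> b\<bar>) * B)"
      unfolding modulation_commutator
      using norm_modconj_diff_le[OF S(2), of \<zeta>]
      by (intro norm_compose_le norm_modulation_le) (auto simp: norm_minus_commute)
    then show ?thesis by simp
  qed
  \<comment> \<open>\<open>S\<close> returns from the right factor through its adjoint and passes
    the scalar \<open>G \<zeta>\<close> by complex linearity.\<close>
  have eq: "mult_op (\<lambda>_. G \<zeta>) (modulation \<zeta> (S \<phi>)) \<bullet> \<psi> - mult_op (\<lambda>_. G \<zeta>) (modulation \<zeta> \<phi>) \<bullet> S' \<psi>
      = mult_op (\<lambda>_. G \<zeta>) (?D \<zeta> \<phi>) \<bullet> \<psi>" for \<zeta>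
  proof -
    have "S (mult_op (\<lambda>_. G \<zeta>) \<eta>) = mult_op (\<lambda>_. G \<zeta>) (S \<eta>)" for \<eta>
      using lin[of "G \<zeta>"] by (metis blinfun_apply_blinfun_compose)
    then show ?thesis
      by (simp add: S'[symmetric] blinfun.diff_left blinfun.diff_right inner_diff_left)
  qed
  have "norm (?T \<phi>) * norm (?T \<phi>) = ?T \<phi> \<bullet> \<psi>"
    by (simp add: \<psi>_def flip: power2_norm_eq_inner power2_eq_square)
  also have "\<dots> = mult_op g (S \<phi>) \<bullet> \<psi> - mult_op g \<phi> \<bullet> S' \<psi>"
    by (simp add: commutator_def blinfun.diff_left inner_diff_left S')
  also have "\<dots> = (LINT \<zeta>|lborel. mult_op (\<lambda>_. G \<zeta>) (modulation \<zeta> (S \<phi>)) \<bullet> \<psi> - mult_op (\<lambda>_. G \<zeta>) (modulation \<zeta> \<phi>) \<bullet> S' \<psi>)"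
    using mult_op_fourier_integral[OF G g bg, of "S \<phi>" \<psi>] mult_op_fourier_integral[OF G g bg, of \<phi> "S' \<psi>"]
    by simp
  also have "\<dots> = (LINT \<zeta>|lborel. mult_op (\<lambda>_. G \<zeta>) (?D \<zeta> \<phi>) \<bullet> \<psi>)"
    by (simp only: eq)
  also have "\<dots> \<le> (LINT \<zeta>|lborel. w \<zeta> * (B * norm \<phi> * norm \<psi>))"
  proof (rule integral_mono)
    show "integrable lborel (\<lambda>\<zeta>. mult_op (\<lambda>_. G \<zeta>) (?D \<zeta> \<phi>) \<bullet> \<psi>)"
      using mult_op_fourier_integral(1)[OF G g bg, of "S \<phi>" \<psi>] mult_op_fourier_integral(1)[OF G g bg, of \<phi> "S' \<psi>"]
      by (simp only: eq[symmetric] Bochner_Integration.integrable_diff)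
    show "integrable lborel (\<lambda>\<zeta>. w \<zeta> * (B * norm \<phi> * norm \<psi>))"
      using int by simp
    fix \<zeta>
    have "mult_op (\<lambda>_. G \<zeta>) (?D \<zeta> \<phi>) \<bullet> \<psi> \<le> norm (mult_op (\<lambda>_. G \<zeta>) (?D \<zeta> \<phi>)) * norm \<psi>"
      by (rule norm_cauchy_schwarz)
    also have "\<dots> \<le> (norm (G \<zeta>) * (((\<Sum>b\<in>Basis. \<bar>\<zeta> \<bullet> b\<bar>) * B) * norm \<phi>)) * norm \<psi>"
    proof (intro mult_right_mono norm_ge_zero)
      have "norm (mult_op (\<lambda>_. G \<zeta>) (?D \<zeta> \<phi>)) \<le> norm (mult_op (\<lambda>_::'a. G \<zeta>)) * norm (?D \<zeta> \<phi>)"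
        by (rule norm_blinfun)
      also have "\<dots> \<le> norm (G \<zeta>) * (((\<Sum>b\<in>Basis. \<bar>\<zeta> \<bullet> b\<bar>) * B) * norm \<phi>)"
      proof (intro mult_mono norm_mult_op_le order_refl norm_ge_zero)
        show "norm (?D \<zeta> \<phi>) \<le> ((\<Sum>b\<in>Basis. \<bar>\<zeta> \<bullet> b\<bar>) * B) * norm \<phi>"
          by (rule order_trans[OF norm_blinfun mult_right_mono[OF D norm_ge_zero]])
      qed
      finally show "norm (mult_op (\<lambda>_. G \<zeta>) (?D \<zeta> \<phi>)) \<le> norm (G \<zeta>) * (((\<Sum>b\<in>Basis. \<bar>\<zeta> \<bullet> b\<bar>) * B) * norm \<phi>)" .
    qed
    also have "\<dots> = (norm (G \<zeta>) * (\<Sum>b\<in>Basis. \<bar>\<zeta> \<bullet> b\<bar>)) * (B * norm \<phi> * norm \<psi>)"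
      by (simp only: mult_ac)
    also have "\<dots> \<le> w \<zeta> * (B * norm \<phi> * norm \<psi>)"
      using S(3) by (intro mult_right_mono le) auto
    finally show "mult_op (\<lambda>_. G \<zeta>) (?D \<zeta> \<phi>) \<bullet> \<psi> \<le> w \<zeta> * (B * norm \<phi> * norm \<psi>)" .
  qed
  also have "\<dots> = (LINT \<zeta>|lborel. w \<zeta>) * (B * norm \<phi> * norm \<psi>)"
    by (rule integral_mult_left_zero)
  finally have "norm (?T \<phi>) * norm (?T \<phi>) \<le> norm (?T \<phi>) * ((LINT \<zeta>|lborel. w \<zeta>) * B * norm \<phi>)"
    by (simp add: \<psi>_def mult_ac)
  moreover have "0 \<le> (LINT \<zeta>|lborel. w \<zeta>) * B * norm \<phi>"
    using w0 S(3) by simp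
  ultimately show "norm (?T \<phi>) \<le> (LINT \<zeta>|lborel. w \<zeta>) * B * norm \<phi>"
    by (cases "norm (?T \<phi>) = 0") (auto simp: mult_le_cancel_left)
qed

lemma integral_decay_translate:
  fixes c :: "'a::euclidean_space"
  shows "integrable lborel (\<lambda>x. K * decay (x - c))"
    and "(LINT x|lborel. K * decay (x - c)) = K * (LINT x|lborel. decay (x::'a))"
  using integrable_translation_iff[of "decay :: 'a \<Rightarrow> real" "- c"] integrable_decay[where 'a='a]
    integral_translation[of "decay :: 'a \<Rightarrow> real" "- c"] by auto

text \<open>Of the \<open>2 * DIM('a) + 1\<close> derivatives of \<open>g\<close>,
  \<open>2 * DIM('a)\<close> make the transform integrable and one pays for the factor growing with
  \<open>\<zeta>\<close>. The constant is uniform in the centre \<open>c\<close>, so it serves for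
  all cubes at once.\<close>

lemma commutator_bd_decay:
  "\<exists>C\<ge>0. \<forall>(S :: 'a::euclidean_space L2 \<Rightarrow>\<^sub>L 'a L2) B K c g.
    clinear_adj S \<longrightarrow> 0 \<le> B \<longrightarrow> (\<forall>b\<in>Basis. \<exists>R. mderiv b S R \<and> norm R \<le> B) \<longrightarrow>
    bd (2 * DIM('a) + 1) (\<lambda>x. K * decay (x - c)) g \<longrightarrow>
    norm (commutator (mult_op g) S) \<le> C * K * B"
proof -
  let ?d = "DIM('a)"
  let ?n = "2 * ?d + 1"
  define I where "I = (LINT x|lborel. decay (x::'a))"
  have I: "0 \<le> I" unfolding I_def using decay_pos by (intro Bochner_Integration.integral_nonneg) (auto intro: less_imp_le)
  \<comment> \<open>The power of \<open>2 * pi\<close> comes from Fourier inversion,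
    \<open>real ?d\<close> from bounding the sum of the coordinates by
    \<open>real ?d * (1 + norm \<zeta>)\<close>, and the rest from
    \<open>norm_ft_decay\<close>.\<close>
  define A where "A = (1 / (2 * pi) ^ ?d) * (real ?d * ((2 * real ?d) ^ ?n * I))"
  have A: "0 \<le> A" unfolding A_def using I by simp
  have main: "norm (commutator (mult_op g) S) \<le> (A * I) * K * B"
    if S: "clinear_adj S" "0 \<le> B" "\<forall>b\<in>Basis. \<exists>R. mderiv b S R \<and> norm R \<le> B"
      and g: "bd ?n (\<lambda>x. K * decay (x - c)) g" for S :: "'a L2 \<Rightarrow>\<^sub>L 'a L2" and B K c g
  proof -
    have gw: "g \<in> wiener"
      by (rule bd_decay_wiener[of K c]) (rule bd_order_mono[OF g], simp)
    then have bg: "bmeas g"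
      by (auto simp: wiener_def bmeas_def borel_measurable_continuous_onI)
    define G where "G \<zeta> = complex_of_real (1 / (2 * pi) ^ ?d) * ft (- 1) g \<zeta>" for \<zeta>
    have Gi: "integrable lborel G"
      unfolding G_def using gw by (intro integrable_mult_right) (simp add: wiener_def)
    have inv: "g x = (LINT \<zeta>|lborel. G \<zeta> * cis (\<zeta> \<bullet> x))" for x
    proof -
      have "(LINT \<zeta>|lborel. G \<zeta> * cis (\<zeta> \<bullet> x)) = (LINT \<zeta>|lborel. complex_of_real (1 / (2 * pi) ^ ?d) * (cis (1 * (\<zeta> \<bullet> x)) * ft (- 1) g \<zeta>))"
        by (intro Bochner_Integration.integral_cong refl) (simp add: G_def mult_ac)
      also have "\<dots> = complex_of_real (1 / (2 * pi) ^ ?d) * ft (- (- 1)) (ft (- 1) g) x"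
        by (subst integral_mult_right_zero) (simp add: ft_def[of "1"])
      also have "\<dots> = complex_of_real (1 / (2 * pi) ^ ?d) * (complex_of_real ((2 * pi) ^ ?d) * g x)"
        by (subst wiener_ft(1)[OF gw]) auto
      also have "\<dots> = g x"
        by (simp only: mult.assoc[symmetric] of_real_mult[symmetric]) simp
      finally show ?thesis by simp
    qed
    have le: "norm (G \<zeta>) * (\<Sum>b\<in>Basis. \<bar>\<zeta> \<bullet> b\<bar>) \<le> (A * K) * decay \<zeta>" for \<zeta>
    proof -
      have p: "0 < (1 + norm \<zeta>) ^ (2 * ?d)" by (simp add: add_pos_nonneg)
      have "(\<Sum>b\<in>Basis. \<bar>\<zeta> \<bullet> b\<bar>) \<le> real (card (Basis::'a set)) * (1 + norm \<zeta>)"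
        by (intro sum_bounded_above order_trans[OF Basis_le_norm]) auto
      then have "norm (G \<zeta>) * (\<Sum>b\<in>Basis. \<bar>\<zeta> \<bullet> b\<bar>) \<le> norm (G \<zeta>) * (real ?d * (1 + norm \<zeta>))"
        by (intro mult_left_mono) auto
      also have "\<dots> = (1 / (2 * pi) ^ ?d * real ?d) * ((1 + norm \<zeta>) * norm (ft (- 1) g \<zeta>))"
        by (simp add: G_def norm_mult norm_divide norm_power)
      also have "\<dots> \<le> (1 / (2 * pi) ^ ?d * real ?d) * (((2 * real ?d) ^ ?n * (K * I)) * (1 / (1 + norm \<zeta>) ^ (2 * ?d)))"
      proof (intro mult_left_mono le_mult_inverse[OF p])
        have "(1 + norm \<zeta>) ^ (2 * ?d) * ((1 + norm \<zeta>) * norm (ft (- 1) g \<zeta>)) = (1 + norm \<zeta>) ^ ?n * norm (ft (- 1) g \<zeta>)"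
          by (simp add: mult_ac)
        also have "\<dots> \<le> (2 * real ?d) ^ ?n * (LINT x|lborel. K * decay (x - c))"
          by (rule norm_ft_decay[OF g integral_decay_translate(1)]) simp
        finally show "(1 + norm \<zeta>) ^ (2 * ?d) * ((1 + norm \<zeta>) * norm (ft (- 1) g \<zeta>)) \<le> (2 * real ?d) ^ ?n * (K * I)"
          unfolding integral_decay_translate(2) I_def .
      qed simp
      also have "\<dots> = (A * K) * decay \<zeta>"
        by (simp only: A_def decay_def mult_ac)
      finally show ?thesis .
    qed
    have "norm (commutator (mult_op g) S) \<le> (LINT \<zeta>|lborel. (A * K) * decay (\<zeta>::'a)) * B"
      using S by (intro commutator_fourier_integral[OF Gi inv bg]) (auto intro!: le integrable_mult_right integrable_decay)
    also have "\<dots> = (A * I) * K * B"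
      by (simp add: I_def)
    finally show ?thesis .
  qed
  then show ?thesis
    using A I by (intro exI[of _ "A * I"]) auto
qed

subsection \<open>Localization to unit cubes\<close>

text \<open>The floor makes the cubes half-open, hence disjoint when different. Only the values of
  \<open>k\<close> on \<open>Basis\<close> matter, so sums over cubes take their indices from
  \<open>PiE\<close>.\<close>

definition cube :: "('a::euclidean_space \<Rightarrow> int) \<Rightarrow> 'a set" where
  "cube k = {x. \<forall>b\<in>Basis. \<lfloor>x \<bullet> b\<rfloor> = k b}"

definition corner :: "('a::euclidean_space \<Rightarrow> int) \<Rightarrow> 'a" where
  "corner k = (\<Sum>b\<in>Basis. real_of_int (k b) *\<^sub>R b)"

definition cube_op :: "('a::euclidean_space \<Rightarrow> int) \<Rightarrow> ('a L2 \<Rightarrow>\<^sub>L 'a L2)" where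
  "cube_op k = mult_op (indicator (cube k))"

lemma cube_borel [measurable]: "cube k \<in> sets borel"
proof -
  have "cube k = (\<Inter>b\<in>Basis. {x \<in> space borel. \<lfloor>x \<bullet> b\<rfloor> = k b})"
    by (auto simp: cube_def)
  also have "\<dots> \<in> sets borel"
    by (intro sets.finite_INT) (simp_all, measurable)
  finally show ?thesis .
qed

lemma bmeas_indicator [simp]: "A \<in> sets borel \<Longrightarrow> bmeas (indicator A)"
  by (rule bmeas_bound[of _ 1]) (auto simp: indicator_def)

lemma cube_inner: "x \<in> cube k \<Longrightarrow> b \<in> Basis \<Longrightarrow> real_of_int (k b) \<le> x \<bullet> b \<and> x \<bullet> b < real_of_int (k b) + 1"
  unfolding cube_def by (simp add: floor_eq_iff)

lemma corner_inner [simp]: "b \<in> Basis \<Longrightarrow> corner k \<bullet> b = real_of_int (k b)"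
  by (simp add: corner_def)

lemma cube_dist_corner:
  fixes x :: "'a::euclidean_space"
  assumes "x \<in> cube l" "\<And>b. b \<in> Basis \<Longrightarrow> \<bar>real_of_int (l b) - real_of_int (k b)\<bar> \<le> m"
  shows "norm (x - corner k) \<le> real DIM('a) * (1 + m)"
proof -
  have "norm (x - corner k) \<le> (\<Sum>b\<in>Basis. \<bar>(x - corner k) \<bullet> b\<bar>)"
    by (rule norm_le_l1)
  also have "\<dots> \<le> real (card (Basis::'a set)) * (1 + m)"
  proof (rule sum_bounded_above)
    fix b :: 'a assume b: "b \<in> Basis"
    show "\<bar>(x - corner k) \<bullet> b\<bar> \<le> 1 + m"
      using cube_inner[OF assms(1) b] assms(2)[OF b] unfolding inner_diff_left corner_inner[OF b] by linarith
  qed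
  finally show ?thesis .
qed

text \<open>\<open>L\<close> controls the derivatives of order 1 to \<open>n + 1\<close>, whereas
  \<open>v\<close> itself is merely bounded by some constant. The asymmetry is essential: the
  generators treated later are large but have small derivatives.\<close>

definition symbol :: "nat \<Rightarrow> real \<Rightarrow> ('a::euclidean_space \<Rightarrow> complex) \<Rightarrow> bool" where
  "symbol n L v \<longleftrightarrow> bmeas v \<and> (\<forall>x. v differentiable (at x)) \<and> (\<forall>b\<in>Basis. bd n (\<lambda>_. L) (pd b v))"

lemma symbol_nonneg: "symbol n L (v :: 'a::euclidean_space \<Rightarrow> complex) \<Longrightarrow> 0 \<le> L"
proof -
  assume v: "symbol n L v"
  obtain b :: 'a where "b \<in> Basis" using SOME_Basis by blast
  then have "bd n (\<lambda>_. L) (pd b v)" using v by (simp add: symbol_def)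
  from order_trans[OF norm_ge_zero bd_le[OF this]] show "0 \<le> L" .
qed

lemma symbol_lipschitz:
  fixes v :: "'a::euclidean_space \<Rightarrow> complex"
  assumes "symbol n L v"
  shows "norm (v x - v c) \<le> (L * real DIM('a)) * norm (x - c)"
proof (rule differentiable_bound[of UNIV v "\<lambda>x. frechet_derivative v (at x)"])
  fix x :: 'a
  have d: "v differentiable (at x)" using assms by (simp add: symbol_def)
  show "(v has_derivative frechet_derivative v (at x)) (at x within UNIV)"
    using frechet_derivative_works[THEN iffD1, OF d] by simp
  have lin: "linear (frechet_derivative v (at x))" by (rule linear_frechet_derivative[OF d])
  show "onorm (frechet_derivative v (at x)) \<le> L * real DIM('a)"
  proof (rule onorm_bound)
    show "0 \<le> L * real DIM('a)" using symbol_nonneg[OF assms] by simp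
    fix h :: 'a
    have "frechet_derivative v (at x) h = (\<Sum>b\<in>Basis. (h \<bullet> b) *\<^sub>R pd b v x)"
      using linear_sum[OF lin, of "\<lambda>b. (h \<bullet> b) *\<^sub>R b" Basis]
      by (simp add: euclidean_representation linear_scale[OF lin] pd_def)
    also have "norm \<dots> \<le> (\<Sum>b\<in>(Basis::'a set). norm h * L)"
    proof (rule sum_norm_le)
      fix b :: 'a assume b: "b \<in> Basis"
      have "bd n (\<lambda>_. L) (pd b v)" using assms b by (simp add: symbol_def)
      then have "norm (pd b v x) \<le> L" by (rule bd_le)
      then show "norm ((h \<bullet> b) *\<^sub>R pd b v x) \<le> norm h * L"
        using Basis_le_norm[OF b, of h] by (auto intro!: mult_mono)
    qed
    finally show "norm (frechet_derivative v (at x) h) \<le> L * real DIM('a) * norm h"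
      by (simp add: mult_ac)
  qed
qed auto

lemma pd_translate: "(\<And>x. f differentiable (at x)) \<Longrightarrow> pd b (\<lambda>x. f (x - c)) = (\<lambda>x. pd b f (x - c))"
proof
  fix x assume d: "\<And>x. f differentiable (at x)"
  have "((\<lambda>x. f (x - c)) has_derivative frechet_derivative f (at (x - c))) (at x)"
    using has_derivative_compose[of "\<lambda>x. x - c" "\<lambda>h. h" x UNIV f] d[of "x - c"]
    by (simp add: frechet_derivative_works has_derivative_diff[OF has_derivative_ident has_derivative_const, simplified])
  then show "pd b (\<lambda>x. f (x - c)) x = pd b f (x - c)"
    by (simp add: has_derivative_imp_pd) (simp add: pd_def)
qed

lemma differentiable_translate:
  assumes "\<And>x. f differentiable (at x)"
  shows "(\<lambda>x. f (x - c)) differentiable (at x)"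
proof -
  have "((\<lambda>x. f (x - c)) has_derivative frechet_derivative f (at (x - c))) (at x)"
    using has_derivative_compose[of "\<lambda>x. x - c" "\<lambda>h. h" x UNIV f] assms[of "x - c"]
    by (simp add: frechet_derivative_works has_derivative_diff[OF has_derivative_ident has_derivative_const, simplified])
  then show ?thesis by (rule differentiableI)
qed

lemma bd_translate: "bd n w f \<Longrightarrow> bd n (\<lambda>x. w (x - c)) (\<lambda>x. f (x - c))"
proof (induction n arbitrary: f)
  case 0
  have "continuous_on UNIV (\<lambda>x. x - c)" by (intro continuous_intros)
  then show ?case
    using 0 continuous_on_compose2[of UNIV f UNIV "\<lambda>x. x - c"] by auto
next
  case (Suc n)
  then show ?case
    by (auto simp: pd_translate differentiable_translate)
qed

text \<open>Subtracting the value at \<open>c\<close> replaces the size of \<open>v\<close>, which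
  \<open>L\<close> does not control, by a linear weight with factor \<open>L\<close>. The Lipschitz
  bound supplies order 0, hence \<open>Suc n\<close>.\<close>

lemma bd_diff_const: "symbol n L v \<Longrightarrow> bd (Suc n) (\<lambda>x. L * real DIM('a) * (1 + norm (x - c))) (\<lambda>x. v x - v (c::'a::euclidean_space))"
  unfolding bd.simps
proof (intro conjI allI ballI)
  assume v: "symbol n L v"
  have d: "v differentiable (at x)" for x using v by (simp add: symbol_def)
  have L: "0 \<le> L" by (rule symbol_nonneg[OF v])
  show "(\<lambda>x. v x - v c) differentiable (at x)" for x
    by (intro differentiable_diff d differentiable_const)
  show "norm (v x - v c) \<le> L * real DIM('a) * (1 + norm (x - c))" for x
    by (rule order_trans[OF symbol_lipschitz[OF v]]) (use L in \<open>auto intro!: mult_left_mono\<close>)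
  fix b :: 'a assume b: "b \<in> Basis"
  have "pd b (\<lambda>x. v x - v c) = pd b v"
    using pd_add[of v "\<lambda>x. - v c" b] d by (simp add: pd_const)
  moreover have "bd n (\<lambda>x. L * real DIM('a) * (1 + norm (x - c))) (pd b v)"
  proof (rule bd_mono)
    show "bd n (\<lambda>_. L) (pd b v)" using v b by (simp add: symbol_def)
    have "1 \<le> real DIM('a)" using DIM_positive[where 'a='a] by linarith
    then have "1 * 1 \<le> real DIM('a) * (1 + norm (x - c))" for x
      by (intro mult_mono) auto
    from mult_left_mono[OF this L] show "L \<le> L * real DIM('a) * (1 + norm (x - c))" for x
      by (simp add: mult_ac)
  qed
  ultimately show "bd n (\<lambda>x. L * real DIM('a) * (1 + norm (x - c))) (pd b (\<lambda>x. v x - v c))"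
    by simp
qed

text \<open>\<open>cube_op k\<close> factors into a Gaussian \<open>g\<close> at the corner
  \<open>c\<close> of the cube and the inverse of \<open>g\<close> restricted to the cube, and
  \<open>v\<close> may be replaced by \<open>v' = v - v c\<close> because constants commute with
  \<open>S\<close>. Now [V', S] G = [V' G, S] - V' [G, S]. Both commutators on the right fall under
  \<open>commutator_bd_decay\<close>; the remaining \<open>V'\<close> is taken on cube
  \<open>l\<close>, where the Lipschitz bound costs the factor \<open>1 + m\<close>.\<close>

lemma cube_commutator:
  "\<exists>C\<ge>0. \<forall>(S :: 'a::euclidean_space L2 \<Rightarrow>\<^sub>L 'a L2) B L v k l m.
    clinear_adj S \<longrightarrow> 0 \<le> B \<longrightarrow> (\<forall>b\<in>Basis. \<exists>R. mderiv b S R \<and> norm R \<le> B) \<longrightarrow>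
    symbol (2 * DIM('a)) L v \<longrightarrow> (\<forall>b\<in>Basis. \<bar>real_of_int (l b) - real_of_int (k b)\<bar> \<le> m) \<longrightarrow>
    norm (cube_op l o\<^sub>L commutator (mult_op v) S o\<^sub>L cube_op k) \<le> C * L * B * (1 + m)"
proof -
  let ?d = "real DIM('a)"
  let ?n = "2 * DIM('a) + 1"
  obtain C0 where C0: "0 \<le> C0" and FC: "\<And>(S :: 'a L2 \<Rightarrow>\<^sub>L 'a L2) B K c g.
      clinear_adj S \<Longrightarrow> 0 \<le> B \<Longrightarrow> \<forall>b\<in>Basis. \<exists>R. mderiv b S R \<and> norm R \<le> B \<Longrightarrow>
      bd ?n (\<lambda>x. K * decay (x - c)) g \<Longrightarrow> norm (commutator (mult_op g) S) \<le> C0 * K * B"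
    using commutator_bd_decay[where 'a='a] by blast
  obtain CG where CG: "0 \<le> CG" and gbd: "bd ?n (\<lambda>x. CG / (1 + norm x) ^ ?n) (\<lambda>x::'a. complex_of_real (gauss x))"
    using schwartz_bd[OF gauss_schwartz, of ?n ?n] by blast
  \<comment> \<open>A bound for \<open>1 / gauss (x - c)\<close> on the cube, whose points have
    distance at most \<open>?d\<close> from the corner.\<close>
  define E where "E = exp (?d\<^sup>2 / 2)"
  define C where "C = (C0 * CG * E) * (2 ^ ?n * ?d + ?d * ?d)"
  have C: "0 \<le> C" using C0 CG by (simp add: C_def E_def)
  have main: "norm (cube_op l o\<^sub>L commutator (mult_op v) S o\<^sub>L cube_op k) \<le> C * L * B * (1 + m)"
    if S: "clinear_adj S" "0 \<le> B" "\<forall>b\<in>Basis. \<exists>R. mderiv b S R \<and> norm R \<le> B"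
      and v: "symbol (2 * DIM('a)) L v" and m: "\<forall>b\<in>Basis. \<bar>real_of_int (l b) - real_of_int (k b)\<bar> \<le> m"
    for S :: "'a L2 \<Rightarrow>\<^sub>L 'a L2" and B L v k l m
  proof -
    have L: "0 \<le> L" by (rule symbol_nonneg[OF v])
    have m0: "0 \<le> m"
      using m SOME_Basis abs_ge_zero order_trans by metis
    define c where "c = (corner k :: 'a)"
    define v' where "v' x = v x - v c" for x
    define g where "g x = complex_of_real (gauss (x - c))" for x
    define e where "e x = indicator (cube k) x * complex_of_real (1 / gauss (x - c))" for x
    have bv: "bmeas v" using v by (simp add: symbol_def)
    have bv': "bmeas v'" using bv by (simp add: v'_def[abs_def])
    have [measurable]: "(\<lambda>x::'a. gauss (x - c)) \<in> borel_measurable borel"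
      by measurable
    have bg: "bmeas g"
      unfolding g_def by (rule bmeas_bound[of _ 1]) (auto simp: gauss_le_1)
    have e_le: "norm (e x) \<le> E" for x
    proof (cases "x \<in> cube k")
      case True
      have "norm (x - c) \<le> ?d * (1 + 0)"
        unfolding c_def by (rule cube_dist_corner[OF True]) simp
      then have "(norm (x - c))\<^sup>2 \<le> ?d\<^sup>2"
        by (intro power_mono) auto
      then show ?thesis
        using True by (simp add: e_def E_def gauss_def norm_mult norm_divide exp_minus field_simps flip: exp_add)
    next
      case False
      then show ?thesis by (simp add: e_def E_def)
    qed
    have be: "bmeas e"
      by (rule bmeas_bound[OF _ e_le]) (unfold e_def, measurable)
    have g1: "bd ?n (\<lambda>x. CG * decay (x - c)) g"
    proof -
      have "CG / (1 + norm y) ^ ?n \<le> CG * decay y" for y :: 'a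
        using CG unfolding decay_def times_divide_eq_right mult_1_right
        by (intro divide_left_mono power_increasing) (auto simp: add_pos_nonneg)
      then show ?thesis
        unfolding g_def by (intro bd_translate bd_mono[OF gbd])
    qed
    \<comment> \<open>The Gaussian is used with decay of order \<open>2 * DIM('a) + 1\<close>; the
      surplus power absorbs the linear growth of \<open>v'\<close>.\<close>
    have g2: "bd ?n (\<lambda>x. (2 ^ ?n * L * ?d * CG) * decay (x - c)) (\<lambda>x. v' x * g x)"
    proof -
      have "bd ?n (\<lambda>x. L * ?d * (1 + norm (x - c))) v'"
        using bd_diff_const[OF v, of c] by (simp add: v'_def[abs_def])
      moreover have "bd ?n (\<lambda>x. CG / (1 + norm (x - c)) ^ ?n) g"
        unfolding g_def by (rule bd_translate[OF gbd])
      ultimately have "bd ?n (\<lambda>x. 2 ^ ?n * ((L * ?d * (1 + norm (x - c))) * (CG / (1 + norm (x - c)) ^ ?n))) (\<lambda>x. v' x * g x)"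
        by (rule bd_mult)
      moreover have "2 ^ ?n * ((L * ?d * (1 + norm y)) * (CG / (1 + norm y) ^ ?n)) = (2 ^ ?n * L * ?d * CG) * decay y" for y :: 'a
      proof -
        have "1 + norm y \<noteq> 0" using norm_ge_zero[of y] by linarith
        then show ?thesis by (simp add: decay_def)
      qed
      ultimately show ?thesis by (simp only:)
    qed
    let ?V' = "mult_op v'" and ?G = "mult_op g" and ?H = "mult_op (\<lambda>x. v' x * g x)" and ?E = "mult_op e"
    have comm: "commutator (mult_op v) S = commutator ?V' S"
    proof -
      have "mult_op v = ?V' + mult_op (\<lambda>_. v c)"
        using bv' by (simp add: mult_op_add v'_def)
      moreover have "mult_op (\<lambda>_. v c) o\<^sub>L S = S o\<^sub>L mult_op (\<lambda>_. v c)"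
        using S(1) by (simp add: clinear_adj_def)
      ultimately show ?thesis
        by (simp add: commutator_def blinfun_compose_simps)
    qed
    have GE: "?G o\<^sub>L ?E = cube_op k"
    proof -
      have "(\<lambda>x. g x * e x) = indicator (cube k)"
        by (simp add: g_def e_def fun_eq_iff less_imp_neq[OF gauss_pos, THEN not_sym])
      then show ?thesis using bg be by (simp add: mult_op_compose cube_op_def)
    qed
    have VG: "?V' o\<^sub>L ?G = ?H"
      using bv' bg by (simp add: mult_op_compose)
    have split: "commutator ?V' S o\<^sub>L ?G = commutator ?H S - (?V' o\<^sub>L commutator ?G S)"
    proof -
      have "commutator ?V' S o\<^sub>L ?G = (?V' o\<^sub>L (S o\<^sub>L ?G)) - (S o\<^sub>L (?V' o\<^sub>L ?G))"
        by (simp add: commutator_def blinfun_compose_simps blinfun_compose_assoc)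
      moreover have "?V' o\<^sub>L commutator ?G S = ((?V' o\<^sub>L ?G) o\<^sub>L S) - (?V' o\<^sub>L (S o\<^sub>L ?G))"
        by (simp add: commutator_def blinfun_compose_simps blinfun_compose_assoc)
      ultimately show ?thesis
        unfolding VG by (simp add: commutator_def)
    qed
    have eq: "cube_op l o\<^sub>L commutator (mult_op v) S o\<^sub>L cube_op k
        = (cube_op l o\<^sub>L commutator ?H S o\<^sub>L ?E) - ((cube_op l o\<^sub>L ?V') o\<^sub>L commutator ?G S o\<^sub>L ?E)"
      unfolding comm GE[symmetric]
      by (simp only: blinfun_compose_assoc[symmetric])
        (simp only: blinfun_compose_assoc[of _ "commutator ?V' S" ?G] split blinfun_compose_simps blinfun_compose_assoc)
    have nE: "norm ?E \<le> E" by (rule norm_mult_op_le[OF e_le])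
    have nl: "norm (cube_op l :: 'a L2 \<Rightarrow>\<^sub>L 'a L2) \<le> 1"
      unfolding cube_op_def by (rule norm_mult_op_le) (simp add: indicator_def)
    have nV: "norm (cube_op l o\<^sub>L ?V') \<le> L * ?d * (?d * (1 + m))"
    proof -
      have "norm (indicator (cube l) x * v' x) \<le> L * ?d * (?d * (1 + m))" for x
      proof (cases "x \<in> cube l")
        case True
        have "norm (v' x) \<le> (L * ?d) * norm (x - c)"
          unfolding v'_def by (rule symbol_lipschitz[OF v])
        also have "\<dots> \<le> (L * ?d) * (?d * (1 + m))"
          unfolding c_def using m L by (intro mult_left_mono cube_dist_corner[OF True]) auto
        finally show ?thesis using True by simp
      next
        case False
        then show ?thesis using L m0 by simp
      qed
      then show ?thesis
        using bv' by (simp add: cube_op_def mult_op_compose norm_mult_op_le)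
    qed
    have n1: "norm (commutator ?H S) \<le> C0 * (2 ^ ?n * L * ?d * CG) * B"
      by (rule FC[OF S g2])
    have n2: "norm (commutator ?G S) \<le> C0 * CG * B"
      by (rule FC[OF S g1])
    have "norm (cube_op l o\<^sub>L commutator (mult_op v) S o\<^sub>L cube_op k)
        \<le> (1 * (C0 * (2 ^ ?n * L * ?d * CG) * B)) * E + (L * ?d * (?d * (1 + m)) * (C0 * CG * B)) * E"
      unfolding eq
      by (rule order_trans[OF norm_triangle_ineq4]) (intro add_mono norm_compose_le nl n1 n2 nE nV)
    also have "\<dots> = (C0 * CG * E * L * B) * (2 ^ ?n * ?d * 1) + (C0 * CG * E * L * B) * (?d * ?d * (1 + m))"
      by (simp add: mult_ac)
    also have "\<dots> \<le> (C0 * CG * E * L * B) * (2 ^ ?n * ?d * (1 + m)) + (C0 * CG * E * L * B) * (?d * ?d * (1 + m))"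
      using C0 CG L S(2) m0 by (intro add_right_mono mult_left_mono) (auto simp: E_def)
    also have "\<dots> = C * L * B * (1 + m)"
      by (simp add: C_def distrib_left distrib_right mult_ac)
    finally show ?thesis .
  qed
  then show ?thesis
    using C by (intro exI[of _ C]) auto
qed

section \<open>Decay of the blocks off the diagonal\<close>

lemma cis_taylor: "norm (cis \<theta> - 1 - \<i> * complex_of_real \<theta>) \<le> \<theta>\<^sup>2 / 2"
  using iexp_approx1[of \<theta> 1] by (simp add: cis_conv_exp power2_eq_square fact_numeral algebra_simps)

text \<open>The coordinate \<open>x \<bullet> b\<close> is unbounded as a multiplier but bounded on
  a single cube, so the modulation becomes differentiable in norm after localization.\<close>

lemma cube_modulation_derivative:
  fixes b :: "'a::euclidean_space"
  assumes b: "b \<in> Basis"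
  shows "((\<lambda>r. mult_op (\<lambda>x. cis (s * r * (x \<bullet> b)) * indicator (cube k) x)) has_vector_derivative
      mult_op (\<lambda>x. \<i> * complex_of_real (s * (x \<bullet> b)) * indicator (cube k) x)) (at 0)"
proof -
  let ?X = "\<bar>real_of_int (k b)\<bar> + 1"
  have X: "\<bar>x \<bullet> b\<bar> \<le> ?X" if "x \<in> cube k" for x
    using cube_inner[OF that b] by linarith
  have bm: "bmeas (\<lambda>x. \<i> * complex_of_real (s * (x \<bullet> b)) * indicator (cube k) x)"
  proof (rule bmeas_bound)
    show "norm (\<i> * complex_of_real (s * (x \<bullet> b)) * indicator (cube k) x) \<le> \<bar>s\<bar> * ?X" for x
      using X[of x] by (cases "x \<in> cube k") (auto simp: norm_mult abs_mult intro!: mult_left_mono)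
  qed measurable
  have bc: "bmeas (\<lambda>x. cis (s * r * (x \<bullet> b)) * indicator (cube k) x)" for r
    by (intro bmeas_mult bmeas_indicator bmeas_bound[of _ 1]) auto
  show ?thesis
  proof (rule has_vector_derivative_quadratic[of _ _ "(s * ?X)\<^sup>2 / 2"])
    fix r :: real
    have "norm (cis (s * r * (x \<bullet> b)) * indicator (cube k) x - cis (s * 0 * (x \<bullet> b)) * indicator (cube k) x
        - r *\<^sub>R (\<i> * complex_of_real (s * (x \<bullet> b)) * indicator (cube k) x)) \<le> (s * ?X)\<^sup>2 / 2 * r\<^sup>2" for x
    proof (cases "x \<in> cube k")
      case True
      have "norm (cis (s * r * (x \<bullet> b)) - 1 - \<i> * complex_of_real (s * r * (x \<bullet> b))) \<le> (s * r * (x \<bullet> b))\<^sup>2 / 2"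
        by (rule cis_taylor)
      also have "\<dots> = (s * r)\<^sup>2 * \<bar>x \<bullet> b\<bar>\<^sup>2 / 2"
        by (simp add: power_mult_distrib)
      also have "\<dots> \<le> (s * r)\<^sup>2 * ?X\<^sup>2 / 2"
        using X[OF True] by (intro divide_right_mono mult_left_mono power_mono) auto
      also have "\<dots> = (s * ?X)\<^sup>2 / 2 * r\<^sup>2"
        by (simp add: power_mult_distrib mult_ac)
      finally show ?thesis
        using True by (simp add: scaleR_conv_of_real mult_ac)
    qed simp
    then show "norm (mult_op (\<lambda>x. cis (s * r * (x \<bullet> b)) * indicator (cube k) x)
        - mult_op (\<lambda>x. cis (s * 0 * (x \<bullet> b)) * indicator (cube k) x)
        - r *\<^sub>R mult_op (\<lambda>x. \<i> * complex_of_real (s * (x \<bullet> b)) * indicator (cube k) x)) \<le> (s * ?X)\<^sup>2 / 2 * r\<^sup>2"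
      by (simp only: mult_op_scaleR[OF bm] mult_op_diff[OF bc bc] mult_op_diff[OF bmeas_diff[OF bc bc] bmeas_scaleR[OF bm]])
        (rule norm_mult_op_le)
  qed
qed

text \<open>Up to the imaginary unit and a sign, the derivation is the commutator with
  multiplication by \<open>x \<bullet> b\<close>. Between the two cubes this coordinate may be
  replaced by \<open>k b\<close> on one side and by \<open>l b\<close> on the other, with an error
  of at most 1 each; this accounts for the \<open>- 2\<close>.\<close>

lemma cube_decay:
  fixes T :: "'a::euclidean_space L2 \<Rightarrow>\<^sub>L 'a L2"
  assumes T: "clinear_adj T" "mderiv b T R" and b: "b \<in> Basis"
  shows "(\<bar>real_of_int (k b) - real_of_int (l b)\<bar> - 2) * norm (cube_op l o\<^sub>L T o\<^sub>L cube_op k) \<le> norm (cube_op l o\<^sub>L R o\<^sub>L cube_op k)"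
proof -
  define J where "J z = (mult_op (\<lambda>_. \<i> * complex_of_real z) :: 'a L2 \<Rightarrow>\<^sub>L 'a L2)" for z
  define X where "X k = (mult_op (\<lambda>x. \<i> * complex_of_real (x \<bullet> b) * indicator (cube k) x) :: 'a L2 \<Rightarrow>\<^sub>L 'a L2)" for k
  define Y where "Y k = (mult_op (\<lambda>x. \<i> * complex_of_real (x \<bullet> b - k b) * indicator (cube k) x) :: 'a L2 \<Rightarrow>\<^sub>L 'a L2)" for k
  have bX: "bmeas (\<lambda>x. \<i> * complex_of_real (x \<bullet> b) * indicator (cube k) x)" for k :: "'a \<Rightarrow> int"
  proof (rule bmeas_bound)
    show "norm (\<i> * complex_of_real (x \<bullet> b) * indicator (cube k) x) \<le> \<bar>real_of_int (k b)\<bar> + 1" for x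
      using cube_inner[OF _ b, of x k] by (cases "x \<in> cube k") (auto simp: norm_mult)
  qed measurable
  have Yle: "norm (\<i> * complex_of_real (x \<bullet> b - k b) * indicator (cube k) x) \<le> 1" for x and k :: "'a \<Rightarrow> int"
    using cube_inner[OF _ b, of x k] by (cases "x \<in> cube k") (auto simp: norm_mult simp del: of_real_diff)
  have bY: "bmeas (\<lambda>x. \<i> * complex_of_real (x \<bullet> b - k b) * indicator (cube k) x)" for k :: "'a \<Rightarrow> int"
    by (rule bmeas_bound[OF _ Yle]) measurable
  have nY: "norm (Y k) \<le> 1" for k
    unfolding Y_def by (rule norm_mult_op_le[OF Yle])
  have XY1: "X k = (J (k b) o\<^sub>L cube_op k) + (cube_op k o\<^sub>L Y k)" for k
    unfolding X_def J_def cube_op_def Y_def using bY[of k]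
    by (simp add: mult_op_compose mult_op_add del: of_real_diff, intro arg_cong[where f=mult_op])
      (auto simp: fun_eq_iff algebra_simps split: split_indicator)
  have XY2: "X k = (J (k b) o\<^sub>L cube_op k) + (Y k o\<^sub>L cube_op k)" for k
    unfolding X_def J_def cube_op_def Y_def using bY[of k]
    by (simp add: mult_op_compose mult_op_add del: of_real_diff, intro arg_cong[where f=mult_op])
      (auto simp: fun_eq_iff algebra_simps split: split_indicator)
  have JT: "J z o\<^sub>L T = T o\<^sub>L J z" for z
    using T(1) by (simp add: clinear_adj_def J_def)
  have Jc: "J z o\<^sub>L cube_op l = cube_op l o\<^sub>L J z" for z
    by (simp add: J_def cube_op_def mult_op_compose mult.commute)
  let ?T = "cube_op l o\<^sub>L T o\<^sub>L cube_op k" and ?R = "cube_op l o\<^sub>L R o\<^sub>L cube_op k"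
  have d1: "((\<lambda>r. cube_op l o\<^sub>L modconj (r *\<^sub>R b) T o\<^sub>L cube_op k) has_vector_derivative ?R) (at 0)"
  proof -
    have "bounded_linear (\<lambda>A. cube_op l o\<^sub>L A o\<^sub>L (cube_op k :: 'a L2 \<Rightarrow>\<^sub>L 'a L2))"
    proof (rule bounded_linear_intro)
      show "norm (cube_op l o\<^sub>L A o\<^sub>L (cube_op k :: 'a L2 \<Rightarrow>\<^sub>L 'a L2)) \<le> norm A * (norm (cube_op l :: 'a L2 \<Rightarrow>\<^sub>L 'a L2) * norm (cube_op k :: 'a L2 \<Rightarrow>\<^sub>L 'a L2))" for A :: "'a L2 \<Rightarrow>\<^sub>L 'a L2"
        using norm_compose_le[OF norm_blinfun_compose order_refl, of "cube_op l" A "cube_op k"] by (simp add: mult_ac)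
    qed (simp_all add: blinfun_compose_simps)
    then show ?thesis
      using T(2) unfolding mderiv_def by (rule bounded_linear.has_vector_derivative)
  qed
  let ?A = "\<lambda>r. mult_op (\<lambda>x. cis (- 1 * r * (x \<bullet> b)) * indicator (cube l) x) :: 'a L2 \<Rightarrow>\<^sub>L 'a L2"
  let ?B = "\<lambda>r. mult_op (\<lambda>x. cis (1 * r * (x \<bullet> b)) * indicator (cube k) x) :: 'a L2 \<Rightarrow>\<^sub>L 'a L2"
  have AB: "cube_op l o\<^sub>L modconj (r *\<^sub>R b) T o\<^sub>L cube_op k = (?A r o\<^sub>L T) o\<^sub>L ?B r" for r
  proof -
    have "?A r = cube_op l o\<^sub>L modulation (- (r *\<^sub>R b))" "?B r = modulation (r *\<^sub>R b) o\<^sub>L cube_op k"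
      by (simp_all only: cube_op_def modulation_def mult_op_compose bmeas_cis bmeas_indicator cube_borel)
        (simp_all add: inner_commute mult.commute)
    then show ?thesis by (simp add: modconj_def blinfun_compose_assoc)
  qed
  have X': "mult_op (\<lambda>x. \<i> * complex_of_real (- 1 * (x \<bullet> b)) * indicator (cube l) x) = - X l"
    using mult_op_scaleR[OF bX[of l], of "-1"] by (simp add: X_def)
  have dA: "(?A has_vector_derivative - X l) (at 0)"
    using cube_modulation_derivative[OF b, of "-1" l] unfolding X' .
  have dB: "(?B has_vector_derivative X k) (at 0)"
    using cube_modulation_derivative[OF b, of 1 k] by (simp add: X_def)
  have "((\<lambda>r. (?A r o\<^sub>L T) o\<^sub>L ?B r) has_vector_derivative ((?A 0 o\<^sub>L T) o\<^sub>L X k) + ((- X l o\<^sub>L T) o\<^sub>L ?B 0)) (at 0)"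
  proof (rule bounded_bilinear.has_vector_derivative[OF bounded_bilinear_blinfun_compose _ dB])
    from bounded_bilinear.has_vector_derivative[OF bounded_bilinear_blinfun_compose dA has_vector_derivative_const[of T]]
    show "((\<lambda>r. ?A r o\<^sub>L T) has_vector_derivative (- X l o\<^sub>L T)) (at 0)"
      by (simp add: blinfun_compose_simps)
  qed
  then have "?R = ((?A 0 o\<^sub>L T) o\<^sub>L X k) + ((- X l o\<^sub>L T) o\<^sub>L ?B 0)"
    using d1 unfolding AB by (rule vector_derivative_unique_at[rotated])
  also have "\<dots> = (cube_op l o\<^sub>L T o\<^sub>L X k) - (X l o\<^sub>L T o\<^sub>L cube_op k)"
    by (simp add: cube_op_def blinfun_compose_simps)
  also have "cube_op l o\<^sub>L T o\<^sub>L X k = (J (k b) o\<^sub>L ?T) + (?T o\<^sub>L Y k)"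
  proof -
    have "cube_op l o\<^sub>L T o\<^sub>L (J (k b) o\<^sub>L cube_op k) = J (k b) o\<^sub>L ?T"
    proof -
      have "cube_op l o\<^sub>L T o\<^sub>L (J (k b) o\<^sub>L cube_op k) = cube_op l o\<^sub>L (T o\<^sub>L J (k b)) o\<^sub>L cube_op k"
        by (simp only: blinfun_compose_assoc)
      also have "\<dots> = (cube_op l o\<^sub>L J (k b)) o\<^sub>L T o\<^sub>L cube_op k"
        by (simp only: JT[symmetric] blinfun_compose_assoc)
      finally show ?thesis
        by (simp only: Jc[symmetric] blinfun_compose_assoc)
    qed
    then show ?thesis
      unfolding XY1 by (simp add: blinfun_compose_simps blinfun_compose_assoc)
  qed
  also have "X l o\<^sub>L T o\<^sub>L cube_op k = (J (l b) o\<^sub>L ?T) + (Y l o\<^sub>L ?T)"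
    unfolding XY2 by (simp add: blinfun_compose_simps blinfun_compose_assoc)
  finally have R: "?R = (J (real_of_int (k b) - real_of_int (l b)) o\<^sub>L ?T) + (?T o\<^sub>L Y k) - (Y l o\<^sub>L ?T)"
  proof -
    have "J (real_of_int (k b) - real_of_int (l b)) = J (k b) - J (l b)"
      by (simp add: J_def mult_op_diff right_diff_distrib)
    moreover assume "?R = (J (k b) o\<^sub>L ?T) + (?T o\<^sub>L Y k) - ((J (l b) o\<^sub>L ?T) + (Y l o\<^sub>L ?T))"
    ultimately show ?thesis
      by (simp add: blinfun_compose_simps)
  qed
  \<comment> \<open>\<open>J z\<close> has the inverse \<open>J (- 1 / z)\<close>, whose norm is at
    most \<open>1 / \<bar>z\<bar>\<close>.\<close>
  have Jn: "\<bar>z\<bar> * norm A \<le> norm (J z o\<^sub>L A)" for z and A :: "'a L2 \<Rightarrow>\<^sub>L 'a L2"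
  proof (cases "z = 0")
    case False
    have "J (- 1 / z) o\<^sub>L J z = id_blinfun"
      using False by (simp add: J_def mult_op_compose mult_op_1)
    then have "A = J (- 1 / z) o\<^sub>L (J z o\<^sub>L A)"
      by (simp add: blinfun_compose_assoc[symmetric])
    moreover have "norm (J (- 1 / z)) \<le> 1 / \<bar>z\<bar>"
      unfolding J_def by (rule norm_mult_op_le) (simp add: norm_mult norm_divide)
    ultimately have "norm A \<le> 1 / \<bar>z\<bar> * norm (J z o\<^sub>L A)"
      by (metis norm_compose_le order_refl)
    then show ?thesis
      using False by (simp add: field_simps)
  qed simp
  have "J (real_of_int (k b) - real_of_int (l b)) o\<^sub>L ?T = ?R - (?T o\<^sub>L Y k) + (Y l o\<^sub>L ?T)"
    by (simp add: R)
  also have "norm \<dots> \<le> (norm ?R + norm ?T * 1) + 1 * norm ?T"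
    by (intro norm_triangle_mono order_trans[OF norm_triangle_ineq4] add_mono norm_compose_le nY order_refl)
  finally have "\<bar>real_of_int (k b) - real_of_int (l b)\<bar> * norm ?T \<le> norm ?R + 2 * norm ?T"
    using Jn[of "real_of_int (k b) - real_of_int (l b)" ?T] by linarith
  then show ?thesis by (simp add: left_diff_distrib)
qed

section \<open>Summation over the blocks\<close>

lemma mult_le_half_squares: "a * b \<le> (a\<^sup>2 + b\<^sup>2) / 2" for a b :: real
  using sum_squares_bound[of a b] by simp

text \<open>After a shift by \<open>l\<close>, \<open>J\<close> splits into nonnegative and negative
  integers, and each part injects into the naturals by the absolute value.\<close>

lemma int_inverse_square_sum:
  "\<exists>Z\<ge>0. \<forall>(J :: int set) l. finite J \<longrightarrow> (\<Sum>j\<in>J. 1 / (1 + (real_of_int j - real_of_int l)\<^sup>2)) \<le> Z"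
proof -
  let ?f = "\<lambda>n. 1 / (1 + (real n)\<^sup>2)"
  have summ: "summable ?f"
  proof (rule summable_comparison_test)
    show "summable (\<lambda>n. inverse ((real n)\<^sup>2))"
      by (rule inverse_power_summable) simp
    show "\<exists>N. \<forall>n\<ge>N. norm (?f n) \<le> inverse ((real n)\<^sup>2)"
      by (intro exI[of _ 1]) (auto simp: inverse_eq_divide intro!: divide_left_mono mult_pos_pos add_pos_nonneg)
  qed
  define Z where "Z = suminf ?f"
  have Z: "0 \<le> Z" unfolding Z_def by (intro suminf_nonneg summ) simp
  have half: "(\<Sum>j\<in>J. 1 / (1 + (real_of_int j)\<^sup>2)) \<le> Z"
    if "finite J" "(\<forall>j\<in>J. 0 \<le> j) \<or> (\<forall>j\<in>J. j < 0)" for J :: "int set"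
  proof -
    have inj: "inj_on (\<lambda>j. nat \<bar>j\<bar>) J"
    proof (rule inj_onI)
      fix i j assume ij: "i \<in> J" "j \<in> J" "nat \<bar>i\<bar> = nat \<bar>j\<bar>"
      then have "\<bar>i\<bar> = \<bar>j\<bar>" by simp
      moreover have "(0 \<le> i \<and> 0 \<le> j) \<or> (i < 0 \<and> j < 0)"
        using that(2) ij(1,2) by blast
      ultimately show "i = j" by linarith
    qed
    have "(\<Sum>j\<in>J. 1 / (1 + (real_of_int j)\<^sup>2)) = (\<Sum>j\<in>J. ?f (nat \<bar>j\<bar>))"
      by (intro sum.cong refl) (simp add: of_nat_nat)
    also have "\<dots> = (\<Sum>n\<in>(\<lambda>j. nat \<bar>j\<bar>) ` J. ?f n)"
      by (simp add: sum.reindex[OF inj])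
    also have "\<dots> \<le> Z"
      unfolding Z_def by (intro sum_le_suminf summ) (use that in auto)
    finally show ?thesis .
  qed
  have "(\<Sum>j\<in>J. 1 / (1 + (real_of_int j - real_of_int l)\<^sup>2)) \<le> 2 * Z" if J: "finite J" for J :: "int set" and l
  proof -
    let ?J = "(\<lambda>j. j - l) ` J"
    have "(\<Sum>j\<in>J. 1 / (1 + (real_of_int j - real_of_int l)\<^sup>2)) = (\<Sum>j\<in>?J. 1 / (1 + (real_of_int j)\<^sup>2))"
      by (subst sum.reindex) (auto simp: inj_on_def)
    also have "\<dots> = (\<Sum>j\<in>?J \<inter> {0..}. 1 / (1 + (real_of_int j)\<^sup>2)) + (\<Sum>j\<in>?J \<inter> {..<0}. 1 / (1 + (real_of_int j)\<^sup>2))"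
      using J by (subst sum.union_disjoint[symmetric]) (auto intro!: sum.cong)
    also have "\<dots> \<le> Z + Z"
      using J by (intro add_mono half) auto
    finally show ?thesis by simp
  qed
  then show ?thesis
    using Z by (intro exI[of _ "2 * Z"]) auto
qed

lemma cube_disjoint: "k \<in> PiE Basis A \<Longrightarrow> l \<in> PiE Basis A \<Longrightarrow> x \<in> cube k \<Longrightarrow> x \<in> cube l \<Longrightarrow> k = l"
  by (rule PiE_ext) (auto simp: cube_def)

lemma cube_op_idem: "cube_op k o\<^sub>L cube_op k = cube_op k"
proof -
  have "(\<lambda>x. indicator (cube k) x * indicator (cube k) x :: complex) = indicator (cube k)"
    by (auto simp: indicator_def)
  then show ?thesis by (simp add: cube_op_def mult_op_compose)
qed

lemma cube_op_adjoint: "cube_op k \<phi> \<bullet> \<psi> = \<phi> \<bullet> cube_op k \<psi>"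
proof -
  have "(\<lambda>x. cnj (indicator (cube k) x)) = indicator (cube k)"
    by (auto simp: indicator_def)
  then show ?thesis
    using mult_op_adjoint[OF bmeas_indicator[OF cube_borel], of k \<phi> \<psi>] by (simp add: cube_op_def)
qed

text \<open>Schur's test for the block matrix of \<open>T\<close> with respect to the unit cubes.\<close>

lemma cube_schur:
  "\<exists>Z\<ge>0. \<forall>(T :: 'a::euclidean_space L2 \<Rightarrow>\<^sub>L 'a L2) M. 0 \<le> M \<longrightarrow>
    (\<forall>k l. norm (cube_op l o\<^sub>L T o\<^sub>L cube_op k) \<le> M * (\<Prod>b\<in>Basis. 1 / (1 + (real_of_int (k b) - real_of_int (l b))\<^sup>2))) \<longrightarrow>
    norm T \<le> Z * M"
proof -
  obtain Z where Z: "0 \<le> Z" and Zle: "\<And>(J :: int set) l. finite J \<Longrightarrow> (\<Sum>j\<in>J. 1 / (1 + (real_of_int j - real_of_int l)\<^sup>2)) \<le> Z"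
    using int_inverse_square_sum by blast
  define A where "A = Z ^ DIM('a)"
  have main: "norm T \<le> A * M"
    if M: "0 \<le> M" and T: "\<And>k l. norm (cube_op l o\<^sub>L T o\<^sub>L cube_op k) \<le> M * (\<Prod>b\<in>Basis. 1 / (1 + (real_of_int (k b) - real_of_int (l b))\<^sup>2))"
    for T :: "'a L2 \<Rightarrow>\<^sub>L 'a L2" and M
  proof -
    \<comment> \<open>Finite index sets exhausting all cubes; extensionality gives each cube only
      one index.\<close>
    define I where "I N = PiE (Basis :: 'a set) (\<lambda>_. {- int N..<int N})" for N
    have finI: "finite (I N)" for N by (simp add: I_def finite_PiE)
    let ?w = "\<lambda>(k :: 'a \<Rightarrow> int) l. \<Prod>b\<in>Basis. 1 / (1 + (real_of_int (k b) - real_of_int (l b))\<^sup>2)"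
    have w0: "0 \<le> ?w k l" for k l by (intro prod_nonneg) auto
    \<comment> \<open>The weight is a product over coordinates, so its sum over the index box
      factorizes; hence \<open>A = Z ^ DIM('a)\<close>.\<close>
    have wsum: "(\<Sum>k\<in>I N. ?w k l) \<le> A" for N l
    proof -
      have "(\<Sum>k\<in>I N. ?w k l) = (\<Prod>b\<in>Basis. \<Sum>j\<in>{- int N..<int N}. 1 / (1 + (real_of_int j - real_of_int (l b))\<^sup>2))"
        unfolding I_def by (subst prod_sum_PiE[symmetric]) auto
      also have "\<dots> \<le> (\<Prod>b\<in>(Basis::'a set). Z)"
        by (intro prod_mono conjI sum_nonneg Zle) auto
      finally show ?thesis by (simp add: A_def)
    qed
    have wsym: "?w k l = ?w l k" for k l by (intro prod.cong refl) (simp add: power2_commute)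
    define P where "P N = (\<Sum>k\<in>I N. cube_op k :: 'a L2 \<Rightarrow>\<^sub>L 'a L2)" for N
    have P_mult: "P N = mult_op (\<lambda>x. \<Sum>k\<in>I N. indicator (cube k) x)" "bmeas (\<lambda>x::'a. \<Sum>k\<in>I N. indicator (cube k) x :: complex)" for N
    proof -
      have "(\<Sum>k\<in>K. cube_op k :: 'a L2 \<Rightarrow>\<^sub>L 'a L2) = mult_op (\<lambda>x. \<Sum>k\<in>K. indicator (cube k) x) \<and> bmeas (\<lambda>x::'a. \<Sum>k\<in>K. indicator (cube k) x :: complex)"
        if "finite K" for K
        using that
      proof induction
        case empty
        have "mult_op (\<lambda>_. 1 - 1 :: complex) = (0 :: 'a L2 \<Rightarrow>\<^sub>L 'a L2)"
          by (subst mult_op_diff[symmetric]) auto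
        then show ?case by simp
      next
        case (insert k K)
        then show ?case
          by (simp add: cube_op_def mult_op_add)
      qed
      from this[OF finI] show "P N = mult_op (\<lambda>x. \<Sum>k\<in>I N. indicator (cube k) x)" "bmeas (\<lambda>x::'a. \<Sum>k\<in>I N. indicator (cube k) x :: complex)"
        unfolding P_def by blast+
    qed
    have sum_ind: "(\<Sum>k\<in>I N. indicator (cube k) x) = (indicator (\<Union>k\<in>I N. cube k) x :: complex)" for N x
    proof (rule indicator_UN_disjoint[symmetric, OF finI])
      show "disjoint_family_on cube (I N)"
        using cube_disjoint by (auto simp: disjoint_family_on_def I_def)
    qed
    have P_le: "norm (P N \<phi>) \<le> norm \<phi>" for N \<phi>
    proof -
      have "norm (P N) \<le> 1"
        unfolding P_mult sum_ind by (rule norm_mult_op_le) (simp add: indicator_def)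
      then show ?thesis
        using norm_blinfun[of "P N" \<phi>] mult_right_mono[of "norm (P N)" 1 "norm \<phi>"] by simp
    qed
    have P_lim: "(\<lambda>N. P N \<phi>) \<longlonglongrightarrow> \<phi>" for \<phi>
    proof -
      obtain f where sq: "square_integrable f" and \<phi>: "\<phi> = abs_L2 f" by (rule L2_cases)
      have [measurable]: "f \<in> borel_measurable borel" using sq by (simp add: square_integrable_def)
      have U[measurable]: "(\<Union>k\<in>I N. cube k) \<in> sets borel" for N using finI by auto
      have "(\<lambda>N. abs_L2 (\<lambda>x. indicator (\<Union>k\<in>I N. cube k) x * f x)) \<longlonglongrightarrow> abs_L2 f"
      proof (rule abs_L2_dominated_convergence[where g="\<lambda>x. norm (f x)"])
        show "integrable lborel (\<lambda>x. (norm (f x))\<^sup>2)" using sq by (simp add: square_integrable_def)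
        show "AE x in lborel. (\<lambda>n. indicator (\<Union>k\<in>I n. cube k) x * f x) \<longlonglongrightarrow> f x"
        proof (rule AE_I2)
          fix x
          have "\<forall>\<^sub>F n in sequentially. indicator (\<Union>k\<in>I n. cube k) x * f x = f x"
            using eventually_gt_at_top[of "nat \<lceil>norm x\<rceil> + 1"]
          proof eventually_elim
            fix n assume "nat \<lceil>norm x\<rceil> + 1 < n"
            then have n: "norm x + 1 < real n" by linarith
            define k where "k = restrict (\<lambda>b. \<lfloor>x \<bullet> b\<rfloor>) Basis"
            have "k \<in> I n"
              unfolding I_def k_def
            proof (rule restrict_PiE_iff[THEN iffD2], safe)
              fix b :: 'a assume "b \<in> Basis"
              then have "\<bar>x \<bullet> b\<bar> + 1 < real n" using Basis_le_norm[of b x] n by linarith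
              then show "\<lfloor>x \<bullet> b\<rfloor> \<in> {- int n..<int n}" by (simp, linarith)
            qed
            moreover have "x \<in> cube k" by (simp add: cube_def k_def)
            ultimately have "x \<in> (\<Union>k\<in>I n. cube k)" by blast
            then show "indicator (\<Union>k\<in>I n. cube k) x * f x = f x" by simp
          qed
          then show "(\<lambda>n. indicator (\<Union>k\<in>I n. cube k) x * f x) \<longlonglongrightarrow> f x"
            by (rule tendsto_eventually)
        qed
        show "(\<lambda>x. indicator (\<Union>k\<in>I N. cube k) x * f x) \<in> borel_measurable borel" for N
          by (rule borel_measurable_times[OF borel_measurable_indicator[OF U]]) measurable
      qed (auto simp: indicator_def)
      moreover have "P N \<phi> = abs_L2 (\<lambda>x. indicator (\<Union>k\<in>I N. cube k) x * f x)" for N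
        using sq P_mult[of N] unfolding \<phi> sum_ind by (simp add: mult_op_abs)
      ultimately show ?thesis by (simp add: \<phi>)
    qed
    have sq_sum: "(\<Sum>k\<in>I N. (norm (cube_op k \<phi>))\<^sup>2) \<le> (norm \<phi>)\<^sup>2" for N \<phi>
    proof -
      have "(norm (cube_op k \<phi>))\<^sup>2 = cube_op k \<phi> \<bullet> \<phi>" for k
        using cube_op_adjoint[of k "cube_op k \<phi>" \<phi>] cube_op_idem[of k]
        by (metis blinfun_apply_blinfun_compose power2_norm_eq_inner inner_commute)
      then have "(\<Sum>k\<in>I N. (norm (cube_op k \<phi>))\<^sup>2) = P N \<phi> \<bullet> \<phi>"
        by (simp add: P_def blinfun.sum_left inner_sum_left)
      also have "\<dots> \<le> norm (P N \<phi>) * norm \<phi>" by (rule norm_cauchy_schwarz)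
      also have "\<dots> \<le> norm \<phi> * norm \<phi>" by (intro mult_right_mono P_le) auto
      finally show ?thesis by (simp add: power2_eq_square)
    qed
    \<comment> \<open>\<open>mult_le_half_squares\<close> splits each block term into a part for
      \<open>\<phi>\<close> and a part for \<open>\<psi>\<close>. They are summed by the column and
      row sums of the weight, equal by symmetry and at most \<open>A\<close>.\<close>
    have bilin: "T (P N \<phi>) \<bullet> P N \<psi> \<le> A * M * ((norm \<phi>)\<^sup>2 + (norm \<psi>)\<^sup>2) / 2" for N \<phi> \<psi>
    proof -
      let ?u = "\<lambda>k. norm (cube_op k \<phi>)" and ?v = "\<lambda>l. norm (cube_op l \<psi>)"
      have elem: "T (cube_op k \<phi>) \<bullet> cube_op l \<psi> \<le> M / 2 * (?w k l * (?u k)\<^sup>2) + M / 2 * (?w k l * (?v l)\<^sup>2)" for k l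
      proof -
        have "T (cube_op k \<phi>) \<bullet> cube_op l \<psi> = (cube_op l o\<^sub>L T o\<^sub>L cube_op k) (cube_op k \<phi>) \<bullet> cube_op l \<psi>"
          using cube_op_idem[of k] cube_op_idem[of l]
          by (simp add: cube_op_adjoint) (metis blinfun_apply_blinfun_compose)
        also have "\<dots> \<le> norm ((cube_op l o\<^sub>L T o\<^sub>L cube_op k) (cube_op k \<phi>)) * ?v l"
          by (rule norm_cauchy_schwarz)
        also have "\<dots> \<le> ((M * ?w k l) * ?u k) * ?v l"
          by (intro mult_right_mono order_trans[OF norm_blinfun] T norm_ge_zero)
        also have "\<dots> = (M * ?w k l) * (?u k * ?v l)" by (simp only: mult.assoc)
        also have "\<dots> \<le> (M * ?w k l) * (((?u k)\<^sup>2 + (?v l)\<^sup>2) / 2)"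
        proof (intro mult_left_mono mult_nonneg_nonneg M w0)
          show "?u k * ?v l \<le> ((?u k)\<^sup>2 + (?v l)\<^sup>2) / 2"
            by (rule mult_le_half_squares)
        qed
        also have "\<dots> = M / 2 * (?w k l * (?u k)\<^sup>2) + M / 2 * (?w k l * (?v l)\<^sup>2)"
          by (simp only: distrib_left add_divide_distrib times_divide_eq_right times_divide_eq_left mult.assoc)
        finally show ?thesis .
      qed
      have s1: "(\<Sum>l\<in>I N. \<Sum>k\<in>I N. ?w k l * (?u k)\<^sup>2) \<le> A * (norm \<phi>)\<^sup>2"
      proof -
        have "(\<Sum>l\<in>I N. \<Sum>k\<in>I N. ?w k l * (?u k)\<^sup>2) = (\<Sum>k\<in>I N. (\<Sum>l\<in>I N. ?w l k) * (?u k)\<^sup>2)"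
          by (subst sum.swap, simp only: sum_distrib_right)
            (intro sum.cong refl arg_cong2[where f="(*)"] wsym)
        also have "\<dots> \<le> (\<Sum>k\<in>I N. A * (?u k)\<^sup>2)"
          by (intro sum_mono mult_right_mono wsum) auto
        also have "\<dots> \<le> A * (norm \<phi>)\<^sup>2"
          unfolding sum_distrib_left[symmetric] using Z by (intro mult_left_mono sq_sum) (simp add: A_def)
        finally show ?thesis .
      qed
      have s2: "(\<Sum>l\<in>I N. \<Sum>k\<in>I N. ?w k l * (?v l)\<^sup>2) \<le> A * (norm \<psi>)\<^sup>2"
      proof -
        have "(\<Sum>l\<in>I N. \<Sum>k\<in>I N. ?w k l * (?v l)\<^sup>2) = (\<Sum>l\<in>I N. (\<Sum>k\<in>I N. ?w k l) * (?v l)\<^sup>2)"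
          by (simp only: sum_distrib_right)
        also have "\<dots> \<le> (\<Sum>l\<in>I N. A * (?v l)\<^sup>2)"
          by (intro sum_mono mult_right_mono wsum) auto
        also have "\<dots> \<le> A * (norm \<psi>)\<^sup>2"
          unfolding sum_distrib_left[symmetric] using Z by (intro mult_left_mono sq_sum) (simp add: A_def)
        finally show ?thesis .
      qed
      have "T (P N \<phi>) \<bullet> P N \<psi> = (\<Sum>l\<in>I N. \<Sum>k\<in>I N. T (cube_op k \<phi>) \<bullet> cube_op l \<psi>)"
        by (simp add: P_def blinfun.sum_left blinfun.sum_right inner_sum_left inner_sum_right)
      also have "\<dots> \<le> (\<Sum>l\<in>I N. \<Sum>k\<in>I N. M / 2 * (?w k l * (?u k)\<^sup>2) + M / 2 * (?w k l * (?v l)\<^sup>2))"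
        by (intro sum_mono elem)
      also have "\<dots> = M / 2 * (\<Sum>l\<in>I N. \<Sum>k\<in>I N. ?w k l * (?u k)\<^sup>2) + M / 2 * (\<Sum>l\<in>I N. \<Sum>k\<in>I N. ?w k l * (?v l)\<^sup>2)"
        by (simp only: sum.distrib sum_distrib_left)
      also have "\<dots> \<le> M / 2 * (A * (norm \<phi>)\<^sup>2) + M / 2 * (A * (norm \<psi>)\<^sup>2)"
        using M by (intro add_mono mult_left_mono s1 s2) auto
      also have "\<dots> = A * M * ((norm \<phi>)\<^sup>2 + (norm \<psi>)\<^sup>2) / 2"
        by (simp add: distrib_left add_divide_distrib mult_ac)
      finally show ?thesis .
    qed
    have lim: "T \<phi> \<bullet> \<psi> \<le> A * M * ((norm \<phi>)\<^sup>2 + (norm \<psi>)\<^sup>2) / 2" for \<phi> \<psi>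
    proof (rule LIMSEQ_le_const2)
      show "(\<lambda>N. T (P N \<phi>) \<bullet> P N \<psi>) \<longlonglongrightarrow> T \<phi> \<bullet> \<psi>"
        by (intro tendsto_intros P_lim)
    qed (use bilin in blast)
    show ?thesis
    proof (rule norm_blinfun_bound)
      show "0 \<le> A * M" using M Z by (simp add: A_def)
      fix \<phi>
      show "norm (T \<phi>) \<le> A * M * norm \<phi>"
      proof (cases "T \<phi> = 0")
        case True
        then show ?thesis using M Z by (simp add: A_def)
      next
        case False
        then have "\<phi> \<noteq> 0" by auto
        \<comment> \<open>Rescaled to the norm of \<open>\<phi>\<close>, so that the mean of the two
          squares equals the product of the norms.\<close>
        let ?\<psi> = "(norm \<phi> / norm (T \<phi>)) *\<^sub>R T \<phi>"
        have "T \<phi> \<bullet> ?\<psi> = norm \<phi> * norm (T \<phi>)"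
          using False by (simp add: power2_norm_eq_inner[symmetric] power2_eq_square)
        moreover have "norm ?\<psi> = norm \<phi>" using False by simp
        ultimately have "norm \<phi> * norm (T \<phi>) \<le> A * M * (norm \<phi> * norm \<phi>)"
          using lim[of \<phi> ?\<psi>] by (simp add: power2_eq_square)
        then have "norm \<phi> * norm (T \<phi>) \<le> norm \<phi> * (A * M * norm \<phi>)"
          by (simp only: mult_ac)
        then show ?thesis
          by (rule mult_left_le_imp_le) (simp add: \<open>\<phi> \<noteq> 0\<close>)
      qed
    qed
  qed
  then show ?thesis
    using Z by (intro exI[of _ A]) (auto simp: A_def)
qed

text \<open>Derivations pass over the multiplication operator and act on \<open>S\<close> alone, so
  \<open>cube_decay\<close> can be iterated \<open>2 * DIM('a) + 1\<close> times on a block and the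
  result estimated by \<open>cube_commutator\<close>. One power of the distance cancels the linear
  factor there, the others provide the weights for \<open>cube_schur\<close>. Derivatives of
  \<open>S\<close> of order 1 to \<open>2 * DIM('a) + 2\<close> enter the bound, but not
  \<open>S\<close> itself.\<close>

theorem norm_commutator_symbol:
  "\<exists>C\<ge>0. \<forall>(S :: 'a::euclidean_space L2 \<Rightarrow>\<^sub>L 'a L2) B L v.
    clinear_adj S \<longrightarrow> 0 \<le> B \<longrightarrow> (\<forall>b\<in>Basis. \<exists>R. mderiv b S R \<and> opbd (2 * DIM('a) + 1) B R) \<longrightarrow>
    symbol (2 * DIM('a)) L v \<longrightarrow> norm (commutator (mult_op v) S) \<le> C * L * B"
proof -
  let ?d = "DIM('a)"
  let ?n = "2 * DIM('a) + 1"
  obtain C where C: "0 \<le> C" and cc: "\<And>(S :: 'a L2 \<Rightarrow>\<^sub>L 'a L2) B L v k l m.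
    clinear_adj S \<Longrightarrow> 0 \<le> B \<Longrightarrow> \<forall>b\<in>Basis. \<exists>R. mderiv b S R \<and> norm R \<le> B \<Longrightarrow>
    symbol (2 * ?d) L v \<Longrightarrow> \<forall>b\<in>Basis. \<bar>real_of_int (l b) - real_of_int (k b)\<bar> \<le> m \<Longrightarrow>
    norm (cube_op l o\<^sub>L commutator (mult_op v) S o\<^sub>L cube_op k) \<le> C * L * B * (1 + m)"
    using cube_commutator[where 'a='a] by blast
  obtain Z where Z: "0 \<le> Z" and schur: "\<And>(T :: 'a L2 \<Rightarrow>\<^sub>L 'a L2) M. 0 \<le> M \<Longrightarrow>
    (\<And>k l. norm (cube_op l o\<^sub>L T o\<^sub>L cube_op k) \<le> M * (\<Prod>b\<in>Basis. 1 / (1 + (real_of_int (k b) - real_of_int (l b))\<^sup>2))) \<Longrightarrow>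
    norm T \<le> Z * M"
    using cube_schur[where 'a='a] by blast
  have "norm (commutator (mult_op v) S) \<le> (Z * (4 ^ ?n * C)) * L * B"
    if S: "clinear_adj S" "0 \<le> B" "\<forall>b\<in>Basis. \<exists>R. mderiv b S R \<and> opbd ?n B R" and v: "symbol (2 * ?d) L v"
    for S :: "'a L2 \<Rightarrow>\<^sub>L 'a L2" and B L v
  proof -
    have L: "0 \<le> L" by (rule symbol_nonneg[OF v])
    have bv: "bmeas v" using v by (simp add: symbol_def)
    have iter: "(\<bar>real_of_int (k c) - real_of_int (l c)\<bar> - 2) ^ n * norm (cube_op l o\<^sub>L commutator (mult_op v) T o\<^sub>L cube_op k)
        \<le> C * L * B * (1 + \<bar>real_of_int (k c) - real_of_int (l c)\<bar>)"
      if T: "clinear_adj T" "\<forall>b\<in>Basis. \<exists>R. mderiv b T R \<and> opbd n B R" and c: "c \<in> Basis"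
        and ge2: "2 \<le> \<bar>real_of_int (k c) - real_of_int (l c)\<bar>"
        and mx: "\<forall>b\<in>Basis. \<bar>real_of_int (l b) - real_of_int (k b)\<bar> \<le> \<bar>real_of_int (k c) - real_of_int (l c)\<bar>"
      for n T k l and c :: 'a
      using T
    proof (induction n arbitrary: T)
      case 0
      then show ?case
        using cc[of T B L v l k, OF _ S(2) _ v mx] by simp
    next
      case (Suc n)
      obtain R where R: "mderiv c T R" "opbd (Suc n) B R"
        using Suc.prems(2) c by blast
      have "clinear_adj R" by (rule clinear_adj_mderiv[OF R(1) Suc.prems(1)])
      then have IH: "(\<bar>real_of_int (k c) - real_of_int (l c)\<bar> - 2) ^ n * norm (cube_op l o\<^sub>L commutator (mult_op v) R o\<^sub>L cube_op k)
        \<le> C * L * B * (1 + \<bar>real_of_int (k c) - real_of_int (l c)\<bar>)"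
        using R(2) by (intro Suc.IH) auto
      have "mderiv c (commutator (mult_op v) T) (commutator 0 T + commutator (mult_op v) R)"
        by (intro mderiv_commutator mderiv_mult_op bv R)
      then have der: "mderiv c (commutator (mult_op v) T) (commutator (mult_op v) R)"
        by (simp add: commutator_def blinfun_compose_simps)
      have "(\<bar>real_of_int (k c) - real_of_int (l c)\<bar> - 2) ^ Suc n * norm (cube_op l o\<^sub>L commutator (mult_op v) T o\<^sub>L cube_op k)
          = (\<bar>real_of_int (k c) - real_of_int (l c)\<bar> - 2) ^ n * ((\<bar>real_of_int (k c) - real_of_int (l c)\<bar> - 2) * norm (cube_op l o\<^sub>L commutator (mult_op v) T o\<^sub>L cube_op k))"
        by (simp add: mult_ac)
      also have "\<dots> \<le> (\<bar>real_of_int (k c) - real_of_int (l c)\<bar> - 2) ^ n * norm (cube_op l o\<^sub>L commutator (mult_op v) R o\<^sub>L cube_op k)"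
        using ge2 by (intro mult_left_mono cube_decay[OF _ der c] clinear_adj_commutator clinear_adj_mult_op bv Suc.prems(1)) auto
      finally show ?case using IH by linarith
    qed
    have "norm (cube_op l o\<^sub>L commutator (mult_op v) S o\<^sub>L cube_op k)
        \<le> (4 ^ ?n * C * L * B) * (\<Prod>b\<in>Basis. 1 / (1 + (real_of_int (k b) - real_of_int (l b))\<^sup>2))" for k l
    proof -
      let ?\<sigma> = "norm (cube_op l o\<^sub>L commutator (mult_op v) S o\<^sub>L cube_op k)"
      let ?f = "\<lambda>b. \<bar>real_of_int (k b) - real_of_int (l b)\<bar>"
      \<comment> \<open>All decay is drawn from one direction of largest separation, whose power
        dominates the product weight.\<close>
      have "Max (?f ` Basis) \<in> ?f ` Basis" by (intro Max_in) auto
      then obtain c where c: "c \<in> Basis" "Max (?f ` Basis) = ?f c" by (elim imageE)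
      define m where "m = ?f c"
      have m: "?f b \<le> m" if "b \<in> Basis" for b
        unfolding m_def c(2)[symmetric] using that by (intro Max_ge) auto
      then have m': "\<forall>b\<in>Basis. \<bar>real_of_int (l b) - real_of_int (k b)\<bar> \<le> m"
        by (simp add: abs_minus_commute)
      have m0: "0 \<le> m" by (simp add: m_def)
      have key: "(1 + m) ^ (2 * ?d) * ?\<sigma> \<le> 4 ^ ?n * C * L * B"
      proof (cases "m \<le> 2")
        \<comment> \<open>For close cubes \<open>m - 2\<close> yields no decay, but the plain block
          bound suffices since \<open>1 + m \<le> 4\<close>.\<close>
        case True
        have "\<forall>b\<in>Basis. \<exists>R. mderiv b S R \<and> norm R \<le> B"
          using S(3) opbd_le by blast
        then have "?\<sigma> \<le> C * L * B * (1 + m)"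
          by (intro cc S v m')
        then have "(1 + m) ^ (2 * ?d) * ?\<sigma> \<le> (1 + m) ^ (2 * ?d) * (C * L * B * (1 + m))"
          using m0 by (intro mult_left_mono) auto
        also have "\<dots> = (1 + m) ^ ?n * (C * L * B)" by (simp add: mult_ac)
        also have "\<dots> \<le> 4 ^ ?n * (C * L * B)"
          using True m0 C L S(2) by (intro mult_right_mono power_mono) auto
        finally show ?thesis by (simp add: mult_ac)
      next
        case False
        \<comment> \<open>\<open>m\<close> is an integer, so \<open>m > 2\<close> means
          \<open>m \<ge> 3\<close>. There \<open>(1 + m) / 4 \<le> m - 2\<close>, with equality at
          3; this is the origin of the 4.\<close>
        define z where "z = \<bar>k c - l c\<bar>"
        have "m = real_of_int z" by (simp add: m_def z_def)
        then have m3: "3 \<le> m" using False by simp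
        have "((1 + m) / 4) ^ ?n * ?\<sigma> \<le> (m - 2) ^ ?n * ?\<sigma>"
          using m3 by (intro mult_right_mono power_mono) auto
        also have "\<dots> \<le> C * L * B * (1 + m)"
          using iter[OF S(1,3) c(1)] m' m3 by (simp add: m_def)
        finally have "(1 + m) * ((1 + m) ^ (2 * ?d) * ?\<sigma>) \<le> (1 + m) * (4 ^ ?n * C * L * B)"
          by (simp add: power_divide field_simps)
        then show ?thesis
          by (rule mult_left_le_imp_le) (use m0 in linarith)
      qed
      have "(\<Prod>b\<in>Basis. 1 + (real_of_int (k b) - real_of_int (l b))\<^sup>2) \<le> (\<Prod>b\<in>(Basis::'a set). (1 + m)\<^sup>2)"
      proof (rule prod_mono, safe)
        fix b :: 'a assume b: "b \<in> Basis"
        have "(real_of_int (k b) - real_of_int (l b))\<^sup>2 \<le> m\<^sup>2"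
          using m[OF b] m0 by (metis abs_le_square_iff abs_of_nonneg)
        then show "1 + (real_of_int (k b) - real_of_int (l b))\<^sup>2 \<le> (1 + m)\<^sup>2"
          using m0 by (simp add: power2_sum)
      qed auto
      also have "\<dots> = (1 + m) ^ (2 * ?d)" by (simp add: power_mult)
      finally have "(\<Prod>b\<in>Basis. 1 + (real_of_int (k b) - real_of_int (l b))\<^sup>2) * ?\<sigma> \<le> 4 ^ ?n * C * L * B"
        using key by (meson mult_right_mono norm_ge_zero order_trans)
      moreover have "0 < (\<Prod>b\<in>(Basis::'a set). 1 + (real_of_int (k b) - real_of_int (l b))\<^sup>2)"
        by (intro prod_pos) (simp add: add_pos_nonneg)
      ultimately have "?\<sigma> \<le> (4 ^ ?n * C * L * B) * (1 / (\<Prod>b\<in>Basis. 1 + (real_of_int (k b) - real_of_int (l b))\<^sup>2))"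
        by (intro le_mult_inverse)
      then show ?thesis by (simp add: prod_dividef)
    qed
    then have "norm (commutator (mult_op v) S) \<le> Z * (4 ^ ?n * C * L * B)"
      using C L S(2) by (intro schur) auto
    then show ?thesis by (simp add: mult_ac)
  qed
  then show ?thesis
    using C Z by (intro exI[of _ "Z * (4 ^ ?n * C)"]) auto
qed

section \<open>Symbols depending on one variable\<close>

context
  fixes \<pi> :: "'c::euclidean_space \<Rightarrow> 'a::euclidean_space" and \<iota> :: "'a \<Rightarrow> 'c"
  assumes \<pi>: "bounded_linear \<pi>" and \<iota>: "bounded_linear \<iota>" and \<pi>\<iota>: "\<And>x. \<pi> (\<iota> x) = x"
    and Basis: "\<And>b. b \<in> Basis \<Longrightarrow> \<iota> b \<in> Basis"
begin

lemma differentiable_pullback: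
  assumes "\<And>p. (\<lambda>p. f (\<pi> p)) differentiable (at p)"
  shows "f differentiable (at x)" "pd (\<iota> b) (\<lambda>p. f (\<pi> p)) = (\<lambda>p. pd b f (\<pi> p))"
proof -
  have d: "f differentiable (at x)" for x
  proof -
    have "((\<lambda>p. f (\<pi> p)) \<circ> \<iota>) differentiable (at x)"
      by (intro differentiable_chain_at assms bounded_linear_imp_differentiable \<iota>)
    then show ?thesis by (simp add: o_def \<pi>\<iota>)
  qed
  show "f differentiable (at x)" by (rule d)
  show "pd (\<iota> b) (\<lambda>p. f (\<pi> p)) = (\<lambda>p. pd b f (\<pi> p))"
  proof
    fix p
    have "((\<lambda>p. f (\<pi> p)) has_derivative (\<lambda>h. frechet_derivative f (at (\<pi> p)) (\<pi> h))) (at p)"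
      by (rule has_derivative_compose[OF bounded_linear_imp_has_derivative[OF \<pi>] frechet_derivative_works[THEN iffD1, OF d]])
    then show "pd (\<iota> b) (\<lambda>p. f (\<pi> p)) p = pd b f (\<pi> p)"
      by (simp add: has_derivative_imp_pd \<pi>\<iota>) (simp add: pd_def)
  qed
qed

text \<open>Serves both projections of phase space: \<open>\<iota>\<close> includes the variable in
  question, and derivatives of the composite along included basis vectors are those of
  \<open>f\<close>.\<close>

lemma smooth_pullback:
  assumes "smooth (\<lambda>p. f (\<pi> p))"
  shows "smooth f" and "bs \<in> lists Basis \<Longrightarrow> pderivs (map \<iota> bs) (\<lambda>p. f (\<pi> p)) = (\<lambda>p. pderivs bs f (\<pi> p))"
proof -
  have map: "map \<iota> bs \<in> lists Basis" if "bs \<in> lists Basis" for bs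
    using that Basis by auto
  have eq: "pderivs (map \<iota> bs) (\<lambda>p. f (\<pi> p)) = (\<lambda>p. pderivs bs f (\<pi> p))" if "bs \<in> lists Basis" for bs
    using that
  proof (induction bs)
    case Nil
    show ?case by simp
  next
    case (Cons b bs)
    then have IH: "pderivs (map \<iota> bs) (\<lambda>p. f (\<pi> p)) = (\<lambda>p. pderivs bs f (\<pi> p))" by simp
    have "pderivs (map \<iota> bs) (\<lambda>p. f (\<pi> p)) differentiable (at p)" for p
      using assms map Cons by (metis Cons_in_lists_iff smooth_def)
    then have "(\<lambda>p. pderivs bs f (\<pi> p)) differentiable (at p)" for p
      unfolding IH .
    from differentiable_pullback(2)[OF this] show ?case
      by (simp only: list.map pderivs_Cons IH)
  qed
  show "pderivs (map \<iota> bs) (\<lambda>p. f (\<pi> p)) = (\<lambda>p. pderivs bs f (\<pi> p))" if "bs \<in> lists Basis"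
    by (rule eq[OF that])
  show "smooth f"
    unfolding smooth_def
  proof (intro ballI allI)
    fix bs :: "'a list" and x assume bs: "bs \<in> lists Basis"
    have "pderivs (map \<iota> bs) (\<lambda>p. f (\<pi> p)) differentiable (at p)" for p
      using assms map[OF bs] by (simp add: smooth_def)
    then show "pderivs bs f differentiable (at x)"
      unfolding eq[OF bs] by (rule differentiable_pullback(1))
  qed
qed

end

lemma S1_fst:
  fixes v :: "'a::euclidean_space \<Rightarrow> complex"
  assumes "(\<lambda>(x, \<xi>::'a). v x) \<in> S1"
  shows "smooth v" "bs \<in> lists Basis \<Longrightarrow> \<exists>C. \<forall>x. norm (pderivs bs v x) \<le> C"
proof -
  have eq: "(\<lambda>(x, \<xi>::'a). v x) = (\<lambda>p. v (fst p))" by auto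
  have Basis: "(b, 0) \<in> (Basis :: ('a \<times> 'a) set)" if "b \<in> Basis" for b :: 'a
    using that by (simp add: Basis_prod_def)
  have \<iota>: "bounded_linear (\<lambda>x::'a. (x, 0::'a))"
    by (intro bounded_linear_Pair bounded_linear_ident bounded_linear_zero)
  have sm: "smooth (\<lambda>p::'a \<times> 'a. v (fst p))"
    using assms by (simp add: S1_def eq)
  show "smooth v"
    by (rule smooth_pullback(1)[OF bounded_linear_fst \<iota> _ Basis sm]) auto
  assume bs: "bs \<in> lists Basis"
  have "map (\<lambda>x. (x, 0)) bs \<in> lists (Basis :: ('a \<times> 'a) set)"
    using bs Basis by auto
  then obtain C where C: "\<And>p. norm (pderivs (map (\<lambda>x. (x, 0)) bs) (\<lambda>p::'a \<times> 'a. v (fst p)) p) \<le> C"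
    using assms unfolding S1_def eq by blast
  have "pderivs (map (\<lambda>x. (x, 0)) bs) (\<lambda>p::'a \<times> 'a. v (fst p)) = (\<lambda>p. pderivs bs v (fst p))"
    by (rule smooth_pullback(2)[OF bounded_linear_fst \<iota> _ Basis sm bs]) auto
  then have "norm (pderivs bs v x) \<le> C" for x
    using C[of "(x, 0)"] by simp
  then show "\<exists>C. \<forall>x. norm (pderivs bs v x) \<le> C" by blast
qed

lemma S1_within_snd:
  fixes a :: "'a::euclidean_space \<Rightarrow> complex"
  assumes "(\<lambda>(x::'a, \<xi>). a \<xi>) \<in> S1_within K"
  shows "smooth a" "bs \<in> lists Basis \<Longrightarrow> norm (pderivs bs a \<xi>) \<le> K (map (\<lambda>b. (0, b)) bs)"
proof -
  have eq: "(\<lambda>(x::'a, \<xi>). a \<xi>) = (\<lambda>p. a (snd p))" by auto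
  have Basis: "(0, b) \<in> (Basis :: ('a \<times> 'a) set)" if "b \<in> Basis" for b :: 'a
    using that by (simp add: Basis_prod_def)
  have \<iota>: "bounded_linear (\<lambda>x::'a. (0::'a, x))"
    by (intro bounded_linear_Pair bounded_linear_ident bounded_linear_zero)
  have sm: "smooth (\<lambda>p::'a \<times> 'a. a (snd p))"
    using assms by (simp add: S1_within_def S1_def eq)
  show "smooth a"
    by (rule smooth_pullback(1)[OF bounded_linear_snd \<iota> _ Basis sm]) auto
  assume bs: "bs \<in> lists Basis"
  have "map (\<lambda>x. (0, x)) bs \<in> lists (Basis :: ('a \<times> 'a) set)"
    using bs Basis by auto
  then have C: "norm (pderivs (map (\<lambda>x. (0, x)) bs) (\<lambda>p::'a \<times> 'a. a (snd p)) p) \<le> K (map (\<lambda>x. (0, x)) bs)" for p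
    using assms unfolding S1_within_def eq by blast
  have "pderivs (map (\<lambda>x. (0, x)) bs) (\<lambda>p::'a \<times> 'a. a (snd p)) = (\<lambda>p. pderivs bs a (snd p))"
    by (rule smooth_pullback(2)[OF bounded_linear_snd \<iota> _ Basis sm bs]) auto
  then show "norm (pderivs bs a \<xi>) \<le> K (map (\<lambda>b. (0, b)) bs)"
    using C[of "(0, \<xi>)"] by simp
qed

section \<open>Words of commutators\<close>

primrec comm_word :: "(('a::euclidean_space L2 \<Rightarrow>\<^sub>L 'a L2)) list \<Rightarrow> ('a L2 \<Rightarrow>\<^sub>L 'a L2) \<Rightarrow> ('a L2 \<Rightarrow>\<^sub>L 'a L2)" where
  "comm_word [] X = X"
| "comm_word (F # Fs) X = commutator F (comm_word Fs X)"

lemma clinear_adj_comm_word: "(\<And>F. F \<in> set Fs \<Longrightarrow> clinear_adj F) \<Longrightarrow> clinear_adj X \<Longrightarrow> clinear_adj (comm_word Fs X)"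
  by (induction Fs) (auto intro: clinear_adj_commutator)

lemma mderiv_comm_word_mult:
  "(\<And>f. f \<in> set fs \<Longrightarrow> bmeas f) \<Longrightarrow> mderiv b X R \<Longrightarrow> mderiv b (comm_word (map mult_op fs) X) (comm_word (map mult_op fs) R)"
proof (induction fs)
  case (Cons f fs)
  then have "mderiv b (comm_word (map mult_op (f # fs)) X) (commutator 0 (comm_word (map mult_op fs) X) + commutator (mult_op f) (comm_word (map mult_op fs) R))"
    by (auto intro!: mderiv_commutator mderiv_mult_op)
  then show ?case
    by (simp add: commutator_def blinfun_compose_simps)
qed simp

lemma smooth_bmeas:
  assumes "smooth v" "\<And>bs. bs \<in> lists Basis \<Longrightarrow> \<exists>C. \<forall>x. norm (pderivs bs v x) \<le> C" "bs \<in> lists Basis"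
  shows "bmeas (pderivs bs v)"
proof -
  obtain C where "\<And>x. norm (pderivs bs v x) \<le> C" using assms by blast
  moreover have "continuous_on UNIV (pderivs bs v)"
    using assms by (intro differentiable_imp_continuous_on_UNIV) (simp add: smooth_def)
  ultimately show ?thesis
    by (intro bmeas_bound[of _ C] borel_measurable_continuous_onI)
qed

context
  fixes v :: "'a::euclidean_space \<Rightarrow> complex"
  assumes smooth_v: "smooth v" and bounded_v: "\<And>bs. bs \<in> lists Basis \<Longrightarrow> \<exists>C. \<forall>x. norm (pderivs bs v x) \<le> C"
begin

text \<open>The sign is that of the derivation on \<open>fmult (- 1)\<close>.\<close>

definition vop :: "'a list \<Rightarrow> ('a L2 \<Rightarrow>\<^sub>L 'a L2)" where
  "vop bs = (- 1) ^ length bs *\<^sub>R fmult (- 1) (pderivs bs v)"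

lemma bmeas_pderivs: "bs \<in> lists Basis \<Longrightarrow> bmeas (pderivs bs v)"
  by (rule smooth_bmeas[OF smooth_v bounded_v])

lemma clinear_adj_vop: "bs \<in> lists Basis \<Longrightarrow> clinear_adj (vop bs)"
  unfolding vop_def by (intro clinear_adj_scaleR clinear_adj_fmult bmeas_pderivs) auto

lemma mderiv_scaleR: "mderiv b S R \<Longrightarrow> mderiv b (r *\<^sub>R S) (r *\<^sub>R R)"
  unfolding mderiv_def modconj_simps by (rule bounded_linear.has_vector_derivative[OF bounded_linear_scaleR_right])

lemma mderiv_vop:
  assumes bs: "bs \<in> lists Basis" and b: "b \<in> Basis"
  shows "mderiv b (vop bs) (vop (b # bs))"
proof -
  have l: "b # bs \<in> lists Basis" "b # b # bs \<in> lists Basis" using bs b by auto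
  obtain C where C: "\<And>x. norm (pderivs (b # b # bs) v x) \<le> C" using bounded_v[OF l(2)] by blast
  have "mderiv b (fmult (- 1) (pderivs bs v)) (fmult (- 1) (\<lambda>\<xi>. - 1 *\<^sub>R pd b (pderivs bs v) \<xi>))"
  proof (rule mderiv_fmult)
    show "bmeas (pderivs bs v)" "bmeas (pd b (pderivs bs v))"
      using bmeas_pderivs[OF bs] bmeas_pderivs[OF l(1)] by (simp_all only: pderivs_Cons)
    show "pderivs bs v differentiable at x" "pd b (pderivs bs v) differentiable at x" for x
      using smooth_v bs l(1) by (simp_all only: smooth_def pderivs_Cons[symmetric])
    show "norm (pd b (pd b (pderivs bs v)) x) \<le> C" for x
      using C[of x] by (simp only: pderivs_Cons)
  qed simp
  moreover have "fmult (- 1) (\<lambda>\<xi>. - 1 *\<^sub>R pd b (pderivs bs v) \<xi>) = - 1 *\<^sub>R fmult (- 1) (pderivs (b # bs) v)"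
    using bmeas_pderivs[OF l(1)] by (simp only: fmult_scaleR pderivs_Cons)
  ultimately have "mderiv b (vop bs) ((- 1) ^ length bs *\<^sub>R (- 1 *\<^sub>R fmult (- 1) (pderivs (b # bs) v)))"
    unfolding vop_def by (intro mderiv_scaleR) simp
  then show ?thesis
    by (simp add: vop_def del: pderivs.simps)
qed

text \<open>In this picture the letters are multiplication operators and the potential is a Fourier
  multiplier. The outermost commutator is estimated by \<open>norm_commutator_symbol\<close>, whose
  derivations pass over all letters and lengthen \<open>bs\<close>. The induction on the number of
  letters therefore keeps \<open>n\<close> arbitrary, and it yields one factor \<open>L\<close> for
  each letter.\<close>

lemma norm_comm_word_vop:
  "\<exists>C\<ge>0. \<forall>bs Lfs. bs \<in> lists Basis \<longrightarrow> length bs \<le> n \<longrightarrow> length Lfs = k \<longrightarrow>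
    (\<forall>(L, f)\<in>set Lfs. symbol (2 * DIM('a)) L f) \<longrightarrow>
    norm (comm_word (map mult_op (map snd Lfs)) (vop bs)) \<le> C * prod_list (map fst Lfs)"
proof (induction k arbitrary: n)
  case 0
  have "\<forall>bs\<in>lists Basis. \<exists>C. \<forall>x. norm (pderivs bs v x) \<le> C" using bounded_v by blast
  then obtain Cb where Cb: "\<And>bs x. bs \<in> lists Basis \<Longrightarrow> norm (pderivs bs v x) \<le> Cb bs" by metis
  obtain M where M: "0 \<le> M" "\<And>bs. bs \<in> lists Basis \<Longrightarrow> length bs \<le> n \<Longrightarrow> Cb bs \<le> M"
    using bounded_on_short_lists[of n Cb] by blast
  have "norm (vop bs) \<le> M" if "bs \<in> lists Basis" "length bs \<le> n" for bs
  proof -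
    have "norm (fmult (- 1) (pderivs bs v)) \<le> M"
      by (rule norm_fmult_le) (use Cb M that order_trans in blast)+
    then show ?thesis by (simp add: vop_def)
  qed
  then show ?case using M(1) by (intro exI[of _ M]) auto
next
  case (Suc k)
  let ?d = "DIM('a)"
  obtain CL where CL: "0 \<le> CL" and lemL: "\<And>(S :: 'a L2 \<Rightarrow>\<^sub>L 'a L2) B L v. clinear_adj S \<Longrightarrow> 0 \<le> B \<Longrightarrow>
     \<forall>b\<in>Basis. \<exists>R. mderiv b S R \<and> opbd (2 * ?d + 1) B R \<Longrightarrow>
     symbol (2 * ?d) L v \<Longrightarrow> norm (commutator (mult_op v) S) \<le> CL * L * B"
    using norm_commutator_symbol[where 'a='a] by blast
  \<comment> \<open>The core bound differentiates once by \<open>mderiv\<close> and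
    \<open>2 * ?d + 1\<close> times within \<open>opbd\<close>.\<close>
  let ?n = "n + 2 * ?d + 2"
  obtain C where C: "0 \<le> C" and IH: "\<And>bs Lfs. bs \<in> lists Basis \<Longrightarrow> length bs \<le> ?n \<Longrightarrow> length Lfs = k \<Longrightarrow>
    \<forall>(L, f)\<in>set Lfs. symbol (2 * ?d) L f \<Longrightarrow>
    norm (comm_word (map mult_op (map snd Lfs)) (vop bs)) \<le> C * prod_list (map fst Lfs)"
    using Suc.IH[of ?n] by blast
  have "norm (comm_word (map mult_op (map snd Lfs)) (vop bs)) \<le> (CL * C) * prod_list (map fst Lfs)"
    if bs: "bs \<in> lists Basis" "length bs \<le> n" and Lfs: "length Lfs = Suc k" "\<forall>(L, f)\<in>set Lfs. symbol (2 * ?d) L f"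
    for bs Lfs
  proof -
    obtain L f Lfs' where eq: "Lfs = (L, f) # Lfs'" using Lfs(1) by (cases Lfs) auto
    have sym: "symbol (2 * ?d) L f" and Lfs': "length Lfs' = k" "\<forall>(L, f)\<in>set Lfs'. symbol (2 * ?d) L f"
      using Lfs by (simp_all add: eq)
    have bm: "bmeas g" if "g \<in> set (map snd Lfs')" for g
      using Lfs'(2) that by (auto simp: symbol_def)
    let ?S = "\<lambda>bs. comm_word (map mult_op (map snd Lfs')) (vop bs)"
    let ?B = "C * prod_list (map fst Lfs')"
    have der: "mderiv b (?S cs) (?S (b # cs))" if "cs \<in> lists Basis" "b \<in> Basis" for cs b
      by (rule mderiv_comm_word_mult[OF bm mderiv_vop[OF that]])
    have op: "opbd j ?B (?S cs)" if "cs \<in> lists Basis" "length cs + j \<le> ?n" for j cs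
      using that
    proof (induction j arbitrary: cs)
      case 0
      then show ?case using IH[OF _ _ Lfs'] by simp
    next
      case (Suc j)
      have "mderiv b (?S cs) (?S (b # cs)) \<and> opbd j ?B (?S (b # cs))" if "b \<in> Basis" for b
        using Suc.IH[of "b # cs"] Suc.prems that der[OF Suc.prems(1) that] by simp
      then show ?case
        using IH[OF _ _ Lfs', of cs] Suc.prems unfolding opbd.simps by (meson le_add1 order_trans)
    qed
    have "0 \<le> ?B" using order_trans[OF norm_ge_zero opbd_le[OF op[of "[]" 0]]] by simp
    moreover have "clinear_adj (?S bs)"
      using bm by (intro clinear_adj_comm_word clinear_adj_vop bs) (auto intro: clinear_adj_mult_op)
    moreover have "\<forall>b\<in>Basis. \<exists>R. mderiv b (?S bs) R \<and> opbd (2 * ?d + 1) ?B R"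
    proof
      fix b :: 'a assume b: "b \<in> Basis"
      have "opbd (2 * ?d + 1) ?B (?S (b # bs))"
        by (rule op) (use b bs in auto)
      with der[OF bs(1) b] show "\<exists>R. mderiv b (?S bs) R \<and> opbd (2 * ?d + 1) ?B R" by blast
    qed
    ultimately have "norm (commutator (mult_op f) (?S bs)) \<le> CL * L * ?B"
      by (intro lemL sym)
    then show ?thesis by (simp add: eq mult_ac)
  qed
  then show ?case
    using C CL by (intro exI[of _ "CL * C"]) auto
qed

end

section \<open>The propagated potential\<close>

text \<open>\<open>egen A h \<sigma> []\<close> is the symbol of \<open>\<i> \<sigma> A\<^sub>0 / h\<^sup>2\<close>, and \<open>egen A h \<sigma> bs\<close> is its derivative along \<open>bs\<close>.\<close>

definition egen :: "('a::euclidean_space \<Rightarrow> complex) \<Rightarrow> real \<Rightarrow> real \<Rightarrow> 'a list \<Rightarrow> 'a \<Rightarrow> complex" where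
  "egen A h \<sigma> bs \<xi> = \<i> * complex_of_real (\<sigma> * h ^ length bs / h\<^sup>2) * pderivs bs A (h *\<^sub>R \<xi>)"

text \<open>The hypotheses under which all later estimates are uniform: for fixed \<open>v\<close>,
  the symbol enters the constants through \<open>K\<close> only. The vanishing imaginary part of
  \<open>A\<close> makes the propagators contractions, and \<open>D\<close> stands for the time
  step.\<close>

definition params :: "('a::euclidean_space list \<Rightarrow> real) \<Rightarrow> ('a \<Rightarrow> complex) \<Rightarrow> real \<Rightarrow> real \<Rightarrow> bool" where
  "params K A h D \<longleftrightarrow> smooth A \<and> (\<forall>bs\<in>lists Basis. \<forall>\<xi>. norm (pderivs bs A \<xi>) \<le> K bs) \<and>
     (\<forall>\<xi>. Im (A \<xi>) = 0) \<and> 0 < h \<and> h \<le> 1 \<and> h \<le> D \<and> D \<le> 1"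

definition propagator :: "('a::euclidean_space \<Rightarrow> complex) \<Rightarrow> real \<Rightarrow> real \<Rightarrow> ('a L2 \<Rightarrow>\<^sub>L 'a L2)" where
  "propagator A h \<rho> = fmult 1 (\<lambda>\<xi>. exp (egen A h \<rho> [] \<xi>))"

definition gop :: "('a::euclidean_space \<Rightarrow> complex) \<Rightarrow> real \<Rightarrow> real \<times> 'a list \<Rightarrow> ('a L2 \<Rightarrow>\<^sub>L 'a L2)" where
  "gop A h g = fmult 1 (egen A h (fst g) (snd g))"

definition gword :: "('a::euclidean_space \<Rightarrow> complex) \<Rightarrow> ('a \<Rightarrow> complex) \<Rightarrow> real \<Rightarrow> (real \<times> 'a list) list \<Rightarrow> ('a L2 \<Rightarrow>\<^sub>L 'a L2)" where
  "gword v A h gs = comm_word (map (gop A h) gs) (mult_op v)"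

text \<open>\<open>m\<close> is the power of \<open>D\<close> that the word is worth. Letters of
  order 0 are excluded because their first derivatives have size \<open>\<sigma> / h\<close>, which
  is not small.\<close>

definition admissible :: "real \<Rightarrow> nat \<Rightarrow> (real \<times> 'a::euclidean_space list) list \<Rightarrow> bool" where
  "admissible D m gs \<longleftrightarrow> (\<forall>g\<in>set gs. \<bar>fst g\<bar> \<le> 4 * D \<and> snd g \<in> lists Basis \<and> snd g \<noteq> []) \<and>
     sum_list (map (length \<circ> snd) gs) = m"

text \<open>These operators contain the \<open>m\<close>-fold derivatives of the propagated potential; \<open>n\<close> bounds the
  number of words. Parameters up to \<open>4 D\<close> occur because conjugation adds two of size at most \<open>2 D\<close>.\<close>

definition wclass :: "('a::euclidean_space \<Rightarrow> complex) \<Rightarrow> ('a \<Rightarrow> complex) \<Rightarrow> real \<Rightarrow> real \<Rightarrow> real \<Rightarrow> nat \<Rightarrow> nat \<Rightarrow> ('a L2 \<Rightarrow>\<^sub>L 'a L2) \<Rightarrow> bool" where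
  "wclass v A h D \<rho> m n X \<longleftrightarrow> \<bar>\<rho>\<bar> \<le> 4 * D \<and> (\<exists>Ls. length Ls \<le> n \<and> (\<forall>gs\<in>set Ls. admissible D m gs) \<and>
     X = propagator A h \<rho> o\<^sub>L sum_list (map (gword v A h) Ls) o\<^sub>L propagator A h (- \<rho>))"

lemma admissible_length: "admissible D m gs \<Longrightarrow> length gs \<le> m"
proof (induction gs arbitrary: m)
  case (Cons g gs)
  then have "admissible D (m - length (snd g)) gs" "0 < length (snd g)" "length (snd g) \<le> m"
    by (auto simp: admissible_def)
  with Cons.IH[of "m - length (snd g)"] show ?case
    unfolding list.size by linarith
qed simp

lemma admissible_Cons: "\<bar>\<sigma>\<bar> \<le> 4 * D \<Longrightarrow> bs \<in> lists Basis \<Longrightarrow> bs \<noteq> [] \<Longrightarrow> admissible D m gs \<Longrightarrow> admissible D (length bs + m) ((\<sigma>, bs) # gs)"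
  by (auto simp: admissible_def)

lemma admissible_0: "admissible D 0 gs \<Longrightarrow> gs = []"
  using admissible_length by fastforce

lemma commutator_add_right: "commutator P (X + Y) = commutator P X + commutator P Y"
  by (simp add: commutator_def blinfun_compose_simps)

lemma commutator_0 [simp]: "commutator 0 P = 0" "commutator P 0 = 0"
  by (simp_all add: commutator_def blinfun_compose_simps)

lemma commutator_swap: "commutator X Y = - commutator Y X"
  by (simp add: commutator_def)

lemma commutator_sum_list: "commutator P (sum_list (map F Ls)) = sum_list (map (\<lambda>g. commutator P (F g)) Ls)"
  by (induction Ls) (simp_all add: commutator_add_right)

section \<open>Generators and propagators for fixed parameters\<close>

context
  fixes K :: "'a::euclidean_space list \<Rightarrow> real" and A :: "'a \<Rightarrow> complex" and h D :: real
  assumes par: "params K A h D"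
begin

lemma params_h: "0 < h" "h \<le> 1" "h \<le> D" "D \<le> 1" "0 < D"
  using par by (auto simp: params_def)

lemma egen_has_derivative:
  assumes "bs \<in> lists Basis"
  shows "(egen A h \<sigma> bs has_derivative (\<lambda>k. \<i> * complex_of_real (\<sigma> * h ^ length bs / h\<^sup>2) * (h *\<^sub>R frechet_derivative (pderivs bs A) (at (h *\<^sub>R \<xi>)) k))) (at \<xi>)"
proof -
  have d: "pderivs bs A differentiable (at x)" for x
    using par assms by (simp add: params_def smooth_def)
  have "((\<lambda>\<xi>. h *\<^sub>R \<xi>) has_derivative (\<lambda>k. h *\<^sub>R k)) (at \<xi>)"
    by (auto intro!: derivative_eq_intros)
  from has_derivative_compose[OF this frechet_derivative_works[THEN iffD1, OF d]]
  have "((\<lambda>\<xi>. pderivs bs A (h *\<^sub>R \<xi>)) has_derivative (\<lambda>k. h *\<^sub>R frechet_derivative (pderivs bs A) (at (h *\<^sub>R \<xi>)) k)) (at \<xi>)"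
    by (simp add: linear_scale[OF linear_frechet_derivative[OF d]])
  then show ?thesis
    unfolding egen_def[abs_def] by (rule has_derivative_mult_right)
qed

lemma egen_differentiable: "bs \<in> lists Basis \<Longrightarrow> egen A h \<sigma> bs differentiable (at \<xi>)"
  using egen_has_derivative differentiableI by blast

lemma pd_egen: "bs \<in> lists Basis \<Longrightarrow> pd b (egen A h \<sigma> bs) = egen A h \<sigma> (b # bs)"
  by (rule ext) (simp add: has_derivative_imp_pd[OF egen_has_derivative] egen_def scaleR_conv_of_real mult_ac)

lemma norm_egen: "bs \<in> lists Basis \<Longrightarrow> norm (egen A h \<sigma> bs \<xi>) \<le> (\<bar>\<sigma>\<bar> * h ^ length bs / h\<^sup>2) * K bs"
  using par params_h(1)
  by (auto simp: egen_def norm_mult norm_divide norm_power params_def abs_mult intro!: mult_left_mono divide_right_mono simp flip: times_divide_eq_left)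

lemma bmeas_egen: "bs \<in> lists Basis \<Longrightarrow> bmeas (egen A h \<sigma> bs)"
  by (rule bmeas_bound[OF borel_measurable_continuous_onI norm_egen])
    (auto intro: differentiable_imp_continuous_on_UNIV egen_differentiable)

text \<open>A derivative of order \<open>j\<close> carries
  \<open>\<sigma> * h ^ j / h\<^sup>2\<close>. When \<open>j\<close> exceeds the order of
  \<open>bs\<close>, which is at least 1, this is at most
  \<open>4 * D * h ^ (length bs - 1)\<close>, and \<open>h \<le> D\<close> turns it into a power of
  \<open>D\<close>.\<close>

lemma symbol_egen:
  assumes \<sigma>: "\<bar>\<sigma>\<bar> \<le> 4 * D" and bs: "bs \<in> lists Basis" "bs \<noteq> []" and M: "0 \<le> M"
    and le: "\<And>cs. cs \<in> lists Basis \<Longrightarrow> length cs \<le> length bs + 1 + n \<Longrightarrow> K cs \<le> M"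
  shows "symbol n (4 * M * D ^ length bs) (egen A h \<sigma> bs)"
proof -
  have norm: "norm (egen A h \<sigma> cs \<xi>) \<le> 4 * M * D ^ length bs"
    if cs: "cs \<in> lists Basis" "length bs < length cs" "length cs \<le> length bs + 1 + n" for cs \<xi>
  proof -
    obtain l where l: "length bs = Suc l" using bs(2) by (cases "length bs") auto
    \<comment> \<open>There are strictly more derivatives than in \<open>bs\<close>, hence at least
      two, so that \<open>h\<^sup>2\<close> cancels.\<close>
    obtain j where j: "length cs = l + j + 2" using cs(2) l by (metis add.commute add_2_eq_Suc less_iff_Suc_add add_Suc_right add_Suc)
    have "h ^ length cs / h\<^sup>2 = h ^ (l + j)"
      using params_h(1) by (simp add: j power_add power2_eq_square)
    also have "\<dots> \<le> h ^ l" using params_h by (intro power_decreasing) auto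
    also have "\<dots> \<le> D ^ l" using params_h by (intro power_mono) auto
    finally have hl: "h ^ length cs / h\<^sup>2 \<le> D ^ l" .
    have "norm (egen A h \<sigma> cs \<xi>) \<le> (\<bar>\<sigma>\<bar> * h ^ length cs / h\<^sup>2) * K cs"
      by (rule norm_egen[OF cs(1)])
    also have "\<dots> \<le> (\<bar>\<sigma>\<bar> * h ^ length cs / h\<^sup>2) * M"
      using params_h(1) by (intro mult_left_mono le cs) auto
    also have "\<dots> = (\<bar>\<sigma>\<bar> * (h ^ length cs / h\<^sup>2)) * M" by simp
    also have "\<dots> \<le> ((4 * D) * D ^ l) * M"
      using params_h M by (intro mult_right_mono mult_mono \<sigma> hl) auto
    also have "\<dots> = 4 * M * D ^ length bs" by (simp add: l mult_ac)
    finally show ?thesis .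
  qed
  have bd: "bd j (\<lambda>_. 4 * M * D ^ length bs) (egen A h \<sigma> cs)"
    if "cs \<in> lists Basis" "length bs < length cs" "length cs + j \<le> length bs + 1 + n" for cs j
    using that
  proof (induction j arbitrary: cs)
    case 0
    then show ?case
      using norm by (auto intro: differentiable_imp_continuous_on_UNIV egen_differentiable)
  next
    case (Suc j)
    then show ?case
      using norm[of cs] by (auto simp: pd_egen egen_differentiable)
  qed
  show ?thesis
    unfolding symbol_def
    using bs bd[of "_ # bs" n] by (auto simp: bmeas_egen egen_differentiable pd_egen)
qed

lemma Re_egen: "Re (egen A h \<rho> [] \<xi>) = 0"
  using par by (simp add: egen_def params_def)

lemma bmeas_exp_egen: "bmeas (\<lambda>\<xi>. exp (egen A h \<rho> [] \<xi>))"
proof (rule bmeas_bound[of _ 1])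
  show "(\<lambda>\<xi>. exp (egen A h \<rho> [] \<xi>)) \<in> borel_measurable borel"
    by (intro borel_measurable_continuous_onI continuous_on_exp)
      (auto intro: differentiable_imp_continuous_on_UNIV egen_differentiable)
qed (simp add: norm_exp_eq_Re Re_egen)

lemma norm_propagator_le: "norm (propagator A h \<rho>) \<le> 1"
  unfolding propagator_def by (rule norm_fmult_le) (auto simp: norm_exp_eq_Re Re_egen)

lemma propagator_add: "propagator A h \<rho> o\<^sub>L propagator A h \<rho>' = propagator A h (\<rho> + \<rho>')"
proof -
  have "egen A h \<rho> [] \<xi> + egen A h \<rho>' [] \<xi> = egen A h (\<rho> + \<rho>') [] \<xi>" for \<xi>
    by (simp add: egen_def add_divide_distrib distrib_right distrib_left)
  then show ?thesis
    by (simp add: propagator_def fmult_compose bmeas_exp_egen exp_add[symmetric])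
qed

lemma propagator_0: "propagator A h 0 = id_blinfun"
  by (simp add: propagator_def egen_def fmult_1)

lemma clinear_adj_propagator: "clinear_adj (propagator A h \<rho>)"
  unfolding propagator_def by (intro clinear_adj_fmult bmeas_exp_egen) simp

lemma clinear_adj_gop: "snd g \<in> lists Basis \<Longrightarrow> clinear_adj (gop A h g)"
  unfolding gop_def by (intro clinear_adj_fmult bmeas_egen) simp_all

lemma mderiv_gop:
  assumes "bs \<in> lists Basis" "b \<in> Basis"
  shows "mderiv b (gop A h (\<sigma>, bs)) (gop A h (\<sigma>, b # bs))"
proof -
  have l: "b # bs \<in> lists Basis" "b # b # bs \<in> lists Basis" using assms by auto
  have "norm (pd b (pd b (egen A h \<sigma> bs)) \<xi>) \<le> (\<bar>\<sigma>\<bar> * h ^ length (b # b # bs) / h\<^sup>2) * K (b # b # bs)" for \<xi>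
    unfolding pd_egen[OF assms(1)] pd_egen[OF l(1)] by (rule norm_egen[OF l(2)])
  from mderiv_fmult[OF _ _ _ _ _ this, of 1]
  have "mderiv b (fmult 1 (egen A h \<sigma> bs)) (fmult 1 (\<lambda>\<xi>. 1 *\<^sub>R pd b (egen A h \<sigma> bs) \<xi>))"
    by (simp add: pd_egen[OF assms(1)] bmeas_egen[OF assms(1)] bmeas_egen[OF l(1)]
        egen_differentiable[OF assms(1)] egen_differentiable[OF l(1)])
  then show ?thesis
    by (simp add: gop_def pd_egen[OF assms(1)])
qed

text \<open>The derivative falls on the exponent and produces the generator as a factor. The bound
  on the second derivative may depend on \<open>h\<close>, since it only serves differentiability in
  norm.\<close>

lemma mderiv_propagator:
  assumes b: "b \<in> Basis"
  shows "mderiv b (propagator A h \<rho>) (gop A h (\<rho>, [b]) o\<^sub>L propagator A h \<rho>)"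
proof -
  let ?g = "egen A h \<rho> []" and ?f = "\<lambda>\<xi>. exp (egen A h \<rho> [] \<xi>)"
  have l: "[] \<in> lists Basis" "[b] \<in> lists Basis" "[b, b] \<in> lists Basis" using b by auto
  have fd: "(?f has_derivative (\<lambda>k. frechet_derivative ?g (at \<xi>) k * exp (?g \<xi>))) (at \<xi>)" for \<xi>
  proof -
    have "(exp has_derivative (\<lambda>k. exp (?g \<xi>) * k)) (at (?g \<xi>))"
      using DERIV_exp[of "?g \<xi>"] by (simp add: has_field_derivative_def)
    from has_derivative_compose[OF frechet_derivative_works[THEN iffD1, OF egen_differentiable[OF l(1)]] this]
    show ?thesis by (simp add: mult.commute)
  qed
  have pdf: "pd b ?f = (\<lambda>\<xi>. egen A h \<rho> [b] \<xi> * ?f \<xi>)"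
    using pd_egen[OF l(1), of b \<rho>] by (auto simp: has_derivative_imp_pd[OF fd] pd_def fun_eq_iff)
  have fdiff: "?f differentiable (at \<xi>)" for \<xi> using fd differentiableI by blast
  have gdiff: "egen A h \<rho> [b] differentiable (at \<xi>)" for \<xi> by (rule egen_differentiable[OF l(2)])
  have pdpdf: "pd b (pd b ?f) = (\<lambda>\<xi>. egen A h \<rho> [b, b] \<xi> * ?f \<xi> + egen A h \<rho> [b] \<xi> * (egen A h \<rho> [b] \<xi> * ?f \<xi>))"
    unfolding pdf using fdiff gdiff by (simp add: pd_mult pdf pd_egen[OF l(2)])
  have "bmeas (pd b (pd b ?f))"
    unfolding pdpdf by (intro bmeas_add bmeas_mult bmeas_egen bmeas_exp_egen l)
  then obtain C where C: "\<And>\<xi>. norm (pd b (pd b ?f) \<xi>) \<le> C" by (metis bmeasE)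
  have "mderiv b (fmult 1 ?f) (fmult 1 (\<lambda>\<xi>. 1 *\<^sub>R pd b ?f \<xi>))"
  proof (rule mderiv_fmult[OF _ bmeas_exp_egen _ fdiff _ C])
    show "bmeas (pd b ?f)" unfolding pdf by (intro bmeas_mult bmeas_egen bmeas_exp_egen l)
    show "pd b ?f differentiable (at \<xi>)" for \<xi>
      unfolding pdf by (intro differentiable_mult gdiff fdiff)
  qed simp
  then show ?thesis
    using l by (simp add: propagator_def gop_def fmult_compose bmeas_egen bmeas_exp_egen pdf)
qed

lemma gop_propagator_commute: "bs \<in> lists Basis \<Longrightarrow> gop A h (\<sigma>, bs) o\<^sub>L propagator A h \<rho> = propagator A h \<rho> o\<^sub>L gop A h (\<sigma>, bs)"
  by (simp add: propagator_def gop_def fmult_compose bmeas_egen bmeas_exp_egen mult.commute)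

lemma gop_minus: "bs \<in> lists Basis \<Longrightarrow> gop A h (- \<sigma>, bs) = - gop A h (\<sigma>, bs)"
proof -
  assume bs: "bs \<in> lists Basis"
  have "egen A h (- \<sigma>) bs = (\<lambda>\<xi>. (- 1) *\<^sub>R egen A h \<sigma> bs \<xi>)"
    by (simp add: egen_def fun_eq_iff)
  then have "gop A h (- \<sigma>, bs) = (- 1) *\<^sub>R gop A h (\<sigma>, bs)"
    unfolding gop_def using fmult_scaleR[OF bmeas_egen[OF bs], of "- 1" 1 \<sigma>] by simp
  then show ?thesis by simp
qed

lemma norm_propagator_conj: "norm (propagator A h \<rho> o\<^sub>L X o\<^sub>L propagator A h (- \<rho>)) \<le> norm X"
proof -
  have "norm (propagator A h \<rho> o\<^sub>L X o\<^sub>L propagator A h (- \<rho>)) \<le> (1 * norm X) * 1"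
    by (intro norm_compose_le norm_propagator_le order_refl)
  then show ?thesis by simp
qed

lemma propagator_inverse: "propagator A h (- \<rho>) o\<^sub>L (propagator A h \<rho> o\<^sub>L X) = X" "propagator A h \<rho> o\<^sub>L (propagator A h (- \<rho>) o\<^sub>L X) = X"
  by (simp_all add: blinfun_compose_assoc[symmetric] propagator_add propagator_0)

lemma propagator_conj_conj: "propagator A h \<rho> o\<^sub>L (propagator A h \<rho>' o\<^sub>L X o\<^sub>L propagator A h (- \<rho>')) o\<^sub>L propagator A h (- \<rho>) = propagator A h (\<rho> + \<rho>') o\<^sub>L X o\<^sub>L propagator A h (- (\<rho> + \<rho>'))"
proof -
  have "propagator A h \<rho> o\<^sub>L (propagator A h \<rho>' o\<^sub>L X o\<^sub>L propagator A h (- \<rho>')) o\<^sub>L propagator A h (- \<rho>)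
      = (propagator A h \<rho> o\<^sub>L propagator A h \<rho>') o\<^sub>L X o\<^sub>L (propagator A h (- \<rho>') o\<^sub>L propagator A h (- \<rho>))"
    by (simp only: blinfun_compose_assoc)
  then show ?thesis by (simp add: propagator_add add.commute)
qed

lemma propagator_conj_commutator:
  "propagator A h \<rho> o\<^sub>L commutator X Y o\<^sub>L propagator A h (- \<rho>)
    = commutator (propagator A h \<rho> o\<^sub>L X o\<^sub>L propagator A h (- \<rho>)) (propagator A h \<rho> o\<^sub>L Y o\<^sub>L propagator A h (- \<rho>))"
  by (simp add: commutator_def blinfun_compose_simps blinfun_compose_assoc propagator_inverse)

end

section \<open>Estimates uniform in the parameters\<close>

context
  fixes v :: "'a::euclidean_space \<Rightarrow> complex" and K :: "'a list \<Rightarrow> real"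
  assumes smooth_v: "smooth v" and bounded_v: "\<And>bs. bs \<in> lists Basis \<Longrightarrow> \<exists>C. \<forall>x. norm (pderivs bs v x) \<le> C"
begin

lemma bmeas_v: "bmeas v"
  using smooth_bmeas[OF smooth_v bounded_v, of "[]"] by simp

lemma symbol_v: "\<exists>L. symbol n L v"
proof -
  have "\<forall>bs\<in>lists Basis. \<exists>C. \<forall>x. norm (pderivs bs v x) \<le> C" using bounded_v by blast
  then obtain Cb where Cb: "\<And>bs x. bs \<in> lists Basis \<Longrightarrow> norm (pderivs bs v x) \<le> Cb bs" by metis
  obtain M where M: "0 \<le> M" "\<And>bs. bs \<in> lists Basis \<Longrightarrow> length bs \<le> n + 1 \<Longrightarrow> Cb bs \<le> M"
    using bounded_on_short_lists[of "n + 1" Cb] by blast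
  have "bd n (\<lambda>_. M) (pderivs [b] v)" if b: "b \<in> Basis" for b
  proof (rule bd_pderivs[OF _ smooth_v])
    fix cs :: "'a list" assume cs: "cs \<in> lists Basis" "length cs \<le> n"
    then have "cs @ [b] \<in> lists Basis" "length (cs @ [b]) \<le> n + 1" using b by auto
    then show "\<forall>x. norm (pderivs (cs @ [b]) v x) \<le> M"
      using Cb M(2) order_trans by blast
  qed (use b in simp)
  moreover have "v differentiable (at x)" for x
    using smooth_v unfolding smooth_def by (metis lists.Nil pderivs.simps(1))
  ultimately have "symbol n M v"
    unfolding symbol_def using bmeas_v by (simp add: pderivs_Cons del: pderivs.simps(2))
  then show ?thesis by blast
qed

text \<open>Conjugation \<open>\<Phi>\<close> by the Fourier transform turns the letters into
  multiplication operators and the potential into \<open>vop v []\<close>, as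
  \<open>norm_comm_word_vop\<close> requires. By \<open>symbol_egen\<close> a letter of order l
  contributes \<open>4 * M * D ^ l\<close>, and the orders add up to \<open>m\<close>.\<close>

lemma norm_gword:
  "\<exists>C\<ge>0. \<forall>A h D gs. params K A h D \<longrightarrow> admissible D m gs \<longrightarrow> norm (gword v A h gs) \<le> C * D ^ m"
proof -
  let ?d = "DIM('a)"
  obtain M where M: "0 \<le> M" "\<And>bs. bs \<in> lists Basis \<Longrightarrow> length bs \<le> m + 1 + 2 * ?d \<Longrightarrow> K bs \<le> M"
    using bounded_on_short_lists[of "m + 1 + 2 * ?d" K] by blast
  have "\<forall>k. \<exists>C\<ge>0. \<forall>bs Lfs. bs \<in> lists Basis \<longrightarrow> length bs \<le> 0 \<longrightarrow> length Lfs = k \<longrightarrow>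
    (\<forall>(L, f)\<in>set Lfs. symbol (2 * ?d) L f) \<longrightarrow>
    norm (comm_word (map mult_op (map snd Lfs)) (vop v bs)) \<le> C * prod_list (map fst Lfs)"
    using norm_comm_word_vop[OF smooth_v bounded_v] by blast
  then obtain C where C: "\<And>k. 0 \<le> C k" and CW: "\<And>k Lfs. length Lfs = k \<Longrightarrow>
    \<forall>(L, f)\<in>set Lfs. symbol (2 * ?d) L f \<Longrightarrow>
    norm (comm_word (map mult_op (map snd Lfs)) (vop v [])) \<le> C k * prod_list (map fst Lfs)"
    by (metis (no_types, lifting) lists.Nil list.size(3) order_refl)
  \<comment> \<open>A word of order \<open>m\<close> has at most \<open>m\<close> letters, so one
    sum covers the constants of all lengths.\<close>
  define CC where "CC = (\<Sum>k\<le>m. C k * (4 * M) ^ k)"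
  have CC: "0 \<le> CC" unfolding CC_def using C M(1) by (intro sum_nonneg) auto
  have "norm (gword v A h gs) \<le> CC * D ^ m" if par: "params K A h D" and adm: "admissible D m gs" for A h D gs
  proof -
    define \<Phi> where "\<Phi> X = fourier (- 1) o\<^sub>L X o\<^sub>L fourier 1" for X :: "'a L2 \<Rightarrow>\<^sub>L 'a L2"
    have F: "fourier (- 1) o\<^sub>L fourier 1 = (id_blinfun :: 'a L2 \<Rightarrow>\<^sub>L 'a L2)" "fourier 1 o\<^sub>L fourier (- 1) = (id_blinfun :: 'a L2 \<Rightarrow>\<^sub>L 'a L2)"
      using fourier_inverse[of 1] fourier_inverse[of "- 1"] by simp_all
    have Fc: "fourier (- 1) o\<^sub>L (fourier 1 o\<^sub>L X) = X" "fourier 1 o\<^sub>L (fourier (- 1) o\<^sub>L X) = X" for X :: "'a L2 \<Rightarrow>\<^sub>L 'a L2"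
      by (simp_all add: blinfun_compose_assoc[symmetric] F)
    have \<Phi>c: "\<Phi> (commutator X Y) = commutator (\<Phi> X) (\<Phi> Y)" for X Y
      by (simp add: \<Phi>_def commutator_def blinfun_compose_simps blinfun_compose_assoc Fc)
    have \<Phi>g: "\<Phi> (gop A h g) = mult_op (egen A h (fst g) (snd g))" for g
      by (simp add: \<Phi>_def gop_def fmult_def blinfun_compose_assoc Fc F)
    have \<Phi>v: "\<Phi> (mult_op v) = vop v []"
      by (simp add: \<Phi>_def vop_def[OF smooth_v bounded_v] fmult_def)
    have \<Phi>w: "\<Phi> (gword v A h gs) = comm_word (map (\<lambda>g. mult_op (egen A h (fst g) (snd g))) gs) (vop v [])" for gs
      unfolding gword_def by (induction gs) (simp_all add: \<Phi>c \<Phi>g \<Phi>v)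
    have \<Phi>n: "norm X \<le> norm (\<Phi> X)" for X
    proof -
      have "X = fourier 1 o\<^sub>L \<Phi> X o\<^sub>L fourier (- 1)"
        by (simp add: \<Phi>_def blinfun_compose_assoc Fc F)
      also have "norm \<dots> \<le> (1 * norm (\<Phi> X)) * 1"
        by (intro norm_compose_le order_refl norm_fourier_le_1(1)) simp_all
      finally show ?thesis by simp
    qed
    define Lf where "Lf g = (4 * M * D ^ length (snd g), egen A h (fst g) (snd g))" for g :: "real \<times> 'a list"
    have len: "length (snd g) \<le> m" if "g \<in> set gs" for g
      using adm that member_le_sum_list[of "length (snd g)" "map (length \<circ> snd) gs"] by (auto simp: admissible_def)
    have sym: "\<forall>(L, f)\<in>set (map Lf gs). symbol (2 * ?d) L f"
    proof -
      have "symbol (2 * ?d) (4 * M * D ^ length (snd g)) (egen A h (fst g) (snd g))" if g: "g \<in> set gs" for g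
      proof (rule symbol_egen[OF par])
        show "K cs \<le> M" if "cs \<in> lists Basis" "length cs \<le> length (snd g) + 1 + 2 * ?d" for cs
          using that len[OF g] by (intro M(2)) auto
      qed (use adm g M(1) in \<open>auto simp: admissible_def\<close>)
      then show ?thesis by (auto simp: Lf_def)
    qed
    have prod: "prod_list (map fst (map Lf gs)) = (4 * M) ^ length gs * D ^ sum_list (map (length \<circ> snd) gs)" for gs
      by (induction gs) (simp_all add: Lf_def power_add mult_ac)
    have "norm (gword v A h gs) \<le> norm (comm_word (map mult_op (map snd (map Lf gs))) (vop v []))"
      using \<Phi>n[of "gword v A h gs"] by (simp add: \<Phi>w Lf_def o_def)
    also have "\<dots> \<le> C (length gs) * prod_list (map fst (map Lf gs))"
      by (rule CW[OF _ sym]) simp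
    also have "\<dots> = (C (length gs) * (4 * M) ^ length gs) * D ^ m"
      unfolding prod using adm by (simp add: admissible_def)
    also have "\<dots> \<le> CC * D ^ m"
    proof (rule mult_right_mono)
      show "C (length gs) * (4 * M) ^ length gs \<le> CC"
        unfolding CC_def using C M(1) admissible_length[OF adm]
        by (intro member_le_sum[of _ _ "\<lambda>k. C k * (4 * M) ^ k"]) auto
    qed (use params_h(5)[OF par] in auto)
    finally show ?thesis .
  qed
  then show ?thesis using CC by blast
qed

text \<open>Leibniz' rule: one summand for each letter, in which that letter is differentiated once
  more, while the innermost multiplication operator is killed.\<close>

lemma mderiv_gword:
  assumes par: "params K A h D" and b: "b \<in> Basis"
  shows "admissible D m gs \<Longrightarrow> \<exists>Ls. length Ls = length gs \<and> (\<forall>gs'\<in>set Ls. admissible D (Suc m) gs') \<and>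
    mderiv b (gword v A h gs) (sum_list (map (gword v A h) Ls))"
proof (induction gs arbitrary: m)
  case Nil
  show ?case
    using mderiv_mult_op[OF bmeas_v, of b] by (intro exI[of _ "[]"]) (simp add: gword_def)
next
  case (Cons g gs)
  obtain \<sigma> bs where g: "g = (\<sigma>, bs)" by force
  have adm: "\<bar>\<sigma>\<bar> \<le> 4 * D" "bs \<in> lists Basis" "bs \<noteq> []" "admissible D (m - length bs) gs" "length bs \<le> m"
    using Cons.prems by (auto simp: admissible_def g)
  obtain Ls where Ls: "length Ls = length gs" "\<forall>gs'\<in>set Ls. admissible D (Suc (m - length bs)) gs'"
    "mderiv b (gword v A h gs) (sum_list (map (gword v A h) Ls))"
    using Cons.IH[OF adm(4)] by blast
  let ?Ls = "((\<sigma>, b # bs) # gs) # map ((#) g) Ls"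
  have "mderiv b (gword v A h (g # gs)) (commutator (gop A h (\<sigma>, b # bs)) (gword v A h gs) + commutator (gop A h g) (sum_list (map (gword v A h) Ls)))"
    using mderiv_commutator[OF mderiv_gop[OF par adm(2) b, of \<sigma>] Ls(3)] by (simp add: gword_def g)
  also have "commutator (gop A h (\<sigma>, b # bs)) (gword v A h gs) + commutator (gop A h g) (sum_list (map (gword v A h) Ls))
      = sum_list (map (gword v A h) ?Ls)"
    by (simp add: gword_def commutator_sum_list o_def)
  finally have der: "mderiv b (gword v A h (g # gs)) (sum_list (map (gword v A h) ?Ls))" .
  have "admissible D (Suc m) gs'" if "gs' \<in> set ?Ls" for gs'
  proof -
    have "admissible D (length (b # bs) + (m - length bs)) ((\<sigma>, b # bs) # gs)"
      by (rule admissible_Cons) (use adm b in auto)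
    moreover have "admissible D (length bs + Suc (m - length bs)) (g # gs'')" if "gs'' \<in> set Ls" for gs''
      unfolding g by (rule admissible_Cons) (use adm Ls that in auto)
    ultimately show ?thesis
      using that adm(5) by auto
  qed
  then show ?case
    using der Ls(1) by (intro exI[of _ ?Ls]) (auto simp del: sum_list.Cons)
qed

lemma clinear_adj_gword: "params K A h D \<Longrightarrow> admissible D m gs \<Longrightarrow> clinear_adj (gword v A h gs)"
  unfolding gword_def
  by (intro clinear_adj_comm_word clinear_adj_mult_op bmeas_v) (auto simp: admissible_def intro: clinear_adj_gop)

lemma clinear_adj_0: "clinear_adj (0 :: 'a L2 \<Rightarrow>\<^sub>L 'a L2)"
  using clinear_adj_diff[OF clinear_adj_mult_op[OF bmeas_v] clinear_adj_mult_op[OF bmeas_v]] by simp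

lemma clinear_adj_wclass: "params K A h D \<Longrightarrow> wclass v A h D \<rho> m n X \<Longrightarrow> clinear_adj X"
proof -
  assume par: "params K A h D" and "wclass v A h D \<rho> m n X"
  then obtain Ls where Ls: "\<forall>gs\<in>set Ls. admissible D m gs"
    and X: "X = propagator A h \<rho> o\<^sub>L sum_list (map (gword v A h) Ls) o\<^sub>L propagator A h (- \<rho>)"
    by (auto simp: wclass_def)
  have "clinear_adj (sum_list (map (gword v A h) Ls))"
    using Ls by (induction Ls) (auto intro: clinear_adj_0 clinear_adj_add clinear_adj_gword[OF par])
  then show ?thesis
    unfolding X by (intro clinear_adj_compose clinear_adj_propagator[OF par])
qed

lemma norm_wclass:
  "\<exists>C\<ge>0. \<forall>A h D \<rho> X. params K A h D \<longrightarrow> wclass v A h D \<rho> m n X \<longrightarrow> norm X \<le> C * D ^ m"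
proof -
  obtain C where C: "0 \<le> C" "\<And>A h D gs. params K A h D \<Longrightarrow> admissible D m gs \<Longrightarrow> norm (gword v A h gs) \<le> C * D ^ m"
    using norm_gword[of m] by blast
  have "norm X \<le> (real n * C) * D ^ m" if par: "params K A h D" and "wclass v A h D \<rho> m n X" for A h D \<rho> X
  proof -
    obtain Ls where Ls: "length Ls \<le> n" "\<forall>gs\<in>set Ls. admissible D m gs"
      and X: "X = propagator A h \<rho> o\<^sub>L sum_list (map (gword v A h) Ls) o\<^sub>L propagator A h (- \<rho>)"
      using \<open>wclass v A h D \<rho> m n X\<close> by (auto simp: wclass_def)
    have "norm X \<le> norm (sum_list (map (gword v A h) Ls))"
      unfolding X by (rule norm_propagator_conj[OF par])
    also have "\<dots> \<le> real (length Ls) * (C * D ^ m)"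
      using Ls(2)
    proof (induction Ls)
      case (Cons gs Ls)
      have "norm (gword v A h gs + sum_list (map (gword v A h) Ls)) \<le> C * D ^ m + real (length Ls) * (C * D ^ m)"
        by (intro norm_triangle_mono) (use Cons C(2)[OF par] in auto)
      then show ?case by (simp add: distrib_right)
    qed simp
    also have "\<dots> \<le> real n * (C * D ^ m)"
      using Ls(1) C(1) params_h(5)[OF par] by (intro mult_right_mono) auto
    finally show ?thesis by (simp add: mult.assoc)
  qed
  then show ?thesis using C(1) by (intro exI[of _ "real n * C"]) auto
qed

text \<open>The two propagators contribute the generator with opposite signs. As it commutes with
  them, both terms merge into one more commutator letter \<open>(\<rho>, [b])\<close> in front of
  each of the \<open>n\<close> words. Differentiating the words, of at most \<open>m\<close> letters
  each, adds \<open>n * m\<close> more.\<close>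

lemma mderiv_wclass:
  assumes par: "params K A h D" and b: "b \<in> Basis" and W: "wclass v A h D \<rho> m n X"
  shows "\<exists>R. mderiv b X R \<and> wclass v A h D \<rho> (Suc m) (n + n * m) R"
proof -
  obtain Ls where \<rho>: "\<bar>\<rho>\<bar> \<le> 4 * D" and Ls: "length Ls \<le> n" "\<forall>gs\<in>set Ls. admissible D m gs"
    and X: "X = propagator A h \<rho> o\<^sub>L sum_list (map (gword v A h) Ls) o\<^sub>L propagator A h (- \<rho>)"
    using W by (auto simp: wclass_def)
  have "\<exists>Rs. length Rs \<le> length Ls * m \<and> (\<forall>gs\<in>set Rs. admissible D (Suc m) gs) \<and>
      mderiv b (sum_list (map (gword v A h) Ls)) (sum_list (map (gword v A h) Rs))"
    using Ls(2)
  proof (induction Ls)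
    case Nil
    show ?case using mderiv_diff[OF mderiv_mult_op[OF bmeas_v, of b] mderiv_mult_op[OF bmeas_v, of b]] by simp
  next
    case (Cons gs Ls)
    then obtain Rs where Rs: "length Rs \<le> length Ls * m" "\<forall>gs\<in>set Rs. admissible D (Suc m) gs"
      "mderiv b (sum_list (map (gword v A h) Ls)) (sum_list (map (gword v A h) Rs))" by auto
    have adm: "admissible D m gs" using Cons.prems by simp
    obtain Qs where Qs: "length Qs = length gs" "\<forall>gs'\<in>set Qs. admissible D (Suc m) gs'"
      "mderiv b (gword v A h gs) (sum_list (map (gword v A h) Qs))"
      using mderiv_gword[OF par b adm] by blast
    have "mderiv b (sum_list (map (gword v A h) (gs # Ls))) (sum_list (map (gword v A h) (Qs @ Rs)))"
      using mderiv_add[OF Qs(3) Rs(3)] by simp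
    moreover have "length (Qs @ Rs) \<le> length (gs # Ls) * m"
      using Qs(1) Rs(1) admissible_length[OF adm] by simp
    ultimately show ?case
      using Qs(2) Rs(2) by (intro exI[of _ "Qs @ Rs"]) auto
  qed
  then obtain Rs where Rs: "length Rs \<le> length Ls * m" "\<forall>gs\<in>set Rs. admissible D (Suc m) gs"
    "mderiv b (sum_list (map (gword v A h) Ls)) (sum_list (map (gword v A h) Rs))" by blast
  define Q where "Q = sum_list (map (gword v A h) Ls)"
  define R where "R = sum_list (map (gword v A h) Rs)"
  let ?U = "propagator A h \<rho>" and ?U' = "propagator A h (- \<rho>)" and ?P = "gop A h (\<rho>, [b])"
  have l: "[b] \<in> lists Basis" using b by simp
  have QR: "mderiv b Q R" using Rs(3) by (simp add: Q_def R_def)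
  have "mderiv b X (((((?P o\<^sub>L ?U) o\<^sub>L Q) + (?U o\<^sub>L R)) o\<^sub>L ?U') + ((?U o\<^sub>L Q) o\<^sub>L (gop A h (- \<rho>, [b]) o\<^sub>L ?U')))"
    unfolding X Q_def[symmetric]
    using mderiv_compose[OF mderiv_compose[OF mderiv_propagator[OF par b, of \<rho>] QR] mderiv_propagator[OF par b, of "- \<rho>"]] by simp
  also have "((((?P o\<^sub>L ?U) o\<^sub>L Q) + (?U o\<^sub>L R)) o\<^sub>L ?U') + ((?U o\<^sub>L Q) o\<^sub>L (gop A h (- \<rho>, [b]) o\<^sub>L ?U'))
      = ?U o\<^sub>L (commutator ?P Q + R) o\<^sub>L ?U'"
    unfolding gop_minus[OF par l] gop_propagator_commute[OF par l]
    by (simp add: commutator_def blinfun_compose_simps blinfun_compose_assoc)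
  also have "commutator ?P Q + R = sum_list (map (gword v A h) (map ((#) (\<rho>, [b])) Ls @ Rs))"
    by (simp add: Q_def R_def commutator_sum_list gword_def o_def)
  finally have "mderiv b X (?U o\<^sub>L sum_list (map (gword v A h) (map ((#) (\<rho>, [b])) Ls @ Rs)) o\<^sub>L ?U')" .
  moreover have "wclass v A h D \<rho> (Suc m) (n + n * m) (?U o\<^sub>L sum_list (map (gword v A h) (map ((#) (\<rho>, [b])) Ls @ Rs)) o\<^sub>L ?U')"
    unfolding wclass_def
  proof (intro conjI exI[of _ "map ((#) (\<rho>, [b])) Ls @ Rs"] ballI refl)
    show "length (map ((#) (\<rho>, [b])) Ls @ Rs) \<le> n + n * m"
      unfolding length_append length_map
      by (rule add_mono[OF Ls(1) order_trans[OF Rs(1) mult_le_mono1[OF Ls(1)]]])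
    show "admissible D (Suc m) gs" if "gs \<in> set (map ((#) (\<rho>, [b])) Ls @ Rs)" for gs
      using that Ls(2) Rs(2) admissible_Cons[OF \<rho> l, of m] by auto
  qed (rule \<rho>)
  ultimately show ?thesis by blast
qed

text \<open>Further derivations gain further powers of \<open>D\<close>, which are dropped because
  \<open>D \<le> 1\<close>.\<close>

lemma opbd_wclass:
  "\<exists>C\<ge>0. \<forall>A h D \<rho> X. params K A h D \<longrightarrow> wclass v A h D \<rho> m n X \<longrightarrow> opbd j (C * D ^ m) X"
proof (induction j arbitrary: m n)
  case 0
  then show ?case using norm_wclass[of m n] by simp
next
  case (Suc j)
  obtain C1 where C1: "0 \<le> C1" "\<And>A h D \<rho> X. params K A h D \<Longrightarrow> wclass v A h D \<rho> m n X \<Longrightarrow> norm X \<le> C1 * D ^ m"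
    using norm_wclass[of m n] by blast
  obtain C2 where C2: "0 \<le> C2" "\<And>A h D \<rho> X. params K A h D \<Longrightarrow> wclass v A h D \<rho> (Suc m) (n + n * m) X \<Longrightarrow> opbd j (C2 * D ^ Suc m) X"
    using Suc.IH[of "Suc m" "n + n * m"] by blast
  have "opbd (Suc j) ((C1 + C2) * D ^ m) X" if par: "params K A h D" and W: "wclass v A h D \<rho> m n X" for A h D \<rho> X
    unfolding opbd.simps
  proof (intro conjI ballI)
    have Dm: "0 \<le> D ^ m" using params_h(5)[OF par] by simp
    show "norm X \<le> (C1 + C2) * D ^ m"
      using C1(2)[OF par W] mult_nonneg_nonneg[OF C2(1) Dm] by (simp add: distrib_right)
    fix b :: 'a assume "b \<in> Basis"
    then obtain R where R: "mderiv b X R" "wclass v A h D \<rho> (Suc m) (n + n * m) R"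
      using mderiv_wclass[OF par _ W] by blast
    have "C2 * D ^ Suc m \<le> C2 * D ^ m"
      using params_h[OF par] C2(1) by (intro mult_left_mono power_decreasing) auto
    also have "\<dots> \<le> (C1 + C2) * D ^ m"
      using C1(1) Dm by (intro mult_right_mono) auto
    finally show "\<exists>R. mderiv b X R \<and> opbd j ((C1 + C2) * D ^ m) R"
      using R(1) opbd_mono[OF C2(2)[OF par R(2)]] by blast
  qed
  then show ?case using C1(1) C2(1) by (intro exI[of _ "C1 + C2"]) auto
qed

lemma wclass_conj:
  assumes par: "params K A h D" and W: "wclass v A h D \<rho> m n X" and le: "\<bar>\<rho>' + \<rho>\<bar> \<le> 4 * D"
  shows "wclass v A h D (\<rho>' + \<rho>) m n (propagator A h \<rho>' o\<^sub>L X o\<^sub>L propagator A h (- \<rho>'))"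
  using W le propagator_conj_conj[OF par, of \<rho>' \<rho>] unfolding wclass_def by metis

text \<open>The core bound starts at the first derivatives of \<open>X\<close>, which lie in the
  class of order \<open>Suc m\<close>; this is the gain of one power of \<open>D\<close>.\<close>

lemma norm_commutator_mult_wclass:
  "\<exists>C\<ge>0. \<forall>A h D \<rho> X. params K A h D \<longrightarrow> wclass v A h D \<rho> m n X \<longrightarrow> norm (commutator (mult_op v) X) \<le> C * D ^ Suc m"
proof -
  let ?d = "DIM('a)"
  obtain CL where CL: "0 \<le> CL" and lemL: "\<And>(S :: 'a L2 \<Rightarrow>\<^sub>L 'a L2) B L v. clinear_adj S \<Longrightarrow> 0 \<le> B \<Longrightarrow>
     \<forall>b\<in>Basis. \<exists>R. mderiv b S R \<and> opbd (2 * ?d + 1) B R \<Longrightarrow>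
     symbol (2 * ?d) L v \<Longrightarrow> norm (commutator (mult_op v) S) \<le> CL * L * B"
    using norm_commutator_symbol[where 'a='a] by blast
  obtain L where L: "symbol (2 * ?d) L v" using symbol_v by blast
  obtain C where C: "0 \<le> C" "\<And>A h D \<rho> X. params K A h D \<Longrightarrow> wclass v A h D \<rho> (Suc m) (n + n * m) X \<Longrightarrow> opbd (2 * ?d + 1) (C * D ^ Suc m) X"
    using opbd_wclass[of "Suc m" "n + n * m" "2 * ?d + 1"] by blast
  have "norm (commutator (mult_op v) X) \<le> (CL * L * C) * D ^ Suc m"
    if par: "params K A h D" and W: "wclass v A h D \<rho> m n X" for A h D \<rho> X
  proof -
    have "norm (commutator (mult_op v) X) \<le> CL * L * (C * D ^ Suc m)"
    proof (rule lemL[OF clinear_adj_wclass[OF par W] _ _ L])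
      show "0 \<le> C * D ^ Suc m" using C(1) params_h(5)[OF par] by simp
      show "\<forall>b\<in>Basis. \<exists>R. mderiv b X R \<and> opbd (2 * ?d + 1) (C * D ^ Suc m) R"
        using mderiv_wclass[OF par _ W] C(2)[OF par] by blast
    qed
    then show ?thesis by (simp only: mult.assoc)
  qed
  then show ?thesis
    using CL C(1) symbol_nonneg[OF L] by (intro exI[of _ "CL * L * C"]) auto
qed

text \<open>In order 0 all words are empty, so \<open>X1\<close> is a multiple of a conjugate of
  \<open>mult_op v\<close>. Undoing this conjugation gives \<open>X2\<close> the parameter
  \<open>\<rho>2 - \<rho>1\<close>, of size at most \<open>4 * D\<close>, and leaves a commutator
  with the potential itself.\<close>

lemma norm_commutator_wclass_0:
  "\<exists>C\<ge>0. \<forall>A h D \<rho>1 \<rho>2 X1 X2. params K A h D \<longrightarrow> \<bar>\<rho>1\<bar> \<le> 2 * D \<longrightarrow> \<bar>\<rho>2\<bar> \<le> 2 * D \<longrightarrow>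
    wclass v A h D \<rho>1 0 n1 X1 \<longrightarrow> wclass v A h D \<rho>2 (Suc m2) n2 X2 \<longrightarrow> norm (commutator X1 X2) \<le> C * D\<^sup>2"
proof -
  obtain C where C: "0 \<le> C" "\<And>A h D \<rho> X. params K A h D \<Longrightarrow> wclass v A h D \<rho> (Suc m2) n2 X \<Longrightarrow> norm (commutator (mult_op v) X) \<le> C * D ^ Suc (Suc m2)"
    using norm_commutator_mult_wclass[of "Suc m2" n2] by blast
  have "norm (commutator X1 X2) \<le> (real n1 * C) * D\<^sup>2"
    if par: "params K A h D" and \<rho>: "\<bar>\<rho>1\<bar> \<le> 2 * D" "\<bar>\<rho>2\<bar> \<le> 2 * D"
      and W: "wclass v A h D \<rho>1 0 n1 X1" "wclass v A h D \<rho>2 (Suc m2) n2 X2" for A h D \<rho>1 \<rho>2 X1 X2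
  proof -
    obtain Ls where Ls: "length Ls \<le> n1" "\<forall>gs\<in>set Ls. admissible D 0 gs"
      and X1: "X1 = propagator A h \<rho>1 o\<^sub>L sum_list (map (gword v A h) Ls) o\<^sub>L propagator A h (- \<rho>1)"
      using W(1) by (auto simp: wclass_def)
    have sum: "sum_list (map (gword v A h) Ls) = real (length Ls) *\<^sub>R mult_op v"
      using Ls(2)
    proof (induction Ls)
      case (Cons gs Ls)
      then have "gs = []" using admissible_0[of D gs] by simp
      then show ?case using Cons by (simp add: gword_def scaleR_add_left)
    qed simp
    define Y where "Y = propagator A h (- \<rho>1) o\<^sub>L X2 o\<^sub>L propagator A h (- (- \<rho>1))"
    have Y: "wclass v A h D (- \<rho>1 + \<rho>2) (Suc m2) n2 Y"
      unfolding Y_def using \<rho> by (intro wclass_conj[OF par W(2)]) linarith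
    have X2: "X2 = propagator A h \<rho>1 o\<^sub>L Y o\<^sub>L propagator A h (- \<rho>1)"
      by (simp add: Y_def blinfun_compose_assoc propagator_inverse[OF par] propagator_add[OF par] propagator_0[OF par])
    have "norm (commutator X1 X2) \<le> norm (commutator (sum_list (map (gword v A h) Ls)) Y)"
      unfolding X1 X2 propagator_conj_commutator[OF par, symmetric] by (rule norm_propagator_conj[OF par])
    also have "\<dots> = real (length Ls) * norm (commutator (mult_op v) Y)"
      by (simp add: sum commutator_def blinfun_compose_simps flip: scaleR_diff_right)
    also have "\<dots> \<le> real n1 * (C * D ^ Suc (Suc m2))"
      using Ls(1) by (intro mult_mono C(2)[OF par Y]) auto
    also have "\<dots> \<le> real n1 * (C * D\<^sup>2)"
      using C(1) params_h[OF par] by (intro mult_left_mono power_decreasing) auto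
    finally show ?thesis by (simp add: mult.assoc)
  qed
  then show ?thesis using C(1) by (intro exI[of _ "real n1 * C"]) auto
qed

lemma norm_commutator_le: "norm (commutator X Y) \<le> 2 * (norm X * norm Y)"
proof -
  have "norm (commutator X Y) \<le> norm X * norm Y + norm Y * norm X"
    unfolding commutator_def by (rule order_trans[OF norm_triangle_ineq4]) (intro add_mono norm_blinfun_compose)
  then show ?thesis by (simp add: mult.commute)
qed

lemma norm_commutator_wclass:
  assumes "1 \<le> m1 + m2"
  shows "\<exists>C\<ge>0. \<forall>A h D \<rho>1 \<rho>2 X1 X2. params K A h D \<longrightarrow> \<bar>\<rho>1\<bar> \<le> 2 * D \<longrightarrow> \<bar>\<rho>2\<bar> \<le> 2 * D \<longrightarrow>
    wclass v A h D \<rho>1 m1 n1 X1 \<longrightarrow> wclass v A h D \<rho>2 m2 n2 X2 \<longrightarrow> norm (commutator X1 X2) \<le> C * D\<^sup>2"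
proof (cases m1)
  case 0
  then obtain l where "m2 = Suc l" using assms by (cases m2) auto
  then show ?thesis using norm_commutator_wclass_0[of n1 l n2] by (simp only: 0)
next
  case (Suc k1)
  show ?thesis
  proof (cases m2)
    case 0
    obtain C where C: "0 \<le> C" "\<And>A h D \<rho>1 \<rho>2 X1 X2. params K A h D \<Longrightarrow> \<bar>\<rho>1\<bar> \<le> 2 * D \<Longrightarrow> \<bar>\<rho>2\<bar> \<le> 2 * D \<Longrightarrow>
      wclass v A h D \<rho>1 0 n2 X1 \<Longrightarrow> wclass v A h D \<rho>2 (Suc k1) n1 X2 \<Longrightarrow> norm (commutator X1 X2) \<le> C * D\<^sup>2"
      using norm_commutator_wclass_0[of n2 k1 n1] by blast
    have "norm (commutator X1 X2) = norm (commutator X2 X1)" for X1 X2 :: "'a L2 \<Rightarrow>\<^sub>L 'a L2"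
      by (subst commutator_swap) simp
    then show ?thesis
      using C unfolding Suc 0 by (intro exI[of _ C]) metis
  next
    case (Suc k2)
    obtain C1 where C1: "0 \<le> C1" "\<And>A h D \<rho> X. params K A h D \<Longrightarrow> wclass v A h D \<rho> m1 n1 X \<Longrightarrow> norm X \<le> C1 * D ^ m1"
      using norm_wclass[of m1 n1] by blast
    obtain C2 where C2: "0 \<le> C2" "\<And>A h D \<rho> X. params K A h D \<Longrightarrow> wclass v A h D \<rho> m2 n2 X \<Longrightarrow> norm X \<le> C2 * D ^ m2"
      using norm_wclass[of m2 n2] by blast
    have "norm (commutator X1 X2) \<le> (2 * C1 * C2) * D\<^sup>2"
      if par: "params K A h D" and W: "wclass v A h D \<rho>1 m1 n1 X1" "wclass v A h D \<rho>2 m2 n2 X2" for A h D \<rho>1 \<rho>2 X1 X2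
    proof -
      have "norm X1 * norm X2 \<le> (C1 * D ^ m1) * (C2 * D ^ m2)"
        using params_h(5)[OF par] C1(1) by (intro mult_mono C1(2)[OF par W(1)] C2(2)[OF par W(2)]) auto
      also have "\<dots> = (C1 * C2) * D ^ (m1 + m2)" by (simp add: power_add mult_ac)
      also have "\<dots> \<le> (C1 * C2) * D\<^sup>2"
        using params_h[OF par] C1(1) C2(1) Suc \<open>m1 = Suc k1\<close> by (intro mult_left_mono power_decreasing) auto
      finally show ?thesis
        using norm_commutator_le[of X1 X2] by (simp add: mult.assoc)
    qed
    then show ?thesis using C1(1) C2(1) by (intro exI[of _ "2 * C1 * C2"]) auto
  qed
qed

text \<open>Leibniz' rule raises \<open>m1\<close> or \<open>m2\<close>, so the hypothesis on the
  orders persists along the induction while the bounds on the number of words grow.\<close>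

lemma opbd_commutator_wclass:
  assumes "1 \<le> m1 + m2"
  shows "\<exists>C\<ge>0. \<forall>A h D \<rho>1 \<rho>2 X1 X2. params K A h D \<longrightarrow> \<bar>\<rho>1\<bar> \<le> 2 * D \<longrightarrow> \<bar>\<rho>2\<bar> \<le> 2 * D \<longrightarrow>
    wclass v A h D \<rho>1 m1 n1 X1 \<longrightarrow> wclass v A h D \<rho>2 m2 n2 X2 \<longrightarrow> opbd j (C * D\<^sup>2) (commutator X1 X2)"
  using assms
proof (induction j arbitrary: m1 n1 m2 n2)
  case 0
  then show ?case using norm_commutator_wclass[of m1 m2 n1 n2] by simp
next
  case (Suc j)
  obtain C0 where C0: "0 \<le> C0" "\<And>A h D \<rho>1 \<rho>2 X1 X2. params K A h D \<Longrightarrow> \<bar>\<rho>1\<bar> \<le> 2 * D \<Longrightarrow> \<bar>\<rho>2\<bar> \<le> 2 * D \<Longrightarrow>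
    wclass v A h D \<rho>1 m1 n1 X1 \<Longrightarrow> wclass v A h D \<rho>2 m2 n2 X2 \<Longrightarrow> norm (commutator X1 X2) \<le> C0 * D\<^sup>2"
    using norm_commutator_wclass[OF Suc.prems, of n1 n2] by blast
  obtain C1 where C1: "0 \<le> C1" "\<And>A h D \<rho>1 \<rho>2 X1 X2. params K A h D \<Longrightarrow> \<bar>\<rho>1\<bar> \<le> 2 * D \<Longrightarrow> \<bar>\<rho>2\<bar> \<le> 2 * D \<Longrightarrow>
    wclass v A h D \<rho>1 (Suc m1) (n1 + n1 * m1) X1 \<Longrightarrow> wclass v A h D \<rho>2 m2 n2 X2 \<Longrightarrow> opbd j (C1 * D\<^sup>2) (commutator X1 X2)"
    using Suc.IH[of "Suc m1" m2 "n1 + n1 * m1" n2] by auto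
  obtain C2 where C2: "0 \<le> C2" "\<And>A h D \<rho>1 \<rho>2 X1 X2. params K A h D \<Longrightarrow> \<bar>\<rho>1\<bar> \<le> 2 * D \<Longrightarrow> \<bar>\<rho>2\<bar> \<le> 2 * D \<Longrightarrow>
    wclass v A h D \<rho>1 m1 n1 X1 \<Longrightarrow> wclass v A h D \<rho>2 (Suc m2) (n2 + n2 * m2) X2 \<Longrightarrow> opbd j (C2 * D\<^sup>2) (commutator X1 X2)"
    using Suc.IH[of m1 "Suc m2" n1 "n2 + n2 * m2"] by auto
  have "opbd (Suc j) ((C0 + (C1 + C2)) * D\<^sup>2) (commutator X1 X2)"
    if par: "params K A h D" and \<rho>: "\<bar>\<rho>1\<bar> \<le> 2 * D" "\<bar>\<rho>2\<bar> \<le> 2 * D"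
      and W: "wclass v A h D \<rho>1 m1 n1 X1" "wclass v A h D \<rho>2 m2 n2 X2" for A h D \<rho>1 \<rho>2 X1 X2
    unfolding opbd.simps
  proof (intro conjI ballI)
    have p: "0 \<le> (C1 + C2) * D\<^sup>2" "0 \<le> C0 * D\<^sup>2" using C0(1) C1(1) C2(1) by simp_all
    show "norm (commutator X1 X2) \<le> (C0 + (C1 + C2)) * D\<^sup>2"
      using C0(2)[OF par \<rho> W] p(1) by (simp only: distrib_right)
    fix b :: 'a assume b: "b \<in> Basis"
    obtain R1 where R1: "mderiv b X1 R1" "wclass v A h D \<rho>1 (Suc m1) (n1 + n1 * m1) R1"
      using mderiv_wclass[OF par b W(1)] by blast
    obtain R2 where R2: "mderiv b X2 R2" "wclass v A h D \<rho>2 (Suc m2) (n2 + n2 * m2) R2"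
      using mderiv_wclass[OF par b W(2)] by blast
    have "opbd j (C1 * D\<^sup>2 + C2 * D\<^sup>2) (commutator R1 X2 + commutator X1 R2)"
      by (rule opbd_add[OF C1(2)[OF par \<rho> R1(2) W(2)] C2(2)[OF par \<rho> W(1) R2(2)]])
    then have "opbd j ((C0 + (C1 + C2)) * D\<^sup>2) (commutator R1 X2 + commutator X1 R2)"
      by (rule opbd_mono) (use p(2) in \<open>simp add: distrib_right\<close>)
    then show "\<exists>R. mderiv b (commutator X1 X2) R \<and> opbd j ((C0 + (C1 + C2)) * D\<^sup>2) R"
      using mderiv_commutator[OF R1(1) R2(1)] by blast
  qed
  then show ?case
    using C0(1) C1(1) C2(1) by (intro exI[of _ "C0 + (C1 + C2)"]) auto
qed

lemma wclass_propagated: "params K A h D \<Longrightarrow> \<bar>\<rho>\<bar> \<le> 4 * D \<Longrightarrow> wclass v A h D \<rho> 0 1 (propagator A h \<rho> o\<^sub>L mult_op v o\<^sub>L propagator A h (- \<rho>))"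
  unfolding wclass_def by (intro conjI exI[of _ "[[]]"]) (auto simp: admissible_def gword_def)

lemma norm_double_commutator:
  "\<exists>C\<ge>0. \<forall>A h D \<tau> s. params K A h D \<longrightarrow> \<bar>\<tau>\<bar> \<le> D \<longrightarrow> \<bar>s\<bar> \<le> D \<longrightarrow>
    norm (commutator (commutator (mult_op v) (propagator A h \<tau> o\<^sub>L mult_op v o\<^sub>L propagator A h (- \<tau>)))
      (propagator A h s o\<^sub>L mult_op v o\<^sub>L propagator A h (- s))) \<le> C * D\<^sup>2"
proof -
  let ?d = "DIM('a)"
  obtain CL where CL: "0 \<le> CL" and lemL: "\<And>(S :: 'a L2 \<Rightarrow>\<^sub>L 'a L2) B L v. clinear_adj S \<Longrightarrow> 0 \<le> B \<Longrightarrow>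
     \<forall>b\<in>Basis. \<exists>R. mderiv b S R \<and> opbd (2 * ?d + 1) B R \<Longrightarrow>
     symbol (2 * ?d) L v \<Longrightarrow> norm (commutator (mult_op v) S) \<le> CL * L * B"
    using norm_commutator_symbol[where 'a='a] by blast
  obtain L where L: "symbol (2 * ?d) L v" using symbol_v by blast
  obtain C1 where C1: "0 \<le> C1" "\<And>A h D \<rho>1 \<rho>2 X1 X2. params K A h D \<Longrightarrow> \<bar>\<rho>1\<bar> \<le> 2 * D \<Longrightarrow> \<bar>\<rho>2\<bar> \<le> 2 * D \<Longrightarrow>
    wclass v A h D \<rho>1 1 1 X1 \<Longrightarrow> wclass v A h D \<rho>2 0 1 X2 \<Longrightarrow> opbd (2 * ?d + 1) (C1 * D\<^sup>2) (commutator X1 X2)"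
    using opbd_commutator_wclass[of 1 0 1 1 "2 * ?d + 1"] by auto
  obtain C2 where C2: "0 \<le> C2" "\<And>A h D \<rho>1 \<rho>2 X1 X2. params K A h D \<Longrightarrow> \<bar>\<rho>1\<bar> \<le> 2 * D \<Longrightarrow> \<bar>\<rho>2\<bar> \<le> 2 * D \<Longrightarrow>
    wclass v A h D \<rho>1 0 1 X1 \<Longrightarrow> wclass v A h D \<rho>2 1 1 X2 \<Longrightarrow> opbd (2 * ?d + 1) (C2 * D\<^sup>2) (commutator X1 X2)"
    using opbd_commutator_wclass[of 0 1 1 1 "2 * ?d + 1"] by auto
  have "norm (commutator (commutator (mult_op v) (propagator A h \<tau> o\<^sub>L mult_op v o\<^sub>L propagator A h (- \<tau>)))
      (propagator A h s o\<^sub>L mult_op v o\<^sub>L propagator A h (- s))) \<le> (CL * L * (C1 + C2)) * D\<^sup>2"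
    if par: "params K A h D" and \<tau>: "\<bar>\<tau>\<bar> \<le> D" "\<bar>s\<bar> \<le> D" for A h D \<tau> s
  proof -
    let ?V = "mult_op v"
    define W where "W \<rho> = propagator A h \<rho> o\<^sub>L ?V o\<^sub>L propagator A h (- \<rho>)" for \<rho>
    have conj: "propagator A h s o\<^sub>L W \<rho> o\<^sub>L propagator A h (- s) = W (s + \<rho>)" for \<rho>
      unfolding W_def by (rule propagator_conj_conj[OF par])
    have W0: "W 0 = ?V" by (simp add: W_def propagator_0[OF par])
    have wc: "wclass v A h D \<rho> 0 1 (W \<rho>)" if "\<bar>\<rho>\<bar> \<le> 2 * D" for \<rho>
      unfolding W_def using that params_h(5)[OF par] by (intro wclass_propagated[OF par]) linarith
    define S where "S = commutator (W (- s)) (W (\<tau> - s))"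
    have \<rho>: "\<bar>- s\<bar> \<le> 2 * D" "\<bar>\<tau> - s\<bar> \<le> 2 * D" using \<tau> by linarith+
    have "norm (commutator ?V S) \<le> CL * L * ((C1 + C2) * D\<^sup>2)"
    proof (rule lemL[OF _ _ _ L])
      show "clinear_adj S"
        unfolding S_def by (intro clinear_adj_commutator clinear_adj_wclass[OF par wc] \<rho>)
      show "0 \<le> (C1 + C2) * D\<^sup>2" using C1(1) C2(1) by simp
      show "\<forall>b\<in>Basis. \<exists>R. mderiv b S R \<and> opbd (2 * ?d + 1) ((C1 + C2) * D\<^sup>2) R"
      proof
        fix b :: 'a assume b: "b \<in> Basis"
        obtain R1 where R1: "mderiv b (W (- s)) R1" "wclass v A h D (- s) 1 1 R1"
          using mderiv_wclass[OF par b wc[OF \<rho>(1)]] by auto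
        obtain R2 where R2: "mderiv b (W (\<tau> - s)) R2" "wclass v A h D (\<tau> - s) 1 1 R2"
          using mderiv_wclass[OF par b wc[OF \<rho>(2)]] by auto
        have "opbd (2 * ?d + 1) (C1 * D\<^sup>2 + C2 * D\<^sup>2) (commutator R1 (W (\<tau> - s)) + commutator (W (- s)) R2)"
          by (rule opbd_add[OF C1(2)[OF par \<rho> R1(2) wc[OF \<rho>(2)]] C2(2)[OF par \<rho> wc[OF \<rho>(1)] R2(2)]])
        then show "\<exists>R. mderiv b S R \<and> opbd (2 * ?d + 1) ((C1 + C2) * D\<^sup>2) R"
          using mderiv_commutator[OF R1(1) R2(1)] unfolding S_def distrib_right by blast
      qed
    qed
    \<comment> \<open>Conjugation by \<open>propagator A h s\<close> adds \<open>s\<close> to each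
      parameter and takes \<open>W (- s)\<close>, \<open>W (\<tau> - s)\<close>, \<open>W 0\<close>
      to \<open>W 0\<close>, \<open>W \<tau>\<close>, \<open>W s\<close>.\<close>
    moreover have "commutator (commutator ?V (W \<tau>)) (W s) = propagator A h s o\<^sub>L (- commutator ?V S) o\<^sub>L propagator A h (- s)"
    proof -
      have "propagator A h s o\<^sub>L commutator S ?V o\<^sub>L propagator A h (- s) = commutator (commutator (W 0) (W \<tau>)) (W s)"
        unfolding S_def W0[symmetric] by (simp only: propagator_conj_commutator[OF par] conj) simp
      then show ?thesis
        by (simp add: W0 commutator_swap[of S])
    qed
    ultimately have "norm (commutator (commutator ?V (W \<tau>)) (W s)) \<le> CL * L * ((C1 + C2) * D\<^sup>2)"
      using norm_propagator_conj[OF par, of s "- commutator ?V S"] by simp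
    then show ?thesis
      unfolding W_def by (simp only: mult.assoc)
  qed
  then show ?thesis
    using CL C1(1) C2(1) symbol_nonneg[OF L] by (intro exI[of _ "CL * L * (C1 + C2)"]) auto
qed

end

section \<open>Passage to the operators of the statement\<close>

text \<open>The scalar is absorbed into the symbol of the multiplier, and
  \<open>exp_op_fmult\<close> then exponentiates pointwise; the opposite sign gives the right
  factor.\<close>

lemma conj_op_weyl_op:
  fixes A :: "'a::euclidean_space \<Rightarrow> complex"
  assumes par: "params K A h D"
  shows "conj_op (\<i> * complex_of_real (\<tau> / h\<^sup>2)) (weyl_op h (\<lambda>(x, \<xi>). A \<xi>)) X = propagator A h \<tau> o\<^sub>L X o\<^sub>L propagator A h (- \<tau>)"
proof -
  have sm: "smooth A" and bd: "\<And>bs. bs \<in> lists Basis \<Longrightarrow> \<exists>C. \<forall>x. norm (pderivs bs A x) \<le> C"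
    using par by (auto simp: params_def)
  have bA: "bmeas A"
    using smooth_bmeas[OF sm bd, of "[]"] by simp
  have "exp_op (mult_op (\<lambda>_. \<i> * complex_of_real (\<rho> / h\<^sup>2)) o\<^sub>L weyl_op h (\<lambda>(x, \<xi>). A \<xi>)) = propagator A h \<rho>" for \<rho>
  proof -
    have "mult_op (\<lambda>_. \<i> * complex_of_real (\<rho> / h\<^sup>2)) o\<^sub>L weyl_op h (\<lambda>(x, \<xi>). A \<xi>)
        = fmult 1 (\<lambda>\<xi>. \<i> * complex_of_real (\<rho> / h\<^sup>2) * A (h *\<^sub>R \<xi>))"
      unfolding weyl_op_multiplier[OF bA params_h(1)[OF par]]
      by (rule fmult_complex_linear(2)) (simp_all add: bmeas_scale[OF bA])
    also have "(\<lambda>\<xi>. \<i> * complex_of_real (\<rho> / h\<^sup>2) * A (h *\<^sub>R \<xi>)) = egen A h \<rho> []"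
      by (simp add: egen_def fun_eq_iff)
    finally show ?thesis
      using exp_op_fmult[of 1 "egen A h \<rho> []"] bmeas_egen[OF par, of "[]"] by (simp add: propagator_def)
  qed
  from this[of \<tau>] this[of "- \<tau>"] show ?thesis
    by (simp add: conj_op_def)
qed

theorem theorem6:
  fixes v :: "real ^ 'n \<Rightarrow> complex"
    and K :: "((real ^ 'n) \<times> (real ^ 'n)) list \<Rightarrow> real"
  assumes "(\<lambda>(x, \<xi>). v x) \<in> S1"
  shows "\<exists>C. \<forall>(a :: real ^ 'n \<Rightarrow> real) h \<Delta>t.
    (\<lambda>(x, \<xi>). complex_of_real (a \<xi>)) \<in> S1_within K \<longrightarrow>
    0 < h \<longrightarrow> h \<le> 1 \<longrightarrow> 0 \<le> \<Delta>t \<longrightarrow> \<Delta>t \<le> 1 \<longrightarrow> h \<le> \<Delta>t \<longrightarrow>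
    (let V = mult_op v;
         A\<^sub>0 = weyl_op h (\<lambda>(x, \<xi>). complex_of_real (a \<xi>));
         W = (\<lambda>\<tau>. conj_op (\<i> * complex_of_real (\<tau> / h\<^sup>2)) A\<^sub>0 V)
     in (SUP (\<tau>, s) \<in> {-\<Delta>t..\<Delta>t} \<times> {-\<Delta>t..\<Delta>t}.
           ereal (norm (commutator (commutator V (W \<tau>)) (W s)))) \<le> ereal (C * \<Delta>t\<^sup>2))"
proof -
  \<comment> \<open>The symbol depends on \<open>\<xi>\<close> alone, so \<open>K\<close> is read on
    lists embedded in the second component.\<close>
  let ?K = "\<lambda>bs. K (map (\<lambda>b. (0, b)) bs)"
  obtain C where C: "\<And>A h D \<tau> s. params ?K A h D \<Longrightarrow> \<bar>\<tau>\<bar> \<le> D \<Longrightarrow> \<bar>s\<bar> \<le> D \<Longrightarrow>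
    norm (commutator (commutator (mult_op v) (propagator A h \<tau> o\<^sub>L mult_op v o\<^sub>L propagator A h (- \<tau>)))
      (propagator A h s o\<^sub>L mult_op v o\<^sub>L propagator A h (- s))) \<le> C * D\<^sup>2"
    using norm_double_commutator[OF S1_fst[OF assms], of ?K] by blast
  show ?thesis
  proof (intro exI[of _ C] allI impI)
    fix a :: "real ^ 'n \<Rightarrow> real" and h \<Delta>t :: real
    assume a: "(\<lambda>(x, \<xi>). complex_of_real (a \<xi>)) \<in> S1_within K"
      and "0 < h" "h \<le> 1" "0 \<le> \<Delta>t" "\<Delta>t \<le> 1" "h \<le> \<Delta>t"
    let ?A = "\<lambda>\<xi>. complex_of_real (a \<xi>)"
    have par: "params ?K ?A h \<Delta>t"
      using S1_within_snd[OF a] \<open>0 < h\<close> \<open>h \<le> 1\<close> \<open>\<Delta>t \<le> 1\<close> \<open>h \<le> \<Delta>t\<close> by (simp add: params_def)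
    show "(let V = mult_op v;
         A\<^sub>0 = weyl_op h (\<lambda>(x, \<xi>). complex_of_real (a \<xi>));
         W = (\<lambda>\<tau>. conj_op (\<i> * complex_of_real (\<tau> / h\<^sup>2)) A\<^sub>0 V)
     in (SUP (\<tau>, s) \<in> {-\<Delta>t..\<Delta>t} \<times> {-\<Delta>t..\<Delta>t}.
           ereal (norm (commutator (commutator V (W \<tau>)) (W s)))) \<le> ereal (C * \<Delta>t\<^sup>2))"
      unfolding Let_def conj_op_weyl_op[OF par]
    proof (rule SUP_least, clarify)
      fix \<tau> s assume "\<tau> \<in> {-\<Delta>t..\<Delta>t}" "s \<in> {-\<Delta>t..\<Delta>t}"
      then have "\<bar>\<tau>\<bar> \<le> \<Delta>t" "\<bar>s\<bar> \<le> \<Delta>t" by auto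
      then show "ereal (norm (commutator (commutator (mult_op v) (propagator ?A h \<tau> o\<^sub>L mult_op v o\<^sub>L propagator ?A h (- \<tau>)))
          (propagator ?A h s o\<^sub>L mult_op v o\<^sub>L propagator ?A h (- s)))) \<le> ereal (C * \<Delta>t\<^sup>2)"
        using C[OF par] by simp
    qed
  qed
qed

end
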